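(* A DFS traversal of an undirected or directed graph $G$ with $n$ vertices and $m$ edges can be performed in $O(m+n)$ time using $O(n\lg(m/n))$ bits of working space. In the same amount of time and space, given a connected undirected graph $G$, one can compute a chain decomposition of $G$, and determine whether $G$ is $2$-vertex connected and/or $2$-edge connected; if not, in the same amount of time and space, one can compute and report all the bridges and cut vertices of $G$.
   Context: Input model: the graph is in read-only memory in the adjacency array representation (given a vertex $v$ and an integer $k$, the $k$-th neighbour of $v$ is accessible in constant time); only additional workspace is counted, in bits, on a word RAM with words of $\Omega(\lg n)$ bits. Chain decomposition: perform a DFS from root $r$, orient tree edges towards $r$ and back edges away from $r$; mark all vertices unvisited; visit vertices in increasing DFS discovery order, and for each vertex $v$ and each back edge $e$ originating at $v$, traverse the path/cycle starting with $e$ and continuing along tree edges towards the root, stopping at the first visited vertex or at $r$, marking all encountered vertices visited; each such path/cycle is a chain. A cut vertex (resp. bridge) is a vertex (resp. edge) whose removal increases the number of connected components; a connected graph with at least three vertices is $2$-vertex connected iff it has no cut vertex, and a connected graph with at least two vertices is $2$-edge connected iff it has no bridge. As a standing assumption of the paper, input graphs are connected, so $m\ge n-1$.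
   Formalization: The space bound is read as O(n·max(1, lg(m/n))) bits, since lg(m/n) is at most 0 for m ≤ n, and the word length, at least a constant times lg n, is also assumed to be O(n·max(1, lg(m/n))), since otherwise one word already exceeds the bound. *)

theory Defs
  imports Complex_Main "Graph_Theory.Graph_Theory"
begin

section \<open>Word RAM with read-only input and write-only output\<close>

text \<open>
  A program is a three-address while-program over finitely many registers and a random access
  working memory of \<open>w\<close>-bit words. The input (a graph as adjacency arrays, and a vertex) can only
  be queried, the output is a stream of words that can only be appended to. Every instruction and
  every evaluation of a branching condition takes one time unit.
\<close>

type_synonym adj_array = "nat list list"
type_synonym reg = nat

datatype operand = Const nat | Reg reg

datatype binop = Add | Sub | Mul | Div | And | Or | Xor | ShiftL | ShiftR

datatype cond =
    Less operand operand | Leq operand operand | Eq operand operand | Neq operand operand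

datatype com =
    SKIP
  | SET reg operand
  | OP binop reg operand operand
  | LOAD reg operand               \<comment> \<open>\<open>x := mem[a]\<close>\<close>
  | STORE operand operand          \<comment> \<open>\<open>mem[a] := b\<close>\<close>
  | WORDLEN reg
  | NUMVERTS reg
  | START reg                      \<comment> \<open>the vertex given as input\<close>
  | DEGREE reg operand
  | NEIGHBOUR reg operand operand  \<comment> \<open>\<open>x := k\<close>-th neighbour of \<open>v\<close>, counting from 0\<close>
  | OUTPUT operand
  | SEQ com com
  | IF cond com com
  | WHILE cond com

type_synonym state = "(reg \<Rightarrow> nat) \<times> (nat \<Rightarrow> nat)"

fun val :: "nat \<Rightarrow> (reg \<Rightarrow> nat) \<Rightarrow> operand \<Rightarrow> nat" where
  "val w \<rho> (Const c) = take_bit w c"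
| "val w \<rho> (Reg x) = \<rho> x"

fun binop_val :: "nat \<Rightarrow> binop \<Rightarrow> nat \<Rightarrow> nat \<Rightarrow> nat" where
  "binop_val w Add a b = take_bit w (a + b)"
| "binop_val w Sub a b = nat ((int a - int b) mod 2 ^ w)"
| "binop_val w Mul a b = take_bit w (a * b)"
| "binop_val w Div a b = a div b"
| "binop_val w And a b = and a b"
| "binop_val w Or a b = or a b"
| "binop_val w Xor a b = xor a b"
| "binop_val w ShiftL a b = take_bit w (push_bit b a)"
| "binop_val w ShiftR a b = drop_bit b a"

fun holds :: "nat \<Rightarrow> (reg \<Rightarrow> nat) \<Rightarrow> cond \<Rightarrow> bool" where
  "holds w \<rho> (Less a b) = (val w \<rho> a < val w \<rho> b)"
| "holds w \<rho> (Leq a b) = (val w \<rho> a \<le> val w \<rho> b)"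
| "holds w \<rho> (Eq a b) = (val w \<rho> a = val w \<rho> b)"
| "holds w \<rho> (Neq a b) = (val w \<rho> a \<noteq> val w \<rho> b)"

text \<open>
  \<open>exec w adj r c \<sigma> t s out \<sigma>'\<close>: on word length \<open>w\<close> and input \<open>(adj, r)\<close>, the program \<open>c\<close> started
  in \<open>\<sigma>\<close> terminates in \<open>\<sigma>'\<close> after \<open>t\<close> steps, having emitted the words \<open>out\<close>; all memory addresses
  it accesses are below \<open>s\<close>. Input queries outside the arrays get stuck.
\<close>

inductive exec ::
  "nat \<Rightarrow> adj_array \<Rightarrow> nat \<Rightarrow> com \<Rightarrow> state \<Rightarrow> nat \<Rightarrow> nat \<Rightarrow> nat list \<Rightarrow> state \<Rightarrow> bool"
  for w :: nat and adj :: adj_array and r :: nat where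
  Skip: "exec w adj r SKIP \<sigma> 1 0 [] \<sigma>"
| Set: "exec w adj r (SET x a) (\<rho>, \<mu>) 1 0 [] (\<rho>(x := val w \<rho> a), \<mu>)"
| Op: "exec w adj r (OP f x a b) (\<rho>, \<mu>) 1 0 []
        (\<rho>(x := binop_val w f (val w \<rho> a) (val w \<rho> b)), \<mu>)"
| Load: "exec w adj r (LOAD x a) (\<rho>, \<mu>) 1 (Suc (val w \<rho> a)) [] (\<rho>(x := \<mu> (val w \<rho> a)), \<mu>)"
| Store: "exec w adj r (STORE a b) (\<rho>, \<mu>) 1 (Suc (val w \<rho> a)) [] (\<rho>, \<mu>(val w \<rho> a := val w \<rho> b))"
| WordLen: "exec w adj r (WORDLEN x) (\<rho>, \<mu>) 1 0 [] (\<rho>(x := take_bit w w), \<mu>)"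
| NumVerts: "exec w adj r (NUMVERTS x) (\<rho>, \<mu>) 1 0 [] (\<rho>(x := take_bit w (length adj)), \<mu>)"
| Start: "exec w adj r (START x) (\<rho>, \<mu>) 1 0 [] (\<rho>(x := take_bit w r), \<mu>)"
| Degree: "val w \<rho> a < length adj \<Longrightarrow>
    exec w adj r (DEGREE x a) (\<rho>, \<mu>) 1 0 [] (\<rho>(x := take_bit w (length (adj ! val w \<rho> a))), \<mu>)"
| Neighbour: "val w \<rho> a < length adj \<Longrightarrow> val w \<rho> k < length (adj ! val w \<rho> a) \<Longrightarrow>
    exec w adj r (NEIGHBOUR x a k) (\<rho>, \<mu>) 1 0 []
      (\<rho>(x := take_bit w (adj ! val w \<rho> a ! val w \<rho> k)), \<mu>)"
| Output: "exec w adj r (OUTPUT a) (\<rho>, \<mu>) 1 0 [val w \<rho> a] (\<rho>, \<mu>)"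
| Seq: "exec w adj r c1 \<sigma> t1 s1 o1 \<sigma>' \<Longrightarrow> exec w adj r c2 \<sigma>' t2 s2 o2 \<sigma>'' \<Longrightarrow>
    exec w adj r (SEQ c1 c2) \<sigma> (t1 + t2) (max s1 s2) (o1 @ o2) \<sigma>''"
| IfTrue: "holds w (fst \<sigma>) b \<Longrightarrow> exec w adj r c1 \<sigma> t s out \<sigma>' \<Longrightarrow>
    exec w adj r (IF b c1 c2) \<sigma> (Suc t) s out \<sigma>'"
| IfFalse: "\<not> holds w (fst \<sigma>) b \<Longrightarrow> exec w adj r c2 \<sigma> t s out \<sigma>' \<Longrightarrow>
    exec w adj r (IF b c1 c2) \<sigma> (Suc t) s out \<sigma>'"
| WhileFalse: "\<not> holds w (fst \<sigma>) b \<Longrightarrow> exec w adj r (WHILE b c) \<sigma> 1 0 [] \<sigma>"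
| WhileTrue: "holds w (fst \<sigma>) b \<Longrightarrow> exec w adj r c \<sigma> t1 s1 o1 \<sigma>' \<Longrightarrow>
    exec w adj r (WHILE b c) \<sigma>' t2 s2 o2 \<sigma>'' \<Longrightarrow>
    exec w adj r (WHILE b c) \<sigma> (Suc (t1 + t2)) (max s1 s2) (o1 @ o2) \<sigma>''"

inductive_cases exec_elims:
  "exec w adj r SKIP \<sigma> t s out \<sigma>'"
  "exec w adj r (SET x a) \<sigma> t s out \<sigma>'"
  "exec w adj r (OP f x a b) \<sigma> t s out \<sigma>'"
  "exec w adj r (LOAD x a) \<sigma> t s out \<sigma>'"
  "exec w adj r (STORE a b) \<sigma> t s out \<sigma>'"
  "exec w adj r (WORDLEN x) \<sigma> t s out \<sigma>'"
  "exec w adj r (NUMVERTS x) \<sigma> t s out \<sigma>'"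
  "exec w adj r (START x) \<sigma> t s out \<sigma>'"
  "exec w adj r (DEGREE x a) \<sigma> t s out \<sigma>'"
  "exec w adj r (NEIGHBOUR x a k) \<sigma> t s out \<sigma>'"
  "exec w adj r (OUTPUT a) \<sigma> t s out \<sigma>'"
  "exec w adj r (SEQ c1 c2) \<sigma> t s out \<sigma>'"
  "exec w adj r (IF b c1 c2) \<sigma> t s out \<sigma>'"
  "exec w adj r (WHILE b c) \<sigma> t s out \<sigma>'"

lemma exec_deterministic:
  "exec w adj r c \<sigma> t s out \<sigma>' \<Longrightarrow> exec w adj r c \<sigma> t2 s2 out2 \<sigma>2 \<Longrightarrow>
    t2 = t \<and> s2 = s \<and> out2 = out \<and> \<sigma>2 = \<sigma>'"
proof (induction arbitrary: t2 s2 out2 \<sigma>2 rule: exec.induct)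
  case Skip then show ?case by (elim exec_elims(1)) simp
next
  case Set then show ?case by (elim exec_elims(2)) simp
next
  case Op then show ?case by (elim exec_elims(3)) simp
next
  case Load then show ?case by (elim exec_elims(4)) simp
next
  case Store then show ?case by (elim exec_elims(5)) simp
next
  case WordLen then show ?case by (elim exec_elims(6)) simp
next
  case NumVerts then show ?case by (elim exec_elims(7)) simp
next
  case Start then show ?case by (elim exec_elims(8)) simp
next
  case Degree from Degree.prems show ?case by (elim exec_elims(9)) simp
next
  case Neighbour from Neighbour.prems show ?case by (elim exec_elims(10)) simp
next
  case Output then show ?case by (elim exec_elims(11)) simp
next
  case Seq
  from Seq.prems show ?case
    by (rule exec_elims(12)) (use Seq.IH in \<open>metis\<close>)
next
  case IfTrue
  from IfTrue.prems show ?case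
    by (rule exec_elims(13)) (use IfTrue.hyps in \<open>auto dest!: IfTrue.IH\<close>)
next
  case IfFalse
  from IfFalse.prems show ?case
    by (rule exec_elims(13)) (use IfFalse.hyps in \<open>auto dest!: IfFalse.IH\<close>)
next
  case WhileFalse
  from WhileFalse.prems show ?case
    by (rule exec_elims(14)) (use WhileFalse.hyps in auto)
next
  case WhileTrue
  from WhileTrue.prems show ?case
    by (rule exec_elims(14)) (use WhileTrue.hyps WhileTrue.IH in \<open>metis+\<close>)
qed

fun operand_regs :: "operand \<Rightarrow> reg set" where
  "operand_regs (Const c) = {}"
| "operand_regs (Reg x) = {x}"

fun cond_regs :: "cond \<Rightarrow> reg set" where
  "cond_regs (Less a b) = operand_regs a \<union> operand_regs b"
| "cond_regs (Leq a b) = operand_regs a \<union> operand_regs b"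
| "cond_regs (Eq a b) = operand_regs a \<union> operand_regs b"
| "cond_regs (Neq a b) = operand_regs a \<union> operand_regs b"

fun regs :: "com \<Rightarrow> reg set" where
  "regs SKIP = {}"
| "regs (SET x a) = {x} \<union> operand_regs a"
| "regs (OP f x a b) = {x} \<union> operand_regs a \<union> operand_regs b"
| "regs (LOAD x a) = {x} \<union> operand_regs a"
| "regs (STORE a b) = operand_regs a \<union> operand_regs b"
| "regs (WORDLEN x) = {x}"
| "regs (NUMVERTS x) = {x}"
| "regs (START x) = {x}"
| "regs (DEGREE x a) = {x} \<union> operand_regs a"
| "regs (NEIGHBOUR x a k) = {x} \<union> operand_regs a \<union> operand_regs k"
| "regs (OUTPUT a) = operand_regs a"
| "regs (SEQ c1 c2) = regs c1 \<union> regs c2"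
| "regs (IF b c1 c2) = cond_regs b \<union> regs c1 \<union> regs c2"
| "regs (WHILE b c) = cond_regs b \<union> regs c"


section \<open>Graphs given by adjacency arrays\<close>

text \<open>As usual in the library, an undirected graph is a symmetric digraph.\<close>

definition graph_of :: "adj_array \<Rightarrow> (nat, nat \<times> nat) pre_digraph" where
  "graph_of adj = with_proj
     \<lparr> pverts = {..<length adj}, parcs = {(u, v). u < length adj \<and> v \<in> set (adj ! u)} \<rparr>"

definition digraph_instance :: "adj_array \<Rightarrow> bool" where
  "digraph_instance adj \<longleftrightarrow>
     (\<forall>l \<in> set adj. distinct l) \<and> digraph (graph_of adj) \<and> connected (graph_of adj)"

definition graph_instance :: "adj_array \<Rightarrow> bool" where
  "graph_instance adj \<longleftrightarrow>
     (\<forall>l \<in> set adj. distinct l) \<and> graph (graph_of adj) \<and> connected (graph_of adj)"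

definition directed_size :: "adj_array \<Rightarrow> nat" where
  "directed_size adj = card (arcs (graph_of adj))"

text \<open>Each undirected edge is represented by two arcs.\<close>

definition undirected_size :: "adj_array \<Rightarrow> nat" where
  "undirected_size adj = card (arcs (graph_of adj)) div 2"


section \<open>Problems solvable in linear time with $O(n \lg (m/n))$ bits\<close>

text \<open>
  Connectedness only gives \<open>m \<ge> n - 1\<close>, so \<open>lg (m/n)\<close> may vanish or be negative; as usual, the
  logarithmic factor of the bound is read as being at least 1.
\<close>

definition lg_density :: "nat \<Rightarrow> nat \<Rightarrow> real" where
  "lg_density m n = max 1 (log 2 (real m / real n))"

text \<open>
  In \<open>solvable I num_edges spec\<close>, \<open>I\<close> are the admissible inputs and \<open>spec adj r out\<close> says that \<open>out\<close>
  is a correct output for \<open>adj\<close> and \<open>r\<close>. One fixed program has to work for all inputs and on all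
  machines whose words have at least \<open>\<beta> * lg (n + 1)\<close> bits for some constant \<open>\<beta>\<close>. Since a single
  register occupies a whole word, the space bound can only be met if \<open>w = O(n lg (m/n))\<close>; the
  constant \<open>\<kappa>\<close> in this proviso is arbitrary, and the constant of the bounds may depend on it.
  Working space is \<open>w\<close> bits for every register of the program and for every memory word up to the
  largest address used.
\<close>

definition solvable ::
  "(adj_array \<Rightarrow> bool) \<Rightarrow> (adj_array \<Rightarrow> nat) \<Rightarrow> (adj_array \<Rightarrow> nat \<Rightarrow> nat list \<Rightarrow> bool) \<Rightarrow> bool"
where
  "solvable I num_edges spec \<longleftrightarrow>
     (\<exists>(P :: com) (\<beta> :: real). \<forall>\<kappa> :: real. \<exists>C :: real. \<forall>adj r w n m.
        I adj \<and> n = length adj \<and> m = num_edges adj \<and> r < n \<and>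
        \<beta> * log 2 (real (n + 1)) \<le> real w \<and> real w \<le> \<kappa> * (real n * lg_density m n) \<longrightarrow>
        (\<exists>t s out \<sigma>'.
           exec w adj r P (\<lambda>_. 0, \<lambda>_. 0) t s out \<sigma>' \<and>
           real t \<le> C * real (m + n) \<and>
           real (w * (card (regs P) + s)) \<le> C * (real n * lg_density m n) \<and>
           spec adj r out))"


section \<open>Depth-first search\<close>

datatype 'a event = Discover 'a | Finish 'a

text \<open>
  \<open>dfs_run G st D es\<close>: with stack \<open>st\<close> of active vertices (top first) and set \<open>D\<close> of discovered
  vertices, \<open>es\<close> is a possible sequence of the remaining events. Unexplored arcs may be chosen in
  any order.
\<close>

inductive dfs_run :: "('a, 'b) pre_digraph \<Rightarrow> 'a list \<Rightarrow> 'a set \<Rightarrow> 'a event list \<Rightarrow> bool"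
  for G :: "('a, 'b) pre_digraph" where
  Done: "verts G \<subseteq> D \<Longrightarrow> dfs_run G [] D []"
| Restart: "v \<in> verts G \<Longrightarrow> v \<notin> D \<Longrightarrow> dfs_run G [v] (insert v D) es \<Longrightarrow>
    dfs_run G [] D (Discover v # es)"
| Advance: "u \<rightarrow>\<^bsub>G\<^esub> v \<Longrightarrow> v \<notin> D \<Longrightarrow> dfs_run G (v # u # st) (insert v D) es \<Longrightarrow>
    dfs_run G (u # st) D (Discover v # es)"
| Retreat: "(\<And>v. u \<rightarrow>\<^bsub>G\<^esub> v \<Longrightarrow> v \<in> D) \<Longrightarrow> dfs_run G st D es \<Longrightarrow>
    dfs_run G (u # st) D (Finish u # es)"

definition dfs_traversal :: "('a, 'b) pre_digraph \<Rightarrow> 'a \<Rightarrow> 'a event list \<Rightarrow> bool" where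
  "dfs_traversal G r es \<longleftrightarrow>
     r \<in> verts G \<and> (\<exists>es'. es = Discover r # es' \<and> dfs_run G [r] {r} es')"

fun discovery_order :: "'a event list \<Rightarrow> 'a list" where
  "discovery_order [] = []"
| "discovery_order (Discover v # es) = v # discovery_order es"
| "discovery_order (Finish v # es) = discovery_order es"

text \<open>
  The tree edges, as pairs (child, parent), i.e. oriented towards the root. The first argument is
  the current stack.
\<close>

fun tree_edges :: "'a list \<Rightarrow> 'a event list \<Rightarrow> ('a \<times> 'a) set" where
  "tree_edges st [] = {}"
| "tree_edges [] (Discover v # es) = tree_edges [v] es"
| "tree_edges (u # st) (Discover v # es) = insert (v, u) (tree_edges (v # u # st) es)"
| "tree_edges st (Finish v # es) = tree_edges (tl st) es"

definition dfs_spec :: "adj_array \<Rightarrow> nat \<Rightarrow> nat list \<Rightarrow> bool" where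
  "dfs_spec adj r out \<longleftrightarrow> (\<exists>es. dfs_traversal (graph_of adj) r es \<and>
     out = concat (map (case_event (\<lambda>v. [0, v]) (\<lambda>v. [1, v])) es))"


section \<open>Chain decomposition\<close>

text \<open>\<open>(v, x)\<close> is a back edge oriented away from the root: \<open>v\<close> is an ancestor of \<open>x\<close> in the tree \<open>T\<close>.\<close>

definition back_edges :: "('a, 'b) pre_digraph \<Rightarrow> ('a \<times> 'a) set \<Rightarrow> ('a \<times> 'a) set" where
  "back_edges G T = {(v, x). v \<rightarrow>\<^bsub>G\<^esub> x \<and> (x, v) \<in> T\<^sup>+ \<and> (x, v) \<notin> T}"

text \<open>\<open>climb T r S x p\<close>: \<open>p\<close> leads from \<open>x\<close> towards \<open>r\<close>, ending at the first vertex in \<open>S \<union> {r}\<close>.\<close>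

inductive climb :: "('a \<times> 'a) set \<Rightarrow> 'a \<Rightarrow> 'a set \<Rightarrow> 'a \<Rightarrow> 'a list \<Rightarrow> bool"
  for T :: "('a \<times> 'a) set" and r :: 'a and S :: "'a set" where
  Stop: "x \<in> S \<or> x = r \<Longrightarrow> climb T r S x [x]"
| Step: "x \<notin> S \<Longrightarrow> x \<noteq> r \<Longrightarrow> (x, y) \<in> T \<Longrightarrow> climb T r S y p \<Longrightarrow> climb T r S x (x # p)"

text \<open>
  \<open>chains T r S bs cs\<close>: processing the back edges \<open>bs\<close> in this order, with the vertices in \<open>S\<close>
  already visited, yields the chains \<open>cs\<close>, given by their vertex sequences. The first vertex \<open>v\<close> of
  a chain is encountered, and hence marked, before the climb starts.
\<close>

inductive chains ::
  "('a \<times> 'a) set \<Rightarrow> 'a \<Rightarrow> 'a set \<Rightarrow> ('a \<times> 'a) list \<Rightarrow> 'a list list \<Rightarrow> bool"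
  for T :: "('a \<times> 'a) set" and r :: 'a where
  Nil: "chains T r S [] []"
| Cons: "climb T r (insert v S) x p \<Longrightarrow> chains T r (S \<union> set (v # p)) bs cs \<Longrightarrow>
    chains T r S ((v, x) # bs) ((v # p) # cs)"

text \<open>\<open>f v\<close> lists the back edges originating at \<open>v\<close>, whose order is arbitrary.\<close>

definition chain_decomposition :: "('a, 'b) pre_digraph \<Rightarrow> 'a \<Rightarrow> 'a list list \<Rightarrow> bool" where
  "chain_decomposition G r cs \<longleftrightarrow>
     (\<exists>es T f. dfs_traversal G r es \<and> T = tree_edges [] es \<and>
        (\<forall>v \<in> verts G. distinct (f v) \<and> set (f v) = {e \<in> back_edges G T. fst e = v}) \<and>
        chains T r {} (concat (map f (discovery_order es))) cs)"

text \<open>In the output, each chain is terminated by \<open>n\<close>, which is not a vertex.\<close>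

definition chain_spec :: "adj_array \<Rightarrow> nat \<Rightarrow> nat list \<Rightarrow> bool" where
  "chain_spec adj r out \<longleftrightarrow> (\<exists>cs. chain_decomposition (graph_of adj) r cs \<and>
     out = concat (map (\<lambda>c. c @ [length adj]) cs))"


section \<open>Cut vertices, bridges and 2-connectivity\<close>

text \<open>For symmetric digraphs, the strongly connected components are the connected components.\<close>

definition num_components :: "('a, 'b) pre_digraph \<Rightarrow> nat" where
  "num_components G = card (pre_digraph.sccs G)"

definition cut_vertex :: "('a, 'b) pre_digraph \<Rightarrow> 'a \<Rightarrow> bool" where
  "cut_vertex G v \<longleftrightarrow>
     v \<in> verts G \<and> num_components (pre_digraph.del_vert G v) > num_components G"

definition bridge :: "('a, 'a \<times> 'a) pre_digraph \<Rightarrow> 'a \<Rightarrow> 'a \<Rightarrow> bool" where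
  "bridge G u v \<longleftrightarrow> (u, v) \<in> arcs G \<and>
     num_components (pre_digraph.del_arc (pre_digraph.del_arc G (u, v)) (v, u)) > num_components G"

definition two_vertex_connected :: "('a, 'b) pre_digraph \<Rightarrow> bool" where
  "two_vertex_connected G \<longleftrightarrow> card (verts G) \<ge> 3 \<and> connected G \<and> (\<nexists>v. cut_vertex G v)"

definition two_edge_connected :: "('a, 'a \<times> 'a) pre_digraph \<Rightarrow> bool" where
  "two_edge_connected G \<longleftrightarrow> card (verts G) \<ge> 2 \<and> connected G \<and> (\<nexists>u v. bridge G u v)"

definition two_vertex_connected_spec :: "adj_array \<Rightarrow> nat \<Rightarrow> nat list \<Rightarrow> bool" where
  "two_vertex_connected_spec adj r out \<longleftrightarrow>
     out = [if two_vertex_connected (graph_of adj) then 1 else 0]"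

definition two_edge_connected_spec :: "adj_array \<Rightarrow> nat \<Rightarrow> nat list \<Rightarrow> bool" where
  "two_edge_connected_spec adj r out \<longleftrightarrow>
     out = [if two_edge_connected (graph_of adj) then 1 else 0]"

text \<open>Every cut vertex and every bridge is reported exactly once, the latter by its two ends.\<close>

definition cut_vertices_spec :: "adj_array \<Rightarrow> nat \<Rightarrow> nat list \<Rightarrow> bool" where
  "cut_vertices_spec adj r out \<longleftrightarrow> distinct out \<and> set out = {v. cut_vertex (graph_of adj) v}"

definition bridges_spec :: "adj_array \<Rightarrow> nat \<Rightarrow> nat list \<Rightarrow> bool" where
  "bridges_spec adj r out \<longleftrightarrow> (\<exists>bs. out = concat (map (\<lambda>(u, v). [u, v]) bs) \<and>
     distinct (map (\<lambda>(u, v). {u, v}) bs) \<and>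
     set (map (\<lambda>(u, v). {u, v}) bs) = {{u, v} | u v. bridge (graph_of adj) u v})"

end

theory Submission
  imports Defs
begin

text \<open>
 The traversal stores, for every suspended vertex, only the index of the arc it is looking at:
 the remainder modulo \<open>B\<close>, a power of two of about \<open>m/n\<close>, in \<open>lg B\<close> bits and the quotient in unary, in
 a field of \<open>1 + deg v div B\<close> bits. Both take \<open>O(n lg (m/n))\<close> bits in total, and the vertices on the
 stack can be recomputed by following these arcs; landmarks make this linear overall.

 For the chains the same traversal is run twice. The first run records for every vertex the index
 of its parent and the number of its neighbours discovered before it, less one, in
 \<open>O(lg (deg v))\<close> bits each. In the second run this counter is decremented whenever a neighbour is
 discovered, and it underflows exactly at the parent; so an undiscovered neighbour of the current
 vertex is known to be a child or the lower end of a back edge. Climbing the chains, one marks the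
 tree edges covered by a chain, and those covered by a chain that starts strictly above their upper
 end. The bridges are the tree edges without the first mark; a non-root vertex is a cut vertex iff
 some edge to a child lacks the second, and the root iff it has two children.
\<close>

section \<open>A structured language with packed arrays\<close>

text \<open>A stack of \<open>n\<close> vertex names would cost n lg n bits, so a suspended vertex
  is known only through the arcs leading to it from some landmark. With \<open>S\<close> about 2 lg
  n, the buffers and landmarks, which do hold full names, fit into O(n) bits. Recovering a segment
  reads fewer than \<open>S\<close> field bits and is needed only when the buffer has run empty; the
  potential \<open>PH\<close> charges it to the fields of vertices finished meanwhile. The second
  run may use what the first recorded because \<open>step\<close> is deterministic
  (\<open>final_unique\<close>). The counters replace positions, which are too large to store: the
  parent of \<open>x\<close> is the last neighbour discovered before \<open>x\<close>
  (\<open>child_test\<close>). Numbers of lg(deg v) bits differ in length and a pointer to each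
  would again cost n lg n bits, whence the layout by levels with rank queries. Their total length is
  bounded by \<open>bl d <= b + d div 2 ^ b\<close> in place of concavity. The program is fixed
  while \<open>w\<close>, \<open>n\<close> and \<open>B\<close> vary, so field widths and addresses
  are run-time values: a prelude working in registers only computes them, and programs are verified
  in a language with ideal arrays and a clock, then compiled with constant overhead.\<close>

datatype aop = Plus | Minus | Times | Quot | Rem | Shl | Shr

datatype aexp =
  Lit nat
 | Rg reg
 | Bin aop aexp aexp
 | Arr nat aexp
 | Dg aexp
 | Nb aexp aexp
 | NV
 | ST
 | WL

datatype bexp = Lt aexp aexp | Eqv aexp aexp | Neqv aexp aexp

datatype prg =
  Nop
 | Asg reg aexp (infix "::=" 61)
 | Put nat aexp aexp
 | Emit aexp
 | Sq prg prg (infixr ";;" 60)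
 | Cond bexp prg prg
 | Loop bexp prg

type_synonym arrays = "nat => nat => nat"
abbreviation (input) eq_off :: "'a set => ('a => 'b) => ('a => 'b) => bool" where
 "eq_off A f g \<equiv> \<forall>x. x \<notin> A --> f x = g x"

type_synonym hstate = "(reg => nat) \<times> arrays \<times> nat \<times> nat list"

fun op_val :: "aop => nat => nat => nat" where
 "op_val Plus a b = a + b"
| "op_val Minus a b = a - b"
| "op_val Times a b = a * b"
| "op_val Quot a b = a div b"
| "op_val Rem a b = a mod b"
| "op_val Shl a b = a * 2 ^ b"
| "op_val Shr a b = a div 2 ^ b"

text \<open>Machine arithmetic truncates to \<open>w\<close> bits whereas \<open>op_val\<close>
  works in the naturals. These side conditions make the two agree, so every program proof also
  excludes overflow and negative differences.\<close>

fun op_ok :: "nat => aop => nat => nat => bool" where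
 "op_ok w Plus a b = (a + b < 2 ^ w)"
| "op_ok w Minus a b = (b <= a)"
| "op_ok w Times a b = (a * b < 2 ^ w)"
| "op_ok w Quot a b = True"
| "op_ok w Rem a b = True"
| "op_ok w Shl a b = (a * 2 ^ b < 2 ^ w)"
| "op_ok w Shr a b = True"

text \<open>Array lengths and field widths are arbitrary functions here, since the actual ones
  depend on the input. \<open>xl\<close> bounds the registers that a program may assign, which
  protects the descriptors of the arrays.\<close>

locale ram =
 fixes w :: nat and adj :: adj_array and r :: nat
  and na :: nat and len wd :: "nat => nat" and xl :: nat
begin

fun ev :: "(reg => nat) => arrays => aexp => nat" where
 "ev rg ar (Lit c) = c"
| "ev rg ar (Rg x) = rg x"
| "ev rg ar (Bin f a b) = op_val f (ev rg ar a) (ev rg ar b)"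
| "ev rg ar (Arr k e) = ar k (ev rg ar e)"
| "ev rg ar (Dg e) = length (adj ! ev rg ar e)"
| "ev rg ar (Nb e i) = adj ! ev rg ar e ! ev rg ar i"
| "ev rg ar NV = length adj"
| "ev rg ar ST = r"
| "ev rg ar WL = w"

fun ok :: "(reg => nat) => arrays => aexp => bool" where
 "ok rg ar (Lit c) = (c < 2 ^ w)"
| "ok rg ar (Rg x) = (x < 300)"
| "ok rg ar (Bin f a b) = (ok rg ar a & ok rg ar b & op_ok w f (ev rg ar a) (ev rg ar b))"
| "ok rg ar (Arr k e) = (ok rg ar e & k < na & ev rg ar e < len k)"
| "ok rg ar (Dg e) = (ok rg ar e & ev rg ar e < length adj)"
| "ok rg ar (Nb e i) = (ok rg ar e & ok rg ar i & ev rg ar e < length adj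
   & ev rg ar i < length (adj ! ev rg ar e))"
| "ok rg ar NV = True"
| "ok rg ar ST = True"
| "ok rg ar WL = True"

fun bv :: "(reg => nat) => arrays => bexp => bool" where
 "bv rg ar (Lt a b) = (ev rg ar a < ev rg ar b)"
| "bv rg ar (Eqv a b) = (ev rg ar a = ev rg ar b)"
| "bv rg ar (Neqv a b) = (ev rg ar a ~= ev rg ar b)"

fun bok :: "(reg => nat) => arrays => bexp => bool" where
 "bok rg ar (Lt a b) = (ok rg ar a & ok rg ar b)"
| "bok rg ar (Eqv a b) = (ok rg ar a & ok rg ar b)"
| "bok rg ar (Neqv a b) = (ok rg ar a & ok rg ar b)"

text \<open>There is no rule for an instruction whose side conditions fail, so a derivation
  certifies that nothing overflows and no access is out of range. The third component of a state is
  a clock with one tick per statement or test; the cost of evaluating expressions enters only on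
  compilation.\<close>

inductive hx :: "prg => hstate => hstate => bool" where
 hNop: "hx Nop (rg, ar, t, out) (rg, ar, Suc t, out)"
| hAsg: "x < xl ==> ok rg ar e ==> hx (x ::= e) (rg, ar, t, out) (rg(x := ev rg ar e), ar, Suc t, out)"
| hPut: "ok rg ar i ==> ok rg ar e ==> k < na ==> ev rg ar i < len k ==> ev rg ar e < 2 ^ wd k ==>
  hx (Put k i e) (rg, ar, t, out)
   (rg, ar(k := (ar k)(ev rg ar i := ev rg ar e)), Suc t, out)"
| hEmit: "ok rg ar e ==> hx (Emit e) (rg, ar, t, out) (rg, ar, Suc t, out @ [ev rg ar e])"
| hSq: "hx p s s' ==> hx q s' s'' ==> hx (p ;; q) s s''"
| hCondT: "bok rg ar b ==> bv rg ar b ==> hx p (rg, ar, Suc t, out) s' ==>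
  hx (Cond b p q) (rg, ar, t, out) s'"
| hCondF: "bok rg ar b ==> \<not> bv rg ar b ==> hx q (rg, ar, Suc t, out) s' ==>
  hx (Cond b p q) (rg, ar, t, out) s'"
| hLoopF: "bok rg ar b ==> \<not> bv rg ar b ==> hx (Loop b p) (rg, ar, t, out) (rg, ar, Suc t, out)"
| hLoopT: "bok rg ar b ==> bv rg ar b ==> hx p (rg, ar, Suc t, out) s' ==> hx (Loop b p) s' s'' ==>
  hx (Loop b p) (rg, ar, t, out) s''"

inductive_cases hx_elims:
 "hx Nop s s'" "hx (x ::= e) s s'" "hx (Put k i e) s s'" "hx (Emit e) s s'"
 "hx (p ;; q) s s'" "hx (Cond b p q) s s'"

text \<open>The clock advances in every construct, \<open>Nop\<close> included, and can therefore
  serve as the termination measure of loops.\<close>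

lemma hx_time: "hx p s s' ==> fst (snd (snd s)) < fst (snd (snd s'))"
 by (induction rule: hx.induct) auto

text \<open>Total correctness: a run is required to exist. Clock and output are arguments of the
  postcondition, so that results and time bounds are proved together.\<close>

definition wp :: "prg => ((reg => nat) => arrays => nat => nat list => bool) =>
  (reg => nat) => arrays => nat => nat list => bool" where
 "wp p Q rg ar t out \<longleftrightarrow>
  (\<exists>rg' ar' t' out'. hx p (rg, ar, t, out) (rg', ar', t', out') & Q rg' ar' t' out')"

lemma wp_simps [simp]:
 "wp Nop Q rg ar t out = Q rg ar (Suc t) out"
 "wp (x ::= e) Q rg ar t out = (x < xl & ok rg ar e & Q (rg(x := ev rg ar e)) ar (Suc t) out)"
 "wp (Put k i e) Q rg ar t out = (ok rg ar i & ok rg ar e & k < na & ev rg ar i < len k &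
  ev rg ar e < 2 ^ wd k & Q rg (ar(k := (ar k)(ev rg ar i := ev rg ar e))) (Suc t) out)"
 "wp (Emit e) Q rg ar t out = (ok rg ar e & Q rg ar (Suc t) (out @ [ev rg ar e]))"
 "wp (p ;; q) Q rg ar t out = wp p (wp q Q) rg ar t out"
 "wp (Cond b p q) Q rg ar t out = (bok rg ar b &
  (if bv rg ar b then wp p Q rg ar (Suc t) out else wp q Q rg ar (Suc t) out))"
proof -
 show "wp Nop Q rg ar t out = Q rg ar (Suc t) out"
  unfolding wp_def using hNop by (blast elim: hx_elims)
 show "wp (x ::= e) Q rg ar t out = (x < xl & ok rg ar e & Q (rg(x := ev rg ar e)) ar (Suc t) out)"
  unfolding wp_def using hAsg by (blast elim: hx_elims)
 show "wp (Put k i e) Q rg ar t out = (ok rg ar i & ok rg ar e & k < na & ev rg ar i < len k &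
  ev rg ar e < 2 ^ wd k & Q rg (ar(k := (ar k)(ev rg ar i := ev rg ar e))) (Suc t) out)"
  unfolding wp_def using hPut by (blast elim: hx_elims)
 show "wp (Emit e) Q rg ar t out = (ok rg ar e & Q rg ar (Suc t) (out @ [ev rg ar e]))"
  unfolding wp_def using hEmit by (blast elim: hx_elims)
 show "wp (p ;; q) Q rg ar t out = wp p (wp q Q) rg ar t out"
 proof
  assume "wp (p ;; q) Q rg ar t out"
  then obtain rg' ar' t' out' where h: "hx (p ;; q) (rg, ar, t, out) (rg', ar', t', out')" "Q rg' ar' t' out'"
   unfolding wp_def by blast
  from h(1) obtain s where "hx p (rg, ar, t, out) s" "hx q s (rg', ar', t', out')"
   by (blast elim: hx_elims(5))
  then show "wp p (wp q Q) rg ar t out" using h(2)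
   by (cases s) (unfold wp_def, blast)
 next
  assume "wp p (wp q Q) rg ar t out"
  then show "wp (p ;; q) Q rg ar t out" unfolding wp_def by (blast intro: hSq)
 qed
 show "wp (Cond b p q) Q rg ar t out = (bok rg ar b &
  (if bv rg ar b then wp p Q rg ar (Suc t) out else wp q Q rg ar (Suc t) out))"
  unfolding wp_def by (cases "bv rg ar b") (simp_all, (blast elim: hx_elims intro: hCondT hCondF)+)
qed

lemma wp_mono:
 assumes "wp p Q rg ar t out"
  and "\<And>rg' ar' t' out'. Q rg' ar' t' out' ==> t < t' ==> Q' rg' ar' t' out'"
 shows "wp p Q' rg ar t out"
proof -
 obtain rg' ar' t' out' where h: "hx p (rg, ar, t, out) (rg', ar', t', out')" "Q rg' ar' t' out'"
  using assms(1) unfolding wp_def by blast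
 with assms(2) hx_time[OF h(1)] show ?thesis unfolding wp_def by fastforce
qed

text \<open>Since each round advances the clock, an upper bound \<open>B\<close> on the clock within
  the invariant already forces termination; no separate variant is needed, and \<open>B\<close> does
  not occur in the conclusion.\<close>

lemma wp_loop:
 assumes init: "I rg ar t out"
  and bnd: "\<And>rg ar t out. I rg ar t out ==> t <= B"
  and bok: "\<And>rg ar t out. I rg ar t out ==> bok rg ar b"
  and step: "\<And>rg ar t out. I rg ar t out ==> bv rg ar b ==> wp p I rg ar (Suc t) out"
  and fin: "\<And>rg ar t out. I rg ar t out ==> \<not> bv rg ar b ==> Q rg ar (Suc t) out"
 shows "wp (Loop b p) Q rg ar t out"
 using init
proof (induction "B - t" arbitrary: rg ar t out rule: less_induct)
 case less
 show ?case
 proof (cases "bv rg ar b")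
  case False
  then show ?thesis using fin[OF less.prems] bok[OF less.prems]
   unfolding wp_def by (blast intro: hLoopF)
 next
  case True
  obtain rg' ar' t' out' where h: "hx p (rg, ar, Suc t, out) (rg', ar', t', out')" "I rg' ar' t' out'"
   using step[OF less.prems True] unfolding wp_def by blast
  have "t < t'" using hx_time[OF h(1)] by simp
  then have "B - t' < B - t" using bnd[OF h(2)] by linarith
  from less.hyps[OF this h(2)] show ?thesis
   using h(1) bok[OF less.prems] True unfolding wp_def by (blast intro: hLoopT)
 qed
qed

lemma wp_loop':
 assumes "I rg ar t out"
  and "\<And>rg ar t out. I rg ar t out ==> t <= B & bok rg ar b &
   (if bv rg ar b then wp p I rg ar (Suc t) out else Q rg ar (Suc t) out)"
 shows "wp (Loop b p) Q rg ar t out"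
 by (rule wp_loop[of I _ _ _ _ B]) (insert assms, auto split: if_splits)

end

section \<open>Compilation to the word RAM\<close>

text \<open>On code made of assignments, arithmetic and memory accesses only, \<open>exec\<close> is
  a function; \<open>slx\<close>, \<open>sls\<close> and \<open>slt\<close> compute its final state,
  space and time, so that such code is evaluated by rewriting.\<close>

fun straight :: "com => bool" where
 "straight (SET x a) = True"
| "straight (OP f x a b) = True"
| "straight (LOAD x a) = True"
| "straight (STORE a b) = True"
| "straight (SEQ c1 c2) = (straight c1 & straight c2)"
| "straight _ = False"

fun slx :: "nat => com => state => state" where
 "slx w (SET x a) (rg, mu) = (rg(x := val w rg a), mu)"
| "slx w (OP f x a b) (rg, mu) = (rg(x := binop_val w f (val w rg a) (val w rg b)), mu)"
| "slx w (LOAD x a) (rg, mu) = (rg(x := mu (val w rg a)), mu)"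
| "slx w (STORE a b) (rg, mu) = (rg, mu(val w rg a := val w rg b))"
| "slx w (SEQ c1 c2) \<sigma> = slx w c2 (slx w c1 \<sigma>)"
| "slx w _ \<sigma> = \<sigma>"

fun sls :: "nat => com => state => nat" where
 "sls w (LOAD x a) (rg, mu) = Suc (val w rg a)"
| "sls w (STORE a b) (rg, mu) = Suc (val w rg a)"
| "sls w (SEQ c1 c2) \<sigma> = max (sls w c1 \<sigma>) (sls w c2 (slx w c1 \<sigma>))"
| "sls w _ \<sigma> = 0"

fun slt :: "com => nat" where
 "slt (SEQ c1 c2) = slt c1 + slt c2"
| "slt _ = 1"

lemma straight_exec: "straight c ==> exec w adj r c \<sigma> (slt c) (sls w c \<sigma>) [] (slx w c \<sigma>)"
proof (induction c arbitrary: \<sigma>)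
 case (SEQ c1 c2)
 then show ?case using exec.Seq[of w adj r c1 \<sigma> "slt c1" "sls w c1 \<sigma>" "[]" "slx w c1 \<sigma>" c2
   "slt c2" "sls w c2 (slx w c1 \<sigma>)" "[]" "slx w c2 (slx w c1 \<sigma>)"] by simp
qed (auto intro: exec.intros simp del: One_nat_def simp: One_nat_def[symmetric] split: prod.splits)

abbreviation tmp :: nat where "tmp \<equiv> 300"
text \<open>Array \<open>k\<close> is described by four registers: address of its first word, field
  width, fields per word and field mask. They cannot be constants because they depend on the input.
  Fifty arrays fit exactly below \<open>tmp\<close>.\<close>

abbreviation lb :: "nat => nat" where "lb k \<equiv> 100 + 4 * k"
abbreviation lf :: "nat => nat" where "lf k \<equiv> 101 + 4 * k"
abbreviation lq :: "nat => nat" where "lq k \<equiv> 102 + 4 * k"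
abbreviation lm :: "nat => nat" where "lm k \<equiv> 103 + 4 * k"

fun opc :: "aop => nat => com" where
 "opc Plus k = OP Add k (Reg k) (Reg (k + 1))"
| "opc Minus k = OP Sub k (Reg k) (Reg (k + 1))"
| "opc Times k = OP Mul k (Reg k) (Reg (k + 1))"
| "opc Quot k = OP Div k (Reg k) (Reg (k + 1))"
| "opc Rem k = SEQ (OP Div (k + 2) (Reg k) (Reg (k + 1)))
  (SEQ (OP Mul (k + 2) (Reg (k + 2)) (Reg (k + 1))) (OP Sub k (Reg k) (Reg (k + 2))))"
| "opc Shl k = OP ShiftL k (Reg k) (Reg (k + 1))"
| "opc Shr k = OP ShiftR k (Reg k) (Reg (k + 1))"

text \<open>Turns the index in register \<open>k\<close> into the address of its word (in \<open>k + 1\<close>) and the shift within it (in \<open>k + 2\<close>).\<close>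

definition addr_com :: "nat => nat => com" where
 "addr_com j k =
  SEQ (OP Div (k + 1) (Reg k) (Reg (lq j)))
  (SEQ (OP Mul (k + 2) (Reg (k + 1)) (Reg (lq j)))
  (SEQ (OP Sub (k + 2) (Reg k) (Reg (k + 2)))
  (SEQ (OP Mul (k + 2) (Reg (k + 2)) (Reg (lf j)))
    (OP Add (k + 1) (Reg (k + 1)) (Reg (lb j))))))"

definition get_com :: "nat => nat => com" where
 "get_com j k =
  SEQ (addr_com j k)
  (SEQ (LOAD k (Reg (k + 1)))
  (SEQ (OP ShiftR k (Reg k) (Reg (k + 2)))
    (OP And k (Reg k) (Reg (lm j)))))"

text \<open>A field is overwritten by xoring the word with the shifted xor of old and new value;
  this alters no bit of the other fields and needs no complement of the mask.\<close>

definition put_com :: "nat => com" where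
 "put_com j =
  SEQ (addr_com j (tmp + 1))
  (SEQ (LOAD (tmp + 4) (Reg (tmp + 2)))
  (SEQ (OP ShiftR (tmp + 5) (Reg (tmp + 4)) (Reg (tmp + 3)))
  (SEQ (OP And (tmp + 5) (Reg (tmp + 5)) (Reg (lm j)))
  (SEQ (OP Xor (tmp + 5) (Reg (tmp + 5)) (Reg tmp))
  (SEQ (OP ShiftL (tmp + 5) (Reg (tmp + 5)) (Reg (tmp + 3)))
  (SEQ (OP Xor (tmp + 4) (Reg (tmp + 4)) (Reg (tmp + 5)))
    (STORE (Reg (tmp + 2)) (Reg (tmp + 4)))))))))"

text \<open>The registers from \<open>k\<close> upwards act as an evaluation stack whose result is
  left in register \<open>k\<close>.\<close>

fun ce :: "aexp => nat => com" where
 "ce (Lit c) k = SET k (Const c)"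
| "ce (Rg x) k = SET k (Reg x)"
| "ce (Bin f a b) k = SEQ (ce a k) (SEQ (ce b (k + 1)) (opc f k))"
| "ce (Arr j e) k = SEQ (ce e k) (get_com j k)"
| "ce (Dg e) k = SEQ (ce e k) (DEGREE k (Reg k))"
| "ce (Nb e i) k = SEQ (ce e k) (SEQ (ce i (k + 1)) (NEIGHBOUR k (Reg k) (Reg (k + 1))))"
| "ce NV k = NUMVERTS k"
| "ce ST k = START k"
| "ce WL k = WORDLEN k"

definition test_com :: "cond => com" where
 "test_com c = IF c (SET tmp (Const 1)) (SET tmp (Const 0))"

fun cb :: "bexp => com" where
 "cb (Lt a b) = SEQ (ce a tmp) (SEQ (ce b (tmp + 1)) (test_com (Less (Reg tmp) (Reg (tmp + 1)))))"
| "cb (Eqv a b) = SEQ (ce a tmp) (SEQ (ce b (tmp + 1)) (test_com (Eq (Reg tmp) (Reg (tmp + 1)))))"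
| "cb (Neqv a b) = SEQ (ce a tmp) (SEQ (ce b (tmp + 1)) (test_com (Neq (Reg tmp) (Reg (tmp + 1)))))"

text \<open>\<open>WHILE\<close> can only compare operands, so the truth value of a loop condition
  is kept in \<open>tmp\<close> and recomputed at the end of each round.\<close>

fun cp :: "prg => com" where
 "cp Nop = SKIP"
| "cp (x ::= e) = SEQ (ce e tmp) (SET x (Reg tmp))"
| "cp (Put k i e) = SEQ (ce e tmp) (SEQ (ce i (tmp + 1)) (put_com k))"
| "cp (Emit e) = SEQ (ce e tmp) (OUTPUT (Reg tmp))"
| "cp (p ;; q) = SEQ (cp p) (cp q)"
| "cp (Cond b p q) = SEQ (cb b) (IF (Neq (Reg tmp) (Const 0)) (cp p) (cp q))"
| "cp (Loop b p) = SEQ (cb b) (WHILE (Neq (Reg tmp) (Const 0)) (SEQ (cp p) (cb b)))"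

fun ecost :: "aexp => nat" where
 "ecost (Bin f a b) = ecost a + ecost b + slt (opc f 0)"
| "ecost (Arr j e) = ecost e + 8"
| "ecost (Dg e) = ecost e + 1"
| "ecost (Nb e i) = ecost e + ecost i + 1"
| "ecost _ = 1"

fun bcost :: "bexp => nat" where
 "bcost (Lt a b) = ecost a + ecost b + 2"
| "bcost (Eqv a b) = ecost a + ecost b + 2"
| "bcost (Neqv a b) = ecost a + ecost b + 2"

text \<open>Bounds the machine steps that one tick of the abstract clock may cost. Branches are
  added up rather than maximised: the sum is still a constant of the program and dominates the
  weight of every part.\<close>

fun pcost :: "prg => nat" where
 "pcost Nop = 1"
| "pcost (x ::= e) = ecost e + 1"
| "pcost (Put k i e) = ecost i + ecost e + 12"
| "pcost (Emit e) = ecost e + 1"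
| "pcost (p ;; q) = pcost p + pcost q"
| "pcost (Cond b p q) = bcost b + 1 + pcost p + pcost q"
| "pcost (Loop b p) = bcost b + 1 + pcost p"

lemma opc_straight [simp]: "straight (opc f k)"
 by (cases f) auto

lemma slt_opc: "slt (opc f k) = slt (opc f 0)"
 by (cases f) auto

section \<open>Bit fields within words and their update\<close>

definition cell :: "nat => nat => nat => (nat => nat) => nat => nat" where
 "cell f q b mu i = take_bit f (drop_bit (i mod q * f) (mu (b + i div q)))"

lemma cell_put_same:
 assumes "v < 2 ^ f"
 shows "cell f q b (mu(b + i div q := xor (mu (b + i div q)) (push_bit (i mod q * f) (xor (cell f q b mu i) v)))) i = v"
proof -
 have v: "take_bit f v = v" using assms by (simp add: take_bit_nat_eq_self)
 show ?thesis
  unfolding cell_def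
  apply (subst (2) v[symmetric])
  apply (rule bit_eqI)
  apply (auto simp: bit_take_bit_iff bit_drop_bit_eq bit_xor_iff bit_push_bit_iff)
  done
qed

text \<open>Both the old value of the field and \<open>v\<close> are below \<open>2 ^ f\<close>, so
  the shifted pattern has bits only inside the field of \<open>i\<close>, which shares no bit
  position with the field of \<open>j\<close>.\<close>

lemma cell_put_other:
 assumes v: "v < 2 ^ f" and ne: "i ~= j" and q: "0 < q"
 shows "cell f q b (mu(b + i div q := xor (mu (b + i div q)) (push_bit (i mod q * f) (xor (cell f q b mu i) v)))) j
  = cell f q b mu j"
proof (cases "i div q = j div q")
 case True
 have ne': "i mod q ~= j mod q" using ne True by (metis div_mult_mod_eq)
 have v: "take_bit f v = v" using v by (simp add: take_bit_nat_eq_self)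
 \<comment> \<open>Offsets of different fields of one word differ by at least
   \<open>f\<close>.\<close>
 have disj: "\<not> (i mod q * f <= j mod q * f + n & j mod q * f + n < i mod q * f + f)" if "n < f" for n
 proof
  assume a: "i mod q * f <= j mod q * f + n & j mod q * f + n < i mod q * f + f"
  from ne' consider "i mod q + 1 <= j mod q" | "j mod q + 1 <= i mod q" by linarith
  then show False
  proof cases
   case 1
   then have "(i mod q + 1) * f <= j mod q * f" by (rule mult_le_mono1)
   then show False using a by simp
  next
   case 2
   then have "(j mod q + 1) * f <= i mod q * f" by (rule mult_le_mono1)
   then show False using a that by simp
  qed
 qed
 have vb: "\<not> bit v n" if "\<not> n < f" for n using v that by (metis bit_take_bit_iff)
 show ?thesis
  unfolding cell_def
  apply (rule bit_eqI)
  apply (simp add: True bit_take_bit_iff bit_drop_bit_eq bit_xor_iff bit_push_bit_iff)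
  using disj vb by (smt (verit, ccfv_threshold) add.commute le_add_diff_inverse less_diff_conv2 nat_add_left_cancel_less not_less add_less_cancel_right)
next
 case False
 then show ?thesis by (simp add: cell_def)
qed


text \<open>When there are arrays, programs may assign only registers below 100, as the descriptors
  start there. Without arrays the limit rises to 300, which lets the prelude write the descriptors
  that the main program will use.\<close>

locale machine = ram w adj r na len wd xl
 for w adj r na len wd xl +
 fixes base :: "nat => nat" and sp :: nat
 assumes n_lt: "length adj < 2 ^ w" and r_lt: "r < 2 ^ w"
  and deg_lt: "\<And>v. v < length adj ==> length (adj ! v) < 2 ^ w"
  and nb_lt: "\<And>v i. v < length adj ==> i < length (adj ! v) ==> adj ! v ! i < 2 ^ w"
  and wd_pos: "\<And>k. k < na ==> 0 < wd k" and wd_le: "\<And>k. k < na ==> wd k <= w"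
  and addr_lt: "\<And>k i. k < na ==> i < len k ==> base k + i div (w div wd k) < sp"
  and sp_le: "sp <= 2 ^ w"
  and disj: "\<And>k k' i i'. k < na ==> k' < na ==> k ~= k' ==> i < len k ==> i' < len k' ==>
   base k + i div (w div wd k) ~= base k' + i' div (w div wd k')"
  and na_le: "na <= 50" and xl_le: "xl <= 300" and xl_na: "0 < na ==> xl <= 100"
begin

definition layout :: "(nat => nat) => bool" where
 "layout rg \<longleftrightarrow> (\<forall>k<na. rg (lb k) = base k & rg (lf k) = wd k & rg (lq k) = w div wd k &
  rg (lm k) = 2 ^ wd k - 1)"

definition sim :: "(nat => nat) => arrays => (nat => nat) => (nat => nat) => bool" where
 "sim rg ar rg' mu \<longleftrightarrow> (\<forall>x<tmp. rg' x = rg x & rg x < 2 ^ w) & layout rg &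
  (\<forall>k<na. \<forall>i<len k. ar k i = cell (wd k) (w div wd k) (base k) mu i)"

lemma cell_lt: "cell f q b mu i < 2 ^ f"
 by (simp add: cell_def)

text \<open>Every intermediate value fits into a word, so the truncations performed by the machine
  are identities.\<close>

lemma ev_lt: "sim rg ar rg' mu ==> ok rg ar e ==> ev rg ar e < 2 ^ w"
proof (induction e)
 case (Bin f a b)
 then have a: "ev rg ar a < 2 ^ w" "ev rg ar b < 2 ^ w" by auto
 with Bin.prems(2) show ?case
  by (cases f) (auto intro: le_less_trans[OF div_le_dividend] le_less_trans[OF mod_less_eq_dividend])
next
 case (Arr k e)
 then have "ev rg ar (Arr k e) < 2 ^ wd k" by (auto simp: sim_def cell_lt)
 also have "(2 ^ wd k :: nat) <= 2 ^ w" using wd_le Arr.prems(2) by (intro power_increasing) auto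
 finally show ?case .
next
 case WL
 show ?case by simp
qed (auto simp: sim_def n_lt r_lt deg_lt nb_lt)

text \<open>The remainder has no instruction of its own and is computed from quotient and product.
  For \<open>b = 0\<close> both sides are \<open>a\<close>, by the conventions for division by
  zero.\<close>

lemma mod_by_div: "nat ((int a - int (a div b * b)) mod 2 ^ w) = a mod b" if "a < 2 ^ w" for a b :: nat
proof -
 have "int a - int (a div b * b) = int (a mod b)"
  by (simp add: zdiv_int zmod_int minus_div_mult_eq_mod)
 moreover have "a mod b < 2 ^ w" using that le_less_trans[OF mod_less_eq_dividend] by blast
 then have "int (a mod b) < 2 ^ w" by (simp only: of_nat_less_numeral_power_cancel_iff)
 then have "int (a mod b) mod 2 ^ w = int (a mod b)" by (intro mod_pos_pos_trivial) simp_all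
 ultimately show ?thesis by (simp only: nat_int)
qed

lemma sub_val: "nat ((int a - int b) mod 2 ^ w) = a - b" if "a < 2 ^ w" "b <= a" for a b :: nat
proof -
 have "int a - int b = int (a - b)" using that by simp
 moreover have "int (a - b) < 2 ^ w"
  using that(1) by (simp only: of_nat_less_numeral_power_cancel_iff)
 then have "int (a - b) mod 2 ^ w = int (a - b)"
  by (intro mod_pos_pos_trivial) simp_all
 ultimately show ?thesis by (simp only: nat_int)
qed

lemma opc_ok:
 assumes "op_ok w f (rg k) (rg (k + 1))" "rg k < 2 ^ w" "rg (k + 1) < 2 ^ w"
 shows "\<exists>s rg'. exec w adj r (opc f k) (rg, mu) (slt (opc f 0)) s [] (rg', mu) & s <= sp &
  rg' k = op_val f (rg k) (rg (k + 1)) & (\<forall>x<k. rg' x = rg x)"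
proof -
 have dm: "rg k div rg (k + 1) * rg (k + 1) <= rg k" by simp
 then have dm': "rg k div rg (k + 1) * rg (k + 1) < 2 ^ w" using assms(2) by linarith
 define rg' where "rg' = fst (slx w (opc f k) (rg, mu))"
 have e: "slx w (opc f k) (rg, mu) = (rg', mu)" unfolding rg'_def by (cases f) auto
 have s: "sls w (opc f k) (rg, mu) = 0" by (cases f) auto
 have v: "rg' k = op_val f (rg k) (rg (k + 1))"
 proof (cases f)
  case Minus
  then show ?thesis unfolding rg'_def using assms sub_val[OF assms(2)] by simp
 next
  case Rem
  then show ?thesis unfolding rg'_def using dm' mod_by_div[OF assms(2)]
   by (simp add: take_bit_nat_eq_self del: of_nat_mult)
 qed (insert assms, auto simp: rg'_def take_bit_nat_eq_self push_bit_eq_mult drop_bit_eq_div)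
 have x: "\<forall>x<k. rg' x = rg x" unfolding rg'_def by (cases f) auto
 show ?thesis using straight_exec[OF opc_straight, of w adj r f k "(rg, mu)"] e s v x
  by (metis slt_opc zero_le)
qed

lemma addr_com_slx:
 assumes "j < na" "rg k < len j" "layout rg" "k \<ge> tmp" "rg k < 2 ^ w"
 shows "slx w (addr_com j k) (rg, mu) = (rg(k + 1 := base j + rg k div (w div wd j),
  k + 2 := rg k mod (w div wd j) * wd j), mu)"
proof -
 have l: "rg (lb j) = base j" "rg (lf j) = wd j" "rg (lq j) = w div wd j"
  using assms by (auto simp: layout_def)
 have ne: "lq j ~= k + 1" "lq j ~= k + 2" "lf j ~= k + 1" "lf j ~= k + 2" "lb j ~= k + 1" "lb j ~= k + 2"
  "lb j ~= k" "lq j ~= k" "lf j ~= k"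
  using assms na_le by auto
 have dm: "rg k div (w div wd j) * (w div wd j) < 2 ^ w"
  using assms(5) le_less_trans[OF div_times_less_eq_dividend] by blast
 have "0 < w div wd j" using wd_pos wd_le assms(1) by (simp add: div_greater_zero_iff)
 then have "rg k mod (w div wd j) < w div wd j" by simp
 then have "rg k mod (w div wd j) * wd j <= w div wd j * wd j" by simp
 also have "\<dots> <= w" by simp
 also have "w < 2 ^ w" by simp
 finally have sh: "rg k mod (w div wd j) * wd j < 2 ^ w" .
 have ad: "base j + rg k div (w div wd j) < 2 ^ w"
  using addr_lt[OF assms(1,2)] sp_le by linarith
 have sb: "nat ((int (rg k) - int (rg k div (w div wd j) * (w div wd j))) mod 2 ^ w) = rg k mod (w div wd j)"
  by (rule mod_by_div[OF assms(5)])
 show ?thesis unfolding addr_com_def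
  using l ne dm sh ad sb by (simp add: take_bit_nat_eq_self fun_eq_iff add.commute del: of_nat_mult)
qed

lemma get_ok:
 assumes "j < na" "rg k < len j" "layout rg" "k \<ge> tmp" "rg k < 2 ^ w"
 shows "\<exists>s rg'. exec w adj r (get_com j k) (rg, mu) 8 s [] (rg', mu) & s <= sp &
  rg' k = cell (wd j) (w div wd j) (base j) mu (rg k) & (\<forall>x<k. rg' x = rg x)"
proof -
 have l: "rg (lm j) = 2 ^ wd j - 1" using assms by (auto simp: layout_def)
 have ne: "lm j ~= k" "lm j ~= k + 1" "lm j ~= k + 2" using assms na_le by auto
 have st: "straight (get_com j k)" by (simp add: get_com_def addr_com_def)
 have t: "slt (get_com j k) = 8" by (simp add: get_com_def addr_com_def)
 have s: "sls w (get_com j k) (rg, mu) <= sp"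
  using addr_lt[OF assms(1,2)] addr_com_slx[OF assms]
  by (auto simp: get_com_def) (simp add: addr_com_def)
 define rg' where "rg' = fst (slx w (get_com j k) (rg, mu))"
 have e: "slx w (get_com j k) (rg, mu) = (rg', mu)" unfolding rg'_def
  by (auto simp: get_com_def addr_com_slx[OF assms])
 have v: "rg' k = cell (wd j) (w div wd j) (base j) mu (rg k)" unfolding rg'_def
  using l ne by (simp add: get_com_def addr_com_slx[OF assms] cell_def take_bit_eq_mask mask_eq_exp_minus_1)
 have x: "\<forall>x<k. rg' x = rg x" unfolding rg'_def by (auto simp: get_com_def addr_com_slx[OF assms])
 show ?thesis using straight_exec[OF st, of w adj r "(rg, mu)"] e s v x t by metis
qed

lemma put_ok:
 assumes "j < na" "rg (tmp + 1) < len j" "layout rg" "rg (tmp + 1) < 2 ^ w" "rg tmp < 2 ^ wd j"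
 shows "\<exists>s rg' mu'. exec w adj r (put_com j) (rg, mu) 12 s [] (rg', mu') & s <= sp &
  (\<forall>x<tmp. rg' x = rg x) &
  (\<forall>k<na. \<forall>i<len k. cell (wd k) (w div wd k) (base k) mu' i =
   (if k = j & i = rg (tmp + 1) then rg tmp else cell (wd k) (w div wd k) (base k) mu i))"
proof -
 define a where "a = base j + rg (tmp + 1) div (w div wd j)"
 define sh where "sh = rg (tmp + 1) mod (w div wd j) * wd j"
 define old where "old = cell (wd j) (w div wd j) (base j) mu (rg (tmp + 1))"
 define mu' where "mu' = mu(a := xor (mu a) (push_bit sh (xor old (rg tmp))))"
 have as: "slx w (addr_com j (tmp + 1)) (rg, mu) = (rg(tmp + 2 := a, tmp + 3 := sh), mu)"
  using addr_com_slx[of j rg "tmp + 1" mu] assms unfolding a_def sh_def by simp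
 have ss: "sls w (addr_com j (tmp + 1)) (rg, mu) = 0" by (simp add: addr_com_def)
 have l: "rg (lm j) = 2 ^ wd j - 1" "lm j < tmp" using assms na_le by (auto simp: layout_def)
 have st: "straight (put_com j)" by (simp add: put_com_def addr_com_def)
 have t: "slt (put_com j) = 12" by (simp add: put_com_def addr_com_def)
 have asp: "a < sp" unfolding a_def by (rule addr_lt[OF assms(1,2)])
 have s: "sls w (put_com j) (rg, mu) <= sp"
  using as ss asp by (simp add: put_com_def)
 have q: "0 < w div wd j" using wd_pos wd_le assms(1) by (simp add: div_greater_zero_iff)
 have "xor old (rg tmp) < 2 ^ wd j"
 proof -
  have "take_bit (wd j) (xor old (rg tmp)) = xor old (rg tmp)"
   using assms(5) cell_lt[of "wd j"] by (simp add: take_bit_nat_eq_self old_def)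
  then show ?thesis by (metis take_bit_nat_less_exp)
 qed
 then have "xor old (rg tmp) * 2 ^ sh < 2 ^ wd j * 2 ^ sh" by simp
 also have "\<dots> <= (2 ^ w :: nat)"
 proof -
  \<comment> \<open>The field ends within its word, so shifting the pattern into place loses no bit
    to truncation.\<close>
  have "(rg (tmp + 1) mod (w div wd j) + 1) * wd j <= w div wd j * wd j"
   using q by (intro mult_le_mono1) (simp add: Suc_leI)
  also have "\<dots> <= w" by simp
  finally have "wd j + sh <= w" by (simp add: sh_def)
  then show ?thesis by (metis power_add power_increasing one_le_numeral)
 qed
 finally have pb: "take_bit w (push_bit sh (xor old (rg tmp))) = push_bit sh (xor old (rg tmp))"
  by (simp add: push_bit_eq_mult take_bit_nat_eq_self)
 have old: "and (drop_bit sh (mu a)) (2 ^ wd j - Suc 0) = old"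
  by (simp add: old_def cell_def a_def sh_def take_bit_eq_mask mask_eq_exp_minus_1)
 define rg' where "rg' = fst (slx w (put_com j) (rg, mu))"
 have e: "slx w (put_com j) (rg, mu) = (rg', mu')" unfolding rg'_def
  using as l pb old by (simp add: put_com_def mu'_def)
 have x: "\<forall>x<tmp. rg' x = rg x" unfolding rg'_def using as by (auto simp: put_com_def)
 have c: "cell (wd k) (w div wd k) (base k) mu' i =
   (if k = j & i = rg (tmp + 1) then rg tmp else cell (wd k) (w div wd k) (base k) mu i)"
  if k: "k < na" "i < len k" for k i
 proof (cases "k = j")
  case True
  then show ?thesis
   using cell_put_same[OF assms(5)] cell_put_other[OF assms(5) _ q]
   unfolding mu'_def a_def sh_def old_def by metis
 next
  case False
  then show ?thesis using disj[OF k(1) assms(1) False k(2) assms(2)]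
   by (simp add: cell_def mu'_def a_def)
 qed
 show ?thesis using straight_exec[OF st, of w adj r "(rg, mu)"] e s x t c by metis
qed

end

context machine
begin

lemma sim_cong: "sim rg ar rg' mu ==> (\<forall>x<tmp. rg'' x = rg' x) ==> sim rg ar rg'' mu"
 by (simp add: sim_def)

lemma sim_layout: "sim rg ar rg' mu ==> layout rg'"
 using na_le by (auto simp: sim_def layout_def)

lemma exec_seq:
 "exec w adj r c1 \<sigma> t1 s1 o1 \<sigma>' ==> exec w adj r c2 \<sigma>' t2 s2 o2 \<sigma>'' ==> s1 <= sp ==> s2 <= sp ==>
  \<exists>s. exec w adj r (SEQ c1 c2) \<sigma> (t1 + t2) s (o1 @ o2) \<sigma>'' & s <= sp"
 using exec.Seq by (metis max.bounded_iff)

text \<open>That registers below \<open>k\<close> are left alone keeps the left operand safe in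
  \<open>k\<close> while the right one is computed from \<open>k + 1\<close> on, and keeps the
  registers of the program, all below \<open>tmp\<close>, in the simulation relation.\<close>

lemma ce_ok:
 "sim rg ar rg' mu ==> ok rg ar e ==> tmp <= k ==>
 \<exists>s rg''. exec w adj r (ce e k) (rg', mu) (ecost e) s [] (rg'', mu) & s <= sp &
  rg'' k = ev rg ar e & (\<forall>x<k. rg'' x = rg' x)"
proof (induction e arbitrary: k rg')
 case (Lit c)
 have "exec w adj r (SET k (Const c)) (rg', mu) 1 0 [] (rg'(k := val w rg' (Const c)), mu)"
  by (rule exec.Set)
 with Lit show ?case by (auto simp: take_bit_nat_eq_self intro!: exI[of _ 0] exI[of _ "rg'(k := c)"])
next
 case (Rg x)
 have "exec w adj r (SET k (Reg x)) (rg', mu) 1 0 [] (rg'(k := val w rg' (Reg x)), mu)"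
  by (rule exec.Set)
 moreover have "rg' x = rg x" using Rg by (simp add: sim_def)
 ultimately show ?case
  by - (rule exI[of _ 0], rule exI[of _ "rg'(k := rg' x)"], simp add: fun_upd_def)
next
 case (Bin f a b)
 from Bin.prems have o: "ok rg ar a" "ok rg ar b" "op_ok w f (ev rg ar a) (ev rg ar b)" by auto
 from Bin.IH(1)[OF Bin.prems(1) o(1) Bin.prems(3)] obtain s1 rg1 where
  1: "exec w adj r (ce a k) (rg', mu) (ecost a) s1 [] (rg1, mu)" "s1 <= sp"
   "rg1 k = ev rg ar a" "\<forall>x<k. rg1 x = rg' x" by blast
 have sim1: "sim rg ar rg1 mu" using Bin.prems(1,3) 1(4) sim_cong by auto
 have k1: "tmp <= k + 1" using Bin.prems(3) by simp
 from Bin.IH(2)[OF sim1 o(2) k1] obtain s2 rg2 where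
  2: "exec w adj r (ce b (k + 1)) (rg1, mu) (ecost b) s2 [] (rg2, mu)" "s2 <= sp"
   "rg2 (k + 1) = ev rg ar b" "\<forall>x<k + 1. rg2 x = rg1 x" by blast
 have "rg2 k = ev rg ar a" using 1(3) 2(4) by simp
 then obtain s3 rg3 where
  3: "exec w adj r (opc f k) (rg2, mu) (slt (opc f 0)) s3 [] (rg3, mu)" "s3 <= sp"
   "rg3 k = op_val f (ev rg ar a) (ev rg ar b)" "\<forall>x<k. rg3 x = rg2 x"
  using opc_ok[of f rg2 k mu] o(3) 2(3) ev_lt[OF Bin.prems(1) o(1)] ev_lt[OF Bin.prems(1) o(2)] by auto
 obtain s4 where 4: "exec w adj r (SEQ (ce b (k + 1)) (opc f k)) (rg1, mu) (ecost b + slt (opc f 0)) s4 [] (rg3, mu)" "s4 <= sp"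
  using exec_seq[OF 2(1) 3(1) 2(2) 3(2)] by auto
 from exec_seq[OF 1(1) 4(1) 1(2) 4(2)] show ?case
  using 1(4) 2(4) 3(3,4) by (fastforce simp: add.assoc)
next
 case (Arr j e)
 from Arr.prems have o: "ok rg ar e" "j < na" "ev rg ar e < len j" by auto
 from Arr.IH[OF Arr.prems(1) o(1) Arr.prems(3)] obtain s1 rg1 where
  1: "exec w adj r (ce e k) (rg', mu) (ecost e) s1 [] (rg1, mu)" "s1 <= sp"
   "rg1 k = ev rg ar e" "\<forall>x<k. rg1 x = rg' x" by blast
 have sim1: "sim rg ar rg1 mu" using Arr.prems(1,3) 1(4) sim_cong by auto
 from get_ok[of j rg1 k mu] obtain s2 rg2 where
  2: "exec w adj r (get_com j k) (rg1, mu) 8 s2 [] (rg2, mu)" "s2 <= sp"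
   "rg2 k = cell (wd j) (w div wd j) (base j) mu (ev rg ar e)" "\<forall>x<k. rg2 x = rg1 x"
  using o 1(3) sim_layout[OF sim1] Arr.prems(3) ev_lt[OF Arr.prems(1) o(1)] by auto
 have "cell (wd j) (w div wd j) (base j) mu (ev rg ar e) = ar j (ev rg ar e)"
  using Arr.prems(1) o by (auto simp: sim_def)
 with exec_seq[OF 1(1) 2(1) 1(2) 2(2)] show ?case using 1(4) 2(3,4) by fastforce
next
 case (Dg e)
 from Dg.prems have o: "ok rg ar e" "ev rg ar e < length adj" by auto
 from Dg.IH[OF Dg.prems(1) o(1) Dg.prems(3)] obtain s1 rg1 where
  1: "exec w adj r (ce e k) (rg', mu) (ecost e) s1 [] (rg1, mu)" "s1 <= sp"
   "rg1 k = ev rg ar e" "\<forall>x<k. rg1 x = rg' x" by blast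
 have "exec w adj r (DEGREE k (Reg k)) (rg1, mu) 1 0 [] (rg1(k := length (adj ! ev rg ar e)), mu)"
  using exec.Degree[of w rg1 "Reg k" adj r k mu] 1(3) o(2) deg_lt[OF o(2)]
  by (simp add: take_bit_nat_eq_self)
 from exec_seq[OF 1(1) this 1(2)] show ?case using 1(4) by fastforce
next
 case (Nb a b)
 from Nb.prems have o: "ok rg ar a" "ok rg ar b" "ev rg ar a < length adj"
  "ev rg ar b < length (adj ! ev rg ar a)" by auto
 from Nb.IH(1)[OF Nb.prems(1) o(1) Nb.prems(3)] obtain s1 rg1 where
  1: "exec w adj r (ce a k) (rg', mu) (ecost a) s1 [] (rg1, mu)" "s1 <= sp"
   "rg1 k = ev rg ar a" "\<forall>x<k. rg1 x = rg' x" by blast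
 have sim1: "sim rg ar rg1 mu" using Nb.prems(1,3) 1(4) sim_cong by auto
 have k1: "tmp <= k + 1" using Nb.prems(3) by simp
 from Nb.IH(2)[OF sim1 o(2) k1] obtain s2 rg2 where
  2: "exec w adj r (ce b (k + 1)) (rg1, mu) (ecost b) s2 [] (rg2, mu)" "s2 <= sp"
   "rg2 (k + 1) = ev rg ar b" "\<forall>x<k + 1. rg2 x = rg1 x" by blast
 have "rg2 k = ev rg ar a" using 1(3) 2(4) by simp
 then have 3: "exec w adj r (NEIGHBOUR k (Reg k) (Reg (k + 1))) (rg2, mu) 1 0 []
   (rg2(k := adj ! ev rg ar a ! ev rg ar b), mu)"
  using exec.Neighbour[of w rg2 "Reg k" adj "Reg (k + 1)" r k mu] 2(3) o nb_lt[OF o(3,4)]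
  by (simp add: take_bit_nat_eq_self)
 obtain s4 where 4: "exec w adj r (SEQ (ce b (k + 1)) (NEIGHBOUR k (Reg k) (Reg (k + 1)))) (rg1, mu)
   (ecost b + 1) s4 [] (rg2(k := adj ! ev rg ar a ! ev rg ar b), mu)" "s4 <= sp"
  using exec_seq[OF 2(1) 3(1) 2(2)] by auto
 from exec_seq[OF 1(1) 4(1) 1(2) 4(2)] obtain s5 where
  "exec w adj r (ce (Nb a b) k) (rg', mu) (ecost (Nb a b)) s5 []
   (rg2(k := adj ! ev rg ar a ! ev rg ar b), mu)" "s5 <= sp"
  by (auto simp: add.assoc)
 moreover have "\<forall>x<k. (rg2(k := adj ! ev rg ar a ! ev rg ar b)) x = rg' x" using 1(4) 2(4) by simp
 ultimately show ?case
  by - (rule exI[of _ s5], rule exI[of _ "rg2(k := adj ! ev rg ar a ! ev rg ar b)"], simp add: fun_upd_def)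
next
 case NV
 have "exec w adj r (NUMVERTS k) (rg', mu) 1 0 [] (rg'(k := length adj), mu)"
  using exec.NumVerts[of w adj r k rg' mu] n_lt by (simp add: take_bit_nat_eq_self)
 then show ?case
  by - (rule exI[of _ 0], rule exI[of _ "rg'(k := length adj)"], simp add: fun_upd_def)
next
 case ST
 have "exec w adj r (START k) (rg', mu) 1 0 [] (rg'(k := r), mu)"
  using exec.Start[of w adj r k rg' mu] r_lt by (simp add: take_bit_nat_eq_self)
 then show ?case
  by - (rule exI[of _ 0], rule exI[of _ "rg'(k := r)"], simp add: fun_upd_def)
next
 case WL
 have "exec w adj r (WORDLEN k) (rg', mu) 1 0 [] (rg'(k := w), mu)"
  using exec.WordLen[of w adj r k rg' mu] by (simp add: take_bit_nat_eq_self)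
 then show ?case
  by - (rule exI[of _ 0], rule exI[of _ "rg'(k := w)"], simp add: fun_upd_def)
qed

lemma w_pos: "0 < w"
 if "r < length adj" "0 < na"
 using that wd_pos wd_le by (metis le_0_eq neq0_conv)

lemma test_ok:
 assumes "0 < w"
 shows "exec w adj r (test_com c) (rg, mu) 2 0 [] (rg(tmp := if holds w rg c then 1 else 0), mu)"
proof -
 have one: "take_bit w 1 = (1 :: nat)" using assms by simp
 have "exec w adj r (SET tmp (Const 1)) (rg, mu) 1 0 [] (rg(tmp := 1), mu)"
  "exec w adj r (SET tmp (Const 0)) (rg, mu) 1 0 [] (rg(tmp := 0), mu)"
  using exec.Set[of w adj r tmp "Const 1" rg mu] exec.Set[of w adj r tmp "Const 0" rg mu] one by auto
 from exec.IfTrue[OF _ this(1)] exec.IfFalse[OF _ this(2)] show ?thesis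
  unfolding test_com_def by (auto simp: numeral_2_eq_2)
qed

lemma cb_aux:
 assumes w: "0 < w" and s: "sim rg ar rg' mu" and o: "ok rg ar a" "ok rg ar b"
  and c: "\<And>rg''. rg'' tmp = ev rg ar a ==> rg'' (tmp + 1) = ev rg ar b ==> holds w rg'' c = v"
 shows "\<exists>s rg''. exec w adj r (SEQ (ce a tmp) (SEQ (ce b (tmp + 1)) (test_com c))) (rg', mu)
  (ecost a + ecost b + 2) s [] (rg'', mu) & s <= sp &
  (rg'' tmp ~= 0) = v & (\<forall>x<tmp. rg'' x = rg' x)"
proof -
 from ce_ok[OF s o(1), of tmp] obtain s1 rg1 where
  1: "exec w adj r (ce a tmp) (rg', mu) (ecost a) s1 [] (rg1, mu)" "s1 <= sp"
   "rg1 tmp = ev rg ar a" "\<forall>x<tmp. rg1 x = rg' x" by blast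
 have sim1: "sim rg ar rg1 mu" using s 1(4) sim_cong by auto
 from ce_ok[OF sim1 o(2), of "tmp + 1"] obtain s2 rg2 where
  2: "exec w adj r (ce b (tmp + 1)) (rg1, mu) (ecost b) s2 [] (rg2, mu)" "s2 <= sp"
   "rg2 (tmp + 1) = ev rg ar b" "\<forall>x<tmp + 1. rg2 x = rg1 x" by auto
 have h: "holds w rg2 c = v" by (rule c) (use 1 2 in auto)
 obtain s4 where 4: "exec w adj r (SEQ (ce b (tmp + 1)) (test_com c)) (rg1, mu) (ecost b + 2) s4 []
   (rg2(tmp := if v then 1 else 0), mu)" "s4 <= sp"
  using exec_seq[OF 2(1) test_ok[OF w] 2(2)] h by auto
 from exec_seq[OF 1(1) 4(1) 1(2) 4(2)] show ?thesis
  using 1(4) 2(4) by (auto simp: add.assoc intro!: exI[of _ "rg2(tmp := if v then 1 else 0)"] split: if_splits)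
qed

lemma cb_ok:
 assumes "0 < w" "sim rg ar rg' mu" "bok rg ar b"
 shows "\<exists>s rg''. exec w adj r (cb b) (rg', mu) (bcost b) s [] (rg'', mu) & s <= sp &
  (rg'' tmp ~= 0) = bv rg ar b & sim rg ar rg'' mu"
proof -
 have "\<exists>s rg''. exec w adj r (cb b) (rg', mu) (bcost b) s [] (rg'', mu) & s <= sp &
  (rg'' tmp ~= 0) = bv rg ar b & (\<forall>x<tmp. rg'' x = rg' x)"
 proof (cases b)
  case (Lt x y)
  show ?thesis unfolding Lt cb.simps bcost.simps bv.simps
   by (rule cb_aux) (use assms[unfolded Lt bok.simps] in auto)
 next
  case (Eqv x y)
  show ?thesis unfolding Eqv cb.simps bcost.simps bv.simps
   by (rule cb_aux) (use assms[unfolded Eqv bok.simps] in auto)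
 next
  case (Neqv x y)
  show ?thesis unfolding Neqv cb.simps bcost.simps bv.simps
   by (rule cb_aux) (use assms[unfolded Neqv bok.simps] in auto)
 qed
 then show ?thesis using sim_cong[OF assms(2)] by blast
qed

text \<open>If there are arrays, \<open>x\<close> is below 100 and cannot hit a descriptor; if there
  are none, \<open>layout\<close> is vacuous.\<close>

lemma sim_asg:
 assumes s: "sim rg ar rg' mu" and o: "ok rg ar e" and x: "x < xl" and v: "rg'' x = ev rg ar e"
  and f: "\<forall>y<tmp. y ~= x --> rg'' y = rg' y"
 shows "sim (rg(x := ev rg ar e)) ar rg'' mu"
proof -
 have l: "layout (rg(x := ev rg ar e))"
 proof (cases "0 < na")
  case True
  then have "x < 100" using x xl_na by simp
  then show ?thesis using s by (auto simp: sim_def layout_def)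
 next
  case False
  then show ?thesis unfolding layout_def by simp
 qed
 show ?thesis unfolding sim_def
 proof (intro conjI allI impI)
  fix y :: nat assume y: "y < tmp"
  show "rg'' y = (rg(x := ev rg ar e)) y" using v f s y by (auto simp: sim_def)
  show "(rg(x := ev rg ar e)) y < 2 ^ w" using ev_lt[OF s o] s y by (auto simp: sim_def)
 qed (insert l s, auto simp: sim_def)
qed

text \<open>The loop case is stated for the loop proper, i.e. after its condition has been evaluated.\<close>

theorem cp_ok:
 assumes w: "0 < w"
 shows "hx p s s' ==> sim (fst s) (fst (snd s)) rg mu ==>
  \<exists>t a out rg' mu'. exec w adj r (cp p) (rg, mu) t a out (rg', mu') & a <= sp &
   t + pcost p * fst (snd (snd s)) <= pcost p * fst (snd (snd s')) &
   snd (snd (snd s')) = snd (snd (snd s)) @ out &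
   sim (fst s') (fst (snd s')) rg' mu'"
proof (induction arbitrary: rg mu rule: hx.induct)
 case (hNop rgh ar t out)
 then show ?case using exec.Skip[of w adj r "(rg, mu)"] by fastforce
next
 case (hAsg x rgh ar e t out)
 then have s: "sim rgh ar rg mu" by simp
 from ce_ok[OF s hAsg(2), of tmp] obtain s1 rg1 where
  1: "exec w adj r (ce e tmp) (rg, mu) (ecost e) s1 [] (rg1, mu)" "s1 <= sp"
   "rg1 tmp = ev rgh ar e" "\<forall>x<tmp. rg1 x = rg x" by blast
 from exec_seq[OF 1(1) exec.Set[of w adj r x "Reg tmp" rg1 mu] 1(2)]
 obtain s2 where 2: "exec w adj r (cp (x ::= e)) (rg, mu) (ecost e + 1) s2 [] (rg1(x := ev rgh ar e), mu)" "s2 <= sp"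
  using 1(3) by auto
 have "sim (rgh(x := ev rgh ar e)) ar (rg1(x := ev rgh ar e)) mu"
  by (rule sim_asg[OF s hAsg(2,1)]) (use 1(4) in auto)
 with 2 show ?case
  by - (rule exI[of _ "ecost e + 1"], rule exI[of _ s2], rule exI[of _ "[]"], rule exI[of _ "rg1(x := ev rgh ar e)"], rule exI[of _ mu], simp add: fun_upd_def)
next
 case (hPut rgh ar i e k t out)
 then have s: "sim rgh ar rg mu" by simp
 from ce_ok[OF s hPut(2), of tmp] obtain s1 rg1 where
  1: "exec w adj r (ce e tmp) (rg, mu) (ecost e) s1 [] (rg1, mu)" "s1 <= sp"
   "rg1 tmp = ev rgh ar e" "\<forall>x<tmp. rg1 x = rg x" by blast
 have sim1: "sim rgh ar rg1 mu" using s 1(4) sim_cong by auto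
 from ce_ok[OF sim1 hPut(1), of "tmp + 1"] obtain s2 rg2 where
  2: "exec w adj r (ce i (tmp + 1)) (rg1, mu) (ecost i) s2 [] (rg2, mu)" "s2 <= sp"
   "rg2 (tmp + 1) = ev rgh ar i" "\<forall>x<tmp + 1. rg2 x = rg1 x" by auto
 have sim2: "sim rgh ar rg2 mu" using sim1 2(4) sim_cong by auto
 have v: "rg2 tmp = ev rgh ar e" using 1 2 by simp
 from put_ok[of k rg2 mu] obtain s3 rg3 mu3 where
  3: "exec w adj r (put_com k) (rg2, mu) 12 s3 [] (rg3, mu3)" "s3 <= sp" "\<forall>x<tmp. rg3 x = rg2 x"
  "\<forall>k'<na. \<forall>j<len k'. cell (wd k') (w div wd k') (base k') mu3 j =
   (if k' = k & j = ev rgh ar i then ev rgh ar e else cell (wd k') (w div wd k') (base k') mu j)"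
  using hPut(3-5) v 2(3) sim_layout[OF sim2] ev_lt[OF s hPut(1)] by auto
 obtain s4 where 4: "exec w adj r (SEQ (ce i (tmp + 1)) (put_com k)) (rg1, mu) (ecost i + 12) s4 [] (rg3, mu3)" "s4 <= sp"
  using exec_seq[OF 2(1) 3(1) 2(2) 3(2)] by auto
 from exec_seq[OF 1(1) 4(1) 1(2) 4(2)]
 obtain s5 where 5: "exec w adj r (cp (Put k i e)) (rg, mu) (ecost i + ecost e + 12) s5 [] (rg3, mu3)" "s5 <= sp"
  by (auto simp: ac_simps)
 have "sim rgh (ar(k := (ar k)(ev rgh ar i := ev rgh ar e))) rg3 mu3"
  using sim2 3(3,4) by (simp add: sim_def)
 with 5 show ?case
  by - (rule exI[of _ "ecost i + ecost e + 12"], rule exI[of _ s5], rule exI[of _ "[]"], rule exI[of _ rg3], rule exI[of _ mu3], simp add: fun_upd_def)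
next
 case (hEmit rgh ar e t out)
 then have s: "sim rgh ar rg mu" by simp
 from ce_ok[OF s hEmit(1), of tmp] obtain s1 rg1 where
  1: "exec w adj r (ce e tmp) (rg, mu) (ecost e) s1 [] (rg1, mu)" "s1 <= sp"
   "rg1 tmp = ev rgh ar e" "\<forall>x<tmp. rg1 x = rg x" by blast
 have sim1: "sim rgh ar rg1 mu" using s 1(4) sim_cong by auto
 from exec_seq[OF 1(1) exec.Output[of w adj r "Reg tmp" rg1 mu] 1(2)]
 obtain s2 where 2: "exec w adj r (cp (Emit e)) (rg, mu) (ecost e + 1) s2 [ev rgh ar e] (rg1, mu)" "s2 <= sp"
  using 1(3) by auto
 with sim1 show ?case
  by - (rule exI[of _ "ecost e + 1"], rule exI[of _ s2], rule exI[of _ "[ev rgh ar e]"], rule exI[of _ rg1], rule exI[of _ mu], simp)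
next
 case (hSq p s s' q s'')
 from hSq.IH(1)[OF hSq.prems] obtain t1 a1 o1 rg1 mu1 where
  1: "exec w adj r (cp p) (rg, mu) t1 a1 o1 (rg1, mu1)" "a1 <= sp"
   "t1 + pcost p * fst (snd (snd s)) <= pcost p * fst (snd (snd s'))"
   "snd (snd (snd s')) = snd (snd (snd s)) @ o1" "sim (fst s') (fst (snd s')) rg1 mu1" by blast
 from hSq.IH(2)[OF 1(5)] obtain t2 a2 o2 rg2 mu2 where
  2: "exec w adj r (cp q) (rg1, mu1) t2 a2 o2 (rg2, mu2)" "a2 <= sp"
   "t2 + pcost q * fst (snd (snd s')) <= pcost q * fst (snd (snd s''))"
   "snd (snd (snd s'')) = snd (snd (snd s')) @ o2" "sim (fst s'') (fst (snd s'')) rg2 mu2" by blast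
 have m: "pcost p * fst (snd (snd s')) <= pcost p * fst (snd (snd s''))"
  "pcost q * fst (snd (snd s)) <= pcost q * fst (snd (snd s'))"
  using hx_time[OF hSq.hyps(1)] hx_time[OF hSq.hyps(2)] by simp_all
 have t: "(t1 + t2) + pcost (p ;; q) * fst (snd (snd s)) <= pcost (p ;; q) * fst (snd (snd s''))"
  using 1(3) 2(3) m by (simp only: pcost.simps add_mult_distrib)
 from exec_seq[OF 1(1) 2(1) 1(2) 2(2)] obtain a where
  "exec w adj r (cp (p ;; q)) (rg, mu) (t1 + t2) a (o1 @ o2) (rg2, mu2)" "a <= sp" by auto
 with t 1(4) 2(4,5) show ?case
  by - (rule exI[of _ "t1 + t2"], rule exI[of _ a], rule exI[of _ "o1 @ o2"], rule exI[of _ rg2], rule exI[of _ mu2], simp)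
next
 case (hCondT rgh ar b p t out s' q)
 then have s: "sim rgh ar rg mu" by simp
 from cb_ok[OF w s hCondT(1)] hCondT(2) obtain s1 rg1 where
  1: "exec w adj r (cb b) (rg, mu) (bcost b) s1 [] (rg1, mu)" "s1 <= sp" "rg1 tmp ~= 0" "sim rgh ar rg1 mu"
  by blast
 from hCondT.IH[of rg1 mu] 1(4) obtain t2 a2 o2 rg2 mu2 where
  2: "exec w adj r (cp p) (rg1, mu) t2 a2 o2 (rg2, mu2)" "a2 <= sp"
   "t2 + pcost p * Suc t <= pcost p * fst (snd (snd s'))"
   "snd (snd (snd s')) = out @ o2" "sim (fst s') (fst (snd s')) rg2 mu2" by auto
 have "exec w adj r (IF (Neq (Reg tmp) (Const 0)) (cp p) (cp q)) (rg1, mu) (Suc t2) a2 o2 (rg2, mu2)"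
  by (rule exec.IfTrue[OF _ 2(1)]) (use 1(3) in simp)
 from exec_seq[OF 1(1) this 1(2) 2(2)] obtain a where
  3: "exec w adj r (cp (Cond b p q)) (rg, mu) (bcost b + Suc t2) a o2 (rg2, mu2)" "a <= sp" by auto
 have "Suc t <= fst (snd (snd s'))" using hx_time[OF hCondT(3)] by simp
 then obtain d where d: "fst (snd (snd s')) = Suc t + d" using le_Suc_ex by blast
 have "bcost b + Suc t2 + pcost (Cond b p q) * t <= pcost (Cond b p q) * fst (snd (snd s'))"
  using 2(3) unfolding d by (simp add: algebra_simps)
 with 3 2(4,5) show ?case
  by - (rule exI[of _ "bcost b + Suc t2"], rule exI[of _ a], rule exI[of _ o2], rule exI[of _ rg2], rule exI[of _ mu2], simp)
next
 case (hCondF rgh ar b q t out s' p)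
 then have s: "sim rgh ar rg mu" by simp
 from cb_ok[OF w s hCondF(1)] hCondF(2) obtain s1 rg1 where
  1: "exec w adj r (cb b) (rg, mu) (bcost b) s1 [] (rg1, mu)" "s1 <= sp" "rg1 tmp = 0" "sim rgh ar rg1 mu"
  by blast
 from hCondF.IH[of rg1 mu] 1(4) obtain t2 a2 o2 rg2 mu2 where
  2: "exec w adj r (cp q) (rg1, mu) t2 a2 o2 (rg2, mu2)" "a2 <= sp"
   "t2 + pcost q * Suc t <= pcost q * fst (snd (snd s'))"
   "snd (snd (snd s')) = out @ o2" "sim (fst s') (fst (snd s')) rg2 mu2" by auto
 have "exec w adj r (IF (Neq (Reg tmp) (Const 0)) (cp p) (cp q)) (rg1, mu) (Suc t2) a2 o2 (rg2, mu2)"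
  by (rule exec.IfFalse[OF _ 2(1)]) (use 1(3) in simp)
 from exec_seq[OF 1(1) this 1(2) 2(2)] obtain a where
  3: "exec w adj r (cp (Cond b p q)) (rg, mu) (bcost b + Suc t2) a o2 (rg2, mu2)" "a <= sp" by auto
 have "Suc t <= fst (snd (snd s'))" using hx_time[OF hCondF(3)] by simp
 then obtain d where d: "fst (snd (snd s')) = Suc t + d" using le_Suc_ex by blast
 have "bcost b + Suc t2 + pcost (Cond b p q) * t <= pcost (Cond b p q) * fst (snd (snd s'))"
  using 2(3) unfolding d by (simp add: algebra_simps)
 with 3 2(4,5) show ?case
  by - (rule exI[of _ "bcost b + Suc t2"], rule exI[of _ a], rule exI[of _ o2], rule exI[of _ rg2], rule exI[of _ mu2], simp)
next
 case (hLoopF rgh ar b p t out)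
 then have s: "sim rgh ar rg mu" by simp
 from cb_ok[OF w s hLoopF(1)] hLoopF(2) obtain s1 rg1 where
  1: "exec w adj r (cb b) (rg, mu) (bcost b) s1 [] (rg1, mu)" "s1 <= sp" "rg1 tmp = 0" "sim rgh ar rg1 mu"
  by blast
 have "exec w adj r (WHILE (Neq (Reg tmp) (Const 0)) (SEQ (cp p) (cb b))) (rg1, mu) 1 0 [] (rg1, mu)"
  by (rule exec.WhileFalse) (use 1(3) in simp)
 from exec_seq[OF 1(1) this 1(2)] obtain a where
  3: "exec w adj r (cp (Loop b p)) (rg, mu) (bcost b + 1) a [] (rg1, mu)" "a <= sp" by auto
 then show ?case using 1(4)
  by - (rule exI[of _ "bcost b + 1"], rule exI[of _ a], rule exI[of _ "[]"], rule exI[of _ rg1], rule exI[of _ mu], simp)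
next
 case (hLoopT rgh ar b p t out s' s'')
 let ?W = "WHILE (Neq (Reg tmp) (Const 0)) (SEQ (cp p) (cb b))"
 from hLoopT have s: "sim rgh ar rg mu" by simp
 from cb_ok[OF w s hLoopT(1)] hLoopT(2) obtain s1 rg1 where
  1: "exec w adj r (cb b) (rg, mu) (bcost b) s1 [] (rg1, mu)" "s1 <= sp" "rg1 tmp ~= 0" "sim rgh ar rg1 mu"
  by blast
 from hLoopT.IH(1)[of rg1 mu] 1(4) obtain t2 a2 o2 rg2 mu2 where
  2: "exec w adj r (cp p) (rg1, mu) t2 a2 o2 (rg2, mu2)" "a2 <= sp"
   "t2 + pcost p * Suc t <= pcost p * fst (snd (snd s'))"
   "snd (snd (snd s')) = out @ o2" "sim (fst s') (fst (snd s')) rg2 mu2" by auto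
 from hLoopT.IH(2)[OF 2(5)] obtain t3 a3 o3 rg3 mu3 where
  3: "exec w adj r (cp (Loop b p)) (rg2, mu2) t3 a3 o3 (rg3, mu3)" "a3 <= sp"
   "t3 + pcost (Loop b p) * fst (snd (snd s')) <= pcost (Loop b p) * fst (snd (snd s''))"
   "snd (snd (snd s'')) = snd (snd (snd s')) @ o3" "sim (fst s'') (fst (snd s'')) rg3 mu3" by blast
 \<comment> \<open>The run supplied by the induction hypothesis starts by evaluating the condition.
   That evaluation is cut off and becomes the end of the body of the present round.\<close>
 from 3(1) obtain t4 a4 o4 \<sigma>4 t5 a5 o5 where
  4: "exec w adj r (cb b) (rg2, mu2) t4 a4 o4 \<sigma>4" "exec w adj r ?W \<sigma>4 t5 a5 o5 (rg3, mu3)"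
   "t3 = t4 + t5" "a3 = max a4 a5" "o3 = o4 @ o5"
  unfolding cp.simps by (elim exec_elims(12)) blast
 have "exec w adj r ?W (rg1, mu) (Suc ((t2 + t4) + t5)) (max (max a2 a4) a5) ((o2 @ o4) @ o5) (rg3, mu3)"
  by (rule exec.WhileTrue[OF _ exec.Seq[OF 2(1) 4(1)] 4(2)]) (use 1(3) in simp)
 from exec_seq[OF 1(1) this 1(2)] obtain a where
  5: "exec w adj r (cp (Loop b p)) (rg, mu) (bcost b + Suc (t2 + t3)) a (o2 @ o3) (rg3, mu3)" "a <= sp"
  using 2(2) 3(2) 4(3-5) by (auto simp: ac_simps)
 have "Suc t <= fst (snd (snd s'))" using hx_time[OF hLoopT(3)] by simp
 then obtain d where d: "fst (snd (snd s')) = Suc t + d" using le_Suc_ex by blast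
 have "fst (snd (snd s')) <= fst (snd (snd s''))" using hx_time[OF hLoopT(4)] by simp
 then obtain d' where d': "fst (snd (snd s'')) = fst (snd (snd s')) + d'" using le_Suc_ex by blast
 have "bcost b + Suc (t2 + t3) + pcost (Loop b p) * t <= pcost (Loop b p) * fst (snd (snd s''))"
  using 2(3) 3(3) unfolding d d' by (simp add: algebra_simps)
 with 5 2(4) 3(4,5) show ?case
  by - (rule exI[of _ "bcost b + Suc (t2 + t3)"], rule exI[of _ a], rule exI[of _ "o2 @ o3"], rule exI[of _ rg3], rule exI[of _ mu3], simp add: fun_upd_def)
qed

end

section \<open>A deterministic depth-first search\<close>

definition disc :: "'a event list => 'a set" where
 "disc es = set (discovery_order es)"

lemma discovery_order_append [simp]:
 "discovery_order (es @ es') = discovery_order es @ discovery_order es'"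
 by (induction es rule: discovery_order.induct) auto

lemma disc_simps [simp]:
 "disc [] = {}" "disc (es @ [Discover v]) = insert v (disc es)" "disc (es @ [Finish v]) = disc es"
 by (auto simp: disc_def)

fun stack_after :: "'a list => 'a event list => 'a list" where
 "stack_after st [] = st"
| "stack_after st (Discover v # es) = stack_after (v # st) es"
| "stack_after st (Finish v # es) = stack_after (tl st) es"

lemma stack_after_append [simp]: "stack_after st (es @ es') = stack_after (stack_after st es) es'"
 by (induction st es rule: stack_after.induct) auto

lemma tree_edges_append:
 "tree_edges st (es @ es') = tree_edges st es \<union> tree_edges (stack_after st es) es'"
 by (induction st es rule: tree_edges.induct) auto

text \<open>
 A state consists of the stack of vertices with the index of the arc they are looking at (the
 current vertex first), the number of candidate roots considered so far, and the past events.
 The first candidate is the prescribed start vertex.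
\<close>

type_synonym dstate = "(nat \<times> nat) list \<times> nat \<times> nat event list"

locale dfs_input =
 fixes adj :: adj_array and r :: nat
 assumes r_less: "r < length adj"
  and nb_less: "\<And>v x. v < length adj ==> x \<in> set (adj ! v) ==> x < length adj"
begin

abbreviation n :: nat where "n \<equiv> length adj"
abbreviation deg :: "nat => nat" where "deg v \<equiv> length (adj ! v)"

text \<open>Restarts matter for digraphs, in which \<open>r\<close> need not reach every vertex. The
  candidates after the first run through all vertices, so \<open>r\<close> recurs, but by then it is
  discovered.\<close>

definition cand :: "nat => nat" where
 "cand k = (if k = 0 then r else k - 1)"

text \<open>On a discovery the arc index of the suspended vertex stays at the arc to its child; it
  advances only on return. Hence the arcs named on the stack lead from each entry to the one above
  it, and lost entries can be recomputed from lower ones. A final state is a fixed point.\<close>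

fun step :: "dstate => dstate" where
 "step ((u, i) # st, k, es) =
  (if i < deg u then
   if adj ! u ! i \<in> disc es then ((u, i + 1) # st, k, es)
   else ((adj ! u ! i, 0) # (u, i) # st, k, es @ [Discover (adj ! u ! i)])
  else (case st of [] => ([], k, es @ [Finish u])
   | (p, j) # st' => ((p, j + 1) # st', k, es @ [Finish u])))"
| "step ([], k, es) =
  (if k <= n then
   if cand k \<in> disc es then ([], k + 1, es) else ([(cand k, 0)], k + 1, es @ [Discover (cand k)])
  else ([], k, es))"

definition reach :: "dstate => bool" where
 "reach s \<longleftrightarrow> (\<exists>j. s = (step ^^ j) ([], 0, []))"

lemma reach_init: "reach ([], 0, [])"
 unfolding reach_def by (rule exI[of _ 0]) simp

lemma reach_step: "reach s ==> reach (step s)"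
 unfolding reach_def by (metis funpow.simps(2) comp_apply)

lemma reach_induct [consumes 1, case_names init step]:
 assumes "reach s" "P ([], 0, [])" "\<And>s. reach s ==> P s ==> P (step s)"
 shows "P s"
proof -
 have "P ((step ^^ j) ([], 0, []))" for j
 proof (induction j)
  case (Suc j)
  have "reach ((step ^^ j) ([], 0, []))" by (auto simp: reach_def)
  from assms(3)[OF this Suc] show ?case by simp
 qed (use assms in simp)
 then show ?thesis using assms(1) by (auto simp: reach_def)
qed

definition final :: "dstate => bool" where
 "final s \<longleftrightarrow> fst s = [] & n < fst (snd s)"

lemma final_step: "final s ==> step s = s"
 by (cases s) (auto simp: final_def)

lemma final_steps: "final s ==> (step ^^ j) s = s"
 by (induction j) (auto simp: final_step)

lemma reach_final:
 assumes "reach s" "reach f" "final f"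
 shows "\<exists>j. f = (step ^^ j) s"
proof -
 obtain a b where ab: "s = (step ^^ a) ([], 0, [])" "f = (step ^^ b) ([], 0, [])"
  using assms unfolding reach_def by blast
 have "(step ^^ (b + a)) ([], 0, []) = (step ^^ b) s" using ab by (simp add: funpow_add)
 moreover have "(step ^^ (a + b)) ([], 0, []) = f"
  using ab final_steps[OF assms(3), of a] by (simp add: funpow_add)
 ultimately show ?thesis by (metis add.commute)
qed

text \<open>All reachable states lie on one orbit and final states are fixed points. So two
  traversals end in the same state, which allows the second to rely on data recorded by the
  first.\<close>

lemma final_unique: "reach s ==> final s ==> reach f ==> final f ==> s = f"
 using reach_final final_steps by metis

fun dinv :: "dstate => bool" where
 "dinv (stk, k, es) \<longleftrightarrow>
  distinct (map fst stk) & set (map fst stk) \<subseteq> disc es & disc es \<subseteq> {..<n} &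
  distinct (discovery_order es) &
  (\<forall>(u, i) \<in> set stk. i <= deg u & (\<forall>j<i. adj ! u ! j \<in> disc es)) &
  (\<forall>(u, i) \<in> set (tl stk). i < deg u) &
  (\<forall>j. Suc j < length stk --> adj ! fst (stk ! Suc j) ! snd (stk ! Suc j) = fst (stk ! j)) &
  (\<forall>j<k. cand j \<in> disc es) & k <= Suc n &
  stack_after [] es = map fst stk &
  (stk ~= [] --> 0 < k)"

lemma dinv_step:
 assumes "dinv s" shows "dinv (step s)"
proof -
 obtain stk k es where s: "s = (stk, k, es)" by (cases s)
 show ?thesis
 proof (cases stk)
  case Nil
  have "cand k < n" if "k <= n" using that r_less by (auto simp: cand_def)
  then show ?thesis using assms Nil
   by (auto simp: s less_Suc_eq split: if_splits)
    (auto simp: disc_def)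
 next
  case (Cons a st)
  obtain u i where a: "a = (u, i)" by (cases a)
  have u: "u < n" using assms by (auto simp: s Cons a)
  show ?thesis
  proof (cases "i < deg u")
   case True
   show ?thesis
   proof (cases "adj ! u ! i \<in> disc es")
    case d: True
    then show ?thesis using assms True unfolding s Cons a
     by (auto simp: less_Suc_eq nth_Cons split: nat.splits)
   next
    case False
    have "adj ! u ! i < n" using nb_less[OF u] True by simp
    moreover have "adj ! u ! i \<notin> set (discovery_order es)" using False by (simp add: disc_def)
    ultimately show ?thesis using assms True False unfolding s Cons a
     by (auto simp: nth_Cons split: nat.splits)
   qed
  next
   case False
   show ?thesis
   proof (cases st)
    case Nil
    then show ?thesis using assms False unfolding s Cons a by auto
   next
    case (Cons b st')
    obtain p j where b: "b = (p, j)" by (cases b)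
    have pj: "adj ! p ! j = u" "j < deg p" "u \<in> disc es"
     using assms unfolding s \<open>stk = a # st\<close> a Cons b by (auto dest: spec[of _ 0])
    have nx: "\<forall>m. Suc m < length (b # st') -->
      adj ! fst ((b # st') ! Suc m) ! snd ((b # st') ! Suc m) = fst ((b # st') ! m)"
    proof (intro allI impI)
     fix m assume "Suc m < length (b # st')"
     moreover have "\<forall>j. Suc j < length stk -->
      adj ! fst (stk ! Suc j) ! snd (stk ! Suc j) = fst (stk ! j)"
      using assms unfolding s by simp
     ultimately show "adj ! fst ((b # st') ! Suc m) ! snd ((b # st') ! Suc m) = fst ((b # st') ! m)"
      unfolding \<open>stk = a # st\<close> Cons by (auto dest!: spec[of _ "Suc m"])
    qed
    have nx': "\<forall>m. Suc m < length ((p, Suc j) # st') -->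
      adj ! fst (((p, Suc j) # st') ! Suc m) ! snd (((p, Suc j) # st') ! Suc m) = fst (((p, Suc j) # st') ! m)"
     using nx b by (auto simp: nth_Cons split: nat.splits)
    have "step s = ((p, Suc j) # st', k, es @ [Finish u])"
     using False by (simp add: s \<open>stk = a # st\<close> a Cons b)
    moreover have "dinv ((p, Suc j) # st', k, es @ [Finish u])"
     using assms pj nx' unfolding s \<open>stk = a # st\<close> a Cons b
     by (simp add: less_Suc_eq)
    ultimately show ?thesis by simp
   qed
  qed
 qed
qed

lemma reach_dinv: "reach s ==> dinv s"
 by (induction rule: reach_induct) (auto intro: dinv_step simp del: dinv.simps, simp)

lemma graph_dom [simp]: "u \<rightarrow>\<^bsub>graph_of adj\<^esub> v \<longleftrightarrow> u < n & v \<in> set (adj ! u)"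
 by (force simp: graph_of_def with_proj_def arcs_ends_def arc_to_ends_def)

lemma verts_graph [simp]: "verts (graph_of adj) = {..<n}"
 by (simp add: graph_of_def with_proj_def)

text \<open>\<open>dfs_run\<close> describes the events still to come, so the derivation is built
  backwards from the end of the run; steps that merely advance an arc index or the candidate
  contribute no rule.\<close>

lemma dfs_run_steps:
 "dinv s ==> final ((step ^^ j) s) ==>
 \<exists>rest. snd (snd ((step ^^ j) s)) = snd (snd s) @ rest &
  dfs_run (graph_of adj) (map fst (fst s)) (disc (snd (snd s))) rest"
proof (induction j arbitrary: s)
 case 0
 obtain k es where s: "s = ([], k, es)" using 0(2) by (cases s) (auto simp: final_def)
 have "v \<in> disc es" if "v < n" for v
 proof -
  have "cand (Suc v) \<in> disc es" using 0 that by (auto simp: s final_def)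
  then show ?thesis by (simp add: cand_def)
 qed
 then show ?case using s by (auto intro!: dfs_run.Done)
next
 case (Suc j)
 have "dinv (step s)" using dinv_step Suc.prems(1) by blast
 from Suc.IH[OF this] Suc.prems(2) obtain rest where
  r: "snd (snd ((step ^^ Suc j) s)) = snd (snd (step s)) @ rest"
   "dfs_run (graph_of adj) (map fst (fst (step s))) (disc (snd (snd (step s)))) rest"
  by (auto simp: funpow_swap1)
 obtain stk k es where s: "s = (stk, k, es)" by (cases s)
 show ?case
 proof (cases stk)
  case Nil
  have c: "cand k < n" if "k <= n" using that r_less by (auto simp: cand_def)
  show ?thesis
  proof (cases "k <= n & cand k \<notin> disc es")
   case True
   then have "dfs_run (graph_of adj) [] (disc es) (Discover (cand k) # rest)"
    using r(2) c by (intro dfs_run.Restart) (auto simp: s Nil)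
   moreover have "snd (snd ((step ^^ Suc j) s)) = es @ Discover (cand k) # rest"
    using r(1) True by (simp add: s Nil)
   ultimately show ?thesis by (auto simp: s Nil)
  next
   case False
   then show ?thesis using r by (auto simp: s Nil split: if_splits)
  qed
 next
  case (Cons a st)
  obtain u i where a: "a = (u, i)" by (cases a)
  have u: "u < n" using Suc.prems(1) by (auto simp: s Cons a)
  show ?thesis
  proof (cases "i < deg u")
   case True
   show ?thesis
   proof (cases "adj ! u ! i \<in> disc es")
    case d: True
    then show ?thesis using r True unfolding s Cons a by auto
   next
    case False
    have "dfs_run (graph_of adj) (u # map fst st) (disc es) (Discover (adj ! u ! i) # rest)"
     by (rule dfs_run.Advance) (insert True False r(2) u, auto simp: s Cons a)
    moreover have "snd (snd ((step ^^ Suc j) s)) = es @ Discover (adj ! u ! i) # rest"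
     using r(1) True False by (simp add: s Cons a)
    ultimately show ?thesis by (auto simp: s Cons a)
   qed
  next
   case False
   have all: "v \<in> disc es" if "v \<in> set (adj ! u)" for v
   proof -
    from that obtain m where "m < deg u" "v = adj ! u ! m" by (auto simp: in_set_conv_nth)
    then show ?thesis using Suc.prems(1) False by (auto simp: s Cons a)
   qed
   have st: "map fst (fst (step s)) = map fst st" "snd (snd (step s)) = es @ [Finish u]"
    using False by (auto simp: s Cons a split: list.splits)
   have "dfs_run (graph_of adj) (u # map fst st) (disc es) (Finish u # rest)"
    by (rule dfs_run.Retreat) (insert all r(2), auto simp: st)
   moreover have "snd (snd ((step ^^ Suc j) s)) = es @ Finish u # rest"
    using r(1) st by simp
   ultimately show ?thesis by (auto simp: s Cons a)
  qed
 qed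
qed

lemma reach_run:
 assumes "reach s" "reach f" "final f"
 shows "\<exists>rest. snd (snd f) = snd (snd s) @ rest &
  dfs_run (graph_of adj) (map fst (fst s)) (disc (snd (snd s))) rest"
 using reach_final[OF assms] dfs_run_steps reach_dinv[OF assms(1)] assms(3) by blast

lemma traversal:
 assumes "reach f" "final f"
 shows "dfs_traversal (graph_of adj) r (snd (snd f))"
proof -
 have "reach (step ([], 0, []))" by (intro reach_step reach_init)
 then have "reach ([(r, 0)], 1, [Discover r])" by (simp add: cand_def disc_def)
 from reach_run[OF this assms] show ?thesis using r_less by (auto simp: dfs_traversal_def disc_def)
qed

end

text \<open>The white path theorem; \<open>xs\<close> are the vertices above \<open>v\<close> on the stack.\<close>

lemma white_neighbour:
 "dfs_run G stk D es ==> stk = xs @ v # st ==> v \<rightarrow>\<^bsub>G\<^esub> x ==> x \<notin> D ==>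
 tree_edges stk es \<subseteq> T ==> (\<forall>y \<in> set xs. (y, v) \<in> T\<^sup>*) ==> (x, v) \<in> T\<^sup>+"
proof (induction arbitrary: xs rule: dfs_run.induct)
 case (Advance u w D st' es)
 have uv: "(u, v) \<in> T\<^sup>*" using Advance.prems(1,5) by (cases xs) auto
 have wu: "(w, u) \<in> T" using Advance.prems(4) by auto
 with uv have wv: "(w, v) \<in> T\<^sup>+" by (meson rtrancl_into_trancl2)
 show ?case
 proof (cases "x = w")
  case False
  show ?thesis
  proof (rule Advance.IH[of "w # xs"])
   show "w # u # st' = (w # xs) @ v # st" using Advance.prems(1) by simp
   show "\<forall>y \<in> set (w # xs). (y, v) \<in> T\<^sup>*" using wv Advance.prems(5) by auto
   show "tree_edges (w # u # st') es \<subseteq> T" using Advance.prems(4) by simp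
  qed (use False Advance.prems in auto)
 qed (use wv in simp)
next
 case (Retreat u D st' es)
 show ?case
 proof (cases xs)
  case Nil
  \<comment> \<open>Here \<open>v\<close> itself would retreat although its neighbour
    \<open>x\<close> is undiscovered.\<close>
  then show ?thesis using Retreat by auto
 next
  case (Cons y ys)
  show ?thesis by (rule Retreat.IH[of ys]) (use Cons Retreat.prems in auto)
 qed
qed auto

section \<open>Components, bridges and cut vertices in terms of a depth-first search tree\<close>

lemma num_components_one:
 assumes "wf_digraph H" "sym (arcs_ends H)" "z \<in> verts H"
  and con: "\<And>x. x \<in> verts H ==> (x, z) \<in> (arcs_ends H)\<^sup>*"
 shows "num_components H = 1"
proof -
 interpret wf_digraph H by fact
 have r: "x \<rightarrow>\<^sup>*\<^bsub>H\<^esub> y" if "x \<in> verts H" "y \<in> verts H" for x y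
 proof -
  have "(z, y) \<in> (arcs_ends H)\<^sup>*" using con[OF that(2)] assms(2) by (metis symD sym_rtrancl)
  with con[OF that(1)] have "(x, y) \<in> (arcs_ends H)\<^sup>*" by simp
  then show ?thesis using that by (simp add: reachable_conv)
 qed
 have "sccs_verts = {verts H}"
 proof
  show "sccs_verts \<subseteq> {verts H}"
  proof
   fix S assume S: "S \<in> sccs_verts"
   then have "S \<subseteq> verts H" "S ~= {}"
    unfolding sccs_verts_def by (auto dest: reachable_in_verts)
   moreover have "verts H \<subseteq> S" using S r \<open>S \<subseteq> verts H\<close> \<open>S ~= {}\<close>
    unfolding sccs_verts_def by blast
   ultimately show "S \<in> {verts H}" by blast
  qed
  show "{verts H} \<subseteq> sccs_verts" using assms(3) r
   unfolding sccs_verts_def by (auto dest: reachable_in_verts)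
 qed
 then show ?thesis by (metis card_sccs_verts num_components_def is_singletonI is_singleton_altdef)
qed

lemma num_components_empty:
 assumes "wf_digraph H" "verts H = {}"
 shows "num_components H = 0"
proof -
 interpret wf_digraph H by fact
 have "sccs_verts = {}" using assms(2) by (simp add: sccs_verts_conv_scc_of)
 then show ?thesis by (metis card_sccs_verts num_components_def card.empty)
qed

text \<open>A set closed under arcs contains the component of each of its members, so
  \<open>a\<close> and \<open>b\<close> lie in different components. With a subtree as the set this
  serves removed edges and removed vertices alike.\<close>

lemma num_components_two:
 assumes "wf_digraph H" "finite (verts H)" "a \<in> verts H" "b \<in> verts H" "a \<in> S" "b \<notin> S"
  and cl: "\<And>x y. x \<in> S ==> (x, y) \<in> arcs_ends H ==> y \<in> S"
 shows "num_components H > 1"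
proof -
 interpret wf_digraph H by fact
 have "b \<notin> scc_of a"
 proof
  assume "b \<in> scc_of a"
  then have "(a, b) \<in> (arcs_ends H)\<^sup>*" by (simp add: scc_of_def reachable_conv)
  then have "b \<in> S" by (induction rule: rtrancl_induct) (use assms(5) cl in auto)
  then show False using assms(6) by simp
 qed
 moreover have "b \<in> scc_of b" using in_scc_of_self assms by blast
 ultimately have ne: "scc_of a ~= scc_of b" by blast
 have "sccs_verts \<subseteq> Pow (verts H)" unfolding sccs_verts_def by (auto dest: reachable_in_verts)
 then have "finite sccs_verts" using assms(2) by (meson finite_Pow_iff finite_subset)
 moreover have "{scc_of a, scc_of b} \<subseteq> sccs_verts" using scc_of_in_sccs_verts assms by blast
 ultimately have "card {scc_of a, scc_of b} <= card sccs_verts" by (rule card_mono)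
 then show ?thesis using ne card_sccs_verts by (simp add: num_components_def)
qed

lemma single_valued_rtrancl_linear:
 assumes "single_valued T" "(x, a) \<in> T\<^sup>*" "(x, b) \<in> T\<^sup>*"
 shows "(a, b) \<in> T\<^sup>* | (b, a) \<in> T\<^sup>*"
 using single_valued_confluent[OF assms] .

text \<open>What the structure theory needs to know of a traversal: discovery positions, the parent
  relation, and the white path theorem in the form that a neighbour discovered later is a
  descendant.\<close>

locale dfs_tree = dfs_input adj r for adj r +
 fixes pos :: "nat => nat" and T :: "(nat \<times> nat) set"
 assumes sym_adj: "\<And>v x. v < n ==> x \<in> set (adj ! v) ==> v \<in> set (adj ! x)"
  and noloop: "\<And>v. v < n ==> v \<notin> set (adj ! v)"
  and pos_inj: "inj_on pos {..<n}"
  and T_edge: "\<And>x y. (x, y) \<in> T ==> x < n & y < n & x \<in> set (adj ! y) & pos y < pos x"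
  and T_sv: "single_valued T"
  and T_root: "\<And>y. (r, y) \<notin> T"
  and T_parent: "\<And>x. x < n ==> x ~= r ==> \<exists>y. (x, y) \<in> T"
  and white: "\<And>v x. v < n ==> x \<in> set (adj ! v) ==> pos v < pos x ==> (x, v) \<in> T\<^sup>+"
begin

abbreviation G where "G \<equiv> graph_of adj"

text \<open>The value at \<open>r\<close> is unspecified, as no pair of \<open>T\<close> starts at
  the root; facts about \<open>par\<close> are therefore stated for other vertices.\<close>

definition par :: "nat => nat" where "par x = (THE y. (x, y) \<in> T)"

lemma par_eq: "(x, y) \<in> T ==> par x = y"
 unfolding par_def using T_sv by (auto simp: single_valued_def)

lemma par_T: "x < n ==> x ~= r ==> (x, par x) \<in> T"
 using T_parent par_eq by metis

lemma T_pos: "(x, y) \<in> T\<^sup>+ ==> pos y < pos x"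
 by (induction rule: trancl_induct) (use T_edge in fastforce)+

lemma T_less: "(x, y) \<in> T\<^sup>+ ==> x < n & y < n"
 by (metis T_edge tranclD tranclD2)

lemma T_irrefl: "(x, x) \<notin> T\<^sup>+"
 using T_pos by blast

lemma T_to_root: "x < n ==> (x, r) \<in> T\<^sup>*"
proof (induction "pos x" arbitrary: x rule: less_induct)
 case less
 show ?case
 proof (cases "x = r")
  case False
  then have "(x, par x) \<in> T" using par_T less.prems by blast
  with T_edge less.hyps show ?thesis by (meson converse_rtrancl_into_rtrancl)
 qed simp
qed

lemma T_linear: "(x, a) \<in> T\<^sup>* ==> (x, b) \<in> T\<^sup>* ==> (a, b) \<in> T\<^sup>* | (b, a) \<in> T\<^sup>*"
 using single_valued_rtrancl_linear[OF T_sv] .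

lemma T_up: "(x, a) \<in> T\<^sup>+ ==> (x, y) \<in> T ==> (y, a) \<in> T\<^sup>*"
 by (metis T_sv single_valued_def tranclD)

text \<open>An undirected graph has no cross edges: the end discovered later is a descendant of the
  other one by the white path property.\<close>

lemma edge_comparable:
 assumes "v < n" "x \<in> set (adj ! v)"
 shows "(x, v) \<in> T\<^sup>+ | (v, x) \<in> T\<^sup>+"
proof -
 have x: "x < n" using nb_less assms by blast
 have "x ~= v" using noloop assms by blast
 then have "pos x ~= pos v" using pos_inj x assms(1) by (auto simp: inj_on_def)
 then show ?thesis using white[OF assms] white[OF x sym_adj[OF assms]] by linarith
qed

text \<open>All neighbours of \<open>x\<close> discovered before \<open>x\<close> are its ancestors,
  and the parent comes last among them. So \<open>v\<close> is the parent iff none of them was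
  discovered after \<open>v\<close>, and comparing two counts decides this without storing a
  position.\<close>

lemma child_test:
 assumes v: "v < n" "x \<in> set (adj ! v)" "pos v < pos x"
 shows "(x, v) \<in> T \<longleftrightarrow>
  card {z \<in> set (adj ! x). pos z <= pos v} = card {z \<in> set (adj ! x). pos z < pos x}"
proof -
 have x: "x < n" using nb_less v by blast
 have xv: "(x, v) \<in> T\<^sup>+" using white[OF v] .
 then have xr: "x ~= r" using T_root by (metis tranclD)
 then have px: "(x, par x) \<in> T" using par_T x by blast
 have sub: "{z \<in> set (adj ! x). pos z <= pos v} \<subseteq> {z \<in> set (adj ! x). pos z < pos x}"
  using v(3) by auto
 have eq: "card {z \<in> set (adj ! x). pos z <= pos v} = card {z \<in> set (adj ! x). pos z < pos x} \<longleftrightarrow>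
   {z \<in> set (adj ! x). pos z <= pos v} = {z \<in> set (adj ! x). pos z < pos x}"
 proof
  assume "card {z \<in> set (adj ! x). pos z <= pos v} = card {z \<in> set (adj ! x). pos z < pos x}"
  then show "{z \<in> set (adj ! x). pos z <= pos v} = {z \<in> set (adj ! x). pos z < pos x}"
   by (rule card_subset_eq[OF _ sub, rotated]) simp
 qed simp
 show ?thesis unfolding eq
 proof
  assume T: "(x, v) \<in> T"
  show "{z \<in> set (adj ! x). pos z <= pos v} = {z \<in> set (adj ! x). pos z < pos x}"
  proof (rule subset_antisym[OF sub], rule subsetI)
   fix z assume z: "z \<in> {z \<in> set (adj ! x). pos z < pos x}"
   then have "z < n" "x \<in> set (adj ! z)" using nb_less x sym_adj by blast+
   then have "(x, z) \<in> T\<^sup>+" using white z by blast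
   then have "(v, z) \<in> T\<^sup>*" using T_up T by blast
   then have "pos z <= pos v" using T_pos by (metis less_imp_le order_refl rtrancl_eq_or_trancl)
   then show "z \<in> {z \<in> set (adj ! x). pos z <= pos v}" using z by simp
  qed
 next
  assume e: "{z \<in> set (adj ! x). pos z <= pos v} = {z \<in> set (adj ! x). pos z < pos x}"
  have "par x < n" "x \<in> set (adj ! par x)" "pos (par x) < pos x" using T_edge[OF px] by auto
  then have "par x \<in> {z \<in> set (adj ! x). pos z < pos x}" using sym_adj by blast
  then have "pos (par x) <= pos v" using e by blast
  moreover have "(par x, v) \<in> T\<^sup>*" using T_up[OF xv px] .
  ultimately have "par x = v" using T_pos by (metis leD rtrancl_eq_or_trancl)
  then show "(x, v) \<in> T" using px by simp
 qed
qed

text \<open>A tree edge is named by its lower end \<open>c\<close>. The condition says that the tree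
  path from \<open>y\<close> up to \<open>a\<close> uses this edge, i.e. that the edge lies on the
  fundamental cycle of the back edge.\<close>

definition cov :: "nat => bool" where
 "cov c \<longleftrightarrow> (\<exists>(a, y) \<in> back_edges G T. (y, c) \<in> T\<^sup>* & (c, a) \<in> T\<^sup>+)"

text \<open>The fundamental cycle goes on strictly beyond \<open>par c\<close>. The negation is the
  low-point criterion for \<open>par c\<close> to separate the subtree of \<open>c\<close>.\<close>

definition ncov :: "nat => bool" where
 "ncov c \<longleftrightarrow> (\<exists>(a, y) \<in> back_edges G T. (y, c) \<in> T\<^sup>* & (par c, a) \<in> T\<^sup>+)"

lemma back_iff:
 "(a, y) \<in> back_edges G T \<longleftrightarrow> a < n & y \<in> set (adj ! a) & (y, a) \<in> T\<^sup>+ & (y, a) \<notin> T"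
 by (auto simp: back_edges_def)

text \<open>As there are no cross edges, the outer end of an edge leaving the subtree of
  \<open>c\<close> is a proper ancestor of \<open>c\<close>; such an edge is a back edge unless it
  is the tree edge at \<open>c\<close> itself.\<close>

lemma leave_subtree:
 assumes "(y, c) \<in> T\<^sup>*" "y < n" "a \<in> set (adj ! y)" "(a, c) \<notin> T\<^sup>*"
 shows "(c, a) \<in> T\<^sup>+ & ((a, y) \<in> back_edges G T | y = c & (c, a) \<in> T)"
proof -
 have "(a, y) \<notin> T\<^sup>+" using assms(1,4) by (meson trancl_into_rtrancl rtrancl_trans)
 then have ya: "(y, a) \<in> T\<^sup>+" using edge_comparable[OF assms(2,3)] by blast
 then have "(y, a) \<in> T\<^sup>*" by (rule trancl_into_rtrancl)
 then have ca: "(c, a) \<in> T\<^sup>*" using T_linear[OF assms(1)] assms(4) by blast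
 have "c ~= a" using assms(4) by auto
 then have ca: "(c, a) \<in> T\<^sup>+" using ca by (metis rtrancl_eq_or_trancl)
 show ?thesis
 proof (cases "(y, a) \<in> T")
  case True
  have "y = c"
  proof (rule ccontr)
   assume "y ~= c"
   then have "(y, c) \<in> T\<^sup>+" using assms(1) by (metis rtrancl_eq_or_trancl)
   then have "(a, c) \<in> T\<^sup>*" using T_up True by blast
   then show False using assms(4) by blast
  qed
  then show ?thesis using ca True by blast
 next
  case False
  have "a < n" using T_less[OF ya] by blast
  moreover have "y \<in> set (adj ! a)" using sym_adj assms by blast
  ultimately have "(a, y) \<in> back_edges G T" using ya False by (simp add: back_iff)
  then show ?thesis using ca by blast
 qed
qed

lemma wf_G: "wf_digraph G"
 by unfold_locales (auto simp: graph_of_def with_proj_def dest: nb_less)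

lemma arcs_ends_G: "arcs_ends G = {(u, v). u < n & v \<in> set (adj ! u)}"
 by (auto simp: graph_of_def with_proj_def arcs_ends_def arc_to_ends_def)

lemma sym_G: "sym (arcs_ends G)"
 by (auto simp: arcs_ends_G sym_def dest: sym_adj nb_less)

lemma arcs_G: "arcs G = {(u, v). u < n & v \<in> set (adj ! u)}"
 by (simp add: graph_of_def with_proj_def)

lemma T_arcs: "(x, y) \<in> T ==> (x, y) \<in> arcs_ends G"
 using T_edge sym_adj by (auto simp: arcs_ends_G)

lemma num_G: "num_components G = 1"
proof (rule num_components_one[OF wf_G sym_G, of r])
 show "r \<in> verts G" using r_less by simp
 fix x assume "x \<in> verts G"
 then have "(x, r) \<in> T\<^sup>*" using T_to_root by simp
 moreover have "T \<subseteq> arcs_ends G" using T_arcs by auto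
 ultimately show "(x, r) \<in> (arcs_ends G)\<^sup>*" using rtrancl_mono by blast
qed

section \<open>Removing an edge: bridges\<close>

abbreviation delE :: "nat => nat => (nat, nat \<times> nat) pre_digraph" where
 "delE u v \<equiv> pre_digraph.del_arc (pre_digraph.del_arc G (u, v)) (v, u)"

lemma delE_ends: "arcs_ends (delE u v) = arcs_ends G - {(u, v), (v, u)}"
 by (auto simp: pre_digraph.del_arc_def arcs_ends_def arc_to_ends_def graph_of_def with_proj_def)

lemma delE_verts: "verts (delE u v) = {..<n}"
 by (simp add: pre_digraph.del_arc_def)

lemma delE_wf: "wf_digraph (delE u v)"
 by (rule wf_digraph.wf_digraph_del_arc[OF wf_digraph.wf_digraph_del_arc[OF wf_G]])

lemma delE_sym: "sym (arcs_ends (delE u v))"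
 using sym_G unfolding delE_ends sym_def by blast

text \<open>A tree path can use the edge above \<open>c\<close> only by passing from inside the
  subtree of \<open>c\<close> to the outside, which the last hypothesis excludes.\<close>

lemma delE_path:
 assumes "(x, z) \<in> T\<^sup>*" "(c, p) \<in> T" "(z, c) \<in> T\<^sup>* | (x, c) \<notin> T\<^sup>*"
 shows "(x, z) \<in> (arcs_ends (delE c p))\<^sup>*"
 using assms(1,3)
proof (induction rule: converse_rtrancl_induct)
 case (step x y)
 have "x ~= c"
 proof
  assume "x = c"
  then have "(c, z) \<in> T\<^sup>+" "(z, c) \<in> T\<^sup>*" using step by auto
  then show False using T_irrefl by (meson rtrancl_trancl_trancl trancl_rtrancl_trancl)
 qed
 moreover have "(p, c) \<notin> T" using assms(2) T_edge by (meson order.asym)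
 ultimately have "(x, y) \<in> arcs_ends (delE c p)"
  using T_arcs[OF step(1)] step(1) by (auto simp: delE_ends)
 moreover have "(z, c) \<in> T\<^sup>* | (y, c) \<notin> T\<^sup>*"
  using step by (meson converse_rtrancl_into_rtrancl)
 ultimately show ?case using step.IH by (meson converse_rtrancl_into_rtrancl)
qed simp

text \<open>Without a covering back edge the subtree of \<open>c\<close> is closed under the
  remaining arcs. With one, the detour down from \<open>c\<close> to \<open>y\<close>, over the back
  edge to \<open>a\<close> and up to \<open>r\<close> replaces the removed edge.\<close>

lemma tree_bridge:
 assumes cp: "(c, p) \<in> T"
 shows "num_components (delE c p) > 1 \<longleftrightarrow> \<not> cov c"
proof
 assume "\<not> cov c"
 show "num_components (delE c p) > 1"
 proof (rule num_components_two[OF delE_wf, of _ _ c r "{x. (x, c) \<in> T\<^sup>* & x < n}"])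
  show "c \<in> verts (delE c p)" "r \<in> verts (delE c p)" "c \<in> {x. (x, c) \<in> T\<^sup>* & x < n}"
   using T_edge[OF cp] r_less by (auto simp: delE_verts)
  show "r \<notin> {x. (x, c) \<in> T\<^sup>* & x < n}"
   using T_root cp by (auto elim: converse_rtranclE)
  fix x y assume x: "x \<in> {x. (x, c) \<in> T\<^sup>* & x < n}" and xy: "(x, y) \<in> arcs_ends (delE c p)"
  then have e: "y \<in> set (adj ! x)" "y < n" "(x, y) ~= (c, p)"
   using nb_less by (auto simp: delE_ends arcs_ends_G)
  show "y \<in> {x. (x, c) \<in> T\<^sup>* & x < n}"
  proof (rule ccontr)
   assume "y \<notin> {x. (x, c) \<in> T\<^sup>* & x < n}"
   then have "(y, c) \<notin> T\<^sup>*" using e by blast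
   from leave_subtree[OF _ _ e(1) this] x
   have "(c, y) \<in> T\<^sup>+ & ((y, x) \<in> back_edges G T | x = c & (c, y) \<in> T)" by blast
   then show False using \<open>\<not> cov c\<close> x e(3) par_eq[OF cp] par_eq[of c y]
    unfolding cov_def by blast
  qed
 qed (simp add: delE_verts)
next
 assume c: "num_components (delE c p) > 1"
 show "\<not> cov c"
 proof
  assume "cov c"
  then obtain a y where ay: "(a, y) \<in> back_edges G T" "(y, c) \<in> T\<^sup>*" "(c, a) \<in> T\<^sup>+"
   unfolding cov_def by blast
  have ca: "(a, c) \<notin> T\<^sup>*" using ay(3) T_irrefl by (meson trancl_rtrancl_trancl)
  have an: "a < n" "y \<in> set (adj ! a)" "y < n" using ay(1) nb_less by (auto simp: back_iff)
  have ar: "(a, r) \<in> (arcs_ends (delE c p))\<^sup>*"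
   by (rule delE_path[OF T_to_root[OF an(1)] cp]) (use ca in blast)
  have "(y, c) \<in> (arcs_ends (delE c p))\<^sup>*" by (rule delE_path[OF ay(2) cp]) simp
  then have cy: "(c, y) \<in> (arcs_ends (delE c p))\<^sup>*" using delE_sym by (metis symD sym_rtrancl)
  have "(y, a) ~= (c, p)" "(y, a) ~= (p, c)"
   using ay(1) cp ay(2,3) T_irrefl by (auto simp: back_iff dest: trancl_trans)
  then have "(y, a) \<in> arcs_ends (delE c p)"
   using an sym_adj by (auto simp: delE_ends arcs_ends_G)
  with ar cy have cr: "(c, r) \<in> (arcs_ends (delE c p))\<^sup>*" by (meson converse_rtrancl_into_rtrancl rtrancl_trans)
  have "num_components (delE c p) = 1"
  proof (rule num_components_one[OF delE_wf delE_sym, of r])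
   show "r \<in> verts (delE c p)" using r_less by (simp add: delE_verts)
   fix x assume "x \<in> verts (delE c p)"
   then have x: "x < n" by (simp add: delE_verts)
   show "(x, r) \<in> (arcs_ends (delE c p))\<^sup>*"
   proof (cases "(x, c) \<in> T\<^sup>*")
    case True
    have "(x, c) \<in> (arcs_ends (delE c p))\<^sup>*" by (rule delE_path[OF True cp]) simp
    then show ?thesis using cr by simp
   next
    case False
    show ?thesis by (rule delE_path[OF T_to_root[OF x] cp]) (use False in blast)
   qed
  qed
  then show False using c by simp
 qed
qed

lemma nontree_bridge:
 assumes "(u, v) \<notin> T" "(v, u) \<notin> T"
 shows "num_components (delE u v) = 1"
proof (rule num_components_one[OF delE_wf delE_sym, of r])
 show "r \<in> verts (delE u v)" using r_less by (simp add: delE_verts)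
 have sub: "T \<subseteq> arcs_ends (delE u v)" using assms T_arcs by (auto simp: delE_ends)
 fix x assume "x \<in> verts (delE u v)"
 then have "(x, r) \<in> T\<^sup>*" using T_to_root by (simp add: delE_verts)
 then show "(x, r) \<in> (arcs_ends (delE u v))\<^sup>*" using rtrancl_mono[OF sub] by auto
qed

lemma delE_commute: "delE u v = delE v u"
 by (auto simp: pre_digraph.del_arc_def)

lemma bridge_iff: "bridge G u v \<longleftrightarrow> (u, v) \<in> T & \<not> cov u | (v, u) \<in> T & \<not> cov v"
proof -
 have a: "(u, v) \<in> T ==> (u, v) \<in> arcs G" "(v, u) \<in> T ==> (u, v) \<in> arcs G"
  using T_edge sym_adj by (auto simp: arcs_G)
 have x: "(u, v) \<in> T ==> (v, u) \<notin> T" using T_edge by (meson order.asym)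
 show ?thesis
  unfolding bridge_def num_G
  using a x tree_bridge[of u v] tree_bridge[of v u] delE_commute[of u v] nontree_bridge[of u v] by fastforce
qed

section \<open>Removing a vertex: cut vertices\<close>

abbreviation delV :: "nat => (nat, nat \<times> nat) pre_digraph" where
 "delV v \<equiv> pre_digraph.del_vert G v"

lemma delV_ends: "arcs_ends (delV v) = {(x, y) \<in> arcs_ends G. x ~= v & y ~= v}"
 by (auto simp: pre_digraph.del_vert_def arcs_ends_def arc_to_ends_def graph_of_def with_proj_def)

lemma delV_verts: "verts (delV v) = {..<n} - {v}"
 by (simp add: pre_digraph.del_vert_def)

lemma delV_wf: "wf_digraph (delV v)"
 by (rule wf_digraph.wf_digraph_del_vert[OF wf_G])

lemma delV_sym: "sym (arcs_ends (delV v))"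
 using sym_G unfolding delV_ends sym_def by blast

lemma delV_path:
 assumes "(x, z) \<in> T\<^sup>*" "z ~= v" "(z, v) \<in> T\<^sup>* | (x, v) \<notin> T\<^sup>*"
 shows "(x, z) \<in> (arcs_ends (delV v))\<^sup>*"
 using assms(1,3)
proof (induction rule: converse_rtrancl_induct)
 case (step x y)
 have xz: "(x, z) \<in> T\<^sup>+" using step by auto
 have h: "(z, v) \<in> T\<^sup>* | (y, v) \<notin> T\<^sup>*" using step by (meson converse_rtrancl_into_rtrancl)
 have "x ~= v" using xz step.prems T_irrefl by (metis rtrancl.rtrancl_refl rtrancl_trancl_trancl)
 moreover have "y ~= v"
 proof
  assume "y = v"
  then have zv: "(z, v) \<in> T\<^sup>*" using h by blast
  have "(v, z) \<in> T\<^sup>*" using step(2) \<open>y = v\<close> by simp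
  then have "(v, z) \<in> T\<^sup>+" using assms(2) by (metis rtrancl_eq_or_trancl)
  then show False using zv T_irrefl by (meson rtrancl_trancl_trancl)
 qed
 ultimately have "(x, y) \<in> arcs_ends (delV v)"
  using T_arcs[OF step(1)] by (auto simp: delV_ends)
 then show ?case using step.IH[OF h] by (meson converse_rtrancl_into_rtrancl)
qed simp

lemma subtree_child: "(x, v) \<in> T\<^sup>+ ==> \<exists>c. (c, v) \<in> T & (x, c) \<in> T\<^sup>*"
 by (meson tranclD2)

text \<open>The subtree of a child \<open>c\<close> is attached to the rest only through
  \<open>v\<close> and through back edges starting strictly above \<open>v\<close>. If each child
  has such a back edge, every vertex below \<open>v\<close> reaches \<open>r\<close> by a detour
  that avoids \<open>v\<close>.\<close>

lemma cut_vertex_nonroot: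
 assumes v: "v < n" "v ~= r"
 shows "cut_vertex G v \<longleftrightarrow> (\<exists>c. (c, v) \<in> T & \<not> ncov c)"
proof
 assume "\<exists>c. (c, v) \<in> T & \<not> ncov c"
 then obtain c where c: "(c, v) \<in> T" "\<not> ncov c" by blast
 have "num_components (delV v) > 1"
 proof (rule num_components_two[OF delV_wf, of _ c r "{x. (x, c) \<in> T\<^sup>* & x < n}"])
  show "c \<in> verts (delV v)" "r \<in> verts (delV v)" "c \<in> {x. (x, c) \<in> T\<^sup>* & x < n}"
   using T_edge[OF c(1)] r_less v by (auto simp: delV_verts)
  show "r \<notin> {x. (x, c) \<in> T\<^sup>* & x < n}"
   using T_root c(1) by (auto elim: converse_rtranclE)
  fix x y assume x: "x \<in> {x. (x, c) \<in> T\<^sup>* & x < n}" and xy: "(x, y) \<in> arcs_ends (delV v)"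
  then have e: "y \<in> set (adj ! x)" "y < n" "y ~= v"
   using nb_less by (auto simp: delV_ends arcs_ends_G)
  show "y \<in> {x. (x, c) \<in> T\<^sup>* & x < n}"
  proof (rule ccontr)
   assume "y \<notin> {x. (x, c) \<in> T\<^sup>* & x < n}"
   then have "(y, c) \<notin> T\<^sup>*" using e by blast
   from leave_subtree[OF _ _ e(1) this] x
   have l: "(c, y) \<in> T\<^sup>+" "(y, x) \<in> back_edges G T | x = c & (c, y) \<in> T" by blast+
   have "(v, y) \<in> T\<^sup>*" using T_up[OF l(1) c(1)] .
   then have "(v, y) \<in> T\<^sup>+" using e(3) by (metis rtrancl_eq_or_trancl)
   moreover have "par c = v" using par_eq c(1) by blast
   moreover have "(c, y) \<notin> T" using par_eq[of c y] \<open>par c = v\<close> e(3) by blast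
   ultimately show False using c(2) l(2) x unfolding ncov_def by blast
  qed
 qed (simp add: delV_verts)
 then show "cut_vertex G v" using v by (simp add: cut_vertex_def num_G)
next
 assume cut: "cut_vertex G v"
 show "\<exists>c. (c, v) \<in> T & \<not> ncov c"
 proof (rule ccontr)
  assume "\<nexists>c. (c, v) \<in> T & \<not> ncov c"
  then have all: "\<And>c. (c, v) \<in> T ==> ncov c" by blast
  have "num_components (delV v) = 1"
  proof (rule num_components_one[OF delV_wf delV_sym, of r])
   show "r \<in> verts (delV v)" using r_less v by (simp add: delV_verts)
   fix x assume "x \<in> verts (delV v)"
   then have x: "x < n" "x ~= v" by (simp_all add: delV_verts)
   show "(x, r) \<in> (arcs_ends (delV v))\<^sup>*"
   proof (cases "(x, v) \<in> T\<^sup>*")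
    case False
    show ?thesis by (rule delV_path[OF T_to_root[OF x(1)]]) (use False v in auto)
   next
    case True
    then have "(x, v) \<in> T\<^sup>+" using x by (metis rtrancl_eq_or_trancl)
    then obtain c where c: "(c, v) \<in> T" "(x, c) \<in> T\<^sup>*" using subtree_child by blast
    have cv: "c ~= v" "(c, v) \<in> T\<^sup>*" using c(1) T_irrefl by auto
    from all[OF c(1)] obtain a y where
     ay: "(a, y) \<in> back_edges G T" "(y, c) \<in> T\<^sup>*" "(v, a) \<in> T\<^sup>+"
     unfolding ncov_def using par_eq[OF c(1)] by blast
    have an: "a < n" "y \<in> set (adj ! a)" "y < n" using ay(1) nb_less by (auto simp: back_iff)
    have av: "(a, v) \<notin> T\<^sup>*" "a ~= v" using ay(3) T_irrefl by (auto dest: trancl_rtrancl_trancl)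
    have xc: "(x, c) \<in> (arcs_ends (delV v))\<^sup>*" by (rule delV_path[OF c(2) cv(1)]) (use cv in blast)
    have "(y, c) \<in> (arcs_ends (delV v))\<^sup>*" by (rule delV_path[OF ay(2) cv(1)]) (use cv in blast)
    then have cy: "(c, y) \<in> (arcs_ends (delV v))\<^sup>*" using delV_sym by (metis symD sym_rtrancl)
    have "y ~= v" using ay(2) c(1) T_irrefl by (meson rtrancl_into_trancl1)
    then have ya: "(y, a) \<in> arcs_ends (delV v)"
     using an av sym_adj by (auto simp: delV_ends arcs_ends_G)
    have ar: "(a, r) \<in> (arcs_ends (delV v))\<^sup>*"
     by (rule delV_path[OF T_to_root[OF an(1)]]) (use av v in auto)
    show ?thesis using xc cy ya ar by (meson converse_rtrancl_into_rtrancl rtrancl_trans)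
   qed
  qed
  then show False using cut by (simp add: cut_vertex_def num_G)
 qed
qed

text \<open>Nothing lies above the root, so no back edge can join the subtrees of two different
  children.\<close>

lemma cut_vertex_root:
 "cut_vertex G r \<longleftrightarrow> (\<exists>c c'. c ~= c' & (c, r) \<in> T & (c', r) \<in> T)"
proof
 assume "\<exists>c c'. c ~= c' & (c, r) \<in> T & (c', r) \<in> T"
 then obtain c c' where c: "c ~= c'" "(c, r) \<in> T" "(c', r) \<in> T" by blast
 have "num_components (delV r) > 1"
 proof (rule num_components_two[OF delV_wf, of _ c c' "{x. (x, c) \<in> T\<^sup>* & x < n}"])
  show "c \<in> verts (delV r)" "c' \<in> verts (delV r)" "c \<in> {x. (x, c) \<in> T\<^sup>* & x < n}"
   using T_edge c T_root by (auto simp: delV_verts)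
  show "c' \<notin> {x. (x, c) \<in> T\<^sup>* & x < n}"
  proof
   assume "c' \<in> {x. (x, c) \<in> T\<^sup>* & x < n}"
   then have "(c', c) \<in> T\<^sup>+" using c(1) by (metis mem_Collect_eq rtrancl_eq_or_trancl)
   then have "(r, c) \<in> T\<^sup>*" using T_up c(3) by blast
   then show False using T_root c(2) by (auto elim: converse_rtranclE)
  qed
  fix x y assume x: "x \<in> {x. (x, c) \<in> T\<^sup>* & x < n}" and xy: "(x, y) \<in> arcs_ends (delV r)"
  then have e: "y \<in> set (adj ! x)" "y < n" "y ~= r"
   using nb_less by (auto simp: delV_ends arcs_ends_G)
  show "y \<in> {x. (x, c) \<in> T\<^sup>* & x < n}"
  proof (rule ccontr)
   assume "y \<notin> {x. (x, c) \<in> T\<^sup>* & x < n}"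
   then have "(y, c) \<notin> T\<^sup>*" using e by blast
   from leave_subtree[OF _ _ e(1) this] x have "(c, y) \<in> T\<^sup>+" by blast
   then have "(r, y) \<in> T\<^sup>*" using T_up c(2) by blast
   then show False using e(3) T_root by (auto elim: converse_rtranclE)
  qed
 qed (simp add: delV_verts)
 then show "cut_vertex G r" using r_less by (simp add: cut_vertex_def num_G)
next
 assume cut: "cut_vertex G r"
 show "\<exists>c c'. c ~= c' & (c, r) \<in> T & (c', r) \<in> T"
 proof (rule ccontr)
  assume no: "\<nexists>c c'. c ~= c' & (c, r) \<in> T & (c', r) \<in> T"
  have "num_components (delV r) <= 1"
  proof (cases "\<exists>c. (c, r) \<in> T")
   case False
   \<comment> \<open>The root has no child and is the only vertex; the empty graph has no component
     at all.\<close>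
   have "verts (delV r) = {}"
   proof (rule ccontr)
    assume "verts (delV r) ~= {}"
    then obtain x where "x < n" "x ~= r" by (auto simp: delV_verts)
    then have "(x, r) \<in> T\<^sup>+" using T_to_root by (metis rtrancl_eq_or_trancl)
    then show False using False by (meson tranclD2)
   qed
   then show ?thesis using num_components_empty[OF delV_wf] by simp
  next
   case True
   then obtain c where c: "(c, r) \<in> T" by blast
   have "num_components (delV r) = 1"
   proof (rule num_components_one[OF delV_wf delV_sym, of c])
    show "c \<in> verts (delV r)" using T_edge[OF c] T_root c by (auto simp: delV_verts)
    fix x assume "x \<in> verts (delV r)"
    then have x: "x < n" "x ~= r" by (simp_all add: delV_verts)
    then have "(x, r) \<in> T\<^sup>+" using T_to_root by (metis rtrancl_eq_or_trancl)
    then obtain c' where c': "(c', r) \<in> T" "(x, c') \<in> T\<^sup>*" using subtree_child by blast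
    have "c' = c" using no c c'(1) by metis
    then have "(x, c) \<in> T\<^sup>*" using c'(2) by simp
    then show "(x, c) \<in> (arcs_ends (delV r))\<^sup>*"
     by (rule delV_path) (use c T_root in blast)+
   qed
   then show ?thesis by simp
  qed
  then show False using cut by (simp add: cut_vertex_def num_G)
 qed
qed

end

section \<open>Discovery positions of the concrete traversal\<close>

context dfs_input
begin

text \<open>For a vertex not in the list the value is the length of the whole order, hence larger
  than every position of a discovered vertex.\<close>

definition pos :: "nat event list => nat => nat" where
 "pos es x = length (takeWhile (\<lambda>y. y ~= x) (discovery_order es))"

lemma pos_append: "x \<in> disc es ==> pos (es @ es') x = pos es x"
 by (auto simp: pos_def disc_def takeWhile_append)

lemma pos_new: "x \<notin> disc es ==> pos (es @ [Discover x]) x = length (discovery_order es)"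
 by (auto simp: pos_def disc_def takeWhile_append)

lemma pos_lt: "x \<in> disc es ==> pos es x < length (discovery_order es)"
proof -
 have "x \<in> set xs ==> length (takeWhile (\<lambda>y. y ~= x) xs) < length xs" for xs :: "nat list"
  by (induction xs) auto
 then show "x \<in> disc es ==> ?thesis" by (simp add: pos_def disc_def)
qed

lemma pos_ge: "x \<notin> disc es ==> pos (es @ es') x \<ge> length (discovery_order es)"
 by (auto simp: pos_def disc_def takeWhile_append)

lemma pos_nth: "x \<in> disc es ==> discovery_order es ! pos es x = x"
 using nth_length_takeWhile[of "\<lambda>y. y ~= x" "discovery_order es"] pos_lt[of x es] by (simp add: pos_def)

definition tinv :: "nat event list => bool" where
 "tinv es \<longleftrightarrow> single_valued (tree_edges [] es) &
  (\<forall>(x, y) \<in> tree_edges [] es. x \<in> disc es & y \<in> disc es & pos es y < pos es x & x \<in> set (adj ! y)) &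
  (es ~= [] --> r \<in> disc es & pos es r = 0)"

text \<open>The clause about \<open>es = []\<close> records that the first discovery uses candidate
  0. This puts \<open>r\<close> at position 0, so that it cannot have a parent.\<close>

lemma tinv_step:
 assumes "reach (stk, k, es)" "tinv es" "es = [] --> stk = [] & k = 0"
 shows "tinv (snd (snd (step (stk, k, es)))) &
  (snd (snd (step (stk, k, es))) = [] --> fst (step (stk, k, es)) = [] & fst (snd (step (stk, k, es))) = 0)"
proof -
 have di: "dinv (stk, k, es)" using reach_dinv[OF assms(1)] .
 have fin: "tinv (es @ [Finish u])" if "stk ~= []" for u
  using assms that by (auto simp: tinv_def tree_edges_append pos_append pos_def split: prod.splits)
 have new: "tinv (es @ [Discover v])" if v: "v \<notin> disc es"
  "(stk = [] & (es = [] --> v = r)) | (\<exists>u i st. stk = (u, i) # st & i < deg u & v = adj ! u ! i)" for v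
 proof (cases "es = []")
  case True
  then have "stk = []" "v = r" using assms(3) v(2) by auto
  then show ?thesis using True by (auto simp: tinv_def pos_def single_valued_def disc_def)
 next
  case False
  define E where "E = (case stk of [] => {} | (u, i) # st => {(v, u)})"
  have te: "tree_edges [] (es @ [Discover v]) = tree_edges [] es \<union> E"
   using di by (auto simp: tree_edges_append E_def split: list.splits)
  have sv: "single_valued (tree_edges [] es \<union> E)"
   using assms(2) v(1) by (fastforce simp: single_valued_def tinv_def E_def split: list.splits)
  have pn: "pos (es @ [Discover v]) v = length (discovery_order es)" using pos_new v(1) .
  have "x \<in> disc (es @ [Discover v]) & y \<in> disc (es @ [Discover v]) &
   pos (es @ [Discover v]) y < pos (es @ [Discover v]) x & x \<in> set (adj ! y)"
   if "(x, y) \<in> tree_edges [] es \<union> E" for x y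
   using that
  proof
   assume "(x, y) \<in> tree_edges [] es"
   then show ?thesis using assms(2) by (auto simp: tinv_def pos_append)
  next
   assume "(x, y) \<in> E"
   then obtain i st where "stk = (y, i) # st" "x = v" by (auto simp: E_def split: list.splits)
   moreover from this have "y \<in> disc es" using di by auto
   ultimately show ?thesis using v pn pos_lt[of y es] by (auto simp: pos_append)
  qed
  then show ?thesis using False assms(2) sv te by (auto simp: tinv_def pos_append)
 qed
 show ?thesis
 proof (cases stk)
  case Nil
  show ?thesis
   using assms new[of "cand k"] Nil by (auto simp: cand_def)
 next
  case (Cons a st)
  obtain u i where a: "a = (u, i)" by (cases a)
  show ?thesis
   using assms new[of "adj ! u ! i"] fin[of u] unfolding Cons a by (auto split: list.splits)
 qed
qed

lemma reach_tinv: "reach s ==> tinv (snd (snd s))"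
proof -
 assume "reach s"
 then have "tinv (snd (snd s)) & (snd (snd s) = [] --> fst s = [] & fst (snd s) = 0)"
 proof (induction rule: reach_induct)
  case init
  show ?case by (simp add: tinv_def single_valued_def)
 next
  case (step s)
  then show ?case using tinv_step[of "fst s" "fst (snd s)" "snd (snd s)"] by simp
 qed
 then show ?thesis by simp
qed

text \<open>Supplies the state right after the discovery of \<open>v\<close>, in which exactly the
  vertices of larger position are still undiscovered.\<close>

lemma reach_discover:
 "reach s ==> v \<in> disc (snd (snd s)) ==>
  \<exists>stk k es. reach ((v, 0) # stk, k, es @ [Discover v]) & v \<notin> disc es"
proof (induction rule: reach_induct)
 case (step s)
 show ?case
 proof (cases "v \<in> disc (snd (snd s))")
  case False
  obtain stk k es where s: "s = (stk, k, es)" by (cases s)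
  have "\<exists>stk'. step s = ((v, 0) # stk', fst (snd (step s)), es @ [Discover v])"
   using step.prems False unfolding s
   by (cases "(stk, k, es)" rule: step.cases) (auto split: if_splits list.splits)
  then show ?thesis using reach_step[OF step.hyps] False s by (metis snd_conv)
 qed (use step in blast)
qed simp

lemma final_disc: "reach f ==> final f ==> disc (snd (snd f)) = {..<n}"
proof -
 assume f: "reach f" "final f"
 have "v \<in> disc (snd (snd f))" if "v < n" for v
 proof -
  have "cand (Suc v) \<in> disc (snd (snd f))" using reach_dinv[OF f(1)] f(2) that
   by (cases f) (auto simp: final_def)
  then show ?thesis by (simp add: cand_def)
 qed
 then show ?thesis using reach_dinv[OF f(1)] by (cases f) auto
qed

lemma prefix_pos:
 assumes "reach s" "reach f" "final f" "x < n" "v \<in> disc (snd (snd s))" "x \<notin> disc (snd (snd s))"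
 shows "pos (snd (snd f)) v < pos (snd (snd f)) x"
proof -
 obtain rest where "snd (snd f) = snd (snd s) @ rest" using reach_run[OF assms(1-3)] by blast
 then show ?thesis using pos_append[OF assms(5), of rest] pos_lt[OF assms(5)] pos_ge[OF assms(6), of rest] by simp
qed

text \<open>Expresses the discovered set at the discovery of \<open>v\<close> by positions in the
  completed order: the counters change during the run, whereas \<open>child_test\<close> speaks of
  final positions.\<close>

lemma disc_iff_pos:
 assumes s: "reach (stk, k, es @ [Discover v])" "v \<notin> disc es" and f: "reach f" "final f" and x: "x < n"
 shows "x \<in> disc (es @ [Discover v]) \<longleftrightarrow> pos (snd (snd f)) x <= pos (snd (snd f)) v"
proof
 obtain rest where F: "snd (snd f) = (es @ [Discover v]) @ rest" using reach_run[OF s(1) f] by auto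
 assume a: "x \<in> disc (es @ [Discover v])"
 have v: "pos (snd (snd f)) v = length (discovery_order es)"
  unfolding F by (subst pos_append) (simp_all add: pos_new s(2))
 have "pos (snd (snd f)) x < length (discovery_order (es @ [Discover v]))"
  unfolding F pos_append[OF a] using pos_lt[OF a] .
 then show "pos (snd (snd f)) x <= pos (snd (snd f)) v" using v by simp
next
 assume "pos (snd (snd f)) x <= pos (snd (snd f)) v"
 then show "x \<in> disc (es @ [Discover v])"
  using prefix_pos[OF s(1) f x, of v] by fastforce
qed

lemma white_reach:
 assumes s: "reach ((v, i) # stk, k, es)" and f: "reach f" "final f"
  and x: "v < n" "x \<in> set (adj ! v)" "x \<notin> disc es"
 shows "(x, v) \<in> (tree_edges [] (snd (snd f)))\<^sup>+"
proof -
 obtain rest where F: "snd (snd f) = es @ rest" "dfs_run (graph_of adj) (v # map fst stk) (disc es) rest"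
  using reach_run[OF s f] by auto
 have "stack_after [] es = v # map fst stk" using reach_dinv[OF s] by simp
 then have "tree_edges (v # map fst stk) rest \<subseteq> tree_edges [] (snd (snd f))"
  unfolding F(1) tree_edges_append by simp
 from white_neighbour[OF F(2) _ _ x(3) this, of "[]"] x show ?thesis by simp
qed

lemma graph_facts:
 assumes "graph_instance adj"
 shows "v < n ==> x \<in> set (adj ! v) ==> v \<in> set (adj ! x)"
  and "v < n ==> v \<notin> set (adj ! v)"
  and "x < n ==> (r, x) \<in> (arcs_ends (graph_of adj))\<^sup>*"
proof -
 interpret g: graph "graph_of adj" using assms(1) by (simp add: graph_instance_def)
 show "v \<in> set (adj ! x)" if "v < n" "x \<in> set (adj ! v)"
 proof -
  have "v \<rightarrow>\<^bsub>graph_of adj\<^esub> x" using that by simp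
  then have "x \<rightarrow>\<^bsub>graph_of adj\<^esub> v" using g.sym_arcs unfolding symmetric_def by (meson symD)
  then show ?thesis by simp
 qed
 show "v \<notin> set (adj ! v)" if "v < n"
 proof
  assume "v \<in> set (adj ! v)"
  then have "v \<rightarrow>\<^bsub>graph_of adj\<^esub> v" using that by simp
  then show False by (rule g.adj_not_same)
 qed
 have con: "strongly_connected (graph_of adj)"
  by (rule g.symmetric_connected_imp_strongly_connected[OF g.sym_arcs])
   (insert assms(1), simp add: graph_instance_def)
 show "(r, x) \<in> (arcs_ends (graph_of adj))\<^sup>*" if "x < n"
 proof -
  have "r \<rightarrow>\<^sup>*\<^bsub>graph_of adj\<^esub> x" using con that r_less unfolding strongly_connected_def by simp
  then show ?thesis unfolding g.reachable_conv by simp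
 qed
qed

lemma dfs_tree_final:
 assumes gi: "graph_instance adj" and f: "reach f" "final f"
 shows "dfs_tree adj r (pos (snd (snd f))) (tree_edges [] (snd (snd f)))"
proof -
 let ?F = "snd (snd f)" let ?T = "tree_edges [] (snd (snd f))"
 note sym = graph_facts(1)[OF gi] and loop = graph_facts(2)[OF gi]
 have D: "disc ?F = {..<n}" using final_disc[OF f] .
 have ti: "tinv ?F" using reach_tinv[OF f(1)] .
 have ne: "?F ~= []"
 proof
  assume "?F = []"
  then have "disc ?F = {}" by (simp only: disc_simps)
  then show False using D r_less by (metis lessThan_iff empty_iff)
 qed
 have p0: "pos ?F r = 0" using ti ne by (simp add: tinv_def)
 have inj: "inj_on (pos ?F) {..<n}"
 proof (rule inj_onI)
  fix x y assume xy: "x \<in> {..<n}" "y \<in> {..<n}" "pos ?F x = pos ?F y"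
  have "discovery_order ?F ! pos ?F x = x" by (rule pos_nth) (use xy D in simp)
  moreover have "discovery_order ?F ! pos ?F y = y" by (rule pos_nth) (use xy D in simp)
  ultimately show "x = y" using xy(3) by metis
 qed
 have T: "x < n & y < n & x \<in> set (adj ! y) & pos ?F y < pos ?F x" if "(x, y) \<in> ?T" for x y
  using ti that D unfolding tinv_def by blast
 have sv: "single_valued ?T" using ti by (simp add: tinv_def)
 have rt: "(r, y) \<notin> ?T" for y using T[of r y] p0 by auto
 have wh: "(x, v) \<in> ?T\<^sup>+" if vx: "v < n" "x \<in> set (adj ! v)" "pos ?F v < pos ?F x" for v x
 proof -
  have x: "x < n" using nb_less vx by blast
  have "v \<in> disc ?F" using D vx by simp
  from reach_discover[OF f(1) this] obtain stk k es where
   s: "reach ((v, 0) # stk, k, es @ [Discover v])" "v \<notin> disc es" by blast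
  have "x \<notin> disc (es @ [Discover v])" using disc_iff_pos[OF s f x] vx(3) by simp
  from white_reach[OF s(1) f vx(1,2) this] show ?thesis .
 qed
 \<comment> \<open>In a connected graph there is only one tree. Along a path from \<open>r\<close>
   an edge leads down the tree or to an ancestor of a descendant of \<open>r\<close>; that ancestor
   is comparable to \<open>r\<close> and cannot lie above it.\<close>
 have "(x, r) \<in> ?T\<^sup>*" if "x < n" for x
 proof -
  from graph_facts(3)[OF gi that] show ?thesis
  proof (induction rule: rtrancl_induct)
   case (step v x)
   then have e: "v < n" "x \<in> set (adj ! v)" using graph_dom[of v x] by blast+
   have x: "x < n" using nb_less e by blast
   have "x ~= v" using e loop by blast
   then have "pos ?F v ~= pos ?F x" using inj e x by (auto simp: inj_on_def)
   then consider "pos ?F v < pos ?F x" | "pos ?F x < pos ?F v" by linarith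
   then show ?case
   proof cases
    case 1
    from wh[OF e this] step.IH show ?thesis by (meson trancl_into_rtrancl rtrancl_trans)
   next
    case 2
    from wh[OF x sym[OF e] this] have "(v, x) \<in> ?T\<^sup>*" by (rule trancl_into_rtrancl)
    from single_valued_rtrancl_linear[OF sv step.IH this]
    show ?thesis
    proof
     assume "(r, x) \<in> ?T\<^sup>*"
     then have "r = x" using rt by (auto elim: converse_rtranclE)
     then show ?thesis by simp
    qed
   qed
  qed simp
 qed
 then have par: "\<exists>y. (x, y) \<in> ?T" if "x < n" "x ~= r" for x
  using that by (metis converse_rtranclE)
 show ?thesis
  by unfold_locales (use sym loop inj T sv rt par wh in blast)+
qed

end

lemma distinct_adj: "graph_instance adj | digraph_instance adj ==> v < length adj ==> distinct (adj ! v)"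
 by (auto simp: graph_instance_def digraph_instance_def)

lemma instance_input:
 assumes "graph_instance adj | digraph_instance adj" "r < length adj"
 shows "dfs_input adj r"
proof
 interpret wf_digraph "graph_of adj"
  using assms(1) by (auto simp: graph_instance_def digraph_instance_def graph_def digraph_def fin_digraph_def)
 show "x < length adj" if "v < length adj" "x \<in> set (adj ! v)" for v x
  using head_in_verts[of "(v, x)"] that by (simp add: graph_of_def with_proj_def)
qed fact

section \<open>Vertices visited and edges covered by a set of chains\<close>

context dfs_tree
begin

text \<open>The visited set is described as if each climb ran all the way to the start of its chain.
  Stopping early does not change it, and in this form it depends only on the set of back edges
  processed.\<close>

definition VISs :: "(nat \<times> nat) set => nat set" where
 "VISs B = fst ` B \<union> {c. \<exists>(a, y) \<in> B. (y, c) \<in> T\<^sup>* & (c, a) \<in> T\<^sup>+}"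

definition COVs :: "(nat \<times> nat) set => nat set" where
 "COVs B = {c. \<exists>(a, y) \<in> B. (y, c) \<in> T\<^sup>* & (c, a) \<in> T\<^sup>+}"

text \<open>The parent is quantified instead of written \<open>par c\<close>, so that the root is
  never a member.\<close>

definition NCs :: "(nat \<times> nat) set => nat set" where
 "NCs B = {c. \<exists>(a, y) \<in> B. (y, c) \<in> T\<^sup>* & (\<exists>p. (c, p) \<in> T & (p, a) \<in> T\<^sup>+)}"

definition between :: "nat => nat => nat set" where
 "between x z = {c. (x, c) \<in> T\<^sup>* & (c, z) \<in> T\<^sup>+}"

lemma COVs_back: "COVs (back_edges G T) = {c. cov c}"
 by (auto simp: COVs_def cov_def)

lemma NCs_back: "(c, p) \<in> T ==> c \<in> NCs (back_edges G T) \<longleftrightarrow> ncov c"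
 using par_eq by (fastforce simp: NCs_def ncov_def)

lemma between_self: "between x x = {}"
 using T_irrefl by (auto simp: between_def dest: trancl_rtrancl_trancl rtrancl_trancl_trancl)

lemma between_step:
 assumes "(x, z) \<in> T\<^sup>*" "(z, y) \<in> T"
 shows "between x y = insert z (between x z)"
proof
 show "insert z (between x z) \<subseteq> between x y"
  using assms by (auto simp: between_def)
 show "between x y \<subseteq> insert z (between x z)"
 proof
  fix c assume c: "c \<in> between x y"
  then have "(c, z) \<in> T\<^sup>* | (z, c) \<in> T\<^sup>*" using T_linear assms(1) by (auto simp: between_def)
  then show "c \<in> insert z (between x z)"
  proof
   assume "(c, z) \<in> T\<^sup>*"
   then show ?thesis using c by (auto simp: between_def rtrancl_eq_or_trancl)
  next
   assume zc: "(z, c) \<in> T\<^sup>*"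
   show ?thesis
   proof (rule ccontr)
    assume "c \<notin> insert z (between x z)"
    then have "(z, c) \<in> T\<^sup>+" using zc by (auto simp: rtrancl_eq_or_trancl)
    then have "(y, c) \<in> T\<^sup>*" using T_up assms(2) by blast
    then show False using c T_irrefl by (auto simp: between_def dest: rtrancl_trancl_trancl)
   qed
  qed
 qed
qed

lemma between_notin: "z \<notin> between x z"
 using T_irrefl by (auto simp: between_def)

text \<open>
 A climb that meets a vertex \<open>z\<close> visited before may stop there: everything between \<open>z\<close> and the
 start \<open>v\<close> of the chain has been covered by a chain starting above \<open>v\<close>.
\<close>

lemma covered_above:
 assumes B: "B \<subseteq> back_edges G T" "\<forall>a \<in> fst ` B. pos a <= pos v"
  and v: "v < n" and z: "z \<in> VISs B" "(z, v) \<in> T\<^sup>+"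
 shows "\<exists>(a, y) \<in> B. (y, z) \<in> T\<^sup>* & (v, a) \<in> T\<^sup>*"
proof -
 have "z \<notin> fst ` B"
 proof
  assume "z \<in> fst ` B"
  then have "pos z <= pos v" using B(2) by auto
  then show False using T_pos[OF z(2)] by simp
 qed
 then obtain a y where ay: "(a, y) \<in> B" "(y, z) \<in> T\<^sup>*" "(z, a) \<in> T\<^sup>+" using z(1) by (auto simp: VISs_def)
 have "(a, v) \<in> T\<^sup>* | (v, a) \<in> T\<^sup>*" using T_linear ay(3) z(2) trancl_into_rtrancl by meson
 moreover have "a = v" if "(a, v) \<in> T\<^sup>*" using T_pos B(2) ay(1) that
  by (metis fst_conv image_eqI leD rtrancl_eq_or_trancl)
 ultimately have "(v, a) \<in> T\<^sup>*" by auto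
 then show ?thesis using ay by blast
qed

text \<open>The vertices from \<open>z\<close> up to \<open>v\<close> already have every mark that
  the new back edge would give them, because an earlier chain through \<open>z\<close> started at or
  above \<open>v\<close>. So stopping at \<open>z\<close> loses nothing and only
  \<open>between x z\<close> is new.\<close>

lemma chain_sets:
 assumes B: "B \<subseteq> back_edges G T" "\<forall>a \<in> fst ` B. pos a <= pos v"
  and v: "v < n" and x: "(x, z) \<in> T\<^sup>*" "(z, v) \<in> T\<^sup>*"
  and z: "z \<in> VISs B \<union> {v}"
 shows "COVs (insert (v, x) B) = COVs B \<union> between x z"
  and "NCs (insert (v, x) B) = NCs B \<union> {c \<in> between x z. par c ~= v}"
  and "VISs (insert (v, x) B) = insert v (VISs B \<union> between x z)"
proof -
 have up: "c \<in> COVs B & (\<forall>p. (c, p) \<in> T & (p, v) \<in> T\<^sup>+ --> c \<in> NCs B)" if c: "(z, c) \<in> T\<^sup>*" "(c, v) \<in> T\<^sup>+" for c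
 proof -
  have zv: "(z, v) \<in> T\<^sup>+" using c by (rule rtrancl_trancl_trancl)
  then have "z \<in> VISs B" using z T_irrefl by auto
  from covered_above[OF B v this zv] obtain a y where
   ay: "(a, y) \<in> B" "(y, z) \<in> T\<^sup>*" "(v, a) \<in> T\<^sup>*" by blast
  have yc: "(y, c) \<in> T\<^sup>*" using ay(2) c(1) by simp
  have "(c, a) \<in> T\<^sup>+" using c(2) ay(3) by (rule trancl_rtrancl_trancl)
  moreover have "(p, a) \<in> T\<^sup>+" if "(p, v) \<in> T\<^sup>+" for p using that ay(3) by (rule trancl_rtrancl_trancl)
  ultimately show ?thesis using ay(1) yc unfolding COVs_def NCs_def by blast
 qed
 have split: "c \<in> between x z | (z, c) \<in> T\<^sup>*" if "(x, c) \<in> T\<^sup>*" for c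
  using T_linear[OF x(1) that] that by (auto simp: between_def rtrancl_eq_or_trancl)
 have bv: "(x, c) \<in> T\<^sup>* & (c, v) \<in> T\<^sup>+" if "c \<in> between x z" for c
  using that x(2) by (auto simp: between_def intro: trancl_rtrancl_trancl)
 show C: "COVs (insert (v, x) B) = COVs B \<union> between x z"
 proof
  show "COVs (insert (v, x) B) \<subseteq> COVs B \<union> between x z"
   using split up by (auto simp: COVs_def)
  show "COVs B \<union> between x z \<subseteq> COVs (insert (v, x) B)"
   using bv by (auto simp: COVs_def)
 qed
 have pc: "\<exists>p. (c, p) \<in> T & par c = p & (p ~= v --> (p, v) \<in> T\<^sup>+)" if "c \<in> between x z" for c
 proof -
  from bv[OF that] obtain y where y: "(c, y) \<in> T" "(y, v) \<in> T\<^sup>*" by (meson tranclD)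
  then have "par c = y" using par_eq by blast
  then show ?thesis using y by (auto simp: rtrancl_eq_or_trancl)
 qed
 show "NCs (insert (v, x) B) = NCs B \<union> {c \<in> between x z. par c ~= v}"
 proof
  show "NCs (insert (v, x) B) \<subseteq> NCs B \<union> {c \<in> between x z. par c ~= v}"
  proof
   fix c assume "c \<in> NCs (insert (v, x) B)"
   then consider "c \<in> NCs B" | p where "(x, c) \<in> T\<^sup>*" "(c, p) \<in> T" "(p, v) \<in> T\<^sup>+"
    by (auto simp: NCs_def)
   then show "c \<in> NCs B \<union> {c \<in> between x z. par c ~= v}"
   proof cases
    case 2
    have "par c = p" using par_eq 2(2) by blast
    moreover have "p ~= v" using 2(3) T_irrefl by blast
    moreover have "(c, v) \<in> T\<^sup>+" using 2(2,3) by (rule trancl_into_trancl2)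
    ultimately show ?thesis using split[OF 2(1)] up 2(2,3) by blast
   qed simp
  qed
  show "NCs B \<union> {c \<in> between x z. par c ~= v} \<subseteq> NCs (insert (v, x) B)"
  proof
   fix c assume "c \<in> NCs B \<union> {c \<in> between x z. par c ~= v}"
   then show "c \<in> NCs (insert (v, x) B)"
   proof
    assume "c \<in> {c \<in> between x z. par c ~= v}"
    then show ?thesis using bv[of c] pc[of c] unfolding NCs_def by blast
   qed (auto simp: NCs_def)
  qed
 qed
 show "VISs (insert (v, x) B) = insert v (VISs B \<union> between x z)"
  using C by (auto simp: VISs_def COVs_def)
qed

end

section \<open>The compressed stack\<close>

text \<open>
 A suspended vertex \<open>v\<close> at depth \<open>j\<close> with arc index \<open>i\<close> has a field of \<open>W v = 1 + deg v div B\<close>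
 bits in \<open>aU\<close>, starting at the sum \<open>cs j\<close> of the sizes of the fields below. The quotient \<open>i div B\<close>
 is stored there by a single 1, the remainder in \<open>aLo\<close>. As \<open>B\<close> is about \<open>m/n\<close>, the fields
 have \<open>O(n)\<close> bits in total. The vertices themselves are kept explicitly only for the topmost
 (at most \<open>S\<close>) entries, in the cyclic buffers \<open>aE1\<close> and \<open>aE2\<close>, and for some landmarks,
 from which the other entries can be restored by following arcs upwards. Landmarks are chosen so
 that the fields between consecutive ones have fewer than \<open>S\<close> bits.
\<close>

abbreviation (input) "vU \<equiv> 0 :: nat"
abbreviation (input) "vI \<equiv> 16 :: nat"
abbreviation (input) "vC \<equiv> 2 :: nat"
abbreviation (input) "vD \<equiv> 3 :: nat"
abbreviation (input) "vH \<equiv> 4 :: nat"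
abbreviation (input) "vLo \<equiv> 5 :: nat"
abbreviation (input) "vW \<equiv> 6 :: nat"
abbreviation (input) "vP \<equiv> 7 :: nat"
abbreviation (input) "vX \<equiv> 8 :: nat"
abbreviation (input) "vY \<equiv> 9 :: nat"
abbreviation (input) "vZ \<equiv> 10 :: nat"
abbreviation (input) "vJ \<equiv> 11 :: nat"
abbreviation (input) "vQ \<equiv> 12 :: nat"
abbreviation (input) "vK \<equiv> 13 :: nat"
abbreviation (input) "vA \<equiv> 14 :: nat"
abbreviation (input) "vT \<equiv> 15 :: nat"

text \<open>Registers below 20 belong to the traversal, those from 20 to its hooks, and those from
  70 hold parameters; arrays split at 10 in the same way. In the traversal, \<open>vU\<close> and
  \<open>vI\<close> are the current vertex and its arc index, \<open>vC\<close> the offset of its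
  field, \<open>vD\<close> the number of suspended entries, \<open>vH\<close> that of landmarks,
  \<open>vLo\<close> the lowest buffered depth, \<open>vP\<close> the parent at a discovery,
  \<open>vK\<close> the next candidate, and \<open>vA\<close> is 0 iff the stack is empty.\<close>

abbreviation (input) "gN \<equiv> 70 :: nat"
abbreviation (input) "gS \<equiv> 71 :: nat"
abbreviation (input) "gB \<equiv> 72 :: nat"

abbreviation (input) "aD \<equiv> 0 :: nat"
abbreviation (input) "aU \<equiv> 9 :: nat"
abbreviation (input) "aLo \<equiv> 2 :: nat"
abbreviation (input) "aE1 \<equiv> 3 :: nat"
abbreviation (input) "aE2 \<equiv> 4 :: nat"
abbreviation (input) "aLD \<equiv> 5 :: nat"
abbreviation (input) "aLU \<equiv> 6 :: nat"
abbreviation (input) "aLI \<equiv> 7 :: nat"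
abbreviation (input) "aLC \<equiv> 8 :: nat"

abbreviation (input) plus_e (infixl "+." 65) where "a +. b \<equiv> Bin Plus a b"
abbreviation (input) minus_e (infixl "-." 65) where "a -. b \<equiv> Bin Minus a b"
abbreviation (input) times_e (infixl "*." 70) where "a *. b \<equiv> Bin Times a b"
abbreviation (input) quot_e (infixl "'/." 70) where "a /. b \<equiv> Bin Quot a b"
abbreviation (input) rem_e (infixl "%." 70) where "a %. b \<equiv> Bin Rem a b"

definition wE :: "reg => aexp" where
 "wE x = Lit 1 +. Dg (Rg x) /. Rg gB"

text \<open>The test for a landmark measures field bits rather than entries, since bits bound the
  cost of a restore and, by \<open>cs_gap\<close>, also the number of entries that the buffer must
  take.\<close>

definition
 "suspend =
  vW ::= wE vU ;;
  vT ::= Rg vD %. Rg gS ;;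
  Put aE1 (Rg vT) (Rg vU) ;;
  Put aE2 (Rg vT) (Rg vI) ;;
  Put aLo (Rg vD) (Rg vI %. Rg gB) ;;
  Put aU (Rg vC +. Rg vI /. Rg gB) (Lit 1) ;;
  vT ::= Lit 1 ;;
  Cond (Neqv (Rg vH) (Lit 0))
   (Cond (Lt (Rg vC +. Rg vW) (Arr aLC (Rg vH -. Lit 1) +. Rg gS)) (vT ::= Lit 0) Nop) Nop ;;
  Cond (Eqv (Rg vT) (Lit 1))
   (Put aLD (Rg vH) (Rg vD) ;;
    Put aLU (Rg vH) (Rg vU) ;;
    Put aLI (Rg vH) (Rg vI) ;;
    Put aLC (Rg vH) (Rg vC) ;;
    vH ::= Rg vH +. Lit 1) Nop ;;
  vC ::= Rg vC +. Rg vW ;;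
  vD ::= Rg vD +. Lit 1 ;;
  Cond (Lt (Rg vLo +. Rg gS) (Rg vD)) (vLo ::= Rg vLo +. Lit 1) Nop"

definition
 "find_one = vQ ::= Lit 0 ;; Loop (Neqv (Arr aU (Rg vZ +. Rg vQ)) (Lit 1)) (vQ ::= Rg vQ +. Lit 1)"

definition
 "restore_body =
  vZ ::= Rg vZ +. wE vX ;;
  vX ::= Nb (Rg vX) (Rg vY) ;;
  vJ ::= Rg vJ +. Lit 1 ;;
  find_one ;;
  vY ::= Rg vQ *. Rg gB +. Arr aLo (Rg vJ) ;;
  vT ::= Rg vJ %. Rg gS ;;
  Put aE1 (Rg vT) (Rg vX) ;;
  Put aE2 (Rg vT) (Rg vY)"

text \<open>The landmark entry itself is not copied into the buffers, as it will be resumed from the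
  landmark arrays; hence the buffered range starts one above it.\<close>

definition
 "restore =
  vT ::= Rg vH -. Lit 1 ;;
  vJ ::= Arr aLD (Rg vT) ;;
  vX ::= Arr aLU (Rg vT) ;;
  vY ::= Arr aLI (Rg vT) ;;
  vZ ::= Arr aLC (Rg vT) ;;
  vLo ::= Rg vJ +. Lit 1 ;;
  Loop (Lt (Rg vJ) (Rg vD))
   restore_body"

text \<open>The 1 of the resumed entry is erased so that the area above the stack is always zero and
  new fields need no clearing.\<close>

definition
 "resume =
  vD ::= Rg vD -. Lit 1 ;;
  Cond (Eqv (Arr aLD (Rg vH -. Lit 1)) (Rg vD))
   (vH ::= Rg vH -. Lit 1 ;;
    vU ::= Arr aLU (Rg vH) ;;
    vI ::= Arr aLI (Rg vH) ;;
    vC ::= Arr aLC (Rg vH) ;;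
    Cond (Lt (Rg vD) (Rg vLo)) (vLo ::= Rg vD) Nop)
   (Cond (Lt (Rg vD) (Rg vLo)) restore Nop ;;
    vT ::= Rg vD %. Rg gS ;;
    vU ::= Arr aE1 (Rg vT) ;;
    vI ::= Arr aE2 (Rg vT) ;;
    vC ::= Rg vC -. wE vU) ;;
  Put aU (Rg vC +. Rg vI /. Rg gB) (Lit 0)"

text \<open>\<open>S\<close> is the buffer length as well as the spacing of landmarks in bits,
  \<open>B\<close> the divisor that splits arc indices, \<open>L\<close> the width of a cell for a
  full number. The bound \<open>wsum\<close> is what a choice of \<open>B\<close> about m/n
  achieves, and the landmark arrays are sized by \<open>kinv_bound\<close>.\<close>

locale dfs_mem = ram w adj r na len wd xl + dfs_input adj r
 for w adj r na len wd xl +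
 fixes S B L :: nat
 assumes xl: "xl = 100" and na: "10 <= na"
  and S_pos: "0 < S" and S_le: "S <= 4 * n + 4" and B_pos: "0 < B" and B_le: "B <= 2 * n + 2"
  and w_big: "1000 * ((n + 1) * (n + 1)) <= 2 ^ w"
  and L_big: "4 * ((n + 1) * (n + 1)) <= 2 ^ L"
  and lens: "len aD = n" "len aU = 2 * n + 1" "len aLo = n" "len aE1 = S" "len aE2 = S"
   "len aLD = 4 * (n div S) + 8" "len aLU = 4 * (n div S) + 8" "len aLI = 4 * (n div S) + 8"
   "len aLC = 4 * (n div S) + 8"
  and wds: "wd aD = 1" "wd aU = 1" "2 ^ wd aLo = B" "wd aE1 = L" "wd aE2 = L" "wd aLD = L"
   "wd aLU = L" "wd aLI = L" "wd aLC = L"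
  and wsum: "(\<Sum>v<n. 1 + deg v div B) <= 2 * n"
  and deg_le: "\<And>v. v < n ==> deg v <= n"
begin

section \<open>Offsets of the fields and spacing of the landmarks\<close>

definition W :: "nat => nat" where "W v = 1 + deg v div B"

definition cs :: "(nat \<times> nat) list => nat => nat" where
 "cs sus j = sum_list (map (W \<circ> fst) (take j sus))"

definition cst :: "(nat => nat) => bool" where
 "cst rg \<longleftrightarrow> rg gN = n & rg gS = S & rg gB = B"

lemma xl_iff [simp]: "x < xl \<longleftrightarrow> x < 100" by (simp add: xl)

lemma na_lt [simp]: "k < 10 ==> k < na" using na by simp

lemma n_pos: "0 < n" using r_less by linarith

lemma w_pos: "0 < w"
proof (rule ccontr)
 assume "\<not> 0 < w"
 then show False using w_big by simp
qed

text \<open>The traversal handles only numbers of size O(n); this and \<open>smallL\<close>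
  discharge its overflow and width obligations.\<close>

lemma small: "x <= 100 * n + 100 ==> x < 2 ^ w"
proof -
 assume "x <= 100 * n + 100"
 also have "\<dots> = 100 * (n + 1)" by simp
 also have "\<dots> < 1000 * ((n + 1) * (n + 1))" by simp
 also note w_big
 finally show ?thesis .
qed

lemma smallL: "x <= 2 * n + 2 ==> x < 2 ^ L"
proof -
 assume "x <= 2 * n + 2"
 also have "\<dots> = 2 * (n + 1)" by simp
 also have "\<dots> < 4 * ((n + 1) * (n + 1))" by simp
 also note L_big
 finally show ?thesis .
qed

lemma lits [simp]: "Suc 0 < 2 ^ w" "1 < (2 :: nat) ^ w" "0 < w"
 using w_pos one_less_power[of "2 :: nat" w] by simp_all

lemma cs_0 [simp]: "cs sus 0 = 0" by (simp add: cs_def)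

lemma cs_Suc: "j < length sus ==> cs sus (Suc j) = cs sus j + W (fst (sus ! j))"
 by (simp add: cs_def take_Suc_conv_app_nth)

lemma cs_append: "j <= length sus ==> cs (sus @ xs) j = cs sus j"
 by (simp add: cs_def)

lemma cs_snoc [simp]: "cs (sus @ [e]) (Suc (length sus)) = cs sus (length sus) + W (fst e)"
 by (simp add: cs_def)

lemma W_pos [simp]: "0 < W v" "Suc 0 <= W v" by (simp_all add: W_def)

lemma cs_mono: "i <= j ==> cs sus i <= cs sus j"
proof -
 assume "i <= j"
 then have "take j sus = take i sus @ drop i (take j sus)"
  by (metis append_take_drop_id min.absorb1 take_take)
 then show ?thesis unfolding cs_def by (metis le_add1 map_append sum_list_append)
qed

text \<open>No field is empty, so field bits bound the number of entries. Hence a segment of fewer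
  than \<open>S\<close> bits fits into buffers of \<open>S\<close> cells.\<close>

lemma cs_gap: "i <= j ==> j <= length sus ==> cs sus i + (j - i) <= cs sus j"
proof (induction j)
 case (Suc j)
 show ?case
 proof (cases "i = Suc j")
  case False
  then have "cs sus i + (j - i) <= cs sus j" using Suc by simp
  then show ?thesis using cs_Suc[of j sus] Suc.prems False W_pos(2)[of "fst (sus ! j)"]
   by (simp del: W_pos)
 qed simp
qed simp

lemma cs_le: "distinct (map fst sus) ==> (\<forall>x \<in> set sus. fst x < n) ==> cs sus j <= 2 * n"
proof -
 assume a: "distinct (map fst sus)" "\<forall>x \<in> set sus. fst x < n"
 have "cs sus j <= cs sus (max j (length sus))" by (rule cs_mono) simp
 also have "\<dots> = sum_list (map W (map fst sus))" by (simp add: cs_def)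
 also have "\<dots> = sum W (set (map fst sus))" using a(1) by (simp only: sum_list_distinct_conv_sum_set)
 also have "\<dots> <= sum W {..<n}" by (rule sum_mono2) (use a(2) in auto)
 also have "\<dots> <= 2 * n" using wsum by (simp add: W_def)
 finally show ?thesis .
qed

lemma field_unique:
 assumes j: "j < length sus" "q < W (fst (sus ! j))" and k: "k < length sus" "q' < W (fst (sus ! k))"
  and e: "cs sus j + q = cs sus k + q'"
 shows "j = k & q = q'"
proof (cases j k rule: linorder_cases)
 case less
 then have "cs sus (Suc j) <= cs sus k" by (intro cs_mono) simp
 then show ?thesis using cs_Suc[OF j(1)] j(2) e by simp
next
 case greater
 then have "cs sus (Suc k) <= cs sus j" by (intro cs_mono) simp
 then show ?thesis using cs_Suc[OF k(1)] k(2) e by simp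
qed (use e in simp)

lemma quot_less: "i <= deg v ==> i div B < W v"
 by (simp add: W_def div_le_mono less_Suc_eq_le)

text \<open>\<open>ks\<close> are the depths of the landmarks. That the entries after a landmark
  stay within \<open>S\<close> bits of its offset makes a restore cheap; that each next landmark
  would have exceeded this limit bounds their number.\<close>

definition kinv :: "(nat \<times> nat) list => nat list => bool" where
 "kinv sus ks \<longleftrightarrow> sorted_wrt (<) ks & (\<forall>k \<in> set ks. k < length sus) &
  (sus ~= [] --> (\<exists>ks'. ks = 0 # ks')) &
  (\<forall>a j. a < length ks --> ks ! a < j --> j < (if Suc a < length ks then ks ! Suc a else length sus) -->
    cs sus (Suc j) < cs sus (ks ! a) + S) &
  (\<forall>a. Suc a < length ks --> cs sus (ks ! a) + S <= cs sus (Suc (ks ! Suc a)))"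

text \<open>The limit may be exceeded only because of the field of the next landmark itself, so
  \<open>S\<close> bits are guaranteed from each landmark to the one after the next: landmark
  \<open>2 * a\<close> has offset at least \<open>a * S\<close>, while all fields together have at
  most \<open>2 * n\<close> bits.\<close>

lemma kinv_bound:
 assumes k: "kinv sus ks" and c: "\<And>j. cs sus j <= 2 * n"
 shows "length ks <= 4 * (n div S) + 4"
proof -
 have h: "2 * a < length ks ==> a * S <= cs sus (ks ! (2 * a))" for a
 proof (induction a)
  case (Suc a)
  then have "a * S <= cs sus (ks ! (2 * a))" by simp
  moreover have "cs sus (ks ! (2 * a)) + S <= cs sus (Suc (ks ! Suc (2 * a)))"
   using k Suc.prems by (simp add: kinv_def)
  moreover have "ks ! Suc (2 * a) < ks ! Suc (Suc (2 * a))"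
   using k Suc.prems unfolding kinv_def sorted_wrt_iff_nth_less by simp
  then have "cs sus (Suc (ks ! Suc (2 * a))) <= cs sus (ks ! Suc (Suc (2 * a)))" by (intro cs_mono) simp
  ultimately show ?case by simp
 qed simp
 show ?thesis
 proof (cases "ks = []")
  case False
  define a where "a = (length ks - 1) div 2"
  have a: "2 * a < length ks" "length ks <= 2 * a + 2" using False unfolding a_def by (cases ks; simp)+
  have "a * S <= 2 * n" using h[OF a(1)] c le_trans by blast
  then have "a <= 2 * n div S" using S_pos by (simp add: less_eq_div_iff_mult_less_eq)
  also have "2 * n div S <= 2 * (n div S) + 1"
  proof -
   have "n < (n div S + 1) * S" using S_pos by (metis add.commute dividend_less_times_div mult.commute mult_Suc_right plus_1_eq_Suc)
   then have "2 * n < (2 * (n div S) + 2) * S" by (simp add: algebra_simps)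
   then have "2 * n div S < 2 * (n div S) + 2" using S_pos by (simp add: div_less_iff_less_mult)
   then show ?thesis by simp
  qed
  finally show ?thesis using a(2) by simp
 qed simp
qed

lemma kinv_Nil: "kinv [] []" by (simp add: kinv_def)

lemma kinv_push_mark:
 assumes k: "kinv sus ks" and c: "ks = [] | cs sus (last ks) + S <= cs sus (length sus) + W u"
 shows "kinv (sus @ [(u, i)]) (ks @ [length sus])"
proof -
 have lt: "a < length ks ==> ks ! a < length sus" for a using k by (simp add: kinv_def)
 show ?thesis unfolding kinv_def
 proof (intro conjI allI impI)
  show "sorted_wrt (<) (ks @ [length sus])" using k by (auto simp: kinv_def sorted_wrt_append)
  show "\<forall>k\<in>set (ks @ [length sus]). k < length (sus @ [(u, i)])" using k by (auto simp: kinv_def)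
  fix a j assume a: "a < length (ks @ [length sus])" "(ks @ [length sus]) ! a < j"
   "j < (if Suc a < length (ks @ [length sus]) then (ks @ [length sus]) ! Suc a else length (sus @ [(u, i)]))"
  then have al: "a < length ks" by (auto simp: nth_append split: if_splits)
  then have j: "j < (if Suc a < length ks then ks ! Suc a else length sus)"
   using a by (auto simp: nth_append split: if_splits)
  then have "cs sus (Suc j) < cs sus (ks ! a) + S"
   using k a al by (simp add: kinv_def nth_append)
  moreover have "j < length sus" using j lt by (auto split: if_splits intro: less_trans)
  ultimately show "cs (sus @ [(u, i)]) (Suc j) < cs (sus @ [(u, i)]) ((ks @ [length sus]) ! a) + S"
   using al lt[OF al] by (simp add: cs_append nth_append)
 next
  fix a assume a: "Suc a < length (ks @ [length sus])"
  show "cs (sus @ [(u, i)]) ((ks @ [length sus]) ! a) + S <= cs (sus @ [(u, i)]) (Suc ((ks @ [length sus]) ! Suc a))"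
  proof (cases "Suc a < length ks")
   case True
   then show ?thesis using k cs_append[of "ks ! a" sus] cs_append[of "Suc (ks ! Suc a)" sus] lt[OF Suc_lessD[OF True]] lt[OF True]
    by (simp add: kinv_def nth_append Suc_leI Suc_lessD less_imp_le)
  next
   case False
   then have "a = length ks - 1" "ks ~= []" using a by (auto intro: Suc_inject)
   then show ?thesis using c lt[of a] by (simp add: nth_append cs_append last_conv_nth)
  qed
 next
  show "\<exists>ks'. ks @ [length sus] = 0 # ks'" using k by (cases "sus = []") (auto simp: kinv_def)
 qed
qed

lemma kinv_push_plain:
 assumes k: "kinv sus ks" and c: "ks ~= []" "cs sus (length sus) + W u < cs sus (last ks) + S"
 shows "kinv (sus @ [(u, i)]) ks"
proof -
 have lt: "a < length ks ==> ks ! a < length sus" for a using k by (simp add: kinv_def)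
 show ?thesis unfolding kinv_def
 proof (intro conjI allI impI)
  show "sorted_wrt (<) ks" using k by (auto simp: kinv_def sorted_wrt_append)
  show "\<forall>k\<in>set ks. k < length (sus @ [(u, i)])" using k by (auto simp: kinv_def)
  show "\<exists>ks'. ks = 0 # ks'" using k c(1) by (cases "sus = []") (auto simp: kinv_def)
  fix a j assume a: "a < length ks" "ks ! a < j"
   "j < (if Suc a < length ks then ks ! Suc a else length (sus @ [(u, i)]))"
  show "cs (sus @ [(u, i)]) (Suc j) < cs (sus @ [(u, i)]) (ks ! a) + S"
  proof (cases "j = length sus")
   case True
   then have "\<not> Suc a < length ks" using a(3) lt[of "Suc a"] by (auto split: if_splits)
   then have "a = length ks - 1" using a(1) by simp
   then show ?thesis using True c lt[OF a(1)] by (simp add: cs_append last_conv_nth)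
  next
   case False
   then have j: "j < (if Suc a < length ks then ks ! Suc a else length sus)"
    using a by (auto split: if_splits)
   then have "cs sus (Suc j) < cs sus (ks ! a) + S"
    using k a by (simp add: kinv_def)
   moreover have "j < length sus" using j lt by (auto split: if_splits intro: less_trans)
   ultimately show ?thesis using lt[OF a(1)] by (simp add: cs_append)
  qed
 next
  fix a assume a: "Suc a < length ks"
  then show "cs (sus @ [(u, i)]) (ks ! a) + S <= cs (sus @ [(u, i)]) (Suc (ks ! Suc a))"
   using k cs_append[of "ks ! a" sus] cs_append[of "Suc (ks ! Suc a)" sus] lt[OF Suc_lessD[OF a]] lt[OF a]
   by (simp add: kinv_def Suc_leI less_imp_le)
 qed
qed

lemma kinv_pop_mark:
 assumes k: "kinv (sus @ [e]) (ks @ [length sus])"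
 shows "kinv sus ks"
proof -
 have lt: "ks ! a < length sus" if "a < length ks" for a
  using k that by (auto simp: kinv_def sorted_wrt_append)
 show ?thesis unfolding kinv_def
 proof (intro conjI allI impI)
  show "sorted_wrt (<) ks" using k by (auto simp: kinv_def sorted_wrt_append)
  show "\<forall>k\<in>set ks. k < length sus" using k by (auto simp: kinv_def sorted_wrt_append)
  show "\<exists>ks'. ks = 0 # ks'" if "sus ~= []" using k that by (cases ks) (auto simp: kinv_def)
  fix a j assume a: "a < length ks" "ks ! a < j" "j < (if Suc a < length ks then ks ! Suc a else length sus)"
  then have j: "j < length sus" using lt by (auto split: if_splits intro: less_trans)
  have "j < (if Suc a < length (ks @ [length sus]) then (ks @ [length sus]) ! Suc a else length (sus @ [e]))"
   using a by (auto simp: nth_append split: if_splits)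
  then have "cs (sus @ [e]) (Suc j) < cs (sus @ [e]) ((ks @ [length sus]) ! a) + S"
   using k a(1,2) unfolding kinv_def by (metis length_append_singleton less_SucI nth_append)
  then show "cs sus (Suc j) < cs sus (ks ! a) + S"
   using j a(1) lt[OF a(1)] by (simp add: cs_append nth_append)
 next
  fix a assume a: "Suc a < length ks"
  then have "cs (sus @ [e]) ((ks @ [length sus]) ! a) + S <= cs (sus @ [e]) (Suc ((ks @ [length sus]) ! Suc a))"
   using k unfolding kinv_def by (metis length_append_singleton less_SucI)
  then show "cs sus (ks ! a) + S <= cs sus (Suc (ks ! Suc a))"
   using a lt[OF Suc_lessD[OF a]] lt[OF a] by (simp add: cs_append nth_append Suc_leI Suc_lessD)
 qed
qed

lemma kinv_pop_plain:
 assumes k: "kinv (sus @ [e]) ks" and l: "last ks ~= length sus"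
 shows "kinv sus ks"
proof -
 have lt: "ks ! a < length sus" if "a < length ks" for a
 proof (rule ccontr)
  assume "\<not> ks ! a < length sus"
  moreover have "ks ! a < Suc (length sus)" using k that by (auto simp: kinv_def)
  ultimately have e: "ks ! a = length sus" by simp
  have "a = length ks - 1"
  proof (rule ccontr)
   assume "a ~= length ks - 1"
   then have "a < length ks - 1" using that by simp
   then have "ks ! a < ks ! (length ks - 1)"
    using k that unfolding kinv_def sorted_wrt_iff_nth_less by simp
   moreover have "ks ! (length ks - 1) < Suc (length sus)" using k that by (auto simp: kinv_def)
   ultimately show False using e by simp
  qed
  moreover have "ks ~= []" using that by auto
  ultimately show False using l e by (simp add: last_conv_nth)
 qed
 show ?thesis unfolding kinv_def
 proof (intro conjI allI impI)
  show "sorted_wrt (<) ks" using k by (auto simp: kinv_def sorted_wrt_append)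
  show "\<forall>k\<in>set ks. k < length sus" using lt by (auto simp: in_set_conv_nth)
  show "\<exists>ks'. ks = 0 # ks'" using k by (auto simp: kinv_def)
  fix a j assume a: "a < length ks" "ks ! a < j" "j < (if Suc a < length ks then ks ! Suc a else length sus)"
  then have j: "j < length sus" using lt by (auto split: if_splits intro: less_trans)
  have "j < (if Suc a < length ks then ks ! Suc a else length (sus @ [e]))"
   using a by (auto split: if_splits)
  then have "cs (sus @ [e]) (Suc j) < cs (sus @ [e]) (ks ! a) + S"
   using k a(1,2) unfolding kinv_def by metis
  then show "cs sus (Suc j) < cs sus (ks ! a) + S"
   using j lt[OF a(1)] by (simp add: cs_append)
 next
  fix a assume a: "Suc a < length ks"
  then have "cs (sus @ [e]) (ks ! a) + S <= cs (sus @ [e]) (Suc (ks ! Suc a))"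
   using k unfolding kinv_def by metis
  then show "cs sus (ks ! a) + S <= cs sus (Suc (ks ! Suc a))"
   using a lt[OF Suc_lessD[OF a]] lt[OF a] by (simp add: cs_append Suc_leI)
 qed
qed

text \<open>Bounds the cost of restoring a top entry that is not a landmark itself.\<close>

lemma kinv_last_seg:
 assumes k: "kinv (sus @ [e]) ks" and l: "last ks < length sus"
 shows "cs sus (length sus) + W (fst e) < cs sus (last ks) + S"
proof -
 have ne: "ks ~= []" using k by (auto simp: kinv_def)
 define a where "a = length ks - 1"
 have a: "a < length ks" "\<not> Suc a < length ks" "ks ! a = last ks"
  using ne by (simp_all add: a_def last_conv_nth)
 have "cs (sus @ [e]) (Suc (length sus)) < cs (sus @ [e]) (ks ! a) + S"
 proof -
  have "\<forall>a j. a < length ks --> ks ! a < j -->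
    j < (if Suc a < length ks then ks ! Suc a else length (sus @ [e])) -->
    cs (sus @ [e]) (Suc j) < cs (sus @ [e]) (ks ! a) + S"
   using k unfolding kinv_def by (elim conjE) assumption
  from this[rule_format, of a "length sus"] show ?thesis using a l by simp
 qed
 then have "cs (sus @ [e]) (Suc (length sus)) < cs (sus @ [e]) (last ks) + S" using a(3) by simp
 then show ?thesis using l by (simp add: cs_append)
qed

text \<open>The stack whose entries are \<open>sus\<close> (bottom first), below the current vertex \<open>u\<close>.\<close>

definition okst :: "(nat \<times> nat) list => nat => bool" where
 "okst sus u \<longleftrightarrow> distinct (map fst sus @ [u]) & u < n &
  (\<forall>j<length sus. fst (sus ! j) < n & snd (sus ! j) < deg (fst (sus ! j)) &
    adj ! fst (sus ! j) ! snd (sus ! j) = (map fst sus @ [u]) ! Suc j)"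

text \<open>The bits of \<open>aU\<close> are specified on the whole array: exactly the marks of the
  suspended entries are set. The zeros elsewhere are needed by the unary search and by fields added
  later.\<close>

definition drel :: "(nat \<times> nat) list => nat list => (nat => nat) => arrays => bool" where
 "drel sus ks rg ar \<longleftrightarrow>
  rg vD = length sus & rg vC = cs sus (length sus) & rg vH = length ks &
  rg vLo <= length sus & length sus <= rg vLo + S &
  (\<forall>p < 2 * n + 1. ar aU p = (if \<exists>j<length sus. p = cs sus j + snd (sus ! j) div B then 1 else 0)) &
  (\<forall>j<length sus. ar aLo j = snd (sus ! j) mod B) &
  (\<forall>j. rg vLo <= j --> j < length sus -->
    ar aE1 (j mod S) = fst (sus ! j) & ar aE2 (j mod S) = snd (sus ! j)) &
  (\<forall>a<length ks. ar aLD a = ks ! a & ar aLU a = fst (sus ! (ks ! a)) &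
    ar aLI a = snd (sus ! (ks ! a)) & ar aLC a = cs sus (ks ! a)) &
  kinv sus ks"

lemma okst_set: "okst sus u ==> x \<in> set sus ==> fst x < n"
 unfolding okst_def by (metis in_set_conv_nth)

lemma okst_cs: "okst sus u ==> cs sus j <= 2 * n"
 using okst_set by (intro cs_le) (auto simp: okst_def)

lemma okst_total: "okst sus u ==> cs sus (length sus) + W u <= 2 * n"
proof -
 assume o: "okst sus u"
 have "cs (sus @ [(u, 0)]) (Suc (length sus)) <= 2 * n"
  by (rule cs_le) (insert o okst_set[OF o], auto simp: okst_def)
 then show ?thesis by simp
qed

lemma okst_length: "okst sus u ==> length sus < n"
proof -
 assume o: "okst sus u"
 then have "card (set (map fst sus @ [u])) = length sus + 1"
  by (simp only: okst_def distinct_card) simp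
 moreover have "set (map fst sus @ [u]) \<subseteq> {..<n}" using o okst_set[OF o] by (auto simp: okst_def)
 then have "card (set (map fst sus @ [u])) <= n" using card_mono[of "{..<n}"] by fastforce
 ultimately show ?thesis by simp
qed

text \<open>Makes the cyclic buffers injective on any \<open>S\<close> consecutive depths.\<close>

lemma mod_inj: "j mod S = k mod S ==> j < k + S ==> k < j + S ==> j = (k :: nat)"
proof -
 have *: "a = b" if "a mod S = b mod S" "a <= b" "b < a + S" for a b :: nat
 proof -
  have "S dvd b - a" using that by (metis mod_eq_dvd_iff_nat)
  moreover have "b - a < S" using that by simp
  ultimately show ?thesis using that(2) by (metis diff_is_0_eq dvd_imp_le le_antisym not_gr0 not_less)
 qed
 show "j mod S = k mod S ==> j < k + S ==> k < j + S ==> j = k"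
  using *[of j k] *[of k j] by (cases "j <= k") auto
qed

lemma suspend_ok:
 assumes d: "drel sus ks rg ar" and o: "okst sus u" and u: "rg vU = u" "rg vI = i" "i < deg u" and c: "cst rg"
  and Q: "\<And>rg' ar' t' ks'. drel (sus @ [(u, i)]) ks' rg' ar' ==>
   eq_off {vC, vD, vH, vLo, vW, vT} rg' rg ==> (\<forall>k. k < 2 | 10 <= k --> ar' k = ar k) ==>
   rg' vLo = (if rg vLo + S < length sus + 1 then rg vLo + 1 else rg vLo) ==>
   t' <= t + 30 ==> Q rg' ar' t' out"
 shows "wp suspend Q rg ar t out"
proof -
 define c' where "c' = cs sus (length sus)"
 define mark where "mark \<longleftrightarrow> ks = [] | cs sus (last ks) + S <= c' + W u"
 define ks' where "ks' = (if mark then ks @ [length sus] else ks)"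
 define q where "q = i div B"
 have un: "u < n" using o by (simp add: okst_def)
 have tot: "c' + W u <= 2 * n" using okst_total[OF o] by (simp add: c'_def)
 have qW: "q < W u" unfolding q_def using u(3) by (intro quot_less) simp
 have dn: "length sus < n" using okst_length[OF o] .
 have dg: "deg u <= n" using deg_le[OF un] .
 have kb: "length ks <= 4 * (n div S) + 4" using kinv_bound[of sus ks] d okst_cs[OF o] by (simp add: drel_def)
 have nS: "n div S <= n" by simp
 have r: "rg vD = length sus" "rg vC = c'" "rg vH = length ks" "rg vLo <= length sus" "length sus <= rg vLo + S"
  using d by (simp_all add: drel_def c'_def)
 have g: "rg gS = S" "rg gB = B" using c by (simp_all add: cst_def)
 have k: "kinv sus ks" using d by (simp add: drel_def)
 have LC: "ar aLC (length ks - Suc 0) = cs sus (last ks)" if "ks ~= []"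
  using d that by (simp add: drel_def last_conv_nth)
 have lastle: "cs sus (last ks) <= 2 * n" using okst_cs[OF o] .
 have iB: "i mod B < B" using B_pos by simp
 have W: "Suc (deg u div B) = W u" by (simp add: W_def)
 have kinv': "kinv (sus @ [(u, i)]) ks'"
  using kinv_push_mark[OF k, of u i] kinv_push_plain[OF k, of u i] by (auto simp: ks'_def mark_def c'_def)
 have ltk: "a < length ks ==> ks ! a < length sus" for a using k by (simp add: kinv_def)
 have smalls: "W u < 2 ^ w" "c' + q < 2 ^ w" "c' + W u < 2 ^ w" "Suc (length sus) < 2 ^ w"
  "Suc (length ks) < 2 ^ w" "rg vLo + S < 2 ^ w" "Suc (rg vLo) < 2 ^ w" "cs sus (last ks) + S < 2 ^ w"
  "S < 2 ^ w" "length ks < 2 ^ w"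
  using tot qW dn kb nS S_le r lastle by (intro small; linarith)+
 have smallLs: "u < 2 ^ L" "i < 2 ^ L" "length sus < 2 ^ L" "c' < 2 ^ L"
  using un u(3) dg dn tot by (intro smallL; linarith)+
 define a1 where "a1 = ar(aE1 := (ar aE1)(length sus mod S := u), aE2 := (ar aE2)(length sus mod S := i),
  aLo := (ar aLo)(length sus := i mod B), aU := (ar aU)(c' + q := 1))"
 define a2 where "a2 = (if mark then a1(aLD := (ar aLD)(length ks := length sus), aLU := (ar aLU)(length ks := u),
  aLI := (ar aLI)(length ks := i), aLC := (ar aLC)(length ks := c')) else a1)"
 have final: "Q rg' ar' t' out"
  if "rg' vC = c' + W u" "rg' vD = Suc (length sus)" "rg' vH = length ks'"
   "rg' vLo = (if rg vLo + S < length sus + 1 then rg vLo + 1 else rg vLo)"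
   "eq_off {vC, vD, vH, vLo, vW, vT} rg' rg" "t' <= t + 30" "ar' = a2" for rg' ar' t'
  unfolding that(7)
 proof (rule Q[of ks'])
  have lo': "rg' vLo <= Suc (length sus)" "Suc (length sus) <= rg' vLo + S" "rg vLo <= rg' vLo" "length sus < rg' vLo + S"
   using that(4) r S_pos by auto
  have E: "a2 aE1 = (ar aE1)(length sus mod S := u)" "a2 aE2 = (ar aE2)(length sus mod S := i)"
   "a2 aLo = (ar aLo)(length sus := i mod B)" "a2 aU = (ar aU)(c' + q := 1)"
   by (auto simp: a2_def a1_def)
  show "drel (sus @ [(u, i)]) ks' rg' a2"
   unfolding drel_def
  proof (intro conjI allI impI)
   fix p assume p: "p < 2 * n + 1"
   have "(\<exists>j<length (sus @ [(u, i)]). p = cs (sus @ [(u, i)]) j + snd ((sus @ [(u, i)]) ! j) div B) \<longleftrightarrow>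
    (p = c' + q | (\<exists>j<length sus. p = cs sus j + snd (sus ! j) div B))"
   proof -
    have ex: "(\<exists>j<Suc m. P j) \<longleftrightarrow> P m | (\<exists>j<m. P j)" for m :: nat and P
     by (auto simp: less_Suc_eq)
    show ?thesis unfolding length_append_singleton ex
     by (simp add: cs_append nth_append c'_def q_def cong: conj_cong)
   qed
   then show "a2 aU p = (if \<exists>j<length (sus @ [(u, i)]). p = cs (sus @ [(u, i)]) j + snd ((sus @ [(u, i)]) ! j) div B then 1 else 0)"
    using d p by (simp add: E drel_def)
  next
   fix j assume "j < length (sus @ [(u, i)])"
   then show "a2 aLo j = snd ((sus @ [(u, i)]) ! j) mod B"
    using d by (auto simp: E drel_def nth_append less_Suc_eq)
  next
   fix j assume j: "rg' vLo <= j" "j < length (sus @ [(u, i)])"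
   \<comment> \<open>The new top shares its buffer cell only with entries at least \<open>S\<close>
     below it, which the adjusted \<open>vLo\<close> excludes.\<close>
   have ne: "j mod S ~= length sus mod S" if "j ~= length sus"
    using that mod_inj[of j "length sus"] j lo' by auto
   show "a2 aE1 (j mod S) = fst ((sus @ [(u, i)]) ! j)"
    using d j ne lo'(3) by (cases "j = length sus") (auto simp: E drel_def nth_append less_Suc_eq)
   show "a2 aE2 (j mod S) = snd ((sus @ [(u, i)]) ! j)"
    using d j ne lo'(3) by (cases "j = length sus") (auto simp: E drel_def nth_append less_Suc_eq)
  next
   fix a assume a: "a < length ks'"
   have "a2 aLD a = ks' ! a & a2 aLU a = fst ((sus @ [(u, i)]) ! (ks' ! a)) &
    a2 aLI a = snd ((sus @ [(u, i)]) ! (ks' ! a)) & a2 aLC a = cs (sus @ [(u, i)]) (ks' ! a)"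
   proof (cases "a < length ks")
    case True
    then show ?thesis using d ltk[OF True]
     by (simp add: drel_def a2_def a1_def ks'_def nth_append cs_append)
   next
    case False
    then have "mark" "a = length ks" using a by (auto simp: ks'_def split: if_splits)
    then show ?thesis by (simp add: a2_def ks'_def nth_append cs_append c'_def)
   qed
   then show "a2 aLD a = ks' ! a" "a2 aLU a = fst ((sus @ [(u, i)]) ! (ks' ! a))"
    "a2 aLI a = snd ((sus @ [(u, i)]) ! (ks' ! a))" "a2 aLC a = cs (sus @ [(u, i)]) (ks' ! a)" by auto
  qed (insert that lo' kinv', auto simp: c'_def)
  show "\<forall>k. k < 2 | 10 <= k --> a2 k = ar k" by (auto simp: a2_def a1_def)
 qed (use that in auto)
 note ss = suspend_def wE_def r g u W xl na lens wds smalls smallLs un iB LC q_def[symmetric] mark_def ks'_def a2_def a1_def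
 have idx: "c' + q < Suc (2 * n)" "length ks < 4 * (n div S) + 8" "length sus mod S < S"
  using tot qW kb S_pos by auto
 have ksi: "ks ~= [] ==> Suc 0 <= length ks" "length ks - Suc 0 < 4 * (n div S) + 8"
  using idx(2) by (cases ks; simp)+
 show ?thesis unfolding suspend_def wE_def
  apply (cases "ks = []")
  apply (simp_all add: r g u W lens wds smalls smallLs un iB q_def[symmetric] idx dn LC ksi)
  apply (intro conjI impI; (rule final)?; (simp add: ks'_def mark_def a2_def a1_def)?)
  apply (intro conjI impI; (rule final)?; (simp add: ks'_def mark_def a2_def a1_def r not_less)?)
  done
qed

lemma find_one_ok:
 assumes z: "rg vZ + q0 <= 2 * n" and one: "ar aU (rg vZ + q0) = 1" "\<And>q. q < q0 ==> ar aU (rg vZ + q) ~= 1"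
  and Q: "Q (rg(vQ := q0)) ar (t + 2 + 2 * q0) out"
 shows "wp find_one Q rg ar t out"
proof -
 have sm: "rg vZ + q < 2 ^ w" "Suc q < 2 ^ w" if "q <= q0" for q
  using z that by (intro small; linarith)+
 let ?I = "\<lambda>rg' ar' t' out'. \<exists>q\<le>q0. rg' = rg(vQ := q) & ar' = ar & out' = out & t' = t + 1 + 2 * q"
 have "wp (Loop (Neqv (Arr aU (Rg vZ +. Rg vQ)) (Lit 1)) (vQ ::= Rg vQ +. Lit 1)) Q (rg(vQ := 0)) ar (t + 1) out"
 proof (rule wp_loop'[where I = ?I and B = "t + 1 + 2 * q0"])
  show "?I (rg(vQ := 0)) ar (t + 1) out" by auto
  fix rg' ar' t' out' assume "?I rg' ar' t' out'"
  then obtain q where q: "q <= q0" "rg' = rg(vQ := q)" "ar' = ar" "out' = out" "t' = t + 1 + 2 * q" by blast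
  have iff: "ar aU (rg vZ + q) = 1 \<longleftrightarrow> q = q0" using one(1) one(2)[of q] q(1) by (cases "q = q0") auto
  then have iff': "ar aU (rg vZ + q) = Suc 0 \<longleftrightarrow> q = q0" by simp
  have le: "rg vZ + q < Suc (2 * n)" using q(1) z by linarith
  show "t' <= t + 1 + 2 * q0 & bok rg' ar' (Neqv (Arr aU (Rg vZ +. Rg vQ)) (Lit 1)) &
   (if bv rg' ar' (Neqv (Arr aU (Rg vZ +. Rg vQ)) (Lit 1)) then wp (vQ ::= Rg vQ +. Lit 1) ?I rg' ar' (Suc t') out'
    else Q rg' ar' (Suc t') out')"
  proof (cases "q = q0")
   case True
   then show ?thesis using Q iff' q sm[OF q(1)] le by (simp add: lens add.commute)
  next
   case False
   have "\<exists>q'\<le>q0. rg(vQ := Suc q) = rg(vQ := q') & Suc (Suc t') = Suc (t + 2 * q')"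
    by (rule exI[of _ "Suc q"]) (use q False in simp)
   then show ?thesis using iff' q sm[OF q(1)] le False by (simp add: lens)
  qed
 qed
 then show ?thesis by (simp add: find_one_def)
qed

definition onehot :: "(nat \<times> nat) list => nat => bool" where
 "onehot sus p \<longleftrightarrow> (\<exists>j<length sus. p = cs sus j + snd (sus ! j) div B)"

text \<open>The fields are disjoint, so the only mark inside the field of entry \<open>j\<close> is
  its own; this is what the unary search finds.\<close>

lemma onehot_iff:
 assumes o: "okst sus u" and j: "j < length sus" "q < W (fst (sus ! j))"
 shows "onehot sus (cs sus j + q) \<longleftrightarrow> q = snd (sus ! j) div B"
proof
 assume "onehot sus (cs sus j + q)"
 then obtain k where k: "k < length sus" "cs sus j + q = cs sus k + snd (sus ! k) div B"
  by (auto simp: onehot_def)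
 have "snd (sus ! k) div B < W (fst (sus ! k))"
  using o k(1) by (intro quot_less) (simp add: okst_def less_imp_le)
 from field_unique[OF j k(1) this k(2)] show "q = snd (sus ! j) div B" by simp
qed (insert j, auto simp: onehot_def)

text \<open>\<open>ss\<close> includes the entry at depth \<open>d\<close> that is to be resumed.
  Each round follows the arc of a known entry to the next vertex, finds its quotient by searching
  the unary field and reads its remainder from \<open>aLo\<close>. The cost is proportional to the
  field size, so the sum telescopes to a difference of offsets.\<close>

lemma restore_ok:
 assumes o: "okst ss u" and d: "d < length ss" "rg vD = d" and c: "cst rg"
  and U: "\<And>p. p < 2 * n + 1 ==> ar aU p = (if onehot ss p then 1 else 0)"
  and Lo: "\<And>j. j < length ss ==> ar aLo j = snd (ss ! j) mod B"
  and h: "rg vH = Suc h" "h < 4 * (n div S) + 8" "ar aLD h = k0" "ar aLU h = fst (ss ! k0)"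
   "ar aLI h = snd (ss ! k0)" "ar aLC h = cs ss k0"
  and k0: "k0 < d" "cs ss (Suc d) < cs ss k0 + S"
  and Q: "\<And>rg' ar' t'. eq_off {vT, vJ, vX, vY, vZ, vQ, vLo} rg' rg ==> rg' vLo = Suc k0 ==>
   (\<forall>k. k ~= aE1 --> k ~= aE2 --> ar' k = ar k) ==>
   (\<forall>j. k0 < j --> j <= d --> ar' aE1 (j mod S) = fst (ss ! j) & ar' aE2 (j mod S) = snd (ss ! j)) ==>
   t' <= t + 10 + 20 * (cs ss (Suc d) - cs ss (Suc k0)) ==> Q rg' ar' t' out"
 shows "wp restore Q rg ar t out"
proof -
 define I where "I = (\<lambda>rg' ar' t' out'. \<exists>j. k0 <= j & j <= d & rg' vJ = j & rg' vX = fst (ss ! j) & rg' vY = snd (ss ! j) &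
  rg' vZ = cs ss j & rg' vLo = Suc k0 & eq_off {vT, vJ, vX, vY, vZ, vQ, vLo} rg' rg &
  (\<forall>k. k ~= aE1 --> k ~= aE2 --> ar' k = ar k) &
  (\<forall>i. k0 < i --> i <= j --> ar' aE1 (i mod S) = fst (ss ! i) & ar' aE2 (i mod S) = snd (ss ! i)) &
  t' <= t + 6 + 20 * (cs ss (Suc j) - cs ss (Suc k0)) & out' = out)"
 have dn: "d < n" using okst_length[OF o] d by simp
 have dS: "d < k0 + S"
 proof -
  have "cs ss k0 + (Suc d - k0) <= cs ss (Suc d)" by (rule cs_gap) (use k0 d in auto)
  then show ?thesis using k0 by simp
 qed
 have csle: "cs ss j <= 2 * n" for j using okst_cs[OF o] .
 have g: "rg gS = S" "rg gB = B" using c by (simp_all add: cst_def)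
 have hs: "Suc k0 < 2 ^ w" using dn k0 by (intro small; linarith)
 have body: "wp restore_body I rg' ar' (Suc t') out'" if I: "I rg' ar' t' out'" "rg' vJ < d" for rg' ar' t' out'
 proof -
  from I obtain j where j: "k0 <= j" "j < d" "rg' vJ = j" "rg' vX = fst (ss ! j)" "rg' vY = snd (ss ! j)"
  "rg' vZ = cs ss j" "rg' vLo = Suc k0" "\<And>x. x \<notin> {vT, vJ, vX, vY, vZ, vQ, vLo} ==> rg' x = rg x"
  "\<And>k. k ~= aE1 ==> k ~= aE2 ==> ar' k = ar k"
  "\<And>i. k0 < i ==> i <= j ==> ar' aE1 (i mod S) = fst (ss ! i) & ar' aE2 (i mod S) = snd (ss ! i)"
  "t' <= t + 6 + 20 * (cs ss (Suc j) - cs ss (Suc k0))" "out' = out" unfolding I_def by auto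
  define x where "x = fst (ss ! j)"
  define y where "y = snd (ss ! j)"
  define x' where "x' = fst (ss ! Suc j)"
  define y' where "y' = snd (ss ! Suc j)"
  have jl: "j < length ss" "Suc j < length ss" using j d by auto
  have xn: "x < n" "y < deg x" "adj ! x ! y = x'" "x' < n" "y' < deg x'"
   using o jl by (auto simp: okst_def x_def y_def x'_def y'_def nth_append)
  have csj: "cs ss j + W x = cs ss (Suc j)" using cs_Suc[OF jl(1)] by (simp add: x_def)
  have csj': "cs ss (Suc j) + W x' = cs ss (Suc (Suc j))" using cs_Suc[OF jl(2)] by (simp add: x'_def)
  have Wx: "Suc (deg x div B) = W x" by (simp add: W_def)
  have q: "y' div B < W x'" using xn by (intro quot_less) simp
  have yy: "y' div B * B + y' mod B = y'" by simp
  have dgx: "deg x' <= n" using deg_le xn by simp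
  have qB: "y' div B * B <= y'" by simp
  have le: "cs ss (Suc j) + y' div B <= 2 * n" using csle[of "Suc (Suc j)"] csj' q by linarith
  have smalls: "cs ss (Suc j) < 2 ^ w" "Suc j < 2 ^ w" "W x < 2 ^ w" "y' div B * B < 2 ^ w" "y' < 2 ^ w"
   using csle[of "Suc j"] csj dn j(2) xn dgx qB by (intro small; linarith)+
  have smallLs: "x' < 2 ^ L" "y' < 2 ^ L" using xn dgx by (intro smallL; linarith)+
  have U1: "ar' aU (cs ss (Suc j) + q') = (if q' = y' div B then 1 else 0)" if "q' < W x'" for q'
  proof -
   have "cs ss (Suc j) + q' < 2 * n + 1" using csle[of "Suc (Suc j)"] csj' that by linarith
   then show ?thesis using U onehot_iff[OF o jl(2)] that j(9) by (simp add: x'_def y'_def)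
  qed
  have Lo': "ar' aLo (Suc j) = y' mod B" using Lo[OF jl(2)] j(9) by (simp add: y'_def)
  have fin: "I rg'' ar'' t'' out'" if "rg'' vJ = Suc j" "rg'' vX = x'" "rg'' vY = y'" "rg'' vZ = cs ss (Suc j)"
   "rg'' vLo = Suc k0" "eq_off {vT, vJ, vX, vY, vZ, vQ, vLo} rg'' rg'"
   "ar'' = ar'(aE1 := (ar' aE1)(Suc j mod S := x'), aE2 := (ar' aE2)(Suc j mod S := y'))"
   "t'' <= t' + 12 + 2 * (y' div B)" for rg'' ar'' t''
   unfolding I_def
  proof (intro exI[of _ "Suc j"] conjI)
   show "k0 <= Suc j" "Suc j <= d" using j by auto
   show "eq_off {vT, vJ, vX, vY, vZ, vQ, vLo} rg'' rg" using that(6) j(8) by simp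
   show "\<forall>k. k ~= aE1 --> k ~= aE2 --> ar'' k = ar k" using that(7) j(9) by simp
   show "\<forall>i. k0 < i --> i <= Suc j --> ar'' aE1 (i mod S) = fst (ss ! i) & ar'' aE2 (i mod S) = snd (ss ! i)"
   proof (intro allI impI)
    fix i assume i: "k0 < i" "i <= Suc j"
    show "ar'' aE1 (i mod S) = fst (ss ! i) & ar'' aE2 (i mod S) = snd (ss ! i)"
    proof (cases "i = Suc j")
     case True
     then show ?thesis using that(7) by (simp add: x'_def y'_def)
    next
     case False
     then have "i mod S ~= Suc j mod S" using mod_inj[of i "Suc j"] i dS j by auto
     then show ?thesis using that(7) j(10)[of i] i False by simp
    qed
   qed
   have m: "cs ss (Suc k0) <= cs ss (Suc j)" by (rule cs_mono) (use j in simp)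
   \<comment> \<open>The fixed cost of a round is charged to the field, which has at least one
     bit.\<close>
   have "12 + 2 * (y' div B) <= 20 * W x'" using q W_pos(2)[of x'] by linarith
   then have "t'' <= t' + 20 * W x'" using that(8) by linarith
   also have "\<dots> <= t + 6 + 20 * (cs ss (Suc (Suc j)) - cs ss (Suc k0))" using j(11) csj' m by linarith
   finally show "t'' <= t + 6 + 20 * (cs ss (Suc (Suc j)) - cs ss (Suc k0))" .
  qed (insert that j, auto simp: x'_def y'_def)
  have g': "rg' gS = S" "rg' gB = B" using g j(8) by auto
  have sjn: "Suc j < n" using j dn by simp
  have "Suc j mod S < S" using S_pos by simp
  show ?thesis unfolding wE_def restore_body_def
   apply (simp add: j(3-7) x_def[symmetric] y_def[symmetric] xn g' Wx csj smalls)
   apply (rule find_one_ok[where ?q0.0 = "y' div B"])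
    apply (simp add: le)
    apply (use U1[of "y' div B"] q in simp)
   apply (use U1 q in simp)
   apply (simp add: g' lens wds smalls smallLs Lo' yy sjn S_pos)
   apply (rule fin)
      apply (simp_all add: j)
   done
 qed
 have B: "t' <= t + 6 + 20 * cs ss (Suc d)" if "I rg' ar' t' out'" for rg' ar' t' out'
 proof -
  from that obtain j where j: "j <= d" "t' <= t + 6 + 20 * (cs ss (Suc j) - cs ss (Suc k0))"
   unfolding I_def by auto
  have "cs ss (Suc j) <= cs ss (Suc d)" by (rule cs_mono) (use j in simp)
  then show ?thesis using j by linarith
 qed
 have fin: "Q rg' ar' (Suc t') out'" if I: "I rg' ar' t' out'" "\<not> rg' vJ < rg' vD" for rg' ar' t' out'
 proof -
  from I(1) have out: "out' = out" and vd: "rg' vD = d" using d unfolding I_def by auto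
  from I vd have *: "I rg' ar' t' out' & rg' vJ = d" unfolding I_def by auto
  show ?thesis unfolding out
   by (rule Q) (insert *, auto simp: I_def)
 qed
 show ?thesis unfolding restore_def
  apply (simp add: h lens hs)
  apply (rule wp_loop[where I = I and B = "t + 6 + 20 * cs ss (Suc d)"])
    apply (unfold I_def, rule exI[of _ k0], use k0 in simp)[1]
   apply (erule B)
   apply simp
  apply (rule body, assumption)
  apply (use d in \<open>fastforce simp: I_def\<close>)
  apply (rule fin, assumption, simp)
  done
qed

text \<open>The potential that pays for restores, cut off at 0: the number of bits by which the
  buffered fields, together with a current field of \<open>x\<close> bits, fall short of
  \<open>S\<close>. It is large when the buffer has run empty, and a restore uses it up in
  proportion to the bits read. Finishing a vertex raises it by at most the size of its field, hence
  O(n) in total.\<close>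

definition PH :: "(nat \<times> nat) list => nat => nat => nat" where
 "PH sus x lo = S - (cs sus (length sus) + x - cs sus lo)"

lemma onehot_snoc:
 assumes "okst (sus @ [(p, j)]) u"
 shows "onehot sus x \<longleftrightarrow> onehot (sus @ [(p, j)]) x & x ~= cs sus (length sus) + j div B"
proof -
 have ex: "(\<exists>j<Suc m. P j) \<longleftrightarrow> P m | (\<exists>j<m. P j)" for m :: nat and P
  by (auto simp: less_Suc_eq)
 have 1: "onehot (sus @ [(p, j)]) x \<longleftrightarrow> x = cs sus (length sus) + j div B | onehot sus x"
  unfolding onehot_def length_append_singleton ex
  by (simp add: cs_append nth_append cong: conj_cong)
 have "x < cs sus (length sus)" if x: "onehot sus x"
 proof -
  obtain k where k: "k < length sus" "x = cs sus k + snd (sus ! k) div B" using x by (auto simp: onehot_def)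
  have "snd ((sus @ [(p, j)]) ! k) < deg (fst ((sus @ [(p, j)]) ! k))"
   using assms k(1) unfolding okst_def by auto
  then have "snd (sus ! k) < deg (fst (sus ! k))" using k(1) by (simp add: nth_append)
  then have "snd (sus ! k) div B < W (fst (sus ! k))" by (intro quot_less) simp
  then have "x < cs sus (Suc k)" using cs_Suc[OF k(1)] k(2) by simp
  also have "\<dots> <= cs sus (length sus)" by (rule cs_mono) (use k in simp)
  finally show ?thesis .
 qed
 then show ?thesis using 1 by auto
qed

text \<open>The time bound is amortised: a drop of the potential pays for a restore, and the term
  \<open>20 * W u\<close> compensates for the field bits that the finished vertex \<open>u\<close>
  takes away.\<close>

lemma resume_ok:
 assumes d: "drel (sus @ [(p, j)]) ks rg ar" and o: "okst (sus @ [(p, j)]) u" and c: "cst rg"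
  and Q: "\<And>rg' ar' t' ks'. drel sus ks' rg' ar' ==> rg' vU = p ==> rg' vI = j ==>
   eq_off {vU, vI, vC, vD, vH, vLo, vT, vJ, vX, vY, vZ, vQ} rg' rg ==>
   (\<forall>k. k < 2 | 10 <= k --> ar' k = ar k) ==>
   t' + 20 * PH sus (W p) (rg' vLo) <= t + 40 + 20 * PH (sus @ [(p, j)]) (W u) (rg vLo) + 20 * W u ==>
   Q rg' ar' t' out"
 shows "wp resume Q rg ar t out"
proof -
 define ss where "ss = sus @ [(p, j)]"
 define dd where "dd = length sus"
 define lo where "lo = rg vLo"
 define h where "h = length ks - 1"
 have kv: "kinv ss ks" using d by (simp add: drel_def ss_def)
 then have ne: "ks ~= []" by (auto simp: kinv_def ss_def)
 have lks: "length ks = Suc h" "ks ! h = last ks" using ne by (simp_all add: h_def last_conv_nth)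
 have lastle: "last ks <= dd" using kv last_in_set[OF ne] by (auto simp: kinv_def ss_def dd_def less_Suc_eq_le simp del: last_in_set)
 have pn: "p < n" "j < deg p" using o by (auto simp: okst_def nth_append dest!: spec[of _ "length sus"])
 have csd: "cs ss dd = cs sus dd" "cs ss (Suc dd) = cs sus dd + W p" by (simp_all add: ss_def dd_def cs_append)
 have csss: "cs ss i = cs sus i" if "i <= dd" for i using that by (simp add: ss_def dd_def cs_append)
 have csle: "cs ss i <= 2 * n" for i using okst_cs[OF o] by (simp add: ss_def)
 have sunth: "ss ! i = sus ! i" if "i < dd" for i using that by (simp add: ss_def dd_def nth_append)
 have r: "rg vD = Suc dd" "rg vC = cs sus dd + W p" "rg vH = Suc h" "rg vLo = lo" "lo <= Suc dd" "dd < lo + S"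
  using d lks csd by (simp_all add: drel_def ss_def dd_def lo_def)
 have g: "rg gS = S" "rg gB = B" using c by (simp_all add: cst_def)
 have kb: "Suc h <= 4 * (n div S) + 4" using kinv_bound[OF kv csle] lks by simp
 have LM: "ar aLD a = ks ! a" "ar aLU a = fst (ss ! (ks ! a))" "ar aLI a = snd (ss ! (ks ! a))"
  "ar aLC a = cs ss (ks ! a)" if "a < length ks" for a
  using d that by (simp_all add: drel_def ss_def)
 have LMh: "ar aLD h = last ks" "ar aLU h = fst (ss ! last ks)" "ar aLI h = snd (ss ! last ks)"
  "ar aLC h = cs ss (last ks)" using LM[of h] lks by simp_all
 have hl: "h < 4 * (n div S) + 8" using kb by simp
 have U: "ar aU x = (if onehot ss x then 1 else 0)" if "x < 2 * n + 1" for x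
  using d that unfolding drel_def onehot_def ss_def by blast
 have Lo: "ar aLo i = snd (ss ! i) mod B" if "i < length ss" for i
  using d that by (simp add: drel_def ss_def)
 have E: "ar aE1 (i mod S) = fst (ss ! i) & ar aE2 (i mod S) = snd (ss ! i)" if "lo <= i" "i < length ss" for i
  using d that by (simp add: drel_def ss_def lo_def)
 have ltss: "dd < length ss" "length ss = Suc dd" by (simp_all add: ss_def dd_def)
 have ssd: "ss ! dd = (p, j)" by (simp add: ss_def dd_def)
 have qW: "j div B < W p" using pn by (intro quot_less) simp
 have le: "cs sus dd + j div B <= 2 * n" using csle[of "Suc dd"] csd qW by linarith
 then have le': "cs sus dd + j div B < Suc (2 * n)" by simp
 have smalls: "Suc dd < 2 ^ w" "cs sus dd + j div B < 2 ^ w" "W p < 2 ^ w"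
  using le okst_length[OF o] csle[of "Suc dd"] csd by (intro small; simp add: dd_def)+
 have Wp: "Suc (deg p div B) = W p" by (simp add: W_def)
 have fin: "Q rg' ar'' t' out"
  if k': "kinv sus ks'" "length ks' <= length ks" "\<And>a. a < length ks' ==> ks' ! a = ks ! a"
   and rg': "rg' vU = p" "rg' vI = j" "rg' vD = dd" "rg' vC = cs sus dd" "rg' vH = length ks'" "rg' vLo <= dd" "dd <= rg' vLo + S"
    "eq_off {vU, vI, vC, vD, vH, vLo, vT, vJ, vX, vY, vZ, vQ} rg' rg"
   and ar': "\<And>k. k ~= aE1 ==> k ~= aE2 ==> ar' k = ar k"
    "\<And>i. rg' vLo <= i ==> i < dd ==> ar' aE1 (i mod S) = fst (ss ! i) & ar' aE2 (i mod S) = snd (ss ! i)"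
   and ar'': "ar'' = ar'(aU := (ar' aU)(cs sus dd + j div B := 0))"
   and t: "t' + 20 * PH sus (W p) (rg' vLo) <= t + 40 + 20 * PH ss (W u) lo + 20 * W u"
  for ks' rg' ar' ar'' t'
 proof (rule Q[of ks'])
  have ltk: "ks' ! a < dd" if "a < length ks'" for a using k'(1) that by (simp add: kinv_def dd_def)
  show "drel sus ks' rg' ar''" unfolding drel_def
  proof (intro conjI allI impI)
   fix x assume x: "x < 2 * n + 1"
   show "ar'' aU x = (if \<exists>j<length sus. x = cs sus j + snd (sus ! j) div B then 1 else 0)"
    using U[OF x] onehot_snoc[OF o, of x] ar'(1)[of aU] ar''
    by (auto simp: onehot_def[symmetric] ss_def dd_def)
  next
   fix i assume "i < length sus"
   then show "ar'' aLo i = snd (sus ! i) mod B" using Lo[of i] ar'(1)[of aLo] ar'' ltss sunth[of i] by (simp add: dd_def)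
  next
   fix i assume "rg' vLo <= i" "i < length sus"
   then show "ar'' aE1 (i mod S) = fst (sus ! i)" "ar'' aE2 (i mod S) = snd (sus ! i)"
    using ar'(2)[of i] ar'' sunth[of i] by (simp_all add: dd_def)
  next
   fix a assume a: "a < length ks'"
   have "a < length ks" using a k'(2) by simp
   from LM[OF this] ltk[OF a] k'(3)[OF a] show "ar'' aLD a = ks' ! a" "ar'' aLU a = fst (sus ! (ks' ! a))"
    "ar'' aLI a = snd (sus ! (ks' ! a))" "ar'' aLC a = cs sus (ks' ! a)"
    by (simp_all add: ar'' ar'(1) sunth csss)
  qed (insert rg' k', simp_all add: dd_def)
  show "\<forall>k. k < 2 | 10 <= k --> ar'' k = ar k" using ar'(1) ar'' by auto
 qed (insert rg' t, simp_all add: ss_def lo_def)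
 have PHss: "PH ss x l = S - (cs sus dd + W p + x - cs ss l)" for x l
  using csd by (simp add: PH_def ltss)
 have PHs: "PH sus x l = S - (cs sus dd + x - cs sus l)" for x l
  by (simp add: PH_def dd_def)
 show ?thesis
 proof (cases "last ks = dd")
  case True
  define ks' where "ks' = butlast ks"
  have kk: "ks = ks' @ [dd]" using ne True unfolding ks'_def by (metis append_butlast_last_id)
  have k': "kinv sus ks'" using kinv_pop_mark kv kk by (metis ss_def dd_def)
  have lk': "length ks' = h" using lks kk by simp
  \<comment> \<open>The landmark may lie below the buffered range; that range is then empty and its
    lower end is clipped to the new depth.\<close>
  have time: "20 * PH sus (W p) (min lo dd) <= 20 * PH ss (W u) lo + 20 * W u"
  proof (cases "lo <= dd")
   case True
   then show ?thesis using csss[OF True] by (simp add: PHs PHss min_absorb1)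
  next
   case False
   then have "lo = Suc dd" using r by simp
   then show ?thesis using csd by (simp add: PHs PHss)
  qed
  show ?thesis unfolding resume_def
   apply (simp add: r g lens hl LMh True ssd csd smalls le')
   apply (intro conjI impI; rule fin[OF k', where ar' = ar])
   using kk lk' r E ltss time le apply (auto simp: nth_append csd min_def split: if_splits)
   done
 next
  case False
  then have ltl: "last ks < dd" using lastle by simp
  have k': "kinv sus ks" using kinv_pop_plain kv False by (metis ss_def dd_def)
  have seg: "cs sus dd + W p < cs sus (last ks) + S"
   using kinv_last_seg[of sus "(p, j)" ks] kv ltl by (simp add: ss_def dd_def)
  show ?thesis
  proof (cases "lo <= dd")
   case True
   show ?thesis unfolding resume_def wE_def
    apply (simp add: r g lens hl LMh False ssd csd smalls True leD[OF True] E ltss pn Wp S_pos le')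
    apply (rule fin[OF k', where ar' = ar])
    using True r E ltss le lks csss[OF True] apply (auto simp: PHs PHss)
    done
  next
   case lo: False
   then have lo: "lo = Suc dd" using r by simp
   \<comment> \<open>With nothing buffered the potential is full except for the field of
     \<open>u\<close>; this covers the fewer than \<open>S\<close> bits that the restore
     reads.\<close>
   have PHu: "S <= PH ss (W u) lo + W u" using lo csd by (simp add: PHss)
   have Sl: "dd < Suc (last ks) + S"
   proof -
    have "cs sus (last ks) + (dd - last ks) <= cs sus dd" by (rule cs_gap) (insert ltl, simp_all add: dd_def)
    then show ?thesis using seg ltl by simp
   qed
   have tt: "20 * (cs ss (Suc dd) - cs ss (Suc (last ks))) + 20 * PH sus (W p) (Suc (last ks)) <= 20 * PH ss (W u) lo + 20 * W u"
   proof -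
    have "cs ss (Suc (last ks)) = cs sus (Suc (last ks))" using csss ltl by simp
    moreover have "cs sus (last ks) <= cs sus (Suc (last ks))" by (rule cs_mono) simp
    moreover have "cs sus (Suc (last ks)) <= cs sus dd" by (rule cs_mono) (use ltl in simp)
    ultimately show ?thesis using PHu seg csd by (simp add: PHs)
   qed
   have seg': "cs ss (Suc dd) < cs ss (last ks) + S" using seg csd csss ltl by simp
   show ?thesis unfolding resume_def wE_def
    apply (simp add: r g lens hl LMh False smalls lo)
    apply (rule restore_ok[OF o[folded ss_def], where d = dd and h = h and ?k0.0 = "last ks"])
          apply (simp_all add: ltss U Lo r hl LMh ltl seg' c[unfolded cst_def] cst_def g)
    subgoal for rg' ar' t'
     apply (simp add: r g lens ssd csd smalls ltss pn Wp S_pos ltl le')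
     apply (rule fin[OF k', where ar' = ar'])
     using r ltss le lks ltl Sl tt apply (auto simp: csd)
     done
    done
  qed
 qed
qed

end

section \<open>The traversal program\<close>

text \<open>\<open>pd\<close> and \<open>pf\<close> are run at each discovery and finish, so that
  one traversal serves several purposes. The parent is handed over in \<open>vP\<close>; a root is
  recognised by \<open>vP = vU\<close>.\<close>

definition inner_body :: "prg => prg => prg" where
 "inner_body pd pf =
  Cond (Lt (Rg vI) (Dg (Rg vU)))
   (vX ::= Nb (Rg vU) (Rg vI) ;;
    Cond (Eqv (Arr aD (Rg vX)) (Lit 0))
     (suspend ;; Put aD (Rg vX) (Lit 1) ;; vP ::= Rg vU ;; vU ::= Rg vX ;; vI ::= Lit 0 ;; pd)
     (vI ::= Rg vI +. Lit 1))
   (pf ;;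
    Cond (Eqv (Rg vD) (Lit 0)) (vA ::= Lit 0) (resume ;; vI ::= Rg vI +. Lit 1))"

definition inner :: "prg => prg => prg" where
 "inner pd pf = Loop (Neqv (Rg vA) (Lit 0)) (inner_body pd pf)"

definition outer_body :: "prg => prg => prg" where
 "outer_body pd pf =
  Cond (Eqv (Rg vK) (Lit 0)) (vT ::= ST) (vT ::= Rg vK -. Lit 1) ;;
  vK ::= Rg vK +. Lit 1 ;;
  Cond (Eqv (Arr aD (Rg vT)) (Lit 0))
   (Put aD (Rg vT) (Lit 1) ;; vU ::= Rg vT ;; vP ::= Rg vT ;; vI ::= Lit 0 ;; vC ::= Lit 0 ;;
    vD ::= Lit 0 ;; vH ::= Lit 0 ;; vLo ::= Lit 0 ;; vA ::= Lit 1 ;; pd ;; inner pd pf) Nop"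

definition dfs_prog :: "prg => prg => prg" where
 "dfs_prog pd pf = vK ::= Lit 0 ;; vA ::= Lit 0 ;; Loop (Lt (Rg vK) (Rg gN +. Lit 1)) (outer_body pd pf)"

section \<open>Amortised analysis of the traversal\<close>

context dfs_mem
begin

lemma okst_dinv: "dinv ((u, i) # st, k, es) ==> okst (rev st) u"
proof -
 assume d: "dinv ((u, i) # st, k, es)"
 let ?stk = "(u, i) # st"
 have nx: "adj ! fst (?stk ! Suc j) ! snd (?stk ! Suc j) = fst (?stk ! j)" if "Suc j < length ?stk" for j
  using d that by (simp only: dinv.simps)
 have ls: "\<forall>(u, i) \<in> set st. i < deg u" using d by simp
 have sub: "set (map fst ?stk) \<subseteq> {..<n}" using d by (simp only: dinv.simps) blast
 have di: "distinct (map fst ?stk)" using d by (simp only: dinv.simps)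
 show ?thesis unfolding okst_def
 proof (intro conjI allI impI)
  show "distinct (map fst (rev st) @ [u])" using di by (simp add: rev_map[symmetric])
  show "u < n" using sub by simp
  fix j assume j: "j < length (rev st)"
  define m where "m = length st - Suc j"
  have m: "m < length st" "rev st ! j = st ! m" "Suc j = length st - m" using j by (auto simp: m_def rev_nth)
  have mem: "st ! m \<in> set st" using m by simp
  then have "fst (st ! m) \<in> set (map fst ?stk)" by simp
  then show "fst (rev st ! j) < n" using sub m(2) by auto
  show "snd (rev st ! j) < deg (fst (rev st ! j))" using ls mem m by fastforce
  have "adj ! fst (st ! m) ! snd (st ! m) = fst (?stk ! m)" using nx[of m] m by simp
  also have "fst (?stk ! m) = map fst ?stk ! m" using m by (simp only: nth_map length_Cons less_SucI)
  also have "\<dots> = rev (map fst ?stk) ! Suc j"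
   using j rev_nth[of "Suc j" "map fst ?stk"] by (simp only: m_def length_map length_rev length_Cons Suc_less_eq diff_Suc_Suc)
  also have "\<dots> = (map fst (rev st) @ [u]) ! Suc j" by (simp add: rev_map)
  finally show "adj ! fst (rev st ! j) ! snd (rev st ! j) = (map fst (rev st) @ [u]) ! Suc j" using m by simp
 qed
qed

text \<open>With an empty stack the registers of the compressed stack are unconstrained, as they are
  reset before the next root; only \<open>aU\<close> must be zero.\<close>

fun srel :: "dstate => (nat => nat) => arrays => bool" where
 "srel (stk, k, es) rg ar \<longleftrightarrow> cst rg & (\<forall>v<n. ar aD v = (if v \<in> disc es then 1 else 0)) & rg vK = k &
  (case stk of [] => rg vA = 0 & (\<forall>p < 2 * n + 1. ar aU p = 0)
   | (u, i) # st => rg vA ~= 0 & rg vU = u & rg vI = i & (\<exists>ks. drel (rev st) ks rg ar))"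

fun phi :: "dstate => (nat => nat) => nat" where
 "phi ([], k, es) rg = S"
| "phi ((u, i) # st, k, es) rg = PH (rev st) (W u) (rg vLo)"

text \<open>The field bits of the finished vertices, since a discovered vertex is either finished or
  on the stack. The subtraction is safe by \<open>stk_weight\<close>.\<close>

fun fw :: "dstate => nat" where
 "fw (stk, k, es) = (\<Sum>v \<in> disc es. W v) - sum_list (map (W \<circ> fst) stk)"

text \<open>The work left. An undiscovered vertex counts \<open>deg v + 3\<close>, more than the
  \<open>deg v + 1\<close> that it contributes once pushed, so that discoveries lower the sum like
  all other steps.\<close>

fun rem :: "dstate => nat" where
 "rem (stk, k, es) = (\<Sum>v \<in> {..<n} - disc es. deg v + 3) + sum_list (map (\<lambda>(u, i). deg u - i + 1) stk) + (n + 1 - k)"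

lemma fin_disc: "dinv (stk, k, es) ==> finite (disc es)"
 by (auto simp: disc_def)

lemma stk_weight: "dinv (stk, k, es) ==> sum_list (map (W \<circ> fst) stk) <= (\<Sum>v \<in> disc es. W v)"
proof -
 assume d: "dinv (stk, k, es)"
 have "sum_list (map W (map fst stk)) = sum W (set (map fst stk))"
  by (rule sum_list_distinct_conv_sum_set) (use d in simp)
 also have "\<dots> <= (\<Sum>v \<in> disc es. W v)"
  by (rule sum_mono2) (use d fin_disc[OF d] in auto)
 finally show ?thesis by simp
qed

lemma fw_le: "dinv s ==> fw s <= 2 * n"
proof -
 assume d: "dinv s"
 obtain stk k es where s: "s = (stk, k, es)" by (cases s)
 have "(\<Sum>v \<in> disc es. W v) <= sum W {..<n}" by (rule sum_mono2) (use d s in auto)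
 then show ?thesis using wsum s by (simp add: W_def)
qed

lemma fw_discover:
 assumes d: "dinv (stk, k, es)" and v: "v \<notin> disc es"
 shows "fw ((v, 0) # stk, k', es @ [Discover v]) = fw (stk, k, es)"
 using fin_disc[OF d] v by simp

lemma fw_finish:
 assumes d: "dinv ((u, i) # st, k, es)" and e: "map fst st' = map fst st"
 shows "fw (st', k', es @ [Finish u]) = fw ((u, i) # st, k, es) + W u"
proof -
 have "sum_list (map (W \<circ> fst) st') = sum_list (map W (map fst st'))" by simp
 also have "\<dots> = sum_list (map (W \<circ> fst) st)" unfolding e by simp
 finally show ?thesis using stk_weight[OF d] by simp
qed

lemma rem_discover:
 assumes d: "dinv (stk, k, es)" and v: "v \<notin> disc es" "v < n"
 shows "rem ((v, 0) # stk, k', es @ [Discover v]) + 2 + (n + 1 - k) = rem (stk, k, es) + (n + 1 - k')"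
proof -
 have "(\<Sum>x \<in> {..<n} - disc es. deg x + 3) = (deg v + 3) + (\<Sum>x \<in> {..<n} - disc es - {v}. deg x + 3)"
  by (rule sum.remove) (use v in auto)
 moreover have "{..<n} - disc es - {v} = {..<n} - insert v (disc es)" by auto
 ultimately show ?thesis by simp
qed

lemma rem_scan: "i < deg u ==> rem ((u, Suc i) # st, k, es) + 1 = rem ((u, i) # st, k, es)"
 by simp

lemma rem_last: "rem ([], k, es @ [Finish u]) + 1 <= rem ([(u, i)], k, es)"
 by simp

lemma rem_pop: "j < deg p ==> rem ((p, Suc j) # st, k, es @ [Finish u]) + 1 <= rem ((u, i) # (p, j) # st, k, es)"
 by simp

lemma fw_scan: "fw ((u, Suc i) # st, k, es) = fw ((u, i) # st, k, es)"
 by simp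

declare rem.simps [simp del] fw.simps [simp del]

text \<open>The initial \<open>60 * rem\<close>, the potential \<open>20 * S\<close> and 20 for each
  of the at most \<open>2 * n\<close> field bits, with some slack.\<close>

definition DFSB :: nat where
 "DFSB = (\<Sum>v<n. deg v) * 60 + 361 * n + 20 * S + 100"

end

text \<open>\<open>\<tau>\<close> is the time credit accumulated by the hooks: a call may take as
  long as it raises the credit. The invariant determines the admissible credit, so that hooks can
  themselves be analysed in an amortised way.\<close>

abbreviation (input) hook_post :: "(nat event list => nat => (nat => nat) => arrays => nat list => bool) => nat event list =>
  nat => (nat => nat) => arrays => nat => (nat => nat) => arrays => nat => nat list => bool" where
 "hook_post HI es \<tau> rg ar t \<equiv> \<lambda>rg' ar' t' out'. (\<forall>x. x < 20 | 70 <= x --> rg' x = rg x) & (\<forall>k<10. ar' k = ar k) &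
  (\<exists>\<tau>'. HI es \<tau>' rg' ar' out' & t' + \<tau> <= t + \<tau>')"

text \<open>\<open>HI\<close> must not depend on registers below 20 or arrays below 10, which the
  traversal changes between calls. It speaks of the past events, hence of any data gathered along
  the run; \<open>TB\<close> bounds the total credit.\<close>

locale dfs_hooks = dfs_mem +
 fixes pd pf :: prg and HI :: "nat event list => nat => (nat => nat) => arrays => nat list => bool" and TB :: nat
 assumes HI_frame: "\<And>es \<tau> rg ar out rg' ar'. HI es \<tau> rg ar out ==> (\<forall>x\<ge>20. rg' x = rg x) ==>
   (\<forall>k\<ge>10. ar' k = ar k) ==> HI es \<tau> rg' ar' out"
  and HI_bound: "\<And>es \<tau> rg ar out. HI es \<tau> rg ar out ==> \<tau> <= TB"
  and disc_ok: "\<And>u stk k es \<tau> rg ar t out. reach ((u, 0) # stk, k, es @ [Discover u]) ==> u \<notin> disc es ==>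
   HI es \<tau> rg ar out ==> rg vU = u ==> rg vP = (case stk of [] => u | (p, j) # st => p) ==>
   (\<forall>v<n. ar aD v = (if v \<in> disc (es @ [Discover u]) then 1 else 0)) ==>
   wp pd (hook_post HI (es @ [Discover u]) \<tau> rg ar t) rg ar t out"
  and fin_ok: "\<And>u i stk k es \<tau> rg ar t out. reach ((u, i) # stk, k, es) ==> \<not> i < deg u ==>
   HI es \<tau> rg ar out ==> rg vU = u ==>
   wp pf (hook_post HI (es @ [Finish u]) \<tau> rg ar t) rg ar t out"
begin

text \<open>Steps are paid from \<open>rem\<close>, restores from \<open>phi\<close>, and finished
  fields supply 20 per bit. As \<open>rem\<close> and \<open>phi\<close> are naturals, the
  inequality bounds the clock, which also yields termination of the loops.\<close>

definition J :: "nat => (nat => nat) => dstate => (nat => nat) => arrays => nat => nat list => bool" where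
 "J T0 rg0 s rg ar t out \<longleftrightarrow> reach s & srel s rg ar & (\<forall>x\<ge>70. rg x = rg0 x) &
  (\<exists>\<tau>. HI (snd (snd s)) \<tau> rg ar out & t + 60 * rem s + 20 * phi s rg <= T0 + \<tau> + 20 * fw s)"

lemma J_bound: "J T0 rg0 s rg ar t out ==> t <= T0 + TB + 40 * n"
proof -
 assume j: "J T0 rg0 s rg ar t out"
 then have "fw s <= 2 * n" using fw_le reach_dinv by (simp add: J_def)
 moreover obtain \<tau> where "HI (snd (snd s)) \<tau> rg ar out" "t + 60 * rem s + 20 * phi s rg <= T0 + \<tau> + 20 * fw s"
  using j by (auto simp: J_def)
 ultimately show ?thesis using HI_bound by fastforce
qed

lemma drel_cong: "drel sus ks rg ar ==> (\<forall>x \<in> {vD, vC, vH, vLo}. rg' x = rg x) ==> (\<forall>k. 2 <= k & k < 10 --> ar' k = ar k) ==>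
  drel sus ks rg' ar'"
 by (simp add: drel_def)

lemma discover_J:
 assumes s: "reach ((u, 0) # stk, k, es @ [Discover u])" "u \<notin> disc es" and HI: "HI es \<tau> rg ar out"
  and r: "rg vU = u" "rg vI = 0" "rg vA ~= 0" "rg vK = k" "rg vP = (case stk of [] => u | (p, j) # st => p)" "cst rg"
   "\<forall>x\<ge>70. rg x = rg0 x"
  and D: "\<forall>v<n. ar aD v = (if v \<in> disc (es @ [Discover u]) then 1 else 0)"
  and d: "drel (rev stk) ks rg ar"
  and t: "t + 60 * rem ((u, 0) # stk, k, es @ [Discover u]) + 20 * PH (rev stk) (W u) (rg vLo)
   <= T0 + \<tau> + 20 * fw ((u, 0) # stk, k, es @ [Discover u])"
 shows "wp pd (J T0 rg0 ((u, 0) # stk, k, es @ [Discover u])) rg ar t out"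
proof (rule wp_mono[OF disc_ok[OF s HI r(1,5) D]], elim conjE exE)
 fix rg' ar' t' out' \<tau>'
 assume f: "\<forall>x. x < 20 | 70 <= x --> rg' x = rg x" "\<forall>k<10. ar' k = ar k"
  and h: "HI (es @ [Discover u]) \<tau>' rg' ar' out'" "t' + \<tau> <= t + \<tau>'"
 have d': "drel (rev stk) ks rg' ar'" by (rule drel_cong[OF d]) (use f in auto)
 have c': "cst rg'" using r(6) f by (simp add: cst_def)
 have D': "\<forall>v<n. ar' aD v = (if v \<in> disc (es @ [Discover u]) then 1 else 0)" using D f by simp
 have t': "t' + 60 * rem ((u, 0) # stk, k, es @ [Discover u]) + 20 * PH (rev stk) (W u) (rg' vLo)
   <= T0 + \<tau>' + 20 * fw ((u, 0) # stk, k, es @ [Discover u])" using t h(2) f(1) by simp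
 show "J T0 rg0 ((u, 0) # stk, k, es @ [Discover u]) rg' ar' t' out'"
  unfolding J_def using s(1) r f d' c' D' h(1) t'
  by (auto)
qed

text \<open>Usually the field of \<open>u\<close> only moves from the current to the buffered ones.
  If the buffer drops its lowest entry, at least \<open>S\<close> entries remain, hence
  \<open>S\<close> bits, and the potential is 0.\<close>

lemma PH_suspend:
 assumes lo: "lo <= length sus" "lo' = (if lo + S < length sus + 1 then lo + 1 else lo)"
 shows "PH (sus @ [(u, i)]) x lo' <= PH sus (W u) lo"
proof (cases "lo + S < length sus + 1")
 case False
 then show ?thesis using lo by (simp add: PH_def cs_append)
next
 case True
 have "cs (sus @ [(u, i)]) lo' + (length (sus @ [(u, i)]) - lo') <= cs (sus @ [(u, i)]) (length (sus @ [(u, i)]))"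
  by (rule cs_gap) (use True lo S_pos in auto)
 then show ?thesis using True lo by (simp add: PH_def)
qed

lemma inner_step:
 assumes J: "J T0 rg0 s rg ar t out" and ne: "fst s ~= []"
 shows "wp (inner_body pd pf) (J T0 rg0 (step s)) rg ar (Suc t) out"
proof -
 obtain u i st k es where s: "s = ((u, i) # st, k, es)" using ne by (cases s) (auto simp: neq_Nil_conv)
 have rs: "reach s" using J by (simp add: J_def)
 have rs': "reach (step s)" using reach_step rs .
 have di: "dinv ((u, i) # st, k, es)" using reach_dinv[OF rs] s by simp
 have o: "okst (rev st) u" using okst_dinv[OF di] .
 then have un: "u < n" by (simp add: okst_def)
 obtain ks where r: "cst rg" "rg vK = k" "rg vA ~= 0" "rg vU = u" "rg vI = i" and d: "drel (rev st) ks rg ar"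
  and D: "\<And>v. v < n ==> ar aD v = (if v \<in> disc es then 1 else 0)" and x0: "\<And>x. 70 <= x ==> rg x = rg0 x"
  using J by (auto simp: J_def s)
 obtain \<tau> where HI: "HI es \<tau> rg ar out"
  and t: "t + 60 * rem ((u, i) # st, k, es) + 20 * PH (rev st) (W u) (rg vLo) <= T0 + \<tau> + 20 * fw ((u, i) # st, k, es)"
  using J by (auto simp: J_def s)
 have dg: "deg u <= n" using deg_le[OF un] .
 have lens': "len 0 = n" "wd 0 = Suc 0" using lens wds by simp_all
 have lo: "rg vLo <= length (rev st)" using d by (simp only: drel_def)
 have vd: "rg vD = length st" using d by (simp add: drel_def)
 show ?thesis
 proof (cases "i < deg u")
  case True
  define x where "x = adj ! u ! i"
  have xn: "x < n" using nb_less[OF un] True by (simp add: x_def)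
  have sm: "Suc i < 2 ^ w" using True dg by (intro small) simp
  show ?thesis
  proof (cases "x \<in> disc es")
   case x: True
   have st: "step s = ((u, i + 1) # st, k, es)" using True x by (simp add: s x_def)
   have "J T0 rg0 ((u, i + 1) # st, k, es) (rg(vX := x, vI := Suc i)) ar (Suc (Suc (Suc (Suc (Suc t))))) out"
    unfolding J_def
   proof (intro conjI exI[of _ \<tau>])
    show "reach ((u, i + 1) # st, k, es)" using rs' st by simp
    show "srel ((u, i + 1) # st, k, es) (rg(vX := x, vI := Suc i)) ar"
     using r D drel_cong[OF d, of "rg(vX := x, vI := Suc i)" ar] by (auto simp: cst_def)
    show "HI (snd (snd ((u, i + 1) # st, k, es))) \<tau> (rg(vX := x, vI := Suc i)) ar out"
     using HI_frame[OF HI] by simp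
   qed (use x0 t rem_scan[OF True, of st k es] fw_scan[of u i st k es] in auto)
   then show ?thesis unfolding inner_body_def st
    using True x by (simp add: r un xn x_def[symmetric] D lens' sm)
  next
   case x: False
   have st: "step s = ((x, 0) # (u, i) # st, k, es @ [Discover x])" using True x by (simp add: s x_def)
   have rem: "rem ((x, 0) # (u, i) # st, k, es @ [Discover x]) + 2 = rem ((u, i) # st, k, es)"
    using rem_discover[OF di x xn, of k] by simp
   have fw: "fw ((x, 0) # (u, i) # st, k, es @ [Discover x]) = fw ((u, i) # st, k, es)"
    using fw_discover[OF di x] .
   show ?thesis unfolding inner_body_def st
    using True x apply (simp add: r un xn x_def[symmetric] D lens')
    apply (rule suspend_ok[where sus = "rev st" and ks = ks and u = u and i = i])
       apply (rule drel_cong[OF d]; simp)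
      apply (rule o)
      apply (simp_all add: r)
    apply (use r(1) in \<open>simp add: cst_def\<close>)
    subgoal for rg' ar' t' ks'
     apply (simp add: xn lens')
     apply (rule discover_J[where ks = ks' and \<tau> = \<tau>])
           apply (use rs' st in simp)
           apply (rule x)
          apply (rule HI_frame[OF HI]; simp)
     using r D x0 apply (simp_all add: cst_def)
     apply (erule drel_cong; simp)
     unfolding fw using rem t PH_suspend[OF lo refl, where u = u and i = i and x = "W x"]
     apply (cases "rg 5 + S < Suc (length st)"; simp)
     done
    done
  qed
 next
  case False
  have fwf: "fw (st', k, es @ [Finish u]) = fw ((u, i) # st, k, es) + W u" if "map fst st' = map fst st" for st'
   using fw_finish[OF di that] .
  show ?thesis unfolding inner_body_def
   using False apply (simp add: r un)
   apply (rule wp_mono[OF fin_ok[where u = u and i = i and stk = st and k = k and es = es and \<tau> = \<tau>]])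
     apply (use rs s in simp)
    apply simp
    apply (rule HI)
   apply (rule r)
  proof (elim conjE exE)
   fix rg1 ar1 t1 out1 \<tau>1
   assume f: "\<forall>x. x < 20 | 70 <= x --> rg1 x = rg x" "\<forall>k<10. ar1 k = ar k"
    and h: "HI (es @ [Finish u]) \<tau>1 rg1 ar1 out1" "t1 + \<tau> <= Suc (Suc t) + \<tau>1"
   have d1: "drel (rev st) ks rg1 ar1" by (rule drel_cong[OF d]) (use f in auto)
   have r1: "cst rg1" "rg1 vK = k" "rg1 vA ~= 0" "rg1 vU = u" "rg1 vI = i" "rg1 vD = length st" "rg1 vLo = rg vLo"
    using r f vd by (auto simp: cst_def)
   have D1: "ar1 aD v = (if v \<in> disc es then 1 else 0)" if "v < n" for v using D[OF that] f by simp
   show "wp (Cond (Eqv (Rg 3) (Lit 0)) (14 ::= Lit 0) (resume ;; 16 ::= Rg 16 +. Lit (Suc 0))) (J T0 rg0 (step s)) rg1 ar1 t1 out1"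
   proof (cases st)
    case Nil
    have st: "step s = ([], k, es @ [Finish u])" using False by (simp add: s Nil)
    have ks: "kinv [] ks" using d1 Nil by (simp add: drel_def)
    have U: "ar1 aU p = 0" if "p < 2 * n + 1" for p using d1 that Nil by (simp add: drel_def)
    have "J T0 rg0 ([], k, es @ [Finish u]) (rg1(vA := 0)) ar1 (Suc (Suc t1)) out1"
     unfolding J_def
    proof (intro conjI exI[of _ \<tau>1])
     show "reach ([], k, es @ [Finish u])" using rs' st by simp
     show "srel ([], k, es @ [Finish u]) (rg1(vA := 0)) ar1"
      using r1 D1 U by (auto simp: cst_def)
     show "HI (snd (snd ([], k, es @ [Finish u]))) \<tau>1 (rg1(vA := 0)) ar1 out1"
      using HI_frame[OF h(1)] by simp
     \<comment> \<open>Emptying the stack resets the potential to \<open>S\<close>, which is at most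
       \<open>W u\<close> more than before.\<close>
     have "S <= PH (rev st) (W u) (rg vLo) + W u" using lo Nil by (simp add: PH_def)
     moreover have "rem ([], k, es @ [Finish u]) + 1 <= rem ((u, i) # st, k, es)"
      using rem_last Nil by simp
     ultimately show "Suc (Suc t1) + 60 * rem ([], k, es @ [Finish u]) + 20 * phi ([], k, es @ [Finish u]) (rg1(vA := 0))
      <= T0 + \<tau>1 + 20 * fw ([], k, es @ [Finish u])"
      using t h(2) fwf[of "[]"] Nil by simp
    qed (use x0 f in auto)
    then show ?thesis by (simp add: r1 Nil st)
   next
    case (Cons b st')
    obtain p j where b: "b = (p, j)" by (cases b)
    have st: "step s = ((p, j + 1) # st', k, es @ [Finish u])" using False by (simp add: s Cons b)
    have rv: "rev st = rev st' @ [(p, j)]" using Cons b by simp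
    have pj: "p < n" "j < deg p" using di Cons b by (auto simp: subset_iff)
    have sm: "Suc j < 2 ^ w" using pj deg_le[OF pj(1)] by (intro small) simp
    have fin: "J T0 rg0 ((p, j + 1) # st', k, es @ [Finish u]) (rg'(vI := Suc j)) ar' (Suc t') out1"
     if d': "drel (rev st') ks' rg' ar'" and p': "rg' vU = p" "rg' vI = j"
      and fr: "eq_off {vU, vI, vC, vD, vH, vLo, vT, vJ, vX, vY, vZ, vQ} rg' rg1"
       "\<forall>k. k < 2 | 10 <= k --> ar' k = ar1 k"
      and t': "t' + 20 * PH (rev st') (W p) (rg' vLo) <= Suc t1 + 40 + 20 * PH (rev st' @ [(p, j)]) (W u) (rg1 vLo) + 20 * W u"
     for ks' rg' ar' t'
     unfolding J_def
    proof (intro conjI exI[of _ \<tau>1])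
     have c2: "cst (rg'(vI := Suc j))" using r1(1) fr(1) unfolding cst_def by simp
     have "drel (rev st') ks' (rg'(vI := Suc j)) ar'" by (rule drel_cong[OF d']) simp_all
     then have d2: "\<exists>ks'. drel (rev st') ks' (rg'(vI := Suc j)) ar'" by blast
     have D2: "\<forall>v<n. ar' aD v = (if v \<in> disc es then 1 else 0)" using D1 fr(2) by simp
     show "srel ((p, j + 1) # st', k, es @ [Finish u]) (rg'(vI := Suc j)) ar'"
      using c2 d2 D2 p' r1(2,3) fr(1) by simp
     show "reach ((p, j + 1) # st', k, es @ [Finish u])" using rs' st by simp
     show "\<forall>x\<ge>70. (rg'(vI := Suc j)) x = rg0 x" using x0 f(1) fr(1) by simp
     show "HI (snd (snd ((p, j + 1) # st', k, es @ [Finish u]))) \<tau>1 (rg'(vI := Suc j)) ar' out1"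
      using HI_frame[OF h(1)] fr by simp
     show "Suc t' + 60 * rem ((p, j + 1) # st', k, es @ [Finish u]) + 20 * phi ((p, j + 1) # st', k, es @ [Finish u]) (rg'(vI := Suc j))
      <= T0 + \<tau>1 + 20 * fw ((p, j + 1) # st', k, es @ [Finish u])"
      using t t' h(2) fwf[of "(p, Suc j) # st'"] Cons b rv r1(7) rem_pop[OF pj(2), of st' k es u i] by simp
    qed
    show ?thesis
     apply (simp add: r1 Cons)
     apply (rule resume_ok[where u = u, OF d1[unfolded rv] o[unfolded rv] r1(1)])
     subgoal for rg' ar' t' ks'
      using fin[of ks' rg' ar' t'] by (simp add: sm st)
     done
   qed
  qed
 qed
qed

lemma inner_ok:
 assumes J: "J T0 rg0 s rg ar t out" and Q: "\<And>s' rg' ar' t' out'. J T0 rg0 s' rg' ar' t' out' ==> fst s' = [] ==>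
   fst (snd s') = fst (snd s) ==> Q rg' ar' (Suc t') out'"
 shows "wp (inner pd pf) Q rg ar t out"
 unfolding inner_def
proof (rule wp_loop[where I = "\<lambda>rg ar t out. \<exists>s'. J T0 rg0 s' rg ar t out & fst (snd s') = fst (snd s)" and B = "T0 + TB + 40 * n"])
 show "\<exists>s'. J T0 rg0 s' rg ar t out & fst (snd s') = fst (snd s)" using J by blast
 fix rg' ar' t' out' assume "\<exists>s'. J T0 rg0 s' rg' ar' t' out' & fst (snd s') = fst (snd s)"
 then obtain s' where J': "J T0 rg0 s' rg' ar' t' out'" "fst (snd s') = fst (snd s)" by blast
 show "t' <= T0 + TB + 40 * n" using J_bound J' by blast
 show "bok rg' ar' (Neqv (Rg 14) (Lit 0))" by simp
 have A: "rg' vA ~= 0 \<longleftrightarrow> fst s' ~= []"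
  using J' by (cases s') (auto simp: J_def split: list.splits)
 { assume "bv rg' ar' (Neqv (Rg 14) (Lit 0))"
  then have ne: "fst s' ~= []" using A by simp
  have k: "fst (snd (step s')) = fst (snd s')"
   using ne by (cases s' rule: step.cases) (auto split: list.splits)
  show "wp (inner_body pd pf) (\<lambda>rg ar t out. \<exists>s'. J T0 rg0 s' rg ar t out & fst (snd s') = fst (snd s)) rg' ar' (Suc t') out'"
   by (rule wp_mono[OF inner_step[OF J'(1) ne]], rule exI[of _ "step s'"]) (use k J'(2) in simp) }
 { assume "\<not> bv rg' ar' (Neqv (Rg 14) (Lit 0))"
  then show "Q rg' ar' (Suc t') out'" using A Q[OF J'(1)] J'(2) by simp }
qed

text \<open>The one extra tick per candidate pays for the last test of the inner loop.\<close>

definition K0 :: "nat => nat => (nat => nat) => (nat => nat) => arrays => nat => nat list => bool" where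
 "K0 T0 k rg0 rg ar t out \<longleftrightarrow> (\<exists>es. J (T0 + k) rg0 ([], k, es) rg ar t out)"

lemma J_mono: "J T0 rg0 s rg ar t out ==> t' + T0 <= t + T1 ==> J T1 rg0 s rg ar t' out"
 unfolding J_def by fastforce

lemma outer_step:
 assumes J: "J (T0 + k) rg0 ([], k, es) rg ar t out" and k: "k <= n"
 shows "wp (outer_body pd pf) (K0 T0 (Suc k) rg0) rg ar (Suc t) out"
proof -
 define c where "c = cand k"
 have cn: "c < n" using k r_less by (auto simp: c_def cand_def)
 have rs: "reach ([], k, es)" using J by (simp add: J_def)
 have di: "dinv ([], k, es)" using reach_dinv[OF rs] .
 have rs': "reach (step ([], k, es))" using reach_step rs .
 obtain \<tau> where r: "cst rg" "rg vK = k" "rg vA = 0" and D: "\<And>v. v < n ==> ar aD v = (if v \<in> disc es then 1 else 0)"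
  and U: "\<And>p. p < 2 * n + 1 ==> ar aU p = 0" and x0: "\<And>x. 70 <= x ==> rg x = rg0 x"
  and HI: "HI es \<tau> rg ar out" and t: "t + 60 * rem ([], k, es) + 20 * S <= T0 + k + \<tau> + 20 * fw ([], k, es)"
  using J by (auto simp: J_def)
 have lens': "len 0 = n" "wd 0 = Suc 0" using lens wds by simp_all
 have sm: "Suc k < 2 ^ w" using k by (intro small) simp
 have rem1: "rem ([], Suc k, es) + 1 = rem ([], k, es)" using k by (simp add: rem.simps)
 have vT: "wp (Cond (Eqv (Rg 13) (Lit 0)) (15 ::= ST) (15 ::= Rg 13 -. Lit 1)) Q rg ar t1 out"
  if "Q (rg(vT := c)) ar (Suc (Suc t1)) out" for Q t1
  using that r(2) by (auto simp: c_def cand_def)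
 show ?thesis
 proof (cases "c \<in> disc es")
  case True
  have st: "step ([], k, es) = ([], Suc k, es)" using True k by (simp add: c_def)
  have "J (T0 + Suc k) rg0 ([], Suc k, es) (rg(vT := c, vK := Suc k)) ar (Suc (Suc (Suc (Suc (Suc (Suc t)))))) out"
   unfolding J_def
  proof (intro conjI exI[of _ \<tau>])
   show "reach ([], Suc k, es)" using rs' st by simp
   show "srel ([], Suc k, es) (rg(vT := c, vK := Suc k)) ar" using r D U by (auto simp: cst_def)
   show "HI (snd (snd ([], Suc k, es))) \<tau> (rg(vT := c, vK := Suc k)) ar out" using HI_frame[OF HI] by simp
   show "Suc (Suc (Suc (Suc (Suc (Suc t))))) + 60 * rem ([], Suc k, es) + 20 * phi ([], Suc k, es) (rg(15 := c, 13 := Suc k))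
    <= T0 + Suc k + \<tau> + 20 * fw ([], Suc k, es)" using t rem1 by (simp add: fw.simps)
  qed (use x0 in auto)
  then have K: "K0 T0 (Suc k) rg0 (rg(vT := c, vK := Suc k)) ar (Suc (Suc (Suc (Suc (Suc (Suc t)))))) out"
   unfolding K0_def by blast
  show ?thesis unfolding outer_body_def wp_simps(5)
   apply (rule vT)
   using K True by (simp add: r sm cn lens' D)
 next
  case False
  have st: "step ([], k, es) = ([(c, 0)], Suc k, es @ [Discover c])" using False k by (simp add: c_def)
  have rem2: "rem ([(c, 0)], Suc k, es @ [Discover c]) + 3 = rem ([], k, es)"
   using rem_discover[OF di False cn, of "Suc k"] k by simp
  have ph: "PH [] x 0 <= S" for x by (simp add: PH_def)
  have after: "K0 T0 (Suc k) rg0 rg' ar' (Suc t') out'"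
   if "J (T0 + k) rg0 s' rg' ar' t' out'" "fst s' = []" "fst (snd s') = Suc k" for s' rg' ar' t' out'
  proof -
   have "s' = ([], Suc k, snd (snd s'))" using that(2,3) by (cases s') auto
   moreover have "J (T0 + Suc k) rg0 s' rg' ar' (Suc t') out'" by (rule J_mono[OF that(1)]) simp
   ultimately show ?thesis unfolding K0_def by metis
  qed
  show ?thesis unfolding outer_body_def wp_simps(5)
   apply (rule vT)
   using False apply (simp add: r sm cn lens' D)
   apply (rule wp_mono[where Q = "J (T0 + k) rg0 ([(c, 0)], Suc k, es @ [Discover c])"])
   apply (rule discover_J[where ks = "[]" and \<tau> = \<tau>])
         apply (use rs' st in simp)
         apply (rule False)
        apply (rule HI_frame[OF HI]; simp)
   using r x0 D apply (simp_all add: cst_def)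
    apply (use U S_pos in \<open>simp add: drel_def kinv_Nil\<close>)
   using t rem2 ph[of "W c"] fw_discover[OF di False, of "Suc k"] apply (simp)
   apply (erule inner_ok)
   apply (rule after)
    apply assumption
   apply assumption
   apply simp
   done
 qed
qed

text \<open>That \<open>aU\<close> comes back as zero is part of the result, so that a second
  traversal can follow without clearing it.\<close>

lemma dfs_prog_ok:
 assumes c: "cst rg" and D: "\<forall>v<n. ar aD v = 0" and U: "\<forall>p < 2 * n + 1. ar aU p = 0" and HI: "HI [] 0 rg ar out"
  and Q: "\<And>rg' ar' t' out' f \<tau>. reach f ==> final f ==> HI (snd (snd f)) \<tau> rg' ar' out' ==>
   (\<forall>x\<ge>70. rg' x = rg x) ==> (\<forall>p < 2 * n + 1. ar' aU p = 0) ==> t' <= t + \<tau> + DFSB ==> Q rg' ar' t' out'"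
 shows "wp (dfs_prog pd pf) Q rg ar t out"
proof -
 have rem0: "rem ([], 0, []) = (\<Sum>v<n. deg v) + 3 * n + n + 1"
  by (simp add: rem.simps sum.distrib)
 define rg1 where "rg1 = rg(vK := 0, vA := 0)"
 define T0 where "T0 = t + 2 + 60 * rem ([], 0, []) + 20 * S"
 have sm: "Suc n < 2 ^ w" by (intro small) simp
  have J0: "J T0 rg ([], 0, []) rg1 ar (t + 2) out"
   unfolding J_def
  proof (intro conjI exI[of _ "0 :: nat"])
   show "srel ([], 0, []) rg1 ar" using c D U by (auto simp: cst_def rg1_def)
   show "HI (snd (snd ([], 0, []))) 0 rg1 ar out" using HI_frame[OF HI] by (simp add: rg1_def)
   show "t + 2 + 60 * rem ([], 0, []) + 20 * phi ([], 0, []) rg1 <= T0 + 0 + 20 * fw ([], 0, [])"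
    by (simp add: T0_def)
  qed (insert reach_init, auto simp: rg1_def)
  have "wp (Loop (Lt (Rg vK) (Rg gN +. Lit 1)) (outer_body pd pf)) Q rg1 ar (t + 2) out"
  proof (rule wp_loop[where I = "\<lambda>rg' ar' t' out'. \<exists>k\<le>Suc n. K0 T0 k rg rg' ar' t' out'" and B = "T0 + Suc n + TB + 40 * n"])
   show "\<exists>k\<le>Suc n. K0 T0 k rg rg1 ar (t + 2) out"
    using J0 by (intro exI[of _ 0]) (auto simp: K0_def)
   fix rg' ar' t' out' assume "\<exists>k\<le>Suc n. K0 T0 k rg rg' ar' t' out'"
   then obtain k es where k: "k <= Suc n" and J: "J (T0 + k) rg ([], k, es) rg' ar' t' out'"
    unfolding K0_def by blast
   show "t' <= T0 + Suc n + TB + 40 * n" using J_bound[OF J] k by simp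
   have c': "cst rg'" "rg' vK = k" using J by (auto simp: J_def)
   then have g: "rg' gN = n" by (simp add: cst_def)
   show "bok rg' ar' (Lt (Rg vK) (Rg gN +. Lit 1))" using g sm by simp
   show "wp (outer_body pd pf) (\<lambda>rg' ar' t' out'. \<exists>k\<le>Suc n. K0 T0 k rg rg' ar' t' out') rg' ar' (Suc t') out'"
    if "bv rg' ar' (Lt (Rg vK) (Rg gN +. Lit 1))"
   proof -
    have kn: "k <= n" using that c' g by simp
    show ?thesis by (rule wp_mono[OF outer_step[OF J kn]], rule exI[of _ "Suc k"]) (use kn in simp)
   qed
   show "Q rg' ar' (Suc t') out'" if "\<not> bv rg' ar' (Lt (Rg vK) (Rg gN +. Lit 1))"
   proof -
    have kn: "k = Suc n" using that c' g k by simp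
    obtain \<tau> where h: "HI es \<tau> rg' ar' out'" and t: "t' + 20 * S <= T0 + k + \<tau> + 20 * fw ([], k, es)"
     using J by (auto simp: J_def)
    have rs: "reach ([], k, es)" using J by (simp add: J_def)
    have fwl: "fw ([], k, es) <= 2 * n" using fw_le[OF reach_dinv[OF rs]] .
    show ?thesis
    proof (rule Q[of "([], k, es)" \<tau>])
     show "final ([], k, es)" using kn by (simp add: final_def)
     show "\<forall>p<2 * n + 1. ar' aU p = 0" using J by (simp add: J_def)
     show "\<forall>x\<ge>70. rg' x = rg x" using J by (simp add: J_def)
     show "Suc t' <= t + \<tau> + DFSB"
      using t fwl kn unfolding T0_def rem0 DFSB_def by simp
    qed (use h rs in auto)
   qed
  qed
  then show ?thesis by (simp add: dfs_prog_def rg1_def)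
qed

end

section \<open>Random access to one number per vertex\<close>

text \<open>
 Every vertex \<open>v\<close> owns \<open>1 + bl (deg v)\<close> bits, where \<open>bl\<close> is the bit length. They are laid out
 by levels: first bit 0 of all vertices, then bit 1 of the vertices that have one, and so on. The
 bit following the one at position \<open>p\<close> is found at position \<open>n + rank p\<close>, where \<open>rank p\<close> is the
 number of positions before \<open>p\<close> whose bit is not the last one of its owner. Ranks are computed in
 constant time with a table of the bit counts of all words of \<open>h\<close> bits, \<open>h\<close> about \<open>(lg n) / 2\<close>.
\<close>

fun bl :: "nat => nat" where
 "bl 0 = 0"
| "bl (Suc m) = Suc (bl (Suc m div 2))"

lemma bl_pos: "0 < d ==> bl d = Suc (bl (d div 2))"
 by (cases d) simp_all

lemma bl_iff: "j < bl d \<longleftrightarrow> 0 < d div 2 ^ j"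
proof (induction d arbitrary: j rule: bl.induct)
 case (2 m)
 show ?case
 proof (cases j)
  case (Suc i)
  then show ?thesis using 2[of i] by (simp add: div_mult2_eq)
 qed simp
qed simp

lemma bl_less: "d < 2 ^ bl d"
 by (metis bl_iff div_eq_0_iff less_irrefl power_eq_0_iff zero_less_iff_neq_zero zero_neq_numeral)

lemma bl_le: "bl d <= d"
proof (induction d rule: bl.induct)
 case (2 m)
 have "Suc m div 2 <= m" by simp
 then show ?case using 2 by simp
qed simp

lemma bl_mono: "d <= d' ==> bl d <= bl d'"
 by (meson bl_iff div_le_mono leI le_less_trans less_irrefl less_le_trans)

definition binsum :: "(nat => bool) => nat => nat" where
 "binsum f h = (\<Sum>i<h. of_bool (f i) * 2 ^ i)"

lemma binsum_0 [simp]: "binsum f 0 = 0" by (simp add: binsum_def)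

lemma binsum_Suc: "binsum f (Suc h) = binsum f h + of_bool (f h) * 2 ^ h" by (simp add: binsum_def)

lemma binsum_shift: "binsum f (Suc h) = of_bool (f 0) + 2 * binsum (f \<circ> Suc) h"
 by (induction h) (simp_all add: binsum_Suc algebra_simps)

lemma binsum_less: "binsum f h < 2 ^ h"
 by (induction h) (auto simp: binsum_Suc)

lemma binsum_mod: "e <= h ==> binsum f h mod 2 ^ e = binsum f e"
proof (induction h)
 case (Suc h)
 show ?case
 proof (cases "e = Suc h")
  case False
  then have "e <= h" using Suc by simp
  then have "(2 :: nat) ^ h mod 2 ^ e = 0" by (simp add: le_imp_power_dvd)
  then have "of_bool (f h) * (2 :: nat) ^ h mod 2 ^ e = 0" by simp
  then show ?thesis using Suc \<open>e <= h\<close> by (metis add.right_neutral binsum_Suc mod_add_right_eq)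
 next
  case True
  show ?thesis unfolding True by (rule mod_less[OF binsum_less])
 qed
qed simp

text \<open>Population count, by the recursion along which the table is filled.\<close>

fun pc :: "nat => nat" where
 "pc 0 = 0"
| "pc (Suc m) = Suc m mod 2 + pc (Suc m div 2)"

lemma pc_rec: "pc x = x mod 2 + pc (x div 2)"
 by (cases x) simp_all

lemma pc_le: "pc x <= x"
proof (induction x rule: pc.induct)
 case (2 m)
 have "Suc m mod 2 + Suc m div 2 <= Suc m" by presburger
 then show ?case using 2 by simp
qed simp

lemma pc_binsum: "pc (binsum f h) = card {i. i < h & f i}"
proof (induction h arbitrary: f)
 case (Suc h)
 have "pc (binsum f (Suc h)) = of_bool (f 0) + pc (binsum (f \<circ> Suc) h)"
  by (subst pc_rec) (simp add: binsum_shift)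
 also have "\<dots> = of_bool (f 0) + card {i. i < h & f (Suc i)}" using Suc by simp
 also have "\<dots> = card {i. i < Suc h & f i}"
 proof -
  have "{i. i < Suc h & f i} = (if f 0 then {0} else {}) \<union> Suc ` {i. i < h & f (Suc i)}"
   by (auto simp: image_iff less_Suc_eq_0_disj)
  moreover have "card (Suc ` {i. i < h & f (Suc i)}) = card {i. i < h & f (Suc i)}"
   by (rule card_image) simp
  ultimately show ?thesis by (simp add: card_Un_disjoint)
 qed
 finally show ?case .
qed simp

section \<open>Positions and ranks in the layout by levels\<close>

context dfs_mem
begin

text \<open>Level \<open>bl (deg u)\<close> is a position beyond the digits of \<open>u\<close>. It
  keeps level 0 complete even for vertices of degree 0, so that \<open>lpos 0 v = v\<close>, and it
  gives the last digit a successor, so that walks may compute one without a test.\<close>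

definition lev :: "(nat \<times> nat) set" where
 "lev = {(j, u). u < n & j <= bl (deg u)}"

definition before :: "nat => nat => (nat \<times> nat) set" where
 "before j v = {(i, u) \<in> lev. i < j | i = j & u < v}"

definition lpos :: "nat => nat => nat" where
 "lpos j v = card (before j v)"

definition NT :: nat where "NT = card lev"

definition NX :: "nat set" where
 "NX = {lpos j v | j v. v < n & j < bl (deg v)}"

definition rank :: "nat => nat" where
 "rank p = card {q \<in> NX. q < p}"

lemma lev_Sigma: "lev = prod.swap ` (SIGMA u:{..<n}. {..bl (deg u)})"
 by (auto simp: lev_def image_iff)

lemma lev_finite: "finite lev"
 by (simp add: lev_Sigma)

lemma NT_sum: "NT = (\<Sum>v<n. 1 + bl (deg v))"
proof -
 have "card lev = card (SIGMA u:{..<n}. {..bl (deg u)})"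
  unfolding lev_Sigma by (rule card_image) (auto simp: inj_on_def)
 then show ?thesis by (simp add: NT_def)
qed

lemma before_sub: "before j v \<subseteq> lev" by (auto simp: before_def)

lemma before_finite: "finite (before j v)"
 using before_sub lev_finite finite_subset by blast

lemma lpos_less: "(j, v) \<in> lev ==> lpos j v < NT"
proof -
 assume a: "(j, v) \<in> lev"
 have "(j, v) \<notin> before j v" by (auto simp: before_def)
 then have "before j v \<subset> lev" using a before_sub by blast
 then show ?thesis unfolding lpos_def NT_def by (rule psubset_card_mono[OF lev_finite])
qed

lemma lpos_strict:
 assumes "(i, u) \<in> lev" "i < j | i = j & u < v"
 shows "lpos i u < lpos j v"
proof -
 have "before i u \<subseteq> before j v" using assms(2) by (auto simp: before_def)
 moreover have "(i, u) \<in> before j v" "(i, u) \<notin> before i u" using assms by (auto simp: before_def)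
 ultimately have "before i u \<subset> before j v" by blast
 then show ?thesis unfolding lpos_def by (rule psubset_card_mono[OF before_finite])
qed

lemma lpos_inj: "(i, u) \<in> lev ==> (j, v) \<in> lev ==> lpos i u = lpos j v ==> i = j & u = v"
 using lpos_strict[of i u j v] lpos_strict[of j v i u] by (metis less_irrefl linorder_neqE_nat)

lemma lpos_0: "v < n ==> lpos 0 v = v"
proof -
 assume "v < n"
 then have "before 0 v = (\<lambda>u. (0, u)) ` {..<v}" by (auto simp: before_def lev_def)
 then have "lpos 0 v = card ((\<lambda>u. (0 :: nat, u)) ` {..<v})" by (simp only: lpos_def)
 also have "\<dots> = v" by (subst card_image) (auto simp: inj_on_def)
 finally show ?thesis .
qed

text \<open>Raising the level by one is a bijection from the non-last positions before
  \<open>(j, v)\<close> onto the positions of level at least 1 before \<open>(Suc j, v)\<close>; the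
  \<open>n\<close> positions of level 0 come in addition.\<close>

lemma lpos_Suc:
 assumes v: "v < n" "j < bl (deg v)"
 shows "lpos (Suc j) v = n + rank (lpos j v)"
proof -
 define R where "R = {(i, u) \<in> before j v. i < bl (deg u)}"
 have jl: "(j, v) \<in> lev" using v by (simp add: lev_def)
 have Rl: "R \<subseteq> lev" using before_sub by (auto simp: R_def)
 have "{q \<in> NX. q < lpos j v} = (\<lambda>(i, u). lpos i u) ` R"
 proof
  show "{q \<in> NX. q < lpos j v} \<subseteq> (\<lambda>(i, u). lpos i u) ` R"
  proof
   fix q assume "q \<in> {q \<in> NX. q < lpos j v}"
   then obtain i u where q: "q = lpos i u" "u < n" "i < bl (deg u)" "lpos i u < lpos j v"
    by (auto simp: NX_def)
   have il: "(i, u) \<in> lev" using q by (simp add: lev_def)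
   have "\<not> (j < i | j = i & v < u)" using lpos_strict[OF jl, of i u] q(4) by auto
   moreover have "(i, u) ~= (j, v)" using q(4) by auto
   ultimately have "(i, u) \<in> before j v" using il by (auto simp: before_def)
   then show "q \<in> (\<lambda>(i, u). lpos i u) ` R" using q by (force simp: R_def)
  qed
  show "(\<lambda>(i, u). lpos i u) ` R \<subseteq> {q \<in> NX. q < lpos j v}"
  proof
   fix q assume "q \<in> (\<lambda>(i, u). lpos i u) ` R"
   then obtain i u where q: "q = lpos i u" "(i, u) \<in> before j v" "i < bl (deg u)" by (auto simp: R_def)
   have "lpos i u < lpos j v" by (rule lpos_strict) (insert q, auto simp: before_def)
   then show "q \<in> {q \<in> NX. q < lpos j v}" using q by (auto simp: NX_def before_def lev_def)
  qed
 qed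
 moreover have "inj_on (\<lambda>(i, u). lpos i u) R"
 proof (rule inj_onI)
  fix x y assume xy: "x \<in> R" "y \<in> R" "(case x of (i, u) => lpos i u) = (case y of (i, u) => lpos i u)"
  obtain i u i' u' where e: "x = (i, u)" "y = (i', u')" by (cases x, cases y)
  have "(i, u) \<in> lev" "(i', u') \<in> lev" using xy(1,2) Rl unfolding e by (simp_all add: subset_iff)
  moreover have "lpos i u = lpos i' u'" using xy(3) by (simp add: e)
  ultimately show "x = y" using lpos_inj[of i u i' u'] by (simp add: e)
 qed
 ultimately have rk: "rank (lpos j v) = card R"
  unfolding rank_def by (simp only: card_image)
 have b: "before (Suc j) v = (\<lambda>u. (0, u)) ` {..<n} \<union> (\<lambda>(i, u). (Suc i, u)) ` R"
 proof
  show "before (Suc j) v \<subseteq> (\<lambda>u. (0, u)) ` {..<n} \<union> (\<lambda>(i, u). (Suc i, u)) ` R"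
  proof
   fix x assume x: "x \<in> before (Suc j) v"
   obtain i u where xi: "x = (i, u)" by (cases x)
   show "x \<in> (\<lambda>u. (0, u)) ` {..<n} \<union> (\<lambda>(i, u). (Suc i, u)) ` R"
   proof (cases i)
    case 0
    then show ?thesis using x xi by (auto simp: before_def lev_def)
   next
    case (Suc i')
    then have "(i', u) \<in> R" using x xi by (auto simp: before_def lev_def R_def)
    then show ?thesis using xi Suc by force
   qed
  qed
  show "(\<lambda>u. (0, u)) ` {..<n} \<union> (\<lambda>(i, u). (Suc i, u)) ` R \<subseteq> before (Suc j) v"
   by (auto simp: before_def lev_def R_def)
 qed
 have "card (before (Suc j) v) = card ((\<lambda>u. (0 :: nat, u)) ` {..<n}) + card ((\<lambda>(i, u). (Suc i, u)) ` R)"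
  unfolding b by (rule card_Un_disjoint) (use Rl lev_finite finite_subset in auto)
 also have "card ((\<lambda>u. (0 :: nat, u)) ` {..<n}) = n" by (subst card_image) (auto simp: inj_on_def)
 also have "card ((\<lambda>(i, u). (Suc i, u)) ` R) = card R" by (rule card_image) (auto simp: inj_on_def)
 finally show ?thesis using rk by (simp add: lpos_def)
qed

lemma NT_le: "NT <= n + n * n"
proof -
 have "NT <= (\<Sum>v<n. 1 + n)" unfolding NT_sum
  by (rule sum_mono) (metis add_left_mono bl_le deg_le le_trans lessThan_iff)
 then show ?thesis by simp
qed

lemma NX_less: "q \<in> NX ==> q < NT"
 using lpos_less by (auto simp: NX_def lev_def)

lemma NX_finite: "finite NX"
 using NX_less by (metis finite_nat_set_iff_bounded)

lemma rank_block:
 "rank (k * h + e) = rank (k * h) + card {i. i < e & k * h + i \<in> NX}"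
proof -
 have "{q \<in> NX. q < k * h + e} = {q \<in> NX. q < k * h} \<union> (\<lambda>i. k * h + i) ` {i. i < e & k * h + i \<in> NX}"
 proof (intro set_eqI iffI)
  fix q assume q: "q \<in> {q \<in> NX. q < k * h + e}"
  show "q \<in> {q \<in> NX. q < k * h} \<union> (\<lambda>i. k * h + i) ` {i. i < e & k * h + i \<in> NX}"
  proof (cases "q < k * h")
   case False
   then have "q = k * h + (q - k * h)" by simp
   moreover from this have "q - k * h \<in> {i. i < e & k * h + i \<in> NX}" using q False by auto
   ultimately show ?thesis by blast
  qed (use q in simp)
 qed auto
 moreover have "card (\<dots>) = card {q \<in> NX. q < k * h} + card ((\<lambda>i. k * h + i) ` {i. i < e & k * h + i \<in> NX})"
  by (rule card_Un_disjoint) (use NX_finite in auto)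
 moreover have "card ((\<lambda>i. k * h + i) ` {i. i < e & k * h + i \<in> NX}) = card {i. i < e & k * h + i \<in> NX}"
  by (rule card_image) simp
 ultimately show ?thesis by (simp add: rank_def)
qed

lemma rank_le: "rank p <= NT"
proof -
 have "rank p <= card {..<NT}" unfolding rank_def by (rule card_mono) (auto dest: NX_less)
 then show ?thesis by simp
qed

lemma lpos_step: "lpos i (Suc x) = lpos i x + of_bool ((i, x) \<in> lev)"
proof -
 have "before i (Suc x) = before i x \<union> (if (i, x) \<in> lev then {(i, x)} else {})"
  by (auto simp: before_def less_Suc_eq)
 moreover have "(i, x) \<notin> before i x" by (auto simp: before_def)
 ultimately show ?thesis using before_finite[of i x] by (simp add: lpos_def)
qed

lemma lpos_level: "lpos (Suc i) 0 = lpos i 0 + card {u. (i, u) \<in> lev}"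
proof -
 have "before (Suc i) 0 = before i 0 \<union> (\<lambda>u. (i, u)) ` {u. (i, u) \<in> lev}"
  by (auto simp: before_def less_Suc_eq)
 moreover have "finite {u. (i, u) \<in> lev}" by (simp add: lev_def)
 moreover have "before i 0 \<inter> (\<lambda>u. (i, u)) ` {u. (i, u) \<in> lev} = {}" by (auto simp: before_def)
 moreover have "card ((\<lambda>u. (i, u)) ` {u. (i, u) \<in> lev}) = card {u. (i, u) \<in> lev}"
  by (rule card_image) (auto simp: inj_on_def)
 ultimately show ?thesis using before_finite[of i 0] by (simp add: lpos_def card_Un_disjoint)
qed

lemma lpos_le: "lpos i x <= NT"
 unfolding lpos_def NT_def by (rule card_mono[OF lev_finite before_sub])

lemma small2: "x <= 100 * ((n + 1) * (n + 1)) ==> x < 2 ^ w"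
proof -
 assume "x <= 100 * ((n + 1) * (n + 1))"
 also have "\<dots> < 1000 * ((n + 1) * (n + 1))" by simp
 also note w_big
 finally show ?thesis .
qed

lemma NT_sq: "NT <= (n + 1) * (n + 1)"
 using NT_le by simp

lemma smallNT: "x <= 10 * NT + 10 * n + 10 ==> x < 2 ^ w"
 by (rule small2) (use NT_sq in simp)

lemma smallNTL: "x <= NT + n ==> x < 2 ^ L"
proof -
 assume "x <= NT + n"
 also have "\<dots> < 4 * ((n + 1) * (n + 1))" using NT_sq by simp
 also note L_big
 finally show ?thesis .
qed

end

section \<open>Construction of the rank structure\<close>

abbreviation (input) "hP \<equiv> 20 :: nat"
abbreviation (input) "hX \<equiv> 21 :: nat"
abbreviation (input) "hJ \<equiv> 22 :: nat"
abbreviation (input) "hD \<equiv> 23 :: nat"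
abbreviation (input) "hI \<equiv> 24 :: nat"
abbreviation (input) "hW \<equiv> 25 :: nat"
abbreviation (input) "hC \<equiv> 26 :: nat"
abbreviation (input) "hO \<equiv> 27 :: nat"

abbreviation (input) "gH \<equiv> 73 :: nat"
abbreviation (input) "gNT \<equiv> 74 :: nat"
abbreviation (input) "gHH \<equiv> 75 :: nat"
abbreviation (input) "gJ \<equiv> 76 :: nat"

abbreviation (input) "aV \<equiv> 10 :: nat"
abbreviation (input) "aA \<equiv> 11 :: nat"
abbreviation (input) "aT \<equiv> 12 :: nat"
abbreviation (input) "aPI \<equiv> 13 :: nat"
abbreviation (input) "aCT \<equiv> 14 :: nat"
abbreviation (input) "aVIS \<equiv> 15 :: nat"
abbreviation (input) "aCOV \<equiv> 16 :: nat"
abbreviation (input) "aNC \<equiv> 17 :: nat"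
abbreviation (input) "aCur \<equiv> 18 :: nat"
abbreviation (input) "aREP \<equiv> 19 :: nat"

text \<open>Reducing a block modulo a power of two keeps its bits before position \<open>hP\<close>;
  their number is looked up in \<open>aT\<close> and added to the sampled rank of the block.\<close>

definition nextE :: aexp where
 "nextE = Rg gN +. Arr aA (Rg hP /. Rg gH) +.
  Arr aT (Arr aV (Rg hP /. Rg gH) %. Bin Shl (Lit 1) (Rg hP %. Rg gH))"

text \<open>Halving \<open>2 * deg x + 1\<close> until it is 0 takes \<open>1 + bl (deg x)\<close>
  rounds, one for each position of \<open>x\<close>, and the value is 1 in the last of them.\<close>

definition scan_body :: "prg => prg" where
 "scan_body pb =
  Cond (Lt (Lit 0) (Rg hD))
   (pb ;; hD ::= Rg hD /. Lit 2 ;; hJ ::= Rg hJ +. Lit 1)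
   (hX ::= Rg hX +. Lit 1 ;; hJ ::= Lit 0 ;;
    Cond (Lt (Rg hX) (Rg gN)) (hD ::= Dg (Rg hX) *. Lit 2 +. Lit 1) Nop)"

definition scan :: "prg => prg" where
 "scan pb = hX ::= Lit 0 ;; hJ ::= Lit 0 ;; hD ::= Dg (Rg hX) *. Lit 2 +. Lit 1 ;;
  Loop (Lt (Rg hX) (Rg gN)) (scan_body pb)"

definition
 "count_step = Put aCur (Rg hJ +. Lit 1) (Arr aCur (Rg hJ +. Lit 1) +. Lit 1)"

definition
 "prefix_step = Put aCur (Rg hJ) (Arr aCur (Rg hJ) +. Arr aCur (Rg hJ -. Lit 1)) ;; hJ ::= Rg hJ +. Lit 1"

definition
 "fill_step = hP ::= Arr aCur (Rg hJ) ;; Put aCur (Rg hJ) (Rg hP +. Lit 1) ;;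
  Cond (Lt (Lit 1) (Rg hD))
   (Put aV (Rg hP /. Rg gH) (Arr aV (Rg hP /. Rg gH) +. Bin Shl (Lit 1) (Rg hP %. Rg gH))) Nop"

definition
 "table_step = Put aT (Rg hX) (Arr aT (Rg hX /. Lit 2) +. Rg hX %. Lit 2) ;; hX ::= Rg hX +. Lit 1"

definition
 "rank_step = Put aA (Rg hX) (Rg hW) ;; hW ::= Rg hW +. Arr aT (Arr aV (Rg hX)) ;; hX ::= Rg hX +. Lit 1"

text \<open>A counting sort of the positions by level: the histogram of level sizes, prefix sums as
  level starts, then one cursor per level that hands out positions in vertex order. Queries
  afterwards need only the bit vector, the block ranks and the table.\<close>

definition
 "build = scan count_step ;;
  hJ ::= Lit 1 ;; Loop (Lt (Rg hJ) (Rg gJ +. Lit 1)) prefix_step ;;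
  scan fill_step ;;
  hX ::= Lit 1 ;; Loop (Lt (Rg hX) (Rg gHH)) table_step ;;
  hX ::= Lit 0 ;; hW ::= Lit 0 ;; Loop (Lt (Rg hX) (Rg gNT /. Rg gH +. Lit 1)) rank_step"

locale dfs_lev = dfs_mem +
 fixes h :: nat
 assumes na2: "20 <= na" and h_pos: "0 < h" and h_le: "2 ^ h <= 4 * n + 4" and h_w: "h <= n + 2"
  and lens2: "len aV = NT div h + 1" "len aA = NT div h + 1" "len aT = 2 ^ h" "len aPI = NT" "len aCT = NT"
   "len aVIS = n" "len aCOV = n" "len aNC = n" "len aCur = bl n + 3" "len aREP = n"
  and wds2: "wd aV = h" "wd aA = L" "wd aT = L" "wd aPI = 1" "wd aCT = 1" "wd aVIS = 1" "wd aCOV = 1"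
   "wd aNC = 1" "wd aCur = L" "wd aREP = 1"
begin

lemma na_lt2 [simp]: "k < 20 ==> k < na" using na2 by simp

definition cst2 :: "(nat => nat) => bool" where
 "cst2 rg \<longleftrightarrow> cst rg & rg gH = h & rg gNT = NT & rg gHH = 2 ^ h & rg gJ = bl n + 2"

lemma cst2_cong: "cst2 rg ==> (\<forall>x\<ge>70. rg' x = rg x) ==> cst2 rg'"
 by (simp add: cst2_def cst_def)

definition lrel :: "arrays => bool" where
 "lrel ar \<longleftrightarrow> (\<forall>k < NT div h + 1. ar aV k = binsum (\<lambda>i. k * h + i \<in> NX) h & ar aA k = rank (k * h)) &
  (\<forall>x < 2 ^ h. ar aT x = pc x)"

lemma p2_less: "e < h ==> (2 :: nat) ^ e < 2 ^ h"
 by simp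

lemma next_ok:
 assumes l: "lrel ar" and c: "cst2 rg" and v: "v < n" "j < bl (deg v)" and p: "rg hP = lpos j v"
 shows "ok rg ar nextE" "ev rg ar nextE = lpos (Suc j) v"
proof -
 define q where "q = lpos j v"
 have jl: "(j, v) \<in> lev" "(Suc j, v) \<in> lev" using v by (simp_all add: lev_def)
 have q: "q < NT" "lpos (Suc j) v < NT" using lpos_less jl by (simp_all add: q_def)
 have k: "q div h < NT div h + 1" using q div_le_mono[of q NT h] by simp
 have e: "q mod h < h" using h_pos by simp
 have pe: "(2 :: nat) ^ (q mod h) < 2 ^ h" using p2_less[OF e] .
 have V: "ar aV (q div h) = binsum (\<lambda>i. q div h * h + i \<in> NX) h" "ar aA (q div h) = rank (q div h * h)"
  using l k by (simp_all add: lrel_def)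
 have m: "ar aV (q div h) mod 2 ^ (q mod h) = binsum (\<lambda>i. q div h * h + i \<in> NX) (q mod h)"
  unfolding V by (rule binsum_mod) (use e in simp)
 have ml: "binsum (\<lambda>i. q div h * h + i \<in> NX) (q mod h) < 2 ^ h" using binsum_less pe less_trans by blast
 have T: "ar aT (binsum (\<lambda>i. q div h * h + i \<in> NX) (q mod h)) = card {i. i < q mod h & q div h * h + i \<in> NX}"
  using l ml by (simp add: lrel_def pc_binsum)
 have rk: "rank q = rank (q div h * h) + card {i. i < q mod h & q div h * h + i \<in> NX}"
  using rank_block[of "q div h" h "q mod h"] by simp
 have g: "rg gN = n" "rg gH = h" using c by (simp_all add: cst2_def cst_def)
 have res: "lpos (Suc j) v = n + rank q" using lpos_Suc[OF v] by (simp add: q_def)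
 have rle: "rank (q div h * h) <= NT" using rank_le .
 have s1: "n + rank (q div h * h) < 2 ^ w" "lpos (Suc j) v < 2 ^ w" "(2 :: nat) ^ (q mod h) < 2 ^ w"
  using rle q pe h_le by (intro smallNT; linarith)+
 have s2: "n + rank (q div h * h) + card {i. i < q mod h & q div h * h + i \<in> NX} < 2 ^ w"
  using s1(2) res rk by simp
 have kS: "q div h < Suc (NT div h)" using k by simp
 show "ok rg ar nextE" unfolding nextE_def
  using s1 s2 kS by (simp add: p q_def[symmetric] g lens2 m ml T V(2))
 show "ev rg ar nextE = lpos (Suc j) v" unfolding nextE_def
  by (simp add: p q_def[symmetric] g m T V(2) res rk)
qed

lemma level_iff: "0 < (2 * deg x + 1) div 2 ^ j \<longleftrightarrow> j <= bl (deg x)"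
proof -
 have "bl (2 * deg x + 1) = Suc (bl (deg x))" using bl_pos[of "2 * deg x + 1"] by simp
 then show ?thesis by (simp add: bl_iff[symmetric] less_Suc_eq_le)
qed

definition prog_cnt :: "nat => nat => nat" where
 "prog_cnt x j = (\<Sum>v<x. 1 + bl (deg v)) + j"

lemma prog_cnt_le: "x < n ==> j <= Suc (bl (deg x)) ==> prog_cnt x j <= NT"
proof -
 assume a: "x < n" "j <= Suc (bl (deg x))"
 have "prog_cnt x j <= (\<Sum>v<Suc x. 1 + bl (deg v))" using a by (simp add: prog_cnt_def)
 also have "\<dots> <= NT" unfolding NT_sum by (rule sum_mono2) (use a in auto)
 finally show ?thesis .
qed

text \<open>The invariant \<open>I\<close> speaks of the arrays only, so that histogram and filling
  share the reasoning about the enumeration of vertices and levels.\<close>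

lemma scan_ok:
 assumes c: "cst2 rg" and I0: "I 0 0 ar"
  and step: "\<And>x j rg' ar' t' out' Q'. x < n ==> j <= bl (deg x) ==> I x j ar' ==> cst2 rg' ==> rg' hX = x ==> rg' hJ = j ==>
   rg' hD = (2 * deg x + 1) div 2 ^ j ==>
   (\<And>rg'' ar'' t''. (\<forall>y. y ~= hP --> rg'' y = rg' y) ==> I x (Suc j) ar'' ==> t'' <= t' + c0 ==> Q' rg'' ar'' t'' out') ==>
   wp pb Q' rg' ar' t' out'"
  and nxt: "\<And>x ar. x < n ==> I x (Suc (bl (deg x))) ar ==> I (Suc x) 0 ar"
  and Q: "\<And>rg' ar' t'. I n 0 ar' ==> eq_off {hP, hX, hJ, hD} rg' rg ==>
   t' <= t + 10 + (c0 + 5) * NT + 8 * n ==> Q rg' ar' t' out"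
 shows "wp (scan pb) Q rg ar t out"
proof -
 define M where "M = (\<lambda>rg' ar' t' out'. \<exists>x j. x <= n & rg' hX = x & rg' hJ = j & I x j ar' &
  (x < n --> rg' hD = (2 * deg x + 1) div 2 ^ j & j <= Suc (bl (deg x))) & (x = n --> j = 0) &
  eq_off {hP, hX, hJ, hD} rg' rg & out' = out &
  t' <= t + 4 + (c0 + 5) * prog_cnt x j + 8 * x)"
 have done0: "prog_cnt n 0 = NT" by (simp add: prog_cnt_def NT_sum)
 have dlt: "deg v * 2 < 2 ^ w" "Suc (deg v * 2) < 2 ^ w" if "v < n" for v
  using deg_le[OF that] by (intro small; linarith)+
 have lit2: "2 < (2 :: nat) ^ w" by (intro small) simp
 have B: "t' <= t + 4 + (c0 + 5) * NT + 8 * n" if "M rg' ar' t' out'" for rg' ar' t' out'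
 proof -
  from that obtain x j where x: "x <= n" "x < n --> j <= Suc (bl (deg x))" "x = n --> j = 0"
   "t' <= t + 4 + (c0 + 5) * prog_cnt x j + 8 * x" unfolding M_def by auto
  have "prog_cnt x j <= NT" using x prog_cnt_le[of x j] done0 by (cases "x = n") auto
  then have "(c0 + 5) * prog_cnt x j <= (c0 + 5) * NT" by (rule mult_le_mono2)
  then show ?thesis using x by linarith
 qed
 have body: "wp (scan_body pb) M rg' ar' (Suc t') out'" if m: "M rg' ar' t' out'" and lt: "rg' hX < n" for rg' ar' t' out'
 proof -
  from m lt obtain x j where x: "x < n" "rg' hX = x" "rg' hJ = j" "I x j ar'" "rg' hD = (2 * deg x + 1) div 2 ^ j"
   "j <= Suc (bl (deg x))" "eq_off {hP, hX, hJ, hD} rg' rg" "out' = out"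
   "t' <= t + 4 + (c0 + 5) * prog_cnt x j + 8 * x" unfolding M_def by auto
  have c': "cst2 rg'" by (rule cst2_cong[OF c]) (use x in simp)
  then have g: "rg' gN = n" by (simp add: cst2_def cst_def)
  have sm: "Suc j < 2 ^ w" "Suc x < 2 ^ w"
   using x bl_le[of "deg x"] deg_le[OF x(1)] by (intro small; linarith)+
  show ?thesis
  proof (cases "j <= bl (deg x)")
   case True
   then have pos: "0 < rg' hD" using level_iff x(5) by simp
   show ?thesis unfolding scan_body_def
    apply (simp add: pos)
    apply (rule step[where x = x and j = j])
       apply (simp_all add: x(1-4) True c')
    apply (simp add: x(5))
    subgoal for rg'' ar'' t''
     apply (simp add: x sm lit2)
     unfolding M_def
     apply (rule exI[of _ x], rule exI[of _ "Suc j"])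
     using x True apply (simp add: div_mult2_eq[symmetric] mult.commute prog_cnt_def)
     done
    done
  next
   case False
   then have j: "j = Suc (bl (deg x))" using x by simp
   then have z: "rg' hD = 0" using level_iff[of x j] x(5) by simp
   have I': "I (Suc x) 0 ar'" using nxt[OF x(1)] x(4) j by simp
   have dn: "prog_cnt (Suc x) 0 = prog_cnt x j" using j by (simp add: prog_cnt_def)
   show ?thesis unfolding scan_body_def
    apply (simp add: z x(2) sm g)
    apply (intro conjI impI)
      apply (rule lit2)
     apply (simp add: dlt)
     apply (simp add: dlt)
    apply (unfold M_def)
    apply (rule exI[of _ "Suc x"], rule exI[of _ 0])
    using x I' dn apply simp
    apply (rule exI[of _ "Suc x"], rule exI[of _ 0])
    using x I' dn apply simp
    done
  qed
 qed
 have g0: "rg gN = n" using c by (simp add: cst2_def cst_def)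
 show ?thesis unfolding scan_def
  apply (simp add: dlt lit2)
  apply (intro conjI)
   apply (use n_pos in simp)
   apply (use dlt[OF n_pos] in simp)
  apply (use dlt[OF n_pos] in simp)
  apply (rule wp_loop[where I = M and B = "t + 4 + (c0 + 5) * NT + 8 * n"])
    apply (unfold M_def, rule exI[of _ 0], rule exI[of _ 0], use I0 n_pos in \<open>simp add: prog_cnt_def\<close>)[1]
   apply (erule B)
   apply simp
  apply (rule body, assumption)
  apply (use g0 in \<open>auto simp: M_def\<close>)[1]
  subgoal for rg' ar' t' out'
  proof -
   assume m: "M rg' ar' t' out'" and nb: "\<not> bv rg' ar' (Lt (Rg hX) (Rg gN))"
   have g: "rg' gN = n" using m g0 by (auto simp: M_def)
   then have e: "rg' hX = n" using m nb by (auto simp: M_def)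
   have o: "out' = out" using m by (auto simp: M_def)
   show "Q rg' ar' (Suc t') out'" unfolding o
    by (rule Q) (insert m e B[OF m], auto simp: M_def)
  qed
  done
qed

end

context ram
begin

text \<open>For loops with a known number of rounds; the cost may vary with the round, as the
  degrees of vertices do.\<close>

lemma wp_for:
 assumes le: "a <= N" and init: "M a rg ar out"
  and b: "\<And>i rg ar out. M i rg ar out ==> a <= i ==> i <= N ==> bok rg ar b & (bv rg ar b \<longleftrightarrow> i < N)"
  and step: "\<And>i rg ar t out Q'. M i rg ar out ==> a <= i ==> i < N ==>
   (\<And>rg' ar' t' out'. M (Suc i) rg' ar' out' ==> t' <= t + c i ==> Q' rg' ar' t' out') ==> wp p Q' rg ar t out"
  and fin: "\<And>rg' ar' t' out'. M N rg' ar' out' ==> t' <= t + 1 + (\<Sum>i = a..<N. c i + 1) ==> Q rg' ar' t' out'"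
 shows "wp (Loop b p) Q rg ar t out"
proof -
 define I where "I = (\<lambda>rg' ar' t' out'. \<exists>i. a <= i & i <= N & M i rg' ar' out' & t' <= t + (\<Sum>i = a..<i. c i + 1))"
 have mono: "(\<Sum>i = a..<i. c i + 1) <= (\<Sum>i = a..<N. c i + 1)" if "i <= N" for i
  by (rule sum_mono2) (use that in auto)
 show ?thesis
 proof (rule wp_loop[where I = I and B = "t + (\<Sum>i = a..<N. c i + 1)"])
  show "I rg ar t out" unfolding I_def by (rule exI[of _ a]) (use le init in simp)
  show "t' <= t + (\<Sum>i = a..<N. c i + 1)" if "I rg' ar' t' out'" for rg' ar' t' out'
   using that mono unfolding I_def by (meson add_left_mono le_trans)
  show "bok rg' ar' b" if "I rg' ar' t' out'" for rg' ar' t' out' using that b unfolding I_def by blast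
  show "wp p I rg' ar' (Suc t') out'" if h: "I rg' ar' t' out'" "bv rg' ar' b" for rg' ar' t' out'
  proof -
   obtain i where i: "a <= i" "i <= N" "M i rg' ar' out'" "t' <= t + (\<Sum>i = a..<i. c i + 1)"
    using h(1) unfolding I_def by blast
   then have lt: "i < N" using b h(2) by blast
   show ?thesis
   proof (rule step[OF i(3,1) lt])
    fix rg'' ar'' t'' out''
    assume "M (Suc i) rg'' ar'' out''" "t'' <= Suc t' + c i"
    then show "I rg'' ar'' t'' out''" unfolding I_def using i lt by (intro exI[of _ "Suc i"]) simp
   qed
  qed
  show "Q rg' ar' (Suc t') out'" if h: "I rg' ar' t' out'" "\<not> bv rg' ar' b" for rg' ar' t' out'
  proof -
   obtain i where i: "a <= i" "i <= N" "M i rg' ar' out'" "t' <= t + (\<Sum>i = a..<i. c i + 1)"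
    using h(1) unfolding I_def by blast
   then have "i = N" using b h(2) by (metis le_neq_implies_less)
   then show ?thesis using fin i by simp
  qed
 qed
qed

end

text \<open>The bit was clear, so adding a power of two sets it without a carry.\<close>

lemma binsum_insert:
 assumes "p \<notin> N" "0 < h"
 shows "binsum (\<lambda>i. k * h + i \<in> insert p N) h =
  binsum (\<lambda>i. k * h + i \<in> N) h + (if k = p div h then 2 ^ (p mod h) else 0)"
proof -
 have "of_bool (k * h + i \<in> insert p N) * 2 ^ i = of_bool (k * h + i \<in> N) * 2 ^ i +
   (if i = p mod h then if k = p div h then 2 ^ (p mod h) else 0 else (0 :: nat))" if "i < h" for i
 proof (cases "k * h + i = p")
  case True
  then have "k = p div h" "i = p mod h" using that by auto
  then show ?thesis using assms True by simp
 next
  case False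
  then have "\<not> (i = p mod h & k = p div h)" using div_mult_mod_eq[of p h] by metis
  then show ?thesis using False by auto
 qed
 then have "binsum (\<lambda>i. k * h + i \<in> insert p N) h = (\<Sum>i<h. of_bool (k * h + i \<in> N) * 2 ^ i +
   (if i = p mod h then if k = p div h then 2 ^ (p mod h) else 0 else 0))"
  unfolding binsum_def by (intro sum.cong refl) simp
 also have "\<dots> = binsum (\<lambda>i. k * h + i \<in> N) h + (if k = p div h then 2 ^ (p mod h) else 0)"
  using assms(2) by (simp add: sum.distrib binsum_def sum.delta)
 finally show ?thesis .
qed

context dfs_lev
begin

text \<open>Entry \<open>i\<close> counts level \<open>i - 1\<close>; with this shift the prefix
  sums are the level starts themselves.\<close>

definition cnt :: "nat => nat => nat => nat" where
 "cnt x j i = (if i = 0 then 0 else card {u. (i - 1, u) \<in> lev & (u < x | u = x & i - 1 < j)})"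

definition NXs :: "nat => nat => nat set" where
 "NXs x j = {lpos i u | i u. u < n & i < bl (deg u) & (u < x | u = x & i < j)}"

lemma cnt_0: "cnt 0 0 i = 0"
 by (simp add: cnt_def)

lemma cnt_end: "cnt n 0 (Suc i) = card {u. (i, u) \<in> lev}"
proof -
 have "{u. (i, u) \<in> lev & (u < n | u = n & i < 0)} = {u. (i, u) \<in> lev}" by (auto simp: lev_def)
 then show ?thesis by (simp add: cnt_def)
qed

lemma cnt_Suc:
 assumes "x < n" "j <= bl (deg x)"
 shows "cnt x (Suc j) i = cnt x j i + (if i = Suc j then 1 else 0)"
proof (cases i)
 case (Suc i')
 have f: "finite {u. (i', u) \<in> lev & (u < x | u = x & i' < j)}" by (simp add: lev_def)
 have "{u. (i', u) \<in> lev & (u < x | u = x & i' < Suc j)} =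
   (if i' = j then {x} else {}) \<union> {u. (i', u) \<in> lev & (u < x | u = x & i' < j)}"
  using assms by (auto simp: lev_def less_Suc_eq)
 then show ?thesis using f Suc by (simp add: cnt_def)
qed (simp add: cnt_def)

lemma cnt_next: "x < n ==> cnt x (Suc (bl (deg x))) i = cnt (Suc x) 0 i"
proof -
 have "{u. (i - 1, u) \<in> lev & (u < x | u = x & i - 1 < Suc (bl (deg x)))} =
  {u. (i - 1, u) \<in> lev & (u < Suc x | u = Suc x & i - 1 < 0)}"
  by (auto simp: lev_def less_Suc_eq)
 then show ?thesis by (simp add: cnt_def)
qed

lemma cnt_le: "cnt x j i <= n"
proof -
 have "card {u. (i - 1, u) \<in> lev & (u < x | u = x & i - 1 < j)} <= card {..<n}"
  by (rule card_mono) (auto simp: lev_def)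
 then show ?thesis by (simp add: cnt_def)
qed

lemma NXs_0: "NXs 0 0 = {}" by (simp add: NXs_def)

lemma NXs_end: "NXs n 0 = NX" by (auto simp: NXs_def NX_def)

lemma NXs_next: "x < n ==> NXs x (Suc (bl (deg x))) = NXs (Suc x) 0"
 unfolding NXs_def less_Suc_eq by (intro Collect_cong) auto

lemma NXs_Suc: "x < n ==> NXs x (Suc j) = (if j < bl (deg x) then insert (lpos j x) (NXs x j) else NXs x j)"
 unfolding NXs_def less_Suc_eq by auto

lemma NXs_notin: "x < n ==> j < bl (deg x) ==> lpos j x \<notin> NXs x j"
proof
 assume a: "x < n" "j < bl (deg x)" "lpos j x \<in> NXs x j"
 then obtain i u where q: "lpos j x = lpos i u" "u < n" "i < bl (deg u)" "u < x | u = x & i < j"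
  by (auto simp: NXs_def)
 then have "j = i & x = u" using a by (intro lpos_inj) (simp_all add: lev_def)
 then show False using q(4) by simp
qed

lemma bl_deg: "x < n ==> bl (deg x) <= bl n" using bl_mono deg_le by blast

lemma smallT:
 fixes x :: nat
 shows "x < 2 ^ h ==> x < 2 ^ w" "x < 2 ^ h ==> x < 2 ^ L"
proof -
 show "x < 2 ^ w" if "x < 2 ^ h" by (rule small) (use that h_le in linarith)
 show "x < 2 ^ L" if "x < 2 ^ h"
 proof -
  have "x < 4 * (n + 1)" using that h_le by simp
  also have "\<dots> <= 4 * ((n + 1) * (n + 1))" by simp
  also note L_big
  finally show ?thesis .
 qed
qed

lemma count_ok:
 assumes c: "cst2 rg" and z: "\<forall>i < bl n + 3. ar aCur i = 0"
  and Q: "\<And>rg' ar' t'. (\<forall>i < bl n + 3. ar' aCur i = cnt n 0 i) ==> (\<forall>k. k ~= aCur --> ar' k = ar k) ==>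
   eq_off {hP, hX, hJ, hD} rg' rg ==> t' <= t + 10 + 6 * NT + 8 * n ==> Q rg' ar' t' out"
 shows "wp (scan count_step) Q rg ar t out"
proof (rule scan_ok[OF c, where ?c0.0 = 1 and
  I = "\<lambda>x j ar'. (\<forall>i < bl n + 3. ar' aCur i = cnt x j i) & (\<forall>k. k ~= aCur --> ar' k = ar k)"])
 show "(\<forall>i < bl n + 3. ar aCur i = cnt 0 0 i) & (\<forall>k. k ~= aCur --> ar k = ar k)" using z by (simp add: cnt_0)
next
 fix x j rg' ar' t' and out' :: "nat list" and Q'
 assume x: "x < n" "j <= bl (deg x)"
  and I: "(\<forall>i < bl n + 3. ar' aCur i = cnt x j i) & (\<forall>k. k ~= aCur --> ar' k = ar k)"
  and r: "cst2 rg'" "rg' hX = x" "rg' hJ = j"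
  and Q': "\<And>rg'' ar'' (t'' :: nat). (\<forall>y. y ~= hP --> rg'' y = rg' y) ==>
   (\<forall>i < bl n + 3. ar'' aCur i = cnt x (Suc j) i) & (\<forall>k. k ~= aCur --> ar'' k = ar k) ==> t'' <= t' + 1 ==> Q' rg'' ar'' t'' out'"
 have j: "Suc j < bl n + 3" "j < n + 1" using x bl_deg[of x] bl_le[of n] by simp_all
 have v: "ar' aCur (Suc j) = cnt x j (Suc j)" using I j by blast
 have s: "Suc j < 2 ^ w" "Suc (cnt x j (Suc j)) < 2 ^ w" "1 < (2::nat) ^ w"
  using j cnt_le[of x j "Suc j"] by (intro small; linarith)+
 have sL: "Suc (cnt x j (Suc j)) < 2 ^ L" using cnt_le[of x j "Suc j"] by (intro smallL) simp
 show "wp count_step Q' rg' ar' t' out'" unfolding count_step_def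
  apply (simp add: r s v lens2 wds2 sL)
  apply (intro conjI)
  apply (use j in simp)
  apply (rule Q')
   apply simp
  apply (use I v cnt_Suc[OF x] in simp)
  apply simp
  done
next
 fix x ar'
 assume "x < n" "(\<forall>i < bl n + 3. ar' aCur i = cnt x (Suc (bl (deg x))) i) & (\<forall>k. k ~= aCur --> ar' k = ar k)"
 then show "(\<forall>i < bl n + 3. ar' aCur i = cnt (Suc x) 0 i) & (\<forall>k. k ~= aCur --> ar' k = ar k)"
  by (simp add: cnt_next)
qed (use Q in simp)

lemma prefix_ok:
 assumes c: "cst2 rg" and z: "\<forall>i < bl n + 3. ar aCur i = cnt n 0 i" and J: "rg hJ = 1"
  and Q: "\<And>rg' ar' t'. (\<forall>i < bl n + 3. ar' aCur i = lpos i 0) ==> (\<forall>k. k ~= aCur --> ar' k = ar k) ==>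
   (\<forall>y. y ~= hJ --> rg' y = rg y) ==> t' <= t + 10 + 3 * n ==> Q rg' ar' t' out"
 shows "wp (Loop (Lt (Rg hJ) (Rg gJ +. Lit 1)) prefix_step) Q rg ar t out"
proof -
 define M where "M = (\<lambda>i rg' ar' out'. rg' hJ = i & (\<forall>y. y ~= hJ --> rg' y = rg y) & out' = out &
  (\<forall>k. k ~= aCur --> ar' k = ar k) & (\<forall>j < bl n + 3. ar' aCur j = (if j < i then lpos j 0 else cnt n 0 j)))"
 have l0: "lpos 0 0 = 0" using lpos_0 n_pos by simp
 have g: "rg gJ = bl n + 2" using c by (simp add: cst2_def)
 have s: "bl n + 2 < 2 ^ w" "bl n + 3 < 2 ^ w" "Suc (Suc (bl n)) < 2 ^ w" "Suc (Suc (Suc (bl n))) < 2 ^ w" "1 < (2::nat) ^ w"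
  using bl_le[of n] by (intro small; linarith)+
 show ?thesis
 proof (rule wp_for[where a = 1 and N = "bl n + 3" and M = M and c = "\<lambda>_. 2"], goal_cases)
  show "M 1 rg ar out" using J z l0 by (auto simp: M_def cnt_def)
 next
  fix i rg' ar' out' assume m: "M i rg' ar' out'"
  then have "rg' gJ = bl n + 2" "rg' hJ = i" using g by (simp_all add: M_def)
  then show "bok rg' ar' (Lt (Rg hJ) (Rg gJ +. Lit 1)) & (bv rg' ar' (Lt (Rg hJ) (Rg gJ +. Lit 1)) \<longleftrightarrow> i < bl n + 3)"
   using s by (simp add: eval_nat_numeral)
 next
  case (4 i rg' ar' t' out' Q') note m = 4(1) and i = 4(2,3) and Q' = 4(4)
  obtain e where e: "i = Suc e" using i by (cases i) auto
  have mm: "rg' hJ = Suc e" "ar' aCur (Suc e) = cnt n 0 (Suc e)" "ar' aCur e = lpos e 0"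
   using m i e by (simp_all add: M_def)
  have sum: "cnt n 0 (Suc e) + lpos e 0 = lpos (Suc e) 0" using lpos_level[of e] by (simp add: cnt_end)
  have s2: "lpos (Suc e) 0 < 2 ^ w" "Suc (Suc e) < 2 ^ w"
   using lpos_le[of "Suc e" 0] apply (intro smallNT; linarith)
   using i e bl_le[of n] by (intro small; linarith)
  have sL: "lpos (Suc e) 0 < 2 ^ L" using lpos_le[of "Suc e" 0] by (intro smallNTL) simp
  show "wp prefix_step Q' rg' ar' t' out'" unfolding prefix_step_def
   apply (simp add: mm s s2 sum sL wds2 lens2)
   apply (intro conjI)
    apply (use i e in linarith)+
   apply (rule Q')
   apply (use m e in \<open>auto simp: M_def\<close>)[1]
   apply simp
   done
 next
  case (5 rg' ar' t' out') note m = 5(1) and t = 5(2)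
  have o: "out' = out" using m by (simp add: M_def)
  show "Q rg' ar' t' out'" unfolding o
   by (rule Q) (insert m t bl_le[of n], auto simp: M_def)
 qed simp
qed

lemma fill_ok:
 assumes c: "cst2 rg" and z: "\<forall>i < bl n + 3. ar aCur i = lpos i 0" and zV: "\<forall>k < NT div h + 1. ar aV k = 0"
  and Q: "\<And>rg' ar' t'. (\<forall>k < NT div h + 1. ar' aV k = binsum (\<lambda>i. k * h + i \<in> NX) h) ==>
   (\<forall>k. k ~= aCur & k ~= aV --> ar' k = ar k) ==>
   eq_off {hP, hX, hJ, hD} rg' rg ==> t' <= t + 10 + 9 * NT + 8 * n ==> Q rg' ar' t' out"
 shows "wp (scan fill_step) Q rg ar t out"
proof -
 \<comment> \<open>The cursor of level \<open>i\<close> stands at the first vertex not yet served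
   there: \<open>Suc x\<close> on the levels already done for \<open>x\<close>, otherwise
   \<open>x\<close>.\<close>
 define I where "I = (\<lambda>x j ar'. (\<forall>i < bl n + 3. ar' aCur i = lpos i (if i < j then Suc x else x)) &
  (\<forall>k < NT div h + 1. ar' aV k = binsum (\<lambda>i. k * h + i \<in> NXs x j) h) &
  (\<forall>k. k ~= aCur & k ~= aV --> ar' k = ar k))"
 show ?thesis
 proof (rule scan_ok[OF c, where ?c0.0 = 4 and I = I])
  show "I 0 0 ar" using z zV by (simp add: I_def NXs_0 binsum_def)
 next
  fix x j rg' ar' t' and out' :: "nat list" and Q'
  assume x: "x < n" "j <= bl (deg x)" and I: "I x j ar'" and r: "cst2 rg'" "rg' hX = x" "rg' hJ = j" "rg' hD = (2 * deg x + 1) div 2 ^ j"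
   and Q': "\<And>rg'' ar'' (t'' :: nat). (\<forall>y. y ~= hP --> rg'' y = rg' y) ==> I x (Suc j) ar'' ==> t'' <= t' + 4 ==> Q' rg'' ar'' t'' out'"
  define p where "p = lpos j x"
  have j: "j < bl n + 3" "j < n + 1" using x bl_deg[of x] bl_le[of n] by simp_all
  have jl: "(j, x) \<in> lev" using x by (simp add: lev_def)
  have pl: "p < NT" unfolding p_def by (rule lpos_less[OF jl])
  have Sp: "lpos j (Suc x) = Suc p" using lpos_step[of j x] jl by (simp add: p_def)
  have g: "rg' gH = h" using r(1) by (simp add: cst2_def)
  have v: "ar' aCur j = p" using I j by (simp add: I_def p_def)
  have k: "p div h < Suc (NT div h)" using pl div_le_mono[of p NT h] by simp
  have e: "p mod h < h" using h_pos by simp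
  have pe: "(2 :: nat) ^ (p mod h) < 2 ^ h" using p2_less[OF e] .
  have s: "Suc p < 2 ^ w" "1 < (2::nat) ^ w" "(2::nat) ^ (p mod h) < 2 ^ w"
   using pl pe h_le by (intro smallNT; linarith)+
  have sL: "Suc p < 2 ^ L" using pl by (intro smallNTL) simp
  have V: "ar' aV (p div h) = binsum (\<lambda>i. p div h * h + i \<in> NXs x j) h" using I k by (simp add: I_def)
  have one: "1 < (2 * deg x + 1) div 2 ^ j \<longleftrightarrow> j < bl (deg x)"
  proof -
   have "1 < (2 * deg x + 1) div 2 ^ j \<longleftrightarrow> 0 < (2 * deg x + 1) div 2 ^ j div 2" by linarith
   also have "\<dots> \<longleftrightarrow> Suc j <= bl (deg x)" using level_iff[of x "Suc j"] by (simp only: power_Suc2 div_mult2_eq)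
   finally show ?thesis by (simp only: Suc_le_eq)
  qed
  have cur: "\<forall>i < bl n + 3. ((ar' aCur)(j := Suc p)) i = lpos i (if i < Suc j then Suc x else x)"
   using I Sp by (auto simp: I_def less_Suc_eq)
  show "wp fill_step Q' rg' ar' t' out'"
  proof (cases "j < bl (deg x)")
   case True
   have new: "binsum (\<lambda>i. k * h + i \<in> NXs x (Suc j)) h = binsum (\<lambda>i. k * h + i \<in> NXs x j) h + (if k = p div h then 2 ^ (p mod h) else 0)" for k
    using binsum_insert[OF NXs_notin[OF x(1) True] h_pos, of k] True NXs_Suc[OF x(1), of j] by (simp add: p_def)
   have b: "binsum (\<lambda>i. p div h * h + i \<in> NXs x j) h + 2 ^ (p mod h) < 2 ^ h"
    using new[of "p div h"] binsum_less[of "\<lambda>i. p div h * h + i \<in> NXs x (Suc j)" h] by simp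
   show ?thesis unfolding fill_step_def
    apply (simp add: r(1,2,3) j lens2 v s sL wds2 g k V b)
    apply (simp add: r(4)[simplified] one[simplified] True smallT[OF b] h_pos)
    apply (rule Q')
     apply simp
    apply (use cur I new V in \<open>simp add: I_def\<close>)
    apply simp
    done
  next
   case False
   have new: "NXs x (Suc j) = NXs x j" using False NXs_Suc[OF x(1), of j] by simp
   show ?thesis unfolding fill_step_def
    apply (simp add: r(1,2,3) j lens2 v s sL wds2 g k V)
    apply (simp add: r(4)[simplified] one[simplified] False)
    apply (rule Q')
     apply simp
    apply (use cur I new V in \<open>simp add: I_def\<close>)
    apply simp
    done
  qed
 next
  fix x ar'
  assume x: "x < n" "I x (Suc (bl (deg x))) ar'"
  have "lpos i (if i < Suc (bl (deg x)) then Suc x else x) = lpos i (if i < 0 then Suc (Suc x) else Suc x)" for i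
   using lpos_step[of i x] x(1) by (simp add: lev_def)
  then show "I (Suc x) 0 ar'" using x NXs_next[OF x(1)] by (simp add: I_def)
 next
  fix rg' ar' t'
  assume "I n 0 ar'" "eq_off {hP, hX, hJ, hD} rg' rg" "t' <= t + 10 + (4 + 5) * NT + 8 * n"
  then show "Q rg' ar' t' out" by (intro Q) (simp_all add: I_def NXs_end)
 qed
qed

lemma table_ok:
 assumes c: "cst2 rg" and z: "ar aT 0 = 0" and X: "rg hX = 1"
  and Q: "\<And>rg' ar' t'. (\<forall>i < 2 ^ h. ar' aT i = pc i) ==> (\<forall>k. k ~= aT --> ar' k = ar k) ==>
   (\<forall>y. y ~= hX --> rg' y = rg y) ==> t' <= t + 20 + 12 * n ==> Q rg' ar' t' out"
 shows "wp (Loop (Lt (Rg hX) (Rg gHH)) table_step) Q rg ar t out"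
proof -
 define M where "M = (\<lambda>i rg' ar' out'. rg' hX = i & (\<forall>y. y ~= hX --> rg' y = rg y) & out' = out &
  (\<forall>k. k ~= aT --> ar' k = ar k) & (\<forall>j < i. ar' aT j = pc j))"
 have g: "rg gHH = 2 ^ h" using c by (simp add: cst2_def)
 have l2: "2 < (2::nat) ^ w" "1 < (2::nat) ^ w" by (intro small; simp)+
 show ?thesis
 proof (rule wp_for[where a = 1 and N = "2 ^ h" and M = M and c = "\<lambda>_. 2"], goal_cases)
  show "M 1 rg ar out" using X z by (simp add: M_def)
 next
  fix i rg' ar' out' assume m: "M i rg' ar' out'"
  then have "rg' gHH = 2 ^ h" "rg' hX = i" using g by (simp_all add: M_def)
  then show "bok rg' ar' (Lt (Rg hX) (Rg gHH)) & (bv rg' ar' (Lt (Rg hX) (Rg gHH)) \<longleftrightarrow> i < 2 ^ h)" by simp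
 next
  case (4 i rg' ar' t' out' Q') note m = 4(1) and i = 4(2,3) and Q' = 4(4)
  have mm: "rg' hX = i" "ar' aT (i div 2) = pc (i div 2)" using m i by (simp_all add: M_def)
  have sum: "pc (i div 2) + i mod 2 = pc i" using pc_rec[of i] by simp
  have d: "i div 2 < 2 ^ h" using i by simp
  have s2: "pc i < 2 ^ h" using pc_le[of i] i by simp
  have s3: "Suc i < 2 ^ w" by (rule small) (use i h_le in linarith)
  have new: "M (Suc i) (rg'(hX := Suc i)) (ar'(aT := (ar' aT)(i := pc i))) out'"
   using m by (auto simp: M_def less_Suc_eq)
  show "wp table_step Q' rg' ar' t' out'" unfolding table_step_def
   using i(2) by (simp add: mm l2 sum s3 smallT[OF s2] wds2 lens2 d Q'[OF new])
 next
  case (5 rg' ar' t' out') note m = 5(1) and t = 5(2)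
  have o: "out' = out" using m by (simp add: M_def)
  show "Q rg' ar' t' out'" unfolding o
   by (rule Q) (insert m t h_le, auto simp: M_def)
 qed simp
qed

lemma rank_ok:
 assumes c: "cst2 rg" and V: "\<forall>k < NT div h + 1. ar aV k = binsum (\<lambda>i. k * h + i \<in> NX) h"
  and T: "\<forall>i < 2 ^ h. ar aT i = pc i" and X: "rg hX = 0" "rg hW = 0"
  and Q: "\<And>rg' ar' t'. lrel ar' ==> (\<forall>k. k ~= aA --> ar' k = ar k) ==>
   (\<forall>y. y ~= hX & y ~= hW --> rg' y = rg y) ==> t' <= t + 10 + 4 * NT ==> Q rg' ar' t' out"
 shows "wp (Loop (Lt (Rg hX) (Rg gNT /. Rg gH +. Lit 1)) rank_step) Q rg ar t out"
proof -
 define M where "M = (\<lambda>i rg' ar' out'. rg' hX = i & rg' hW = rank (i * h) & (\<forall>y. y ~= hX & y ~= hW --> rg' y = rg y) & out' = out &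
  (\<forall>k. k ~= aA --> ar' k = ar k) & (\<forall>j < i. ar' aA j = rank (j * h)))"
 have g: "rg gNT = NT" "rg gH = h" using c by (simp_all add: cst2_def)
 have q: "NT div h <= NT" by simp
 have l2: "1 < (2::nat) ^ w" "Suc (NT div h) < 2 ^ w" using q by (intro smallNT; linarith)+
 show ?thesis
 proof (rule wp_for[where a = 0 and N = "NT div h + 1" and M = M and c = "\<lambda>_. 3"], goal_cases)
  show "M 0 rg ar out" using X by (simp add: M_def rank_def)
 next
  fix i rg' ar' out' assume m: "M i rg' ar' out'"
  then have "rg' gNT = NT" "rg' gH = h" "rg' hX = i" using g by (simp_all add: M_def)
  then show "bok rg' ar' (Lt (Rg hX) (Rg gNT /. Rg gH +. Lit 1)) &
   (bv rg' ar' (Lt (Rg hX) (Rg gNT /. Rg gH +. Lit 1)) \<longleftrightarrow> i < NT div h + 1)" using l2 h_pos by simp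
 next
  case (4 i rg' ar' t' out' Q') note m = 4(1) and i = 4(3) and Q' = 4(4)
  define x where "x = binsum (\<lambda>j. i * h + j \<in> NX) h"
  have xl: "x < 2 ^ h" by (simp add: x_def binsum_less)
  have mm: "rg' hX = i" "rg' hW = rank (i * h)" "ar' aV i = x" "ar' aT x = pc x"
   using m i V T xl by (simp_all add: M_def x_def)
  have sum: "rank (i * h) + pc x = rank (Suc i * h)"
   using rank_block[of i h h] by (simp add: x_def pc_binsum algebra_simps)
  have s: "rank (i * h) < 2 ^ w" "rank (Suc i * h) < 2 ^ w" "Suc i < 2 ^ w"
   using rank_le[of "i * h"] rank_le[of "Suc i * h"] i q by (intro smallNT; linarith)+
  have sL: "rank (i * h) < 2 ^ L" using rank_le[of "i * h"] by (intro smallNTL) simp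
  define R where "R = rank (Suc i * h)"
  have new: "M (Suc i) (rg'(hW := R, hX := Suc i)) (ar'(aA := (ar' aA)(i := rank (i * h)))) out'"
   unfolding R_def using m by (auto simp: M_def less_Suc_eq)
  show "wp rank_step Q' rg' ar' t' out'" unfolding rank_step_def
   using i s xl by (simp add: mm l2 sum sL wds2 lens2 R_def[symmetric] Q'[OF new] del: mult_Suc)
 next
  case (5 rg' ar' t' out') note m = 5(1) and t = 5(2)
  have o: "out' = out" using m by (simp add: M_def)
  have "t' <= t + 1 + 4 * (NT div h + 1)" using t by (simp add: mult.commute)
  moreover have "t + 1 + 4 * (z + 1) <= t + 10 + 4 * NT" if "z <= NT" for z using that by simp
  ultimately have t5: "t' <= t + 10 + 4 * NT" using q le_trans by blast
  show "Q rg' ar' t' out'" unfolding o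
   by (rule Q) (insert m t5 V T, auto simp: M_def lrel_def)
 qed simp
qed

lemma build_ok:
 assumes c: "cst2 rg" and z: "\<forall>i < bl n + 3. ar aCur i = 0" "\<forall>k < NT div h + 1. ar aV k = 0" "ar aT 0 = 0"
  and Q: "\<And>rg' ar' t'. lrel ar' ==> eq_off {aV, aA, aT, aCur} ar' ar ==> cst2 rg' ==>
   (\<forall>y\<ge>70. rg' y = rg y) ==> t' <= t + 100 + 50 * NT + 50 * n ==> Q rg' ar' t' out"
 shows "wp build Q rg ar t out"
proof -
 have l1: "1 < (2::nat) ^ w" by (intro small) simp
 show ?thesis unfolding build_def wp_simps(5)
 proof (rule count_ok[where ar = ar, OF c z(1)])
  fix rg1 ar1 t1
  assume 1: "\<forall>i<bl n + 3. ar1 aCur i = cnt n 0 i" "\<forall>k. k ~= aCur --> ar1 k = ar k"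
   "eq_off {hP, hX, hJ, hD} rg1 rg" "t1 <= t + 10 + 6 * NT + 8 * n"
  have c1: "cst2 (rg1(hJ := 1))" by (rule cst2_cong[OF c]) (use 1 in simp)
  show "wp (hJ ::= Lit 1) (wp (Loop (Lt (Rg hJ) (Rg gJ +. Lit 1)) prefix_step) (wp (scan fill_step)
    (wp (hX ::= Lit 1) (wp (Loop (Lt (Rg hX) (Rg gHH)) table_step) (wp (hX ::= Lit 0) (wp (hW ::= Lit 0)
    (wp (Loop (Lt (Rg hX) (Rg gNT /. Rg gH +. Lit 1)) rank_step) Q))))))) rg1 ar1 t1 out"
  proof (subst wp_simps(2), intro conjI)
   show "wp (Loop (Lt (Rg hJ) (Rg gJ +. Lit 1)) prefix_step) (wp (scan fill_step)
    (wp (hX ::= Lit 1) (wp (Loop (Lt (Rg hX) (Rg gHH)) table_step) (wp (hX ::= Lit 0) (wp (hW ::= Lit 0)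
    (wp (Loop (Lt (Rg hX) (Rg gNT /. Rg gH +. Lit 1)) rank_step) Q)))))) (rg1(hJ := ev rg1 ar1 (Lit 1))) ar1 (Suc t1) out"
    unfolding ev.simps
   proof (rule prefix_ok[where ar = ar1, OF c1 1(1)])
    fix rg2 ar2 t2
    assume 2: "\<forall>i<bl n + 3. ar2 aCur i = lpos i 0" "\<forall>k. k ~= aCur --> ar2 k = ar1 k"
     "\<forall>y. y ~= hJ --> rg2 y = (rg1(hJ := 1)) y" "t2 <= Suc t1 + 10 + 3 * n"
    have c2: "cst2 rg2" by (rule cst2_cong[OF c1]) (use 2 in simp)
    have V2: "\<forall>k < NT div h + 1. ar2 aV k = 0" using 2 1 z by simp
    show "wp (scan fill_step) (wp (hX ::= Lit 1) (wp (Loop (Lt (Rg hX) (Rg gHH)) table_step) (wp (hX ::= Lit 0) (wp (hW ::= Lit 0)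
    (wp (Loop (Lt (Rg hX) (Rg gNT /. Rg gH +. Lit 1)) rank_step) Q))))) rg2 ar2 t2 out"
    proof (rule fill_ok[where ar = ar2, OF c2 2(1) V2])
     fix rg3 ar3 t3
     assume 3: "\<forall>k<NT div h + 1. ar3 aV k = binsum (\<lambda>i. k * h + i \<in> NX) h" "\<forall>k. k ~= aCur & k ~= aV --> ar3 k = ar2 k"
      "eq_off {hP, hX, hJ, hD} rg3 rg2" "t3 <= t2 + 10 + 9 * NT + 8 * n"
     have c3: "cst2 (rg3(hX := 1))" by (rule cst2_cong[OF c2]) (use 3 in simp)
     have T3: "ar3 aT 0 = 0" using 3 2 1 z by simp
     show "wp (hX ::= Lit 1) (wp (Loop (Lt (Rg hX) (Rg gHH)) table_step) (wp (hX ::= Lit 0) (wp (hW ::= Lit 0)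
      (wp (Loop (Lt (Rg hX) (Rg gNT /. Rg gH +. Lit 1)) rank_step) Q)))) rg3 ar3 t3 out"
     proof (subst wp_simps(2), intro conjI)
      show "wp (Loop (Lt (Rg hX) (Rg gHH)) table_step) (wp (hX ::= Lit 0) (wp (hW ::= Lit 0)
       (wp (Loop (Lt (Rg hX) (Rg gNT /. Rg gH +. Lit 1)) rank_step) Q))) (rg3(hX := ev rg3 ar3 (Lit 1))) ar3 (Suc t3) out"
       unfolding ev.simps
      proof (rule table_ok[where ar = ar3, OF c3 T3])
       fix rg4 ar4 t4
       assume 4: "\<forall>i<2 ^ h. ar4 aT i = pc i" "\<forall>k. k ~= aT --> ar4 k = ar3 k"
        "\<forall>y. y ~= hX --> rg4 y = (rg3(hX := 1)) y" "t4 <= Suc t3 + 20 + 12 * n"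
       have c4: "cst2 (rg4(hX := 0, hW := 0))" by (rule cst2_cong[OF c3]) (use 4 in simp)
       have V4: "\<forall>k<NT div h + 1. ar4 aV k = binsum (\<lambda>i. k * h + i \<in> NX) h" using 4 3 by simp
       have "wp (Loop (Lt (Rg hX) (Rg gNT /. Rg gH +. Lit 1)) rank_step) Q (rg4(hX := 0, hW := 0)) ar4 (Suc (Suc t4)) out"
       proof (rule rank_ok[where ar = ar4, OF c4 V4 4(1)])
        fix rg5 ar5 t5
        assume 5: "lrel ar5" "\<forall>k. k ~= aA --> ar5 k = ar4 k"
         "\<forall>y. y ~= hX & y ~= hW --> rg5 y = (rg4(hX := 0, hW := 0)) y" "t5 <= Suc (Suc t4) + 10 + 4 * NT"
        show "Q rg5 ar5 t5 out"
        proof (rule Q[OF 5(1)])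
         show "cst2 rg5" by (rule cst2_cong[OF c4]) (use 5 in simp)
         show "t5 <= t + 100 + 50 * NT + 50 * n" using 1(4) 2(4) 3(4) 4(4) 5(4) by linarith
        qed (use 1 2 3 4 5 in simp_all)
       qed simp_all
       then show "wp (hX ::= Lit 0) (wp (hW ::= Lit 0)
        (wp (Loop (Lt (Rg hX) (Rg gNT /. Rg gH +. Lit 1)) rank_step) Q)) rg4 ar4 t4 out"
        by (simp add: w_pos)
      qed simp
     qed (simp_all add: l1 w_pos)
    qed
   qed simp
  qed (simp_all add: l1 w_pos)
 qed
qed

end

section \<open>Reading, writing and decrementing the number of a vertex\<close>

definition walk :: "prg => prg" where
 "walk pb = hP ::= Rg hX ;; hD ::= Dg (Rg hX) ;;
  Loop (Lt (Lit 0) (Rg hD)) (pb ;; hD ::= Rg hD /. Lit 2 ;; hP ::= nextE)"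

definition
 "get_bit = Cond (Eqv (Arr aPI (Rg hP)) (Lit 1)) (hI ::= Rg hI +. Rg hW) Nop ;; hW ::= Rg hW *. Lit 2"

definition
 "get = hI ::= Lit 0 ;; hW ::= Lit 1 ;; walk get_bit"

definition
 "put_bits = Put aPI (Rg hP) (Rg hI %. Lit 2) ;; hI ::= Rg hI /. Lit 2 ;;
  Put aCT (Rg hP) (Rg hC %. Lit 2) ;; hC ::= Rg hC /. Lit 2"

text \<open>Borrow propagation: zeros become ones until a one is met. If there is none, the number
  was 0 and \<open>hO\<close> stays 1, which signals the underflow.\<close>

definition
 "dec_body = Cond (Eqv (Arr aCT (Rg hP)) (Lit 1))
  (Put aCT (Rg hP) (Lit 0) ;; hD ::= Lit 0 ;; hO ::= Lit 0)
  (Put aCT (Rg hP) (Lit 1) ;; hD ::= Rg hD /. Lit 2 ;; hP ::= nextE)"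

definition
 "dec = hP ::= Rg hX ;; hD ::= Dg (Rg hX) ;; hO ::= Lit 1 ;; Loop (Lt (Lit 0) (Rg hD)) dec_body"

context dfs_lev
begin

definition nbits :: "(nat => nat) => nat => nat => nat" where
 "nbits f x m = (\<Sum>j<m. f (lpos j x) * 2 ^ j)"

definition nval :: "(nat => nat) => nat => nat" where
 "nval f x = nbits f x (bl (deg x))"

definition isbit :: "(nat => nat) => bool" where
 "isbit f \<longleftrightarrow> (\<forall>p<NT. f p <= 1)"

lemma nbits_Suc: "nbits f x (Suc j) = nbits f x j + f (lpos j x) * 2 ^ j" by (simp add: nbits_def)

lemma nbits_cong: "(\<And>j. j < m ==> f (lpos j x) = g (lpos j x)) ==> nbits f x m = nbits g x m"
 by (simp add: nbits_def)

lemma lpos_lt: "x < n ==> j <= bl (deg x) ==> lpos j x < NT"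
 by (rule lpos_less) (simp add: lev_def)

lemma lpos_eq: "x < n ==> j <= bl (deg x) ==> y < n ==> i <= bl (deg y) ==> lpos j x = lpos i y \<longleftrightarrow> j = i & x = y"
 using lpos_inj[of j x i y] by (auto simp: lev_def)

lemma nbits_less:
 assumes "isbit f" "x < n" shows "m <= bl (deg x) ==> nbits f x m < 2 ^ m"
proof (induction m)
 case (Suc m)
 have "f (lpos m x) <= 1" using assms Suc lpos_lt[of x m] by (simp add: isbit_def)
 then have "f (lpos m x) * 2 ^ m <= 1 * 2 ^ m" by (rule mult_le_mono1)
 moreover have "nbits f x (Suc m) = nbits f x m + f (lpos m x) * 2 ^ m" by (simp add: nbits_def)
 moreover have "nbits f x m < 2 ^ m" using Suc by simp
 moreover have "(2 :: nat) ^ Suc m = 2 ^ m + 2 ^ m" by simp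
 ultimately show ?case by linarith
qed (simp add: nbits_def)

lemma nbits_digits: "(\<And>j. j < m ==> f (lpos j x) = a div 2 ^ j mod 2) ==> nbits f x m = a mod 2 ^ m"
proof (induction m)
 case (Suc m)
 have "nbits f x (Suc m) = a mod 2 ^ m + a div 2 ^ m mod 2 * 2 ^ m" using Suc by (simp add: nbits_def)
 also have "\<dots> = a mod 2 ^ Suc m" by (simp add: mod_mult2_eq power_Suc2 del: power_Suc)
 finally show ?case .
qed (simp add: nbits_def)

lemma pow_le_deg: "j < bl d ==> 2 ^ j <= d"
 using bl_iff[of j d] by (metis div_less leI less_irrefl)

text \<open>The invariant sees only the registers and arrays that a digit step may change, so one
  rule serves reading and writing. The number of digits is read off the degree, which is halved in
  \<open>hD\<close>.\<close>

lemma walk_ok: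
 assumes l: "lrel ar" and c: "cst2 rg" and x: "x < n" "rg hX = x"
  and I0: "I 0 (rg hI) (rg hW) (rg hC) ar"
  and step: "\<And>j rg' ar' t' out' Q'. j < bl (deg x) ==> I j (rg' hI) (rg' hW) (rg' hC) ar' ==> rg' hP = lpos j x ==>
   (\<And>rg'' ar'' t''. I (Suc j) (rg'' hI) (rg'' hW) (rg'' hC) ar'' ==> eq_off {hI, hW, hC} rg'' rg' ==>
    eq_off {aPI, aCT} ar'' ar' ==> t'' <= t' + c0 ==> Q' rg'' ar'' t'' out') ==> wp pb Q' rg' ar' t' out'"
  and Q: "\<And>rg' ar' t'. I (bl (deg x)) (rg' hI) (rg' hW) (rg' hC) ar' ==> eq_off {hP, hD, hI, hW, hC} rg' rg ==>
   eq_off {aPI, aCT} ar' ar ==> t' <= t + 3 + (c0 + 3) * bl (deg x) ==> Q rg' ar' t' out"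
 shows "wp (walk pb) Q rg ar t out"
proof -
 define M where "M = (\<lambda>j rg' ar' out'. I j (rg' hI) (rg' hW) (rg' hC) ar' & (j < bl (deg x) --> rg' hP = lpos j x) & rg' hD = deg x div 2 ^ j &
  eq_off {hP, hD, hI, hW, hC} rg' rg & eq_off {aPI, aCT} ar' ar & out' = out)"
 have lit2: "2 < (2 :: nat) ^ w" by (intro small) simp
 have "deg x < 2 ^ w" using deg_le[OF x(1)] by (intro small) simp
 then show ?thesis unfolding walk_def
  apply (simp add: x)
  apply (rule wp_for[where a = 0 and N = "bl (deg x)" and M = M and c = "\<lambda>_. c0 + 2"])
    apply simp
  subgoal using I0 x by (simp add: M_def lpos_0)
  subgoal for i rg' ar' out' by (simp add: M_def bl_iff)
  subgoal for i rg' ar' t' out' Q'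
  proof -
   assume m: "M i rg' ar' out'" and i: "i < bl (deg x)"
    and Q': "\<And>rg'' ar'' t'' out''. M (Suc i) rg'' ar'' out'' ==> t'' <= t' + (c0 + 2) ==> Q' rg'' ar'' t'' out''"
   show "wp (pb ;; hD ::= Rg hD /. Lit 2 ;; hP ::= nextE) Q' rg' ar' t' out'"
    unfolding wp_simps(5)
   proof (rule step[OF i])
    show "I i (rg' hI) (rg' hW) (rg' hC) ar'" "rg' hP = lpos i x" using m i by (simp_all add: M_def)
    fix rg'' ar'' t''
    assume n: "I (Suc i) (rg'' hI) (rg'' hW) (rg'' hC) ar''" "eq_off {hI, hW, hC} rg'' rg'"
     "eq_off {aPI, aCT} ar'' ar'" "t'' <= t' + c0"
    define rg3 where "rg3 = rg''(hD := deg x div 2 ^ i div 2)"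
    have D: "rg'' hD = deg x div 2 ^ i" using n m by (simp add: M_def)
    have l3: "lrel ar''" using l n m by (simp add: lrel_def M_def)
    have c3: "cst2 rg3" by (rule cst2_cong[OF c]) (insert n m, simp add: M_def rg3_def)
    have p3: "rg3 hP = lpos i x" using n m i by (simp add: M_def rg3_def)
    note nx = next_ok[OF l3 c3 x(1) i p3]
    show "wp (hD ::= Rg hD /. Lit 2) (wp (hP ::= nextE) Q') rg'' ar'' t'' out'"
     apply (simp add: D lit2)
     apply (simp add: rg3_def[symmetric] nx)
     apply (rule Q')
     apply (use n m in \<open>auto simp: M_def rg3_def div_mult2_eq power_Suc2 simp del: power_Suc\<close>)
     done
   qed
  qed
  subgoal for rg' ar' t' out'
   unfolding M_def by (elim conjE, simp only:, rule Q) (simp_all add: algebra_simps)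
  done
qed

lemma get_ok:
 assumes l: "lrel ar" and c: "cst2 rg" and x: "x < n" "rg hX = x" and b: "isbit (ar aPI)"
  and Q: "\<And>rg' t'. rg' hI = nval (ar aPI) x ==> eq_off {hP, hD, hI, hW, hC} rg' rg ==>
   t' <= t + 5 + 8 * bl (deg x) ==> Q rg' ar t' out"
 shows "wp get Q rg ar t out"
proof -
 define I where "I = (\<lambda>j a (b :: nat) (c :: nat) ar'. a = nbits (ar aPI) x j & b = 2 ^ j & ar' = ar)"
 have lit2: "2 < (2 :: nat) ^ w" "Suc 0 < 2 ^ w" by (intro small; simp)+
 have "wp (walk get_bit) Q (rg(hI := 0, hW := Suc 0)) ar (Suc (Suc t)) out"
 proof (rule walk_ok[where I = I and ?c0.0 = 4, OF l _ x(1)])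
  show "cst2 (rg(hI := 0, hW := Suc 0))" by (rule cst2_cong[OF c]) simp
  show "I 0 ((rg(hI := 0, hW := Suc 0)) hI) ((rg(hI := 0, hW := Suc 0)) hW) ((rg(hI := 0, hW := Suc 0)) hC) ar"
   by (simp add: I_def nbits_def)
 next
  fix j rg' ar' t' out' Q'
  assume j: "j < bl (deg x)" and I: "I j (rg' hI) (rg' hW) (rg' hC) ar'" and P: "rg' hP = lpos j x"
   and Q': "\<And>rg'' ar'' (t'' :: nat). I (Suc j) (rg'' hI) (rg'' hW) (rg'' hC) ar'' ==> eq_off {hI, hW, hC} rg'' rg' ==>
    eq_off {aPI, aCT} ar'' ar' ==> t'' <= t' + 4 ==> Q' rg'' ar'' t'' (out' :: nat list)"
  have f: "ar aPI (lpos j x) <= 1" using b lpos_lt[of x j] x(1) j by (simp add: isbit_def)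
  have pj: "(2::nat) ^ j <= n" using pow_le_deg[OF j] deg_le[OF x(1)] by simp
  have nl: "nbits (ar aPI) x j < 2 ^ j" using nbits_less[OF b x(1)] j by simp
  have s: "nbits (ar aPI) x j + 2 ^ j < 2 ^ w" "(2::nat) ^ j * 2 < 2 ^ w" using pj nl by (intro small; linarith)+
  have r: "rg' hI = nbits (ar aPI) x j" "rg' hW = 2 ^ j" "ar' = ar" using I by (simp_all add: I_def)
  have pn: "lpos j x < NT" using lpos_lt[of x j] x(1) j by simp
  show "wp get_bit Q' rg' ar' t' out'" unfolding get_bit_def
   apply (simp add: r P s lens2 pn lit2)
   apply (intro conjI impI)
   apply (rule Q')
     apply (simp add: I_def nbits_Suc)
    apply (simp_all add: r)
   apply (rule Q')
    apply (use f in \<open>simp add: I_def nbits_Suc le_Suc_eq\<close>)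
    apply (simp_all add: r)
   done
 next
  fix rg' ar' t'
  assume I: "I (bl (deg x)) (rg' hI) (rg' hW) (rg' hC) ar'" and r: "\<forall>y. y \<notin> {hP, hD, hI, hW, hC} --> rg' y = (rg(hI := 0, hW := Suc 0)) y"
   and t: "t' <= Suc (Suc t) + 3 + (4 + 3) * bl (deg x)"
  have "ar' = ar" using I by (simp add: I_def)
  then show "Q rg' ar' t' out" using I r t by (simp, intro Q) (simp_all add: I_def nval_def)
 qed (use x in simp)
 then show ?thesis unfolding get_def using lit2 w_pos by simp
qed

lemma put_ok:
 assumes l: "lrel ar" and c: "cst2 rg" and x: "x < n" "rg hX = x" and b: "isbit (ar aPI)" "isbit (ar aCT)"
  and a: "rg hI = a" "a <= deg x" "rg hC = d" "d <= deg x"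
  and Q: "\<And>rg' ar' t'. isbit (ar' aPI) ==> isbit (ar' aCT) ==>
   (\<And>y. y < n ==> nval (ar' aPI) y = (if y = x then a else nval (ar aPI) y)) ==>
   (\<And>y. y < n ==> nval (ar' aCT) y = (if y = x then d else nval (ar aCT) y)) ==>
   eq_off {aPI, aCT} ar' ar ==>
   eq_off {hP, hD, hI, hW, hC} rg' rg ==>
   t' <= t + 3 + 7 * bl (deg x) ==> Q rg' ar' t' out"
 shows "wp (walk put_bits) Q rg ar t out"
proof -
 define I where "I = (\<lambda>(j :: nat) a' (b' :: nat) d' ar'. a' = a div 2 ^ j & d' = d div 2 ^ j & isbit (ar' aPI) & isbit (ar' aCT) &
  (\<forall>i<j. ar' aPI (lpos i x) = a div 2 ^ i mod 2 & ar' aCT (lpos i x) = d div 2 ^ i mod 2) &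
  (\<forall>y<n. y ~= x --> (\<forall>i<bl (deg y). ar' aPI (lpos i y) = ar aPI (lpos i y) & ar' aCT (lpos i y) = ar aCT (lpos i y))))"
 have lit2: "2 < (2 :: nat) ^ w" by (intro small; simp)
 show ?thesis
 proof (rule walk_ok[where I = I and ?c0.0 = 4, OF l c x])
  show "I 0 (rg hI) (rg hW) (rg hC) ar" using a b by (simp add: I_def)
 next
  fix j rg' ar' t' out' Q'
  assume j: "j < bl (deg x)" and I: "I j (rg' hI) (rg' hW) (rg' hC) ar'" and P: "rg' hP = lpos j x"
   and Q': "\<And>rg'' ar'' (t'' :: nat). I (Suc j) (rg'' hI) (rg'' hW) (rg'' hC) ar'' ==> eq_off {hI, hW, hC} rg'' rg' ==>
    eq_off {aPI, aCT} ar'' ar' ==> t'' <= t' + 4 ==> Q' rg'' ar'' t'' (out' :: nat list)"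
  have pn: "lpos j x < NT" using lpos_lt[of x j] x(1) j by simp
  have r: "rg' hI = a div 2 ^ j" "rg' hC = d div 2 ^ j" using I by (simp_all add: I_def)
  define A where "A = a div 2 ^ j"
  define D where "D = d div 2 ^ j"
  have m2: "A mod 2 < 2" "D mod 2 < 2" by simp_all
  have nx: "\<forall>i<bl (deg y). lpos i y ~= lpos j x" if "y < n" "y ~= x" for y
   using that j x(1) lpos_eq[of y _ x j] by auto
  have ni: "\<forall>i<j. lpos i x ~= lpos j x" using j x(1) lpos_eq[of x _ x j] by auto
  have new: "I (Suc j) (A div 2) b' (D div 2) (ar'(aPI := (ar' aPI)(lpos j x := A mod 2), aCT := (ar' aCT)(lpos j x := D mod 2)))" for b'
   unfolding I_def
  proof (intro conjI)
   show "A div 2 = a div 2 ^ Suc j" "D div 2 = d div 2 ^ Suc j"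
    by (simp_all add: A_def D_def div_mult2_eq power_Suc2 del: power_Suc)
  qed (insert I m2 nx ni, auto simp: I_def isbit_def less_Suc_eq A_def D_def)
  show "wp put_bits Q' rg' ar' t' out'" unfolding put_bits_def
   apply (simp add: r P lens2 wds2 pn lit2 A_def[symmetric] D_def[symmetric])
   apply (rule Q')
    apply (simp add: new)
    apply simp_all
   done
 next
  fix rg' ar' t'
  assume I: "I (bl (deg x)) (rg' hI) (rg' hW) (rg' hC) ar'" and r: "eq_off {hP, hD, hI, hW, hC} rg' rg"
   and k: "eq_off {aPI, aCT} ar' ar" and t: "t' <= t + 3 + (4 + 3) * bl (deg x)"
  have le: "a mod 2 ^ bl (deg x) = a" "d mod 2 ^ bl (deg x) = d"
   using a bl_less[of "deg x"] by simp_all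
  have vx: "nval (ar' aPI) x = a" "nval (ar' aCT) x = d" unfolding nval_def
   using nbits_digits[of "bl (deg x)" "ar' aPI" x a] nbits_digits[of "bl (deg x)" "ar' aCT" x d] I le
   by (simp_all add: I_def)
  have vy: "nval (ar' aPI) y = nval (ar aPI) y & nval (ar' aCT) y = nval (ar aCT) y" if "y < n" "y ~= x" for y
   unfolding nval_def using I that by (intro conjI nbits_cong) (auto simp: I_def)
  show "Q rg' ar' t' out"
   by (rule Q) (insert I r k t vx vy, auto simp: I_def)
 qed
qed

text \<open>The potential of binary counters under decrements, over all vertices at once: every
  digit flipped from 0 to 1 lowers it, and a decrement flips at most one digit back.\<close>

definition zeros :: "(nat => nat) => nat" where
 "zeros f = card {p. p < NT & f p = 0}"

lemma zeros_one: "p < NT ==> f p = 0 ==> zeros f = Suc (zeros (f(p := Suc 0)))"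
proof -
 assume p: "p < NT" "f p = 0"
 have "{q. q < NT & f q = 0} = insert p {q. q < NT & (f(p := Suc 0)) q = 0}" using p by auto
 then show ?thesis by (simp add: zeros_def)
qed

lemma zeros_zero: "p < NT ==> f p = 1 ==> zeros (f(p := 0)) = Suc (zeros f)"
proof -
 assume p: "p < NT" "f p = 1"
 have "{q. q < NT & (f(p := 0)) q = 0} = insert p {q. q < NT & f q = 0}" using p by auto
 moreover have "p \<notin> {q. q < NT & f q = 0}" using p by simp
 ultimately show ?thesis by (simp add: zeros_def)
qed

lemma zeros_le: "zeros f <= NT"
proof -
 have "card {p. p < NT & f p = 0} <= card {..<NT}" by (rule card_mono) auto
 then show ?thesis by (simp add: zeros_def)
qed

text \<open>A decrement that flips \<open>k\<close> zeros to ones is paid for by the zeros lost, up to a constant.\<close>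

lemma dec_ok:
 assumes l: "lrel ar" and c: "cst2 rg" and x: "x < n" "rg hX = x" and b: "isbit (ar aCT)"
  and Q: "\<And>rg' f t'. isbit f ==> rg' hO = (if nval (ar aCT) x = 0 then 1 else 0) ==>
   (0 < nval (ar aCT) x ==> nval f x + 1 = nval (ar aCT) x) ==>
   (\<And>y. y < n ==> y ~= x ==> nval f y = nval (ar aCT) y) ==>
   eq_off {hP, hD, hO} rg' rg ==>
   t' + 5 * zeros f <= t + 20 + 5 * zeros (ar aCT) ==> Q rg' (ar(aCT := f)) t' out"
 shows "wp dec Q rg ar t out"
proof -
 define f0 where "f0 = ar aCT"
 define C where "C = (\<lambda>f rg' ar' out'. isbit f & (\<forall>y<n. y ~= x --> (\<forall>i<bl (deg y). f (lpos i y) = f0 (lpos i y))) &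
  eq_off {hP, hD, hO} rg' rg & ar' = ar(aCT := f) & out' = out)"
 \<comment> \<open>\<open>A\<close>: the borrow has passed the lowest \<open>j\<close> digits,
   turning zeros into ones. The next predicate \<open>E\<close>: it has been absorbed by digit
   \<open>j\<close>.\<close>
 define A where "A = (\<lambda>f (j::nat). \<forall>i. (i < j --> f0 (lpos i x) = 0 & f (lpos i x) = 1) &
  (j <= i & i < bl (deg x) --> f (lpos i x) = f0 (lpos i x)))"
 define E where "E = (\<lambda>f (j::nat). j < bl (deg x) & (\<forall>i<j. f0 (lpos i x) = 0 & f (lpos i x) = 1) & f0 (lpos j x) = 1 &
  f (lpos j x) = 0 & (\<forall>i. j < i & i < bl (deg x) --> f (lpos i x) = f0 (lpos i x)))"
 define I where "I = (\<lambda>rg' ar' t' out'. \<exists>f j. C f rg' ar' out' & j <= bl (deg x) &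
  ((rg' hO = 1 & rg' hD = deg x div 2 ^ j & (j < bl (deg x) --> rg' hP = lpos j x) & A f j & t' + 5 * zeros f <= t + 3 + 5 * zeros f0) \<or>
  (rg' hO = 0 & rg' hD = 0 & E f j & t' + 5 * zeros f <= t + 15 + 5 * zeros f0)))"
 have l2: "2 < (2::nat) ^ w" "Suc 0 < 2 ^ w" "deg x < 2 ^ w" using deg_le[OF x(1)] by (intro small; simp)+
 have "wp (Loop (Lt (Lit 0) (Rg hD)) dec_body) Q (rg(hP := x, hD := deg x, hO := 1)) ar (t + 3) out"
 proof (rule wp_loop[where I = I and B = "t + 15 + 5 * zeros f0"])
  have "C f0 (rg(hP := x, hD := deg x, hO := 1)) ar out" using b by (simp add: C_def f0_def)
  moreover have "A f0 0" by (simp add: A_def)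
  ultimately show "I (rg(hP := x, hD := deg x, hO := 1)) ar (t + 3) out" unfolding I_def
   by (intro exI[of _ f0] exI[of _ 0]) (simp add: lpos_0[OF x(1)])
 next
  fix rg' ar' t' out' assume "I rg' ar' t' out'"
  then show "t' <= t + 15 + 5 * zeros f0" unfolding I_def by auto
 next
  fix rg' ar' t' out' assume I: "I rg' ar' t' out'" and bv: "bv rg' ar' (Lt (Lit 0) (Rg hD))"
  then obtain f j where C: "C f rg' ar' out'" and jl: "j <= bl (deg x)" and r: "rg' hO = 1" "rg' hD = deg x div 2 ^ j"
   "j < bl (deg x) --> rg' hP = lpos j x" and A: "A f j" and t: "t' + 5 * zeros f <= t + 3 + 5 * zeros f0"
   unfolding I_def by auto
  have j: "j < bl (deg x)" using bv r by (simp add: bl_iff)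
  have P: "rg' hP = lpos j x" using r j by simp
  have pn: "lpos j x < NT" using lpos_lt[OF x(1)] j by simp
  have ct: "ar' aCT = f" using C by (simp add: C_def)
  have fb: "f (lpos j x) <= 1" using C pn by (simp add: C_def isbit_def)
  have nx: "\<forall>i<bl (deg y). lpos i y ~= lpos j x" if "y < n" "y ~= x" for y
   using that j x(1) lpos_eq[of y _ x j] by auto
  have ni: "lpos i x ~= lpos j x" if "i < bl (deg x)" "i ~= j" for i using that j x(1) lpos_eq[of x i x j] by auto
  have Cn: "C (f(lpos j x := z)) rg'' (ar'(aCT := f(lpos j x := z))) out'"
   if "z <= 1" "eq_off {hP, hD, hO} rg'' rg'" for z rg''
   using C that nx by (simp add: C_def isbit_def)
  show "wp dec_body I rg' ar' (Suc t') out'"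
  proof (cases "f (lpos j x) = 1")
   case True
   define g where "g = f(lpos j x := 0)"
   have E: "E g j" unfolding E_def
   proof (intro conjI allI impI)
    fix i assume i: "i < j"
    show "f0 (lpos i x) = 0" "g (lpos i x) = 1" using A i ni[of i] j by (simp_all add: A_def g_def)
   next
    show "f0 (lpos j x) = 1" using A j True by (simp add: A_def)
    fix i assume i: "j < i & i < bl (deg x)"
    then show "g (lpos i x) = f0 (lpos i x)" using A ni[of i] by (simp add: A_def g_def)
   qed (simp_all add: j g_def)
   have zg: "zeros g = Suc (zeros f)" unfolding g_def using zeros_zero[of "lpos j x" f] pn True by simp
   show ?thesis unfolding dec_body_def
    using True apply (simp add: P ct lens2 pn l2 w_pos)
    unfolding I_def g_def[symmetric]
    apply (rule exI[of _ g], rule exI[of _ j])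
    using E jl t zg Cn[of 0 "rg'(hD := 0, hO := 0)"] by (simp add: g_def)
  next
   case False
   then have z: "f (lpos j x) = 0" using fb by simp
   define g where "g = f(lpos j x := Suc 0)"
   have A': "A g (Suc j)" unfolding A_def
   proof (intro allI conjI impI)
    fix i assume i: "i < Suc j"
    show "f0 (lpos i x) = 0" "g (lpos i x) = 1" using A i ni[of i] j z by (auto simp: A_def g_def less_Suc_eq)
   next
    fix i assume i: "Suc j <= i & i < bl (deg x)"
    then show "g (lpos i x) = f0 (lpos i x)" using A ni[of i] by (simp add: A_def g_def)
   qed
   have zg: "zeros f = Suc (zeros g)" unfolding g_def using zeros_one[of "lpos j x" f] pn z by simp
   define rg3 where "rg3 = rg'(hD := deg x div 2 ^ j div 2)"
   have l3: "lrel (ar'(aCT := g))" using l C by (simp add: lrel_def C_def)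
   have c3: "cst2 rg3" by (rule cst2_cong[OF c]) (insert C, simp add: C_def rg3_def)
   have p3: "rg3 hP = lpos j x" using P by (simp add: rg3_def)
   note nx = next_ok[OF l3 c3 x(1) j p3]
   show ?thesis unfolding dec_body_def
    apply (simp add: P ct z lens2 wds2 pn l2 w_pos r(2) g_def[symmetric])
    apply (simp add: rg3_def[symmetric] nx)
    unfolding I_def
    apply (rule exI[of _ g], rule exI[of _ "Suc j"])
    using A' j t zg Cn[of 1 "rg3(hP := lpos (Suc j) x)"] r(1)
    by (simp add: g_def rg3_def div_mult2_eq power_Suc2 del: power_Suc)
  qed
 next
  fix rg' ar' t' out' assume I: "I rg' ar' t' out'" and bv: "\<not> bv rg' ar' (Lt (Lit 0) (Rg hD))"
  then obtain f j where C: "C f rg' ar' out'" and jl: "j <= bl (deg x)" and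
   alt: "rg' hO = 1 & rg' hD = deg x div 2 ^ j & A f j & t' + 5 * zeros f <= t + 3 + 5 * zeros f0 \<or>
    rg' hO = 0 & E f j & t' + 5 * zeros f <= t + 15 + 5 * zeros f0"
   unfolding I_def by auto
  have al: "ar' = ar(aCT := f)" "out' = out" using C by (simp_all add: C_def)
  have oth: "nval f y = nval f0 y" if "y < n" "y ~= x" for y
   unfolding nval_def using C that by (intro nbits_cong) (simp add: C_def)
  have key: "rg' hO = (if nval f0 x = 0 then 1 else 0) & (0 < nval f0 x --> nval f x + 1 = nval f0 x)"
   using alt
  proof
   assume a: "rg' hO = 1 & rg' hD = deg x div 2 ^ j & A f j & t' + 5 * zeros f <= t + 3 + 5 * zeros f0"
   have "j = bl (deg x)" using a bv jl bl_iff[of j "deg x"] by auto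
   then have "nval f0 x = 0" using a by (simp add: nval_def nbits_def A_def)
   then show ?thesis using a by simp
  next
   assume a: "rg' hO = 0 & E f j & t' + 5 * zeros f <= t + 15 + 5 * zeros f0"
   have "nval f x + 1 = nval f0 x"
   proof -
    have e: "j < m ==> m <= bl (deg x) ==> nbits f x m + 1 = nbits f0 x m" for m
    proof (induction m)
     case (Suc m)
     \<comment> \<open>The digits below \<open>j\<close> rise from value 0 to
       \<open>2 ^ j - 1\<close> while digit \<open>j\<close> loses \<open>2 ^ j\<close>, a
       difference of 1.\<close>
     have low: "nbits f0 x i = 0 & nbits f x i + 1 = 2 ^ i" if "i <= j" for i
      using that by (induction i) (insert a, simp_all add: nbits_def E_def)
     show ?case
     proof (cases "j = m")
      case True
      then show ?thesis using low[of m] a by (simp add: nbits_def E_def)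
     next
      case False
      then show ?thesis using Suc a by (simp add: nbits_def E_def)
     qed
    qed simp
    show ?thesis unfolding nval_def by (rule e) (insert a, simp_all add: E_def)
   qed
   then show ?thesis using a by simp
  qed
  have tt: "Suc t' + 5 * zeros f <= t + 20 + 5 * zeros f0" using alt by auto
  show "Q rg' ar' (Suc t') out'" unfolding al
  proof (rule Q)
   show "isbit f" "eq_off {hP, hD, hO} rg' rg" using C by (simp_all add: C_def)
  qed (insert key oth tt, simp_all add: f0_def)
 qed simp
 then show ?thesis unfolding dec_def using x l2 by (simp add: eval_nat_numeral)
qed

end

abbreviation (input) "hK \<equiv> 28 :: nat"
abbreviation (input) "hA \<equiv> 29 :: nat"
abbreviation (input) "hY \<equiv> 31 :: nat"

context dfs_input
begin

lemma reach_length: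
 "reach s ==> length (snd (snd s)) + length (fst s) = 2 * length (discovery_order (snd (snd s)))"
proof (induction rule: reach_induct)
 case (step s)
 obtain stk k es where s: "s = (stk, k, es)" by (cases s)
 show ?case
 proof (cases stk)
  case Nil
  then show ?thesis using step s by auto
 next
  case (Cons a st)
  obtain u i where a: "a = (u, i)" by (cases a)
  show ?thesis using step s Cons a by (auto split: list.split)
 qed
qed simp

lemma reach_events: "reach s ==> length (snd (snd s)) <= 2 * n"
proof -
 assume s: "reach s"
 then have d: "distinct (discovery_order (snd (snd s)))" "disc (snd (snd s)) \<subseteq> {..<n}"
  using reach_dinv[OF s] by (cases s; simp)+
 have "length (discovery_order (snd (snd s))) = card (disc (snd (snd s)))"
  using d(1) by (simp add: disc_def distinct_card)
 also have "\<dots> <= n" using card_mono[OF _ d(2)] by simp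
 finally show ?thesis using reach_length[OF s] by simp
qed

lemma reach_finish: "reach ((u, i) # stk, k, es) ==> \<not> i < deg u ==> \<exists>s. reach s & snd (snd s) = es @ [Finish u]"
 using reach_step[of "((u, i) # stk, k, es)"] by (auto split: list.splits)

lemma reach_tree:
 assumes "reach ((u, 0) # stk, k, es @ [Discover u])"
 shows "tree_edges [] (es @ [Discover u]) =
  (case stk of [] => tree_edges [] es | (p, j) # st => insert (u, p) (tree_edges [] es))"
proof -
 have "stack_after [] es = map fst stk" using reach_dinv[OF assms] by simp
 then show ?thesis by (cases stk) (auto simp: tree_edges_append)
qed

lemma reach_parent:
 assumes "reach ((u, 0) # (p, j) # st, k, es)"
 shows "p ~= u" "p < n" "u \<in> set (adj ! p)" "p \<in> disc es"
proof -
 have d: "distinct (map fst ((u, 0) # (p, j) # st))" "set (map fst ((u, 0) # (p, j) # st)) \<subseteq> disc es"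
  "disc es \<subseteq> {..<n}" "\<forall>(u, i) \<in> set (tl ((u, 0) # (p, j) # st)). i < deg u"
  "\<And>m. Suc m < length ((u, 0) # (p, j) # st) ==>
   adj ! fst (((u, 0) # (p, j) # st) ! Suc m) ! snd (((u, 0) # (p, j) # st) ! Suc m) = fst (((u, 0) # (p, j) # st) ! m)"
  using reach_dinv[OF assms] unfolding dinv.simps by blast+
 show "p ~= u" using d(1) by auto
 show "p \<in> disc es" using d(2) by simp
 then show "p < n" using d(3) by blast
 have "adj ! p ! j = u" using d(5)[of 0] by simp
 moreover have "j < deg p" using d(4) by simp
 ultimately show "u \<in> set (adj ! p)" by auto
qed

lemma reach_vertex: "reach ((u, i) # stk, k, es) ==> u < n"
 using reach_dinv by force

end

subsection \<open>Reporting the traversal\<close>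

definition
 "report_prog = dfs_prog (Emit (Lit 0) ;; Emit (Rg vU)) (Emit (Lit 1) ;; Emit (Rg vU))"

context dfs_mem
begin

lemma report_ok:
 assumes c: "cst rg" and D: "\<forall>v<n. ar aD v = 0" and U: "\<forall>p < 2 * n + 1. ar aU p = 0"
  and Q: "\<And>rg' ar' t' es. dfs_traversal (graph_of adj) r es ==> t' <= t + 4 * n + DFSB ==>
   Q rg' ar' t' (out @ concat (map (case_event (\<lambda>v. [0, v]) (\<lambda>v. [1, v])) es))"
 shows "wp report_prog Q rg ar t out"
proof -
 define HI :: "nat event list => nat => (nat => nat) => arrays => nat list => bool" where
  "HI = (\<lambda>es \<tau> rg' ar' out'. (\<exists>s. reach s & snd (snd s) = es) & \<tau> = 2 * length es &
   out' = out @ concat (map (case_event (\<lambda>v. [0, v]) (\<lambda>v. [1, v])) es))"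
 have l1: "Suc 0 < 2 ^ w" by (intro small) simp
 interpret H: dfs_hooks w adj r na len wd xl S B L "Emit (Lit 0) ;; Emit (Rg vU)"
  "Emit (Lit 1) ;; Emit (Rg vU)" HI "4 * n"
 proof
  fix es \<tau> rg' ar' out' assume "HI es \<tau> rg' ar' out'"
  then show "\<tau> <= 4 * n" using reach_events by (fastforce simp: HI_def)
 next
  fix u stk k es \<tau> rg' ar' t' out'
  assume s: "reach ((u, 0) # stk, k, es @ [Discover u])" and h: "HI es \<tau> rg' ar' out'" "rg' vU = u"
  then have "HI (es @ [Discover u]) (\<tau> + 2) rg' ar' (out' @ [0, u])"
   by (auto simp: HI_def intro!: exI[of _ "((u, 0) # stk, k, es @ [Discover u])"])
  then show "wp (Emit (Lit 0) ;; Emit (Rg vU)) (hook_post HI (es @ [Discover u]) \<tau> rg' ar' t') rg' ar' t' out'"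
   using h(2) by (auto simp: w_pos intro!: exI[of _ "\<tau> + 2"])
 next
  fix u i stk k es \<tau> rg' ar' t' out'
  assume s: "reach ((u, i) # stk, k, es)" "\<not> i < deg u" and h: "HI es \<tau> rg' ar' out'" "rg' vU = u"
  have "HI (es @ [Finish u]) (\<tau> + 2) rg' ar' (out' @ [1, u])"
   using reach_finish[OF s] h(1) by (simp add: HI_def)
  then show "wp (Emit (Lit 1) ;; Emit (Rg vU)) (hook_post HI (es @ [Finish u]) \<tau> rg' ar' t') rg' ar' t' out'"
   using h(2) by (auto simp: l1 intro!: exI[of _ "\<tau> + 2"])
 qed (simp add: HI_def)
 have "HI [] 0 rg ar out" unfolding HI_def by (auto intro!: exI[of _ "([], 0, [])"] reach_init)
 then show ?thesis unfolding report_prog_def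
 proof (rule H.dfs_prog_ok[OF c D U])
  fix rg' ar' t' out' f \<tau>
  assume f: "reach f" "final f" "HI (snd (snd f)) \<tau> rg' ar' out'" and t: "t' <= t + \<tau> + DFSB"
  then have o: "out' = out @ concat (map (case_event (\<lambda>v. [0, v]) (\<lambda>v. [1, v])) (snd (snd f)))" by (simp add: HI_def)
  show "Q rg' ar' t' out'" unfolding o
   by (rule Q[OF traversal[OF f(1,2)]]) (use t H.HI_bound[OF f(3)] in linarith)
 qed
qed

end

subsection \<open>First traversal: parents and counters\<close>

definition
 "count_body = Cond (Eqv (Nb (Rg hX) (Rg hK)) (Rg vP)) (hA ::= Rg hK) Nop ;;
  Cond (Eqv (Arr aD (Nb (Rg hX) (Rg hK))) (Lit 1)) (hO ::= Rg hO +. Lit 1) Nop ;; hK ::= Rg hK +. Lit 1"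

text \<open>Roots are skipped: they have no parent, and in the second run over a connected graph the
  root is discovered before all its neighbours, so that its counter is never asked for.\<close>

definition
 "hook1 = Cond (Eqv (Rg vP) (Rg vU)) Nop
  (hX ::= Rg vU ;; hK ::= Lit 0 ;; hA ::= Lit 0 ;; hO ::= Lit 0 ;;
   Loop (Lt (Rg hK) (Dg (Rg hX))) count_body ;;
   hI ::= Rg hA ;; hC ::= Rg hO -. Lit 1 ;; walk put_bits)"

definition
 "first_prog = dfs_prog hook1 Nop"

definition
 "reset_prog = hX ::= Lit 0 ;; Loop (Lt (Rg hX) (Rg gN)) (Put aD (Rg hX) (Lit 0) ;; hX ::= Rg hX +. Lit 1)"

locale dfs_und = dfs_lev +
 assumes gi: "graph_instance adj"
begin

definition parent_ok :: "(nat \<times> nat) set => arrays => bool" where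
 "parent_ok T ar \<longleftrightarrow> (\<forall>(x, y) \<in> T. x < n & nval (ar aPI) x < deg x & adj ! x ! nval (ar aPI) x = y)"

definition lower :: "nat event list => nat => nat set" where
 "lower es x = {z \<in> set (adj ! x). pos es z < pos es x}"

definition counters_ok :: "nat event list => arrays => bool" where
 "counters_ok es ar \<longleftrightarrow> (\<forall>(x, y) \<in> tree_edges [] es. nval (ar aCT) x + 1 = card (lower es x))"

definition cost1 :: "nat => nat" where "cost1 x = 30 + 20 * deg x"

definition HI1 :: "(nat => nat) => arrays => nat list => nat event list => nat => (nat => nat) => arrays => nat list => bool" where
 "HI1 rg0 ar0 out0 es \<tau> rg ar out \<longleftrightarrow> (\<exists>s. reach s & snd (snd s) = es) & (\<forall>x\<ge>70. rg x = rg0 x) & lrel ar & out = out0 &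
  isbit (ar aPI) & isbit (ar aCT) & parent_ok (tree_edges [] es) ar & counters_ok es ar &
  (\<forall>k. 15 <= k --> ar k = ar0 k) & \<tau> = length es + (\<Sum>x\<in>disc es. cost1 x)"

lemma pos_upto: "x \<notin> disc es ==> z \<in> disc (es @ [Discover x]) & z ~= x \<longleftrightarrow> pos (es @ [Discover x]) z < pos (es @ [Discover x]) x"
proof -
 assume x: "x \<notin> disc es"
 have px: "pos (es @ [Discover x]) x = length (discovery_order es)" by (rule pos_new[OF x])
 show ?thesis
 proof (cases "z \<in> disc es")
  case True
  then show ?thesis using pos_append[OF True, of "[Discover x]"] pos_lt[OF True] px x by auto
 next
  case False
  then show ?thesis using pos_ge[OF False, of "[Discover x]"] px by auto
 qed
qed

text \<open>Later discoveries get larger positions, so the set is settled once \<open>x\<close> is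
  discovered; therefore the counter can be computed at that moment.\<close>

lemma lower_append: "x \<in> disc es ==> lower (es @ es') x = lower es x"
proof -
 assume x: "x \<in> disc es"
 have "pos (es @ es') z < pos (es @ es') x \<longleftrightarrow> pos es z < pos es x" for z
 proof (cases "z \<in> disc es")
  case True
  then show ?thesis using x by (simp add: pos_append)
 next
  case False
  then show ?thesis using pos_ge[OF False, of es'] pos_ge[OF False, of "[]"] pos_lt[OF x] x by (simp add: pos_append)
 qed
 then show ?thesis by (simp add: lower_def)
qed

text \<open>Adjacency lists are distinct, so counting indices counts neighbours.\<close>

lemma count_index: "v < n ==> card {i. i < deg v & adj ! v ! i \<in> X} = card {z \<in> set (adj ! v). z \<in> X}"
proof -
 assume v: "v < n"
 have "distinct (adj ! v)" using distinct_adj gi v by blast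
 then have "inj_on ((!) (adj ! v)) {i. i < deg v & adj ! v ! i \<in> X}"
  by (auto simp: inj_on_def nth_eq_iff_index_eq)
 then have "card ((!) (adj ! v) ` {i. i < deg v & adj ! v ! i \<in> X}) = card {i. i < deg v & adj ! v ! i \<in> X}"
  by (rule card_image)
 moreover have "(!) (adj ! v) ` {i. i < deg v & adj ! v ! i \<in> X} = {z \<in> set (adj ! v). z \<in> X}"
  by (auto simp: in_set_conv_nth)
 ultimately show ?thesis by simp
qed

lemma count_loop_ok:
 assumes u: "u < n" "rg hX = u" "rg vP = p" "p \<in> set (adj ! u)" and D: "\<forall>v<n. ar aD v = (if v \<in> X then 1 else 0)"
  and z: "rg hK = 0" "rg hO = 0"
  and Q: "\<And>rg' t'. rg' hA < deg u ==> adj ! u ! rg' hA = p ==> rg' hO = card {z \<in> set (adj ! u). z \<in> X} ==>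
   eq_off {hA, hO, hK} rg' rg ==> t' <= t + 1 + 6 * deg u ==> Q rg' ar t' out"
 shows "wp (Loop (Lt (Rg hK) (Dg (Rg hX))) count_body) Q rg ar t out"
proof -
 define M where "M = (\<lambda>i rg' ar' out'. rg' hK = i & rg' hO = card {j. j < i & adj ! u ! j \<in> X} &
  ((\<exists>j<i. adj ! u ! j = p) --> rg' hA < deg u & adj ! u ! rg' hA = p) &
  eq_off {hA, hO, hK} rg' rg & ar' = ar & out' = out)"
 have dn: "deg u <= n" using deg_le u by simp
 show ?thesis
 proof (rule wp_for[where a = 0 and N = "deg u" and M = M and c = "\<lambda>_. 5"], goal_cases)
  show "M 0 rg ar out" using z by (simp add: M_def)
 next
  fix i rg' ar' out' assume m: "M i rg' ar' out'"
  then have "rg' hX = u" "rg' hK = i" using u by (simp_all add: M_def)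
  then show "bok rg' ar' (Lt (Rg hK) (Dg (Rg hX))) & (bv rg' ar' (Lt (Rg hK) (Dg (Rg hX))) \<longleftrightarrow> i < deg u)"
   using u by simp
 next
  case (4 i rg' ar' t' out' Q') note m = 4(1) and i = 4(3) and Q' = 4(4)
  define y where "y = adj ! u ! i"
  have r: "rg' hX = u" "rg' hK = i" "rg' vP = p" "ar' = ar" using m u by (simp_all add: M_def)
  have y: "y < n" using nb_less[OF u(1), of y] i by (simp add: y_def)
  have f: "finite {j. j < i & adj ! u ! j \<in> X}" by simp
  have ce: "{j. j < Suc i & adj ! u ! j \<in> X} = (if y \<in> X then {i} else {}) \<union> {j. j < i & adj ! u ! j \<in> X}"
   by (auto simp: less_Suc_eq y_def)
  have cc: "card {j. j < Suc i & adj ! u ! j \<in> X} = (if y \<in> X then Suc (card {j. j < i & adj ! u ! j \<in> X}) else card {j. j < i & adj ! u ! j \<in> X})"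
   unfolding ce using f by simp
  have "card {j. j < i & adj ! u ! j \<in> X} <= card {..<i}" by (rule card_mono) auto
  then have cl: "rg' hO <= n" using m i dn by (simp add: M_def)
  have s: "Suc (rg' hO) < 2 ^ w" "Suc i < 2 ^ w" "1 < (2::nat) ^ w" using cl i dn by (intro small; linarith)+
  have new: "M (Suc i) (rg'(hA := (if y = p then i else rg' hA), hO := (if y \<in> X then Suc (rg' hO) else rg' hO), hK := Suc i)) ar out'"
   using m i unfolding M_def cc by (auto simp: less_Suc_eq y_def)
  show "wp count_body Q' rg' ar' t' out'" unfolding count_body_def
   apply (simp add: r i y_def[symmetric] y lens s u(1) D)
   using Q'[OF new] y nb_less[OF u(1,4)] D by (cases "y = p"; cases "y \<in> X"; cases "p \<in> X"; simp add: r fun_upd_idem)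
 next
  case (5 rg' ar' t' out') note m = 5(1) and t = 5(2)
  have o: "out' = out" "ar' = ar" using m by (simp_all add: M_def)
  have "\<exists>j<deg u. adj ! u ! j = p" using u(4) by (auto simp: in_set_conv_nth)
  then show "Q rg' ar' t' out'" unfolding o
   by (intro Q) (insert m t count_index[OF u(1)], auto simp: M_def)
 qed simp
qed

lemma first_ok:
 assumes c: "cst2 rg" and l: "lrel ar" and D: "\<forall>v<n. ar aD v = 0" and U: "\<forall>p < 2 * n + 1. ar aU p = 0"
  and b: "isbit (ar aPI)" "isbit (ar aCT)"
  and Q: "\<And>rg' ar' t' f \<tau>. reach f ==> final f ==> cst2 rg' ==> lrel ar' ==> isbit (ar' aPI) ==> isbit (ar' aCT) ==>
   parent_ok (tree_edges [] (snd (snd f))) ar' ==> counters_ok (snd (snd f)) ar' ==> (\<forall>k. 15 <= k --> ar' k = ar k) ==>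
   (\<forall>x\<ge>70. rg' x = rg x) ==> (\<forall>p < 2 * n + 1. ar' aU p = 0) ==>
   t' <= t + 2 * n + (\<Sum>x<n. cost1 x) + DFSB ==> Q rg' ar' t' out"
 shows "wp first_prog Q rg ar t out"
proof -
 interpret H: dfs_hooks w adj r na len wd xl S B L hook1 Nop "HI1 rg ar out" "2 * n + (\<Sum>x<n. cost1 x)"
 proof
  fix es \<tau> rg' ar' out' assume h: "HI1 rg ar out es \<tau> rg' ar' out'"
  then obtain s where s: "reach s" "snd (snd s) = es" by (auto simp: HI1_def)
  have "disc es \<subseteq> {..<n}" using reach_dinv[OF s(1)] s(2) by (cases s) simp
  then have "(\<Sum>x\<in>disc es. cost1 x) <= (\<Sum>x<n. cost1 x)" by (intro sum_mono2) auto
  then show "\<tau> <= 2 * n + (\<Sum>x<n. cost1 x)" using h reach_events[OF s(1)] s(2) by (simp add: HI1_def)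
 next
  fix es \<tau> rg1 ar1 out1 rg2 ar2
  assume "HI1 rg ar out es \<tau> rg1 ar1 out1" "\<forall>x\<ge>20. rg2 x = rg1 x" "\<forall>k\<ge>10. ar2 k = ar1 k"
  then show "HI1 rg ar out es \<tau> rg2 ar2 out1" by (simp add: HI1_def lrel_def parent_ok_def counters_ok_def)
 next
  fix u i stk k es \<tau> rg' ar' t' out'
  assume s: "reach ((u, i) # stk, k, es)" "\<not> i < deg u" and h: "HI1 rg ar out es \<tau> rg' ar' out'"
  have te: "tree_edges [] (es @ [Finish u]) = tree_edges [] es" by (simp add: tree_edges_append)
  obtain s0 where s0: "reach s0" "snd (snd s0) = es" using h by (auto simp: HI1_def)
  have td: "x \<in> disc es" if "(x, y) \<in> tree_edges [] es" for x y
   using reach_tinv[OF s0(1)] s0(2) that by (auto simp: tinv_def)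
  have "HI1 rg ar out (es @ [Finish u]) (\<tau> + 1) rg' ar' out'"
   using reach_finish[OF s] h lower_append[OF td] by (auto simp: HI1_def te counters_ok_def)
  then show "wp Nop (hook_post (HI1 rg ar out) (es @ [Finish u]) \<tau> rg' ar' t') rg' ar' t' out'"
   by (auto intro!: exI[of _ "\<tau> + 1"])
 next
  fix u stk k es \<tau> rg' ar' t' out'
  assume s: "reach ((u, 0) # stk, k, es @ [Discover u])" "u \<notin> disc es" and h: "HI1 rg ar out es \<tau> rg' ar' out'"
   and vU: "rg' vU = u" and vP: "rg' vP = (case stk of [] => u | (p, j) # st => p)"
   and D: "\<forall>v<n. ar' aD v = (if v \<in> disc (es @ [Discover u]) then 1 else 0)"
  define es' where "es' = es @ [Discover u]"
  have un: "u < n" using reach_vertex[OF s(1)] .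
  have dn: "deg u <= n" using deg_le un by simp
  obtain s0 where s0: "reach s0" "snd (snd s0) = es" using h by (auto simp: HI1_def)
  have td: "x \<in> disc es & x < n" if "(x, y) \<in> tree_edges [] es" for x y
  proof -
   have "x \<in> disc es" using reach_tinv[OF s0(1)] s0(2) that by (auto simp: tinv_def)
   moreover have "disc es \<subseteq> {..<n}" using reach_dinv[OF s0(1)] s0(2) by (cases s0) simp
   ultimately show ?thesis by auto
  qed
  have fd: "finite (disc es)" by (simp add: disc_def)
  have tau: "length es' + (\<Sum>x\<in>disc es'. cost1 x) = \<tau> + 1 + cost1 u"
   using h fd s(2) by (simp add: HI1_def es'_def)
  define Q' where "Q' = (hook_post (HI1 rg ar out) es' \<tau> rg' ar' t')"
  have re: "\<exists>s. reach s & snd (snd s) = es'" using s(1) by (auto simp: es'_def)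
  have "wp hook1 Q' rg' ar' t' out'"
  proof (cases stk)
   case Nil
   have te: "tree_edges [] es' = tree_edges [] es" using reach_tree[OF s(1)] Nil by (simp add: es'_def)
   have "counters_ok es' ar'" using h td lower_append[of _ es "[Discover u]"] unfolding counters_ok_def te
    by (fastforce simp: HI1_def counters_ok_def es'_def)
   then have "HI1 rg ar out es' (\<tau> + 1 + cost1 u) rg' ar' out'"
    using h re tau by (simp add: HI1_def te)
   then have "Q' rg' ar' (Suc (Suc t')) out'" unfolding Q'_def
    by (auto simp: cost1_def intro!: exI[of _ "\<tau> + 1 + cost1 u"])
   then show ?thesis unfolding hook1_def using vU vP Nil by simp
  next
   case (Cons a st)
   obtain p j where a: "a = (p, j)" by (cases a)
   note sp = s(1)[unfolded Cons a]
   note pr = reach_parent[OF sp]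
   have te: "tree_edges [] es' = insert (u, p) (tree_edges [] es)" using reach_tree[OF s(1)] Cons a by (simp add: es'_def)
   have pu: "p \<in> set (adj ! u)" using graph_facts(1)[OF gi pr(2,3)] .
   have uu: "u \<notin> set (adj ! u)" using graph_facts(2)[OF gi un] .
   define X where "X = disc es'"
   \<comment> \<open>\<open>u\<close> is itself marked as discovered at this moment but is not its
     own neighbour, so the count is exact.\<close>
   have lw: "{z \<in> set (adj ! u). z \<in> X} = lower es' u"
    using pos_upto[OF s(2)] uu by (auto simp: lower_def X_def es'_def)
   have pl: "p \<in> lower es' u" using pr(4) pu unfolding lw[symmetric] by (simp add: X_def es'_def)
   \<comment> \<open>The parent is among the counted neighbours, so subtracting 1 is safe.\<close>
   have cp: "0 < card (lower es' u)" using pl by (auto simp: card_gt_0_iff lower_def)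
   have cd: "card (lower es' u) <= deg u"
   proof -
    have "card (lower es' u) <= card (set (adj ! u))" by (rule card_mono) (auto simp: lower_def)
    then show ?thesis using card_length[of "adj ! u"] by simp
   qed
   have s1: "Suc 0 < 2 ^ w" "deg u < 2 ^ w" using dn by (intro small; simp)+
   have vp: "rg' vP = p" using vP Cons a by simp
   define rg1 where "rg1 = rg'(hX := u, hK := 0, hA := 0, hO := 0)"
   have "wp (Loop (Lt (Rg hK) (Dg (Rg hX))) count_body)
     (wp (hI ::= Rg hA ;; hC ::= Rg hO -. Lit 1 ;; walk put_bits) Q') rg1 ar' (t' + 5) out'"
   proof (rule count_loop_ok[OF un _ _ pu, where X = X])
    show "rg1 hX = u" "rg1 vP = p" "rg1 hK = 0" "rg1 hO = 0" using vp by (simp_all add: rg1_def)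
    show "\<forall>v<n. ar' aD v = (if v \<in> X then 1 else 0)" using D by (simp add: X_def es'_def)
    fix rg2 t2
    assume r2: "rg2 hA < deg u" "adj ! u ! rg2 hA = p" "rg2 hO = card {z \<in> set (adj ! u). z \<in> X}"
     "eq_off {hA, hO, hK} rg2 rg1" and t2: "t2 <= t' + 5 + 1 + 6 * deg u"
    define c where "c = card (lower es' u) - 1"
    define rg3 where "rg3 = rg2(hI := rg2 hA, hC := c)"
    have "wp (walk put_bits) Q' rg3 ar' (Suc (Suc t2)) out'"
    proof (rule put_ok[where a = "rg2 hA" and d = c and x = u])
     show "lrel ar'" "isbit (ar' aPI)" "isbit (ar' aCT)" using h by (simp_all add: HI1_def)
     show "cst2 rg3" by (rule cst2_cong[OF assms(1)]) (insert h r2, simp add: HI1_def rg3_def rg1_def)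
     show "rg3 hX = u" "rg3 hI = rg2 hA" "rg3 hC = c" using r2 by (simp_all add: rg3_def rg1_def)
     show "c <= deg u" using cd by (simp add: c_def)
     fix rg4 ar4 t4
     assume b4: "isbit (ar4 aPI)" "isbit (ar4 aCT)"
      and v4: "\<And>y. y < n ==> nval (ar4 aPI) y = (if y = u then rg2 hA else nval (ar' aPI) y)"
       "\<And>y. y < n ==> nval (ar4 aCT) y = (if y = u then c else nval (ar' aCT) y)"
      and k4: "eq_off {aPI, aCT} ar4 ar'" and r4: "eq_off {hP, hD, hI, hW, hC} rg4 rg3"
      and t4: "t4 <= Suc (Suc t2) + 3 + 7 * bl (deg u)"
     have nu: "(u, y) \<notin> tree_edges [] es" for y using td s(2) by blast
     have P4: "parent_ok (tree_edges [] es') ar4"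
      unfolding parent_ok_def te
     proof (intro ballI, clarify)
      fix x y assume xy: "(x, y) \<in> insert (u, p) (tree_edges [] es)"
      show "x < n & nval (ar4 aPI) x < deg x & adj ! x ! nval (ar4 aPI) x = y"
      proof (cases "(x, y) = (u, p)")
       case True
       then show ?thesis using v4(1)[of u] r2 un by simp
      next
       case False
       then have "(x, y) \<in> tree_edges [] es" using xy by auto
       moreover from this have "x ~= u" "x < n" using nu td by blast+
       ultimately show ?thesis using h v4(1)[of x] by (fastforce simp: HI1_def parent_ok_def)
      qed
     qed
     have C4: "counters_ok es' ar4"
      unfolding counters_ok_def te
     proof (intro ballI, clarify)
      fix x y assume xy: "(x, y) \<in> insert (u, p) (tree_edges [] es)"
      show "nval (ar4 aCT) x + 1 = card (lower es' x)"
      proof (cases "(x, y) = (u, p)")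
       case True
       then show ?thesis using v4(2)[of u] un cp by (simp add: c_def)
      next
       case False
       then have e: "(x, y) \<in> tree_edges [] es" using xy by auto
       then have x: "x ~= u" "x < n" "x \<in> disc es" using nu td by blast+
       have "nval (ar' aCT) x + 1 = card (lower es x)" using h e by (fastforce simp: HI1_def counters_ok_def)
       then show ?thesis using x v4(2)[of x] lower_append[OF x(3), of "[Discover u]"] by (simp add: es'_def)
      qed
     qed
     have "HI1 rg ar out es' (\<tau> + 1 + cost1 u) rg4 ar4 out'"
      using h re tau b4 k4 r4 r2 P4 C4 by (simp add: HI1_def lrel_def rg3_def rg1_def)
     moreover have "t4 + \<tau> <= t' + (\<tau> + 1 + cost1 u)"
      using t4 t2 bl_le[of "deg u"] by (simp add: cost1_def)
     ultimately show "Q' rg4 ar4 t4 out'" unfolding Q'_def using k4 r4 r2 by (auto simp: rg3_def rg1_def)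
    qed (use un r2 in simp_all)
    then show "wp (hI ::= Rg hA ;; hC ::= Rg hO -. Lit 1 ;; walk put_bits) Q' rg2 ar' t2 out'"
     using r2(3) cp s1 by (simp add: rg3_def c_def lw Suc_le_eq)
   qed
   moreover have "t' + 5 = Suc (Suc (Suc (Suc (Suc t'))))" by simp
   ultimately show ?thesis unfolding hook1_def using vU vp pr(1) w_pos by (simp add: rg1_def)
  qed
  then show "wp hook1 (hook_post (HI1 rg ar out) (es @ [Discover u]) \<tau> rg' ar' t') rg' ar' t' out'"
   by (simp add: Q'_def es'_def)
 qed
 have h0: "HI1 rg ar out [] 0 rg ar out" unfolding HI1_def using b l
  by (auto simp: parent_ok_def counters_ok_def intro!: exI[of _ "([], 0, [])"] reach_init)
 have "cst rg" using c by (simp add: cst2_def)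
 then show ?thesis unfolding first_prog_def
 proof (rule H.dfs_prog_ok[OF _ D U h0])
  fix rg' ar' t' out' f \<tau>
  assume f: "reach f" "final f" "HI1 rg ar out (snd (snd f)) \<tau> rg' ar' out'" and g: "\<forall>x\<ge>70. rg' x = rg x"
   "\<forall>p<2 * n + 1. ar' aU p = 0" and t: "t' <= t + \<tau> + DFSB"
  have o: "out' = out" using f(3) by (simp add: HI1_def)
  show "Q rg' ar' t' out'" unfolding o
  proof (rule Q[OF f(1,2)])
   show "cst2 rg'" by (rule cst2_cong[OF c g(1)])
   show "t' <= t + 2 * n + (\<Sum>x<n. cost1 x) + DFSB" using t H.HI_bound[OF f(3)] by linarith
  qed (insert f(3) g, simp_all add: HI1_def)
 qed
qed

lemma reset_ok:
 assumes c: "cst2 rg"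
  and Q: "\<And>rg' ar' t'. (\<forall>v<n. ar' aD v = 0) ==> (\<forall>k. k ~= aD --> ar' k = ar k) ==> (\<forall>x. x ~= hX --> rg' x = rg x) ==>
   t' <= t + 2 + 3 * n ==> Q rg' ar' t' out"
 shows "wp reset_prog Q rg ar t out"
proof -
 define M where "M = (\<lambda>i rg' ar' out'. rg' hX = i & (\<forall>v<i. ar' aD v = 0) & (\<forall>k. k ~= aD --> ar' k = ar k) &
  (\<forall>x. x ~= hX --> rg' x = rg x) & out' = out)"
 have g: "rg gN = n" using c by (simp add: cst2_def cst_def)
 show ?thesis unfolding reset_prog_def wp_simps(5) wp_simps(2)
 proof (intro conjI)
  show "wp (Loop (Lt (Rg hX) (Rg gN)) (Put aD (Rg hX) (Lit 0) ;; hX ::= Rg hX +. Lit 1)) Q (rg(hX := ev rg ar (Lit 0))) ar (Suc t) out"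
  proof (rule wp_for[where a = 0 and N = n and M = M and c = "\<lambda>_. 2"], goal_cases)
   show "M 0 (rg(hX := ev rg ar (Lit 0))) ar out" by (simp add: M_def)
  next
   fix i rg' ar' out' assume m: "M i rg' ar' out'"
   then have "rg' hX = i" "rg' gN = n" using g by (simp_all add: M_def)
   then show "bok rg' ar' (Lt (Rg hX) (Rg gN)) & (bv rg' ar' (Lt (Rg hX) (Rg gN)) \<longleftrightarrow> i < n)" by simp
  next
   case (4 i rg' ar' t' out' Q') note m = 4(1) and i = 4(3) and Q' = 4(4)
   have s: "Suc i < 2 ^ w" "1 < (2::nat) ^ w" using i by (intro small; linarith)+
   have "rg' hX = i" using m by (simp add: M_def)
   moreover have "M (Suc i) (rg'(hX := Suc i)) (ar'(aD := (ar' aD)(i := 0))) out'"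
    using m by (auto simp: M_def less_Suc_eq)
   ultimately show "wp (Put aD (Rg hX) (Lit 0) ;; hX ::= Rg hX +. Lit 1) Q' rg' ar' t' out'"
    using i s by (simp add: lens Q' w_pos)
  next
   case (5 rg' ar' t' out') note m = 5(1) and t = 5(2)
   have o: "out' = out" using m by (simp add: M_def)
   show "Q rg' ar' t' out'" unfolding o by (rule Q) (insert m t, auto simp: M_def)
  qed simp
 qed (simp_all add: w_pos)
qed

end

subsection \<open>Second traversal: chains\<close>

text \<open>The flag is fixed when the program is built: one construction yields the program that
  prints the chains and the silent one behind the connectivity tests.\<close>

definition emit_if :: "bool => aexp => prg" where
 "emit_if em e = (if em then Emit e else Nop)"

definition
 "chain_step em = emit_if em (Rg hX) ;; get ;; Put aVIS (Rg hX) (Lit 1) ;; Put aCOV (Rg hX) (Lit 1) ;;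
  hY ::= Nb (Rg hX) (Rg hI) ;; Cond (Neqv (Rg hY) (Rg vU)) (Put aNC (Rg hX) (Lit 1)) Nop ;; hX ::= Rg hY"

text \<open>The loop tests only for visited vertices: \<open>v\<close> is marked first, so a climb
  ends at \<open>v\<close> at the latest and cannot pass \<open>r\<close>.\<close>

definition
 "chain_prog em = Put aVIS (Rg vU) (Lit 1) ;; emit_if em (Rg vU) ;;
  Loop (Eqv (Arr aVIS (Rg hX)) (Lit 0)) (chain_step em) ;; emit_if em (Rg hX) ;; emit_if em (Rg gN)"

definition
 "hook2_body em = hX ::= Nb (Rg vU) (Rg hK) ;; hK ::= Rg hK +. Lit 1 ;;
  Cond (Eqv (Arr aD (Rg hX)) (Lit 0)) (dec ;; Cond (Eqv (Rg hO) (Lit 0)) (chain_prog em) Nop) Nop"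

definition
 "hook2 em = hK ::= Lit 0 ;; Loop (Lt (Rg hK) (Dg (Rg vU))) (hook2_body em)"

definition
 "second_prog em = dfs_prog (hook2 em) Nop"

lemma (in ram) wp_emit_if [simp]:
 "wp (emit_if em e) Q rg ar t out = ((em --> ok rg ar e) & Q rg ar (Suc t) (out @ (if em then [ev rg ar e] else [])))"
 by (simp add: emit_if_def)

text \<open>\<open>chains\<close> peels off the first back edge, whereas the program appends a chain
  at the end. The visited set is then the union of the chains so far.\<close>

lemma chains_snoc:
 "chains T r S bs cs ==> climb T r (insert v (S \<union> \<Union>(set ` set cs))) x p ==>
  chains T r S (bs @ [(v, x)]) (cs @ [v # p])"
proof (induction rule: chains.induct)
 case (Nil S)
 then show ?case by (auto intro: chains.intros)
next
 case (Cons a S y q bs cs)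
 have "S \<union> set (a # q) \<union> \<Union>(set ` set cs) = S \<union> \<Union>(set ` set ((a # q) # cs))" by auto
 then show ?case using Cons by (auto intro!: chains.intros simp del: Un_insert_left Un_insert_right)
qed

locale dfs_second = dfs_und w adj r na len wd xl S B L h + dfs_tree adj r P T
 for w adj r na len wd xl S B L h P T +
 fixes F :: dstate
 assumes F: "reach F" "final F" and P_eq: "P = dfs_input.pos (snd (snd F))" and T_eq: "T = tree_edges [] (snd (snd F))"
begin

text \<open>The back edges in the order of the adjacency array, in which the program meets them; the
  specification leaves this order open.\<close>

definition bf :: "nat => (nat \<times> nat) list" where
 "bf v = map (Pair v) (filter (\<lambda>x. P v < P x & (x, v) \<notin> T) (adj ! v))"

definition bks :: "nat event list => (nat \<times> nat) list" where
 "bks es = concat (map bf (discovery_order es))"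

lemma bf_back: "v < n ==> set (bf v) = {e \<in> back_edges G T. fst e = v}"
 using T_pos[of _ v] white[of v] by (auto simp: bf_def back_iff)

lemma bf_distinct: "v < n ==> distinct (bf v)"
 using distinct_adj[OF disjI1[OF gi]] by (auto simp: bf_def distinct_map inj_on_def)

definition sets3 :: "nat set => nat set => nat set => arrays => bool" where
 "sets3 V C N ar \<longleftrightarrow> (\<forall>z<n. ar aVIS z = of_bool (z \<in> V) & ar aCOV z = of_bool (z \<in> C) & ar aNC z = of_bool (z \<in> N))"

definition cv :: "nat => nat" where "cv z = 20 + 8 * bl (deg z)"

text \<open>\<open>cv z\<close> pays for reading the parent index of \<open>z\<close>. Every vertex
  is passed by at most one climb, the one that marks it, so apart from a constant per chain all
  climbs together cost at most \<open>vsum UNIV\<close>.\<close>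

definition vsum :: "nat set => nat" where "vsum V = (\<Sum>z<n. if z \<in> V then cv z else 0)"

lemma vsum_mono: "V \<subseteq> V' ==> vsum V <= vsum V'"
 unfolding vsum_def by (rule sum_mono) auto

lemma vsum_insert: "z < n ==> z \<notin> V ==> vsum (insert z V) = vsum V + cv z"
proof -
 assume z: "z < n" "z \<notin> V"
 have "vsum (insert z V) = (\<Sum>y<n. (if y \<in> V then cv y else 0) + (if y = z then cv y else 0))"
  unfolding vsum_def by (rule sum.cong) (use z in auto)
 also have "\<dots> = vsum V + (\<Sum>y<n. if y = z then cv y else 0)" by (simp add: sum.distrib vsum_def)
 finally show ?thesis using z by simp
qed

lemma chain_ok:
 assumes l: "lrel ar" and c: "cst2 rg" and b: "isbit (ar aPI)" and pa: "parent_ok T ar"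
  and B0: "B0 \<subseteq> back_edges G T" "\<forall>a \<in> fst ` B0. P a <= P v"
  and vx: "(v, x) \<in> back_edges G T" "rg vU = v" "rg hX = x"
  and s: "sets3 (VISs B0) (COVs B0) (NCs B0) ar"
  and Q: "\<And>rg' ar' t' p. climb T r (insert v (VISs B0)) x p ==> VISs (insert (v, x) B0) = VISs B0 \<union> set (v # p) ==>
   sets3 (VISs (insert (v, x) B0)) (COVs (insert (v, x) B0)) (NCs (insert (v, x) B0)) ar' ==>
   eq_off {aVIS, aCOV, aNC} ar' ar ==> eq_off {hP, hD, hI, hW, hC, hX, hY} rg' rg ==>
   t' + vsum (VISs B0) <= t + 10 + vsum (VISs (insert (v, x) B0)) ==>
   Q rg' ar' t' (out @ (if em then v # p @ [n] else []))"
 shows "wp (chain_prog em) Q rg ar t out"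
proof -
 define S' where "S' = insert v (VISs B0)"
 have v: "v < n" "x < n" "(x, v) \<in> T\<^sup>+" using vx(1) nb_less by (auto simp: back_iff)
 \<comment> \<open>The climb stands at \<open>z\<close> and has passed \<open>zs\<close>; any climb
   from \<open>z\<close> extends to one from \<open>x\<close>, so the chain is complete as soon as
   \<open>z\<close> stops it.\<close>
 define I where "I = (\<lambda>rg' ar' t' out'. \<exists>z zs. z < n & rg' hX = z & (x, z) \<in> T\<^sup>* & (z, v) \<in> T\<^sup>* & set zs = between x z &
  (\<forall>p. climb T r S' z p --> climb T r S' x (zs @ p)) & between x z \<inter> S' = {} &
  sets3 (S' \<union> between x z) (COVs B0 \<union> between x z) (NCs B0 \<union> {c \<in> between x z. par c ~= v}) ar' &
  eq_off {aVIS, aCOV, aNC} ar' ar & eq_off {hP, hD, hI, hW, hC, hX, hY} rg' rg &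
  out' = out @ (if em then v # zs else []) & t' + vsum S' <= t + 2 + vsum (S' \<union> between x z))"
 have l1: "Suc 0 < 2 ^ w" "1 < (2::nat) ^ w" by (intro small; simp)+
 define ar1 where "ar1 = ar(aVIS := (ar aVIS)(v := 1))"
 have "I rg ar1 (t + 2) (out @ (if em then [v] else []))"
  unfolding I_def
  apply (rule exI[of _ x], rule exI[of _ "[]"])
  using v vx s by (auto simp: between_self sets3_def ar1_def S'_def)
 then have "wp (Loop (Eqv (Arr aVIS (Rg hX)) (Lit 0)) (chain_step em))
  (wp (emit_if em (Rg hX) ;; emit_if em (Rg gN)) Q) rg ar1 (t + 2) (out @ (if em then [v] else []))"
 proof (rule wp_loop[where I = I and B = "t + 2 + vsum UNIV"])
  fix rg' ar' t' out' assume "I rg' ar' t' out'"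
  then obtain z where "t' + vsum S' <= t + 2 + vsum (S' \<union> between x z)" unfolding I_def by blast
  then show "t' <= t + 2 + vsum UNIV" using vsum_mono[of "S' \<union> between x z" UNIV] by simp
 next
  fix rg' ar' t' out' assume "I rg' ar' t' out'"
  then show "bok rg' ar' (Eqv (Arr aVIS (Rg hX)) (Lit 0))" unfolding I_def by (auto simp: lens2 w_pos)
 next
  fix rg' ar' t' out' assume "I rg' ar' t' out'" and bv: "bv rg' ar' (Eqv (Arr aVIS (Rg hX)) (Lit 0))"
  then obtain z zs where z: "z < n" "rg' hX = z" "(x, z) \<in> T\<^sup>*" "(z, v) \<in> T\<^sup>*" "set zs = between x z"
   "\<forall>p. climb T r S' z p --> climb T r S' x (zs @ p)" "between x z \<inter> S' = {}"
   and s': "sets3 (S' \<union> between x z) (COVs B0 \<union> between x z) (NCs B0 \<union> {c \<in> between x z. par c ~= v}) ar'"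
   and fr: "eq_off {aVIS, aCOV, aNC} ar' ar" "eq_off {hP, hD, hI, hW, hC, hX, hY} rg' rg"
   and o: "out' = out @ (if em then v # zs else [])" and t: "t' + vsum S' <= t + 2 + vsum (S' \<union> between x z)"
   unfolding I_def by blast
  have zn: "z \<notin> S' \<union> between x z" using bv s' z(1,2) by (auto simp: sets3_def)
  then have zv: "(z, v) \<in> T\<^sup>+" using z(4) by (auto simp: S'_def rtrancl_eq_or_trancl)
  have zr: "z ~= r" using zv T_root by (auto dest: tranclD)
  define y where "y = par z"
  have zy: "(z, y) \<in> T" unfolding y_def by (rule par_T[OF z(1) zr])
  have y: "y < n" using T_edge[OF zy] by simp
  have yv: "(y, v) \<in> T\<^sup>*" by (rule T_up[OF zv zy])
  have xy: "(x, y) \<in> T\<^sup>*" using z(3) zy by simp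
  have bs: "between x y = insert z (between x z)" by (rule between_step[OF z(3) zy])
  have pz: "nval (ar aPI) z < deg z" "adj ! z ! nval (ar aPI) z = y" using pa zy by (auto simp: parent_ok_def)
  have ve: "vsum (S' \<union> between x y) = vsum (S' \<union> between x z) + cv z" using vsum_insert[OF z(1) zn] by (simp add: bs)
  have cl: "climb T r S' x (zs @ z # p)" if "climb T r S' y p" for p
   using z(6) climb.Step[of z S' r y T p] zn zr zy that by blast
  have u': "rg' vU = v" using fr(2) vx by simp
  show "wp (chain_step em) I rg' ar' (Suc t') out'" unfolding chain_step_def
   apply (simp add: z(2) split del: if_split)
   apply (rule get_ok[where x = z])
     apply (use l fr in \<open>simp add: lrel_def\<close>)
     apply (rule cst2_cong[OF c])
     apply (use fr in simp)
    apply (rule z(1))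
    apply (rule z(2))
   apply (use b fr in simp)
   subgoal for rg2 t2
   proof -
    assume r2: "rg2 hI = nval (ar' aPI) z" "eq_off {hP, hD, hI, hW, hC} rg2 rg'" and t2: "t2 <= Suc (Suc t') + 5 + 8 * bl (deg z)"
    have r2': "rg2 hI = nval (ar aPI) z" "rg2 hX = z" "rg2 vU = v" using r2 fr z u' by simp_all
    define N' where "N' = (if y = v then ar' aNC else (ar' aNC)(z := Suc 0))"
    define ar3 where "ar3 = ar'(aVIS := (ar' aVIS)(z := Suc 0), aCOV := (ar' aCOV)(z := Suc 0), aNC := N')"
    have s3: "sets3 (S' \<union> between x y) (COVs B0 \<union> between x y) (NCs B0 \<union> {c \<in> between x y. par c ~= v}) ar3"
     using s' zn unfolding sets3_def bs by (auto simp: ar3_def N'_def y_def)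
    have J: "I (rg2(hY := y, hX := y)) ar3 t3 (out' @ (if em then [z] else []))" if "t3 <= t2 + 6" for t3
     unfolding I_def
     apply (rule exI[of _ y], rule exI[of _ "zs @ [z]"])
     using y xy yv bs z(5,7) zn cl s3 fr r2 o t ve t2 that by (simp add: ar3_def cv_def)
    have idem: "ar'(aVIS := (ar' aVIS)(z := Suc 0), aCOV := (ar' aCOV)(z := Suc 0)) = ar3" if "y = v"
     using that by (auto simp: ar3_def N'_def)
    show ?thesis
     apply (simp add: r2' z(1) lens2 wds2 l1 pz split del: if_split)
     apply (cases "y = v")
     subgoal using J idem by (simp add: z(2) split del: if_split cong: if_cong)
     subgoal using J by (simp add: ar3_def N'_def z(1,2) r2' lens2 wds2 l1 split del: if_split cong: if_cong)
     done
   qed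
   done
 next
  fix rg' ar' t' out' assume "I rg' ar' t' out'" and bv: "\<not> bv rg' ar' (Eqv (Arr aVIS (Rg hX)) (Lit 0))"
  then obtain z zs where z: "z < n" "rg' hX = z" "(x, z) \<in> T\<^sup>*" "(z, v) \<in> T\<^sup>*" "set zs = between x z"
   "\<forall>p. climb T r S' z p --> climb T r S' x (zs @ p)" "between x z \<inter> S' = {}"
   and s': "sets3 (S' \<union> between x z) (COVs B0 \<union> between x z) (NCs B0 \<union> {c \<in> between x z. par c ~= v}) ar'"
   and fr: "eq_off {aVIS, aCOV, aNC} ar' ar" "eq_off {hP, hD, hI, hW, hC, hX, hY} rg' rg"
   and o: "out' = out @ (if em then v # zs else [])" and t: "t' + vsum S' <= t + 2 + vsum (S' \<union> between x z)"
   unfolding I_def by blast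
  have "z \<in> S' \<union> between x z" using bv s' z(1,2) by (auto simp: sets3_def)
  then have zS: "z \<in> S'" using between_notin by blast
  then have zV: "z \<in> VISs B0 \<union> {v}" by (auto simp: S'_def)
  \<comment> \<open>The marks actually set reach only up to \<open>z\<close>, yet they amount to
    those of the whole path up to \<open>v\<close>.\<close>
  note sets = chain_sets[OF B0 v(1) z(3,4) zV]
  have cl: "climb T r S' x (zs @ [z])" using z(6) climb.Stop[of z S' r T] zS by blast
  have V: "VISs (insert (v, x) B0) = S' \<union> between x z" using sets(3) by (auto simp: S'_def)
  have g: "rg' gN = n" using fr c by (simp add: cst2_def cst_def)
  have tt: "Suc (Suc (Suc t')) + vsum (VISs B0) <= t + 10 + vsum (VISs (insert (v, x) B0))"
  proof -
   have "vsum (VISs B0) <= vsum S'" by (rule vsum_mono) (auto simp: S'_def)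
   then show ?thesis using t unfolding V by linarith
  qed
  have "Q rg' ar' (Suc (Suc (Suc t'))) (out @ (if em then v # (zs @ [z]) @ [n] else []))"
  proof (rule Q[OF _ _ _ fr tt])
   show "climb T r (insert v (VISs B0)) x (zs @ [z])" using cl by (simp add: S'_def)
   show "VISs (insert (v, x) B0) = VISs B0 \<union> set (v # zs @ [z])" using zS z(5) unfolding V by (auto simp: S'_def)
   show "sets3 (VISs (insert (v, x) B0)) (COVs (insert (v, x) B0)) (NCs (insert (v, x) B0)) ar'"
    using s' unfolding V sets(1,2) .
  qed
  then show "wp (emit_if em (Rg hX) ;; emit_if em (Rg gN)) Q rg' ar' (Suc t') out'"
   using z(2) g o by (cases em) simp_all
 qed
 then show ?thesis unfolding chain_prog_def using vx v l1
  by (simp add: lens2 wds2 ar1_def split del: if_split cong: if_cong)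
qed

text \<open>\<open>DD x\<close> are the discovered vertices already accounted for in the counter of
  \<open>x\<close>; it varies with \<open>x\<close> because in the midst of the scan at
  \<open>v\<close> only some neighbours have been decremented for \<open>v\<close>. Nothing is
  claimed once all lower neighbours are accounted for, as the counter has then underflowed.\<close>

definition ctr :: "nat set => (nat => nat set) => arrays => bool" where
 "ctr Dn DD ar \<longleftrightarrow> (\<forall>x<n. x \<notin> Dn --> card (set (adj ! x) \<inter> DD x) < card {z \<in> set (adj ! x). P z < P x} -->
  nval (ar aCT) x + card (set (adj ! x) \<inter> DD x) + 1 = card {z \<in> set (adj ! x). P z < P x})"

definition crel :: "bool => (nat => nat) => arrays => nat list => (nat \<times> nat) list => nat set => (nat => nat set) =>
  (nat => nat) => arrays => nat list => bool" where
 "crel em rg0 ar0 out0 bs Dn DD rg ar out \<longleftrightarrow> (\<forall>x\<ge>70. rg x = rg0 x) & lrel ar & isbit (ar aPI) & isbit (ar aCT) &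
  parent_ok T ar & ctr Dn DD ar & sets3 (VISs (set bs)) (COVs (set bs)) (NCs (set bs)) ar & ar aREP = ar0 aREP &
  (\<exists>cs. chains T r {} bs cs & \<Union>(set ` set cs) = VISs (set bs) &
   out = out0 @ (if em then concat (map (\<lambda>c. c @ [n]) cs) else []))"

definition cost2 :: "nat => nat" where "cost2 x = 5 + 45 * deg x"

text \<open>The credit is bounded by an inequality because the decrements are amortised:
  \<open>5 * zeros\<close> is their potential, at most \<open>5 * NT\<close>.\<close>

definition HI2 :: "bool => (nat => nat) => arrays => nat list => nat event list => nat => (nat => nat) => arrays => nat list => bool" where
 "HI2 em rg0 ar0 out0 es \<tau> rg ar out \<longleftrightarrow> (\<exists>s. reach s & snd (snd s) = es) &
  crel em rg0 ar0 out0 (bks es) (disc es) (\<lambda>_. disc es) rg ar out &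
  \<tau> + 5 * zeros (ar aCT) <= length es + (\<Sum>x\<in>disc es. cost2 x) + vsum (VISs (set (bks es))) + 5 * NT"

lemma hook2_ok:
 assumes c: "cst2 rg0"
  and s: "reach ((v, 0) # stk, k, es @ [Discover v])" "v \<notin> disc es"
  and h: "crel em rg0 ar0 out0 (bks es) (disc es) (\<lambda>_. disc es) rg ar out"
  and vU: "rg vU = v" and D: "\<forall>x<n. ar aD x = (if x \<in> disc (es @ [Discover v]) then 1 else 0)"
  and Q: "\<And>rg' ar' t' out'. crel em rg0 ar0 out0 (bks (es @ [Discover v])) (disc (es @ [Discover v])) (\<lambda>_. disc (es @ [Discover v])) rg' ar' out' ==>
   (\<forall>x<20. rg' x = rg x) ==> (\<forall>k<10. ar' k = ar k) ==>
   t' + 5 * zeros (ar' aCT) + vsum (VISs (set (bks es))) <= t + cost2 v + 5 * zeros (ar aCT) + vsum (VISs (set (bks (es @ [Discover v])))) ==>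
   Q rg' ar' t' out'"
 shows "wp (hook2 em) Q rg ar t out"
proof -
 define Dn where "Dn = disc (es @ [Discover v])"
 have Dn: "Dn = insert v (disc es)" by (simp add: Dn_def)
 have v: "v < n" using reach_vertex[OF s(1)] .
 have dv: "deg v <= n" using deg_le v by simp
 have dpos: "x \<in> Dn \<longleftrightarrow> P x <= P v" if "x < n" for x
  using disc_iff_pos[OF s F that] by (simp add: Dn_def P_eq)
 define bt where "bt = (\<lambda>x. P v < P x & (x, v) \<notin> T)"
 define bsk where "bsk = (\<lambda>i. bks es @ map (Pair v) (filter bt (take i (adj ! v))))"
 \<comment> \<open>After \<open>i\<close> arcs the first \<open>i\<close> neighbours count as
   decremented on behalf of \<open>v\<close>, the others not yet.\<close>
 define DD where "DD = (\<lambda>i x. if x \<in> set (take i (adj ! v)) then Dn else disc es)"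
 have dsub: "disc es \<subseteq> {..<n}" using reach_dinv[OF s(1)] by simp
 have bse: "set (bks es) \<subseteq> back_edges G T" "\<forall>a \<in> fst ` set (bks es). P a <= P v"
 proof -
  show "set (bks es) \<subseteq> back_edges G T" using bf_back dsub by (force simp: bks_def disc_def)
  have "a \<in> disc es" if "a \<in> fst ` set (bks es)" for a using that by (force simp: bks_def bf_def disc_def)
  then show "\<forall>a \<in> fst ` set (bks es). P a <= P v" using dpos dsub Dn by blast
 qed
 have bsk: "set (bsk i) \<subseteq> back_edges G T" "\<forall>a \<in> fst ` set (bsk i). P a <= P v" for i
 proof -
  have "set (map (Pair v) (filter bt (take i (adj ! v)))) \<subseteq> set (bf v)"
   unfolding bf_def bt_def by (auto dest: in_set_takeD)
  then show "set (bsk i) \<subseteq> back_edges G T" using bse(1) bf_back[OF v] by (auto simp: bsk_def)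
  show "\<forall>a \<in> fst ` set (bsk i). P a <= P v" using bse(2) by (auto simp: bsk_def)
 qed
 define M where "M = (\<lambda>rg' ar' t' out'. \<exists>i. i <= deg v & rg' hK = i & rg' vU = v & (\<forall>x<20. rg' x = rg x) & (\<forall>k<10. ar' k = ar k) &
  crel em rg0 ar0 out0 (bsk i) Dn (DD i) rg' ar' out' &
  t' + 5 * zeros (ar' aCT) + vsum (VISs (set (bks es))) <= t + 1 + 45 * i + 5 * zeros (ar aCT) + vsum (VISs (set (bsk i))))"
 have l1: "Suc 0 < 2 ^ w" by (intro small; simp)
 have bsk0: "bsk 0 = bks es" by (simp add: bsk_def)
 have bskn: "bsk (deg v) = bks (es @ [Discover v])" by (simp add: bsk_def bks_def bf_def bt_def)
 have body: "wp (hook2_body em) M rg' ar' (Suc t') out'" if m: "M rg' ar' t' out'" and lt: "rg' hK < deg v" for rg' ar' t' out'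
 proof -
  obtain i where i: "i < deg v" "rg' hK = i" "rg' vU = v" "\<forall>x<20. rg' x = rg x" "\<forall>k<10. ar' k = ar k"
   and cr: "crel em rg0 ar0 out0 (bsk i) Dn (DD i) rg' ar' out'"
   and t: "t' + 5 * zeros (ar' aCT) + vsum (VISs (set (bks es))) <= t + 1 + 45 * i + 5 * zeros (ar aCT) + vsum (VISs (set (bsk i)))"
   using m lt unfolding M_def by auto
  define x where "x = adj ! v ! i"
  have xa: "x \<in> set (adj ! v)" using i by (simp add: x_def)
  have x: "x < n" using nb_less[OF v xa] .
  have vx: "v \<in> set (adj ! x)" using sym_adj[OF v xa] .
  have si: "Suc i < 2 ^ w" using i dv by (intro small) linarith
  have tk: "take (Suc i) (adj ! v) = take i (adj ! v) @ [x]" using i by (simp add: x_def take_Suc_conv_app_nth)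
  have xi: "x \<notin> set (take i (adj ! v))"
  proof -
   have "distinct (take (Suc i) (adj ! v))" using distinct_adj[OF disjI1[OF gi] v] by simp
   then show ?thesis unfolding tk by simp
  qed
  have DDS: "DD (Suc i) = (DD i)(x := Dn)" unfolding DD_def tk by (rule ext) simp
  have bS: "bsk (Suc i) = bsk i @ (if bt x then [(v, x)] else [])" unfolding bsk_def tk by simp
  define rg1 where "rg1 = rg'(hX := x, hK := Suc i)"
  have c1: "cst2 rg1" by (rule cst2_cong[OF c]) (insert cr, simp add: crel_def rg1_def)
  have Dx: "ar' aD x = (if x \<in> Dn then 1 else 0)" using D i(5) x by (simp add: Dn_def)
  show ?thesis
  proof (cases "x \<in> Dn")
   case True
   then have nb: "\<not> bt x" using dpos[OF x] by (simp add: bt_def)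
   have "ctr Dn (DD (Suc i)) ar'" using cr True by (simp add: crel_def ctr_def DDS)
   then have "crel em rg0 ar0 out0 (bsk (Suc i)) Dn (DD (Suc i)) rg1 ar' out'"
    using cr nb by (simp add: crel_def bS rg1_def)
   then have "M rg1 ar' (t' + 5) out'" unfolding M_def
    using i t nb by (intro exI[of _ "Suc i"]) (simp add: bS rg1_def)
   moreover have "t' + 5 = Suc (Suc (Suc (Suc (Suc t'))))" by simp
   ultimately show ?thesis unfolding hook2_body_def
    using i(1-3) v x si l1 True by (simp add: x_def[symmetric] Dx lens rg1_def w_pos)
  next
   case False
   define a where "a = card (set (adj ! x) \<inter> disc es)"
   define cc where "cc = card {z \<in> set (adj ! x). P z < P x}"
   have e1: "set (adj ! x) \<inter> Dn = insert v (set (adj ! x) \<inter> disc es)" using vx Dn by auto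
   have a1: "card (set (adj ! x) \<inter> Dn) = Suc a" unfolding e1 a_def using s(2) by simp
   have pvx: "P v < P x" using dpos[OF x] False by simp
   have e2: "set (adj ! x) \<inter> Dn = {z \<in> set (adj ! x). P z <= P v}" using dpos nb_less[OF x] by auto
   have sub: "set (adj ! x) \<inter> Dn \<subseteq> {z \<in> set (adj ! x). P z < P x}" using e2 pvx by auto
   then have le: "Suc a <= cc" unfolding a1[symmetric] cc_def by (intro card_mono) auto
   have child: "(x, v) \<in> T \<longleftrightarrow> Suc a = cc" using child_test[OF v xa pvx] unfolding e2[symmetric] a1 cc_def .
   \<comment> \<open>Before this decrement the counter is the number of lower neighbours of
     \<open>x\<close> other than \<open>v\<close> and those discovered before \<open>v\<close>. By
     \<open>child_test\<close> it is 0 iff \<open>v\<close> is the parent, which tells tree edges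
     from back edges.\<close>
   have nv: "nval (ar' aCT) x + a + 1 = cc"
   proof -
    have ct: "ctr Dn (DD i) ar'" using cr by (simp add: crel_def)
    have DDx: "DD i x = disc es" using xi by (simp add: DD_def)
    have "a < cc" using le by simp
    then have "card (set (adj ! x) \<inter> DD i x) < card {z \<in> set (adj ! x). P z < P x}" by (simp add: DDx a_def cc_def)
    from ct[unfolded ctr_def, rule_format, OF x False this] show ?thesis by (simp add: DDx a_def cc_def)
   qed
   have bt: "bt x \<longleftrightarrow> 0 < nval (ar' aCT) x" using child nv pvx by (simp add: bt_def) linarith
   have "wp dec (wp (Cond (Eqv (Rg hO) (Lit 0)) (chain_prog em) Nop) M) rg1 ar' (t' + 4) out'"
   proof (rule dec_ok[where x = x])
    show "lrel ar'" "isbit (ar' aCT)" "cst2 rg1" "x < n" "rg1 hX = x" using cr c1 x by (simp_all add: crel_def rg1_def)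
    fix rg2 f t2
    assume f: "isbit f" and r2: "rg2 hO = (if nval (ar' aCT) x = 0 then 1 else 0)"
     and fx: "0 < nval (ar' aCT) x ==> nval f x + 1 = nval (ar' aCT) x"
     and fy: "\<And>y. y < n ==> y ~= x ==> nval f y = nval (ar' aCT) y"
     and g2: "eq_off {hP, hD, hO} rg2 rg1"
     and t2: "t2 + 5 * zeros f <= t' + 4 + 20 + 5 * zeros (ar' aCT)"
    define ar2 where "ar2 = ar'(aCT := f)"
    have ct2: "ctr Dn (DD (Suc i)) ar2"
     unfolding ctr_def
    proof (intro allI impI)
     fix y assume y: "y < n" "y \<notin> Dn" "card (set (adj ! y) \<inter> DD (Suc i) y) < card {z \<in> set (adj ! y). P z < P y}"
     show "nval (ar2 aCT) y + card (set (adj ! y) \<inter> DD (Suc i) y) + 1 = card {z \<in> set (adj ! y). P z < P y}"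
     proof (cases "y = x")
      case True
      then have "Suc a < cc" using y a1 by (simp add: DDS cc_def)
      then have "0 < nval (ar' aCT) x" using nv by linarith
      then have "nval f x + Suc a + 1 = cc" using fx nv by linarith
      then show ?thesis using True a1 by (simp add: DDS ar2_def cc_def)
     next
      case yx: False
      then show ?thesis using cr y fy[OF y(1)] by (simp add: crel_def ctr_def DDS ar2_def)
     qed
    qed
    have cr2: "crel em rg0 ar0 out0 (bsk i) Dn (DD (Suc i)) rg2 ar2 out'"
     using cr ct2 f g2 by (simp add: crel_def ar2_def lrel_def parent_ok_def sets3_def rg1_def)
    have c2: "cst2 rg2" by (rule cst2_cong[OF c1]) (use g2 in simp)
    show "wp (Cond (Eqv (Rg hO) (Lit 0)) (chain_prog em) Nop) M rg2 (ar'(aCT := f)) t2 out'"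
    proof (cases "bt x")
     case nb: False
     have "M rg2 ar2 (Suc (Suc t2)) out'" unfolding M_def
      using i t cr2 nb g2 t2 by (intro exI[of _ "Suc i"]) (simp add: bS rg1_def ar2_def)
     then show ?thesis using nb bt r2 w_pos by (simp add: ar2_def)
    next
     case tb: True
     have vxb: "(v, x) \<in> back_edges G T"
      using tb white[OF v xa pvx] v xa by (simp add: back_iff bt_def)
     have "wp (chain_prog em) M rg2 ar2 (Suc t2) out'"
     proof (rule chain_ok[OF _ c2 _ _ bsk(1)[of i] bsk(2)[of i] vxb])
      show "lrel ar2" "isbit (ar2 aPI)" "parent_ok T ar2" using cr2 by (simp_all add: crel_def)
      show "sets3 (VISs (set (bsk i))) (COVs (set (bsk i))) (NCs (set (bsk i))) ar2" using cr2 by (simp add: crel_def)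
      show "rg2 vU = v" "rg2 hX = x" using g2 i by (simp_all add: rg1_def)
      fix rg3 ar3 t3 p
      assume cl: "climb T r (insert v (VISs (set (bsk i)))) x p"
       and Vs: "VISs (insert (v, x) (set (bsk i))) = VISs (set (bsk i)) \<union> set (v # p)"
       and s3: "sets3 (VISs (insert (v, x) (set (bsk i)))) (COVs (insert (v, x) (set (bsk i)))) (NCs (insert (v, x) (set (bsk i)))) ar3"
       and g3: "eq_off {aVIS, aCOV, aNC} ar3 ar2" "eq_off {hP, hD, hI, hW, hC, hX, hY} rg3 rg2"
       and t3: "t3 + vsum (VISs (set (bsk i))) <= Suc t2 + 10 + vsum (VISs (insert (v, x) (set (bsk i))))"
      have bse: "set (bsk (Suc i)) = insert (v, x) (set (bsk i))" using tb by (simp add: bS)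
      have bsl: "bsk (Suc i) = bsk i @ [(v, x)]" using tb by (simp add: bS)
      obtain cs where cs: "chains T r {} (bsk i) cs" "\<Union>(set ` set cs) = VISs (set (bsk i))"
       "out' = out0 @ (if em then concat (map (\<lambda>c. c @ [n]) cs) else [])" using cr2 unfolding crel_def by blast
      have ch: "chains T r {} (bsk (Suc i)) (cs @ [v # p])" unfolding bsl
       by (rule chains_snoc[OF cs(1)]) (use cl cs(2) in simp)
      have un: "\<Union>(set ` set (cs @ [v # p])) = VISs (set (bsk (Suc i)))"
       unfolding bse Vs using cs(2) by auto
      have "crel em rg0 ar0 out0 (bsk (Suc i)) Dn (DD (Suc i)) rg3 ar3 (out' @ (if em then v # p @ [n] else []))"
       unfolding crel_def
      proof (intro conjI)
       show "\<exists>cs. chains T r {} (bsk (Suc i)) cs & \<Union> (set ` set cs) = VISs (set (bsk (Suc i))) &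
        out' @ (if em then v # p @ [n] else []) = out0 @ (if em then concat (map (\<lambda>c. c @ [n]) cs) else [])"
        using ch un cs(3) by (intro exI[of _ "cs @ [v # p]"]) simp
       show "sets3 (VISs (set (bsk (Suc i)))) (COVs (set (bsk (Suc i)))) (NCs (set (bsk (Suc i)))) ar3"
        using s3 unfolding bse .
      qed (insert cr2 g3, simp_all add: crel_def lrel_def parent_ok_def ctr_def)
      moreover have "t3 + 5 * zeros (ar3 aCT) + vsum (VISs (set (bks es))) <= t + 1 + 45 * Suc i + 5 * zeros (ar aCT) + vsum (VISs (set (bsk (Suc i))))"
       using t t2 t3 g3 unfolding bse by (simp add: ar2_def)
      ultimately show "M rg3 ar3 t3 (out' @ (if em then v # p @ [n] else []))" unfolding M_def
       using i g3 g2 by (intro exI[of _ "Suc i"]) (simp add: rg1_def ar2_def)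
     qed
     then show ?thesis using tb bt r2 w_pos by (simp add: ar2_def)
    qed
   qed
   moreover have "t' + 4 = Suc (Suc (Suc (Suc t')))" by simp
   ultimately show ?thesis unfolding hook2_body_def
    using i(1-3) v x si l1 False by (simp add: x_def[symmetric] Dx lens rg1_def w_pos)
  qed
 qed
 have dn0: "ctr Dn (DD 0) ar" using h by (simp add: crel_def ctr_def DD_def Dn)
 have M0: "M (rg(hK := 0)) ar (Suc t) out" unfolding M_def
  using vU h dn0 by (intro exI[of _ 0]) (simp add: bsk0 crel_def)
 have bvd: "bv rg' ar' (Lt (Rg hK) (Dg (Rg vU))) \<longleftrightarrow> rg' hK < deg v" if "M rg' ar' t' out'" for rg' ar' t' out'
  using that unfolding M_def by auto
 have fin: "Q rg' ar' (Suc t') out'" if m: "M rg' ar' t' out'" and ge: "\<not> rg' hK < deg v" for rg' ar' t' out'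
 proof -
  have cr: "crel em rg0 ar0 out0 (bsk (deg v)) Dn (DD (deg v)) rg' ar' out'" and g: "\<forall>x<20. rg' x = rg x" "\<forall>k<10. ar' k = ar k"
   and t: "t' + 5 * zeros (ar' aCT) + vsum (VISs (set (bks es))) <= t + 1 + 45 * deg v + 5 * zeros (ar aCT) + vsum (VISs (set (bsk (deg v))))"
   using m ge unfolding M_def by (auto simp: not_less dest: le_antisym)
  \<comment> \<open>Vertices outside the list of \<open>v\<close> do not have \<open>v\<close> as a
    neighbour, so for them the distinction made by \<open>DD\<close> disappears.\<close>
  have "set (adj ! x) \<inter> DD (deg v) x = set (adj ! x) \<inter> Dn" if "x < n" for x
   using sym_adj[OF that, of v] by (auto simp: DD_def Dn)
  then have "ctr Dn (\<lambda>_. Dn) ar'" using cr by (simp add: crel_def ctr_def)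
  then have "crel em rg0 ar0 out0 (bks (es @ [Discover v])) Dn (\<lambda>_. Dn) rg' ar' out'"
   using cr by (simp add: crel_def bskn)
  then show ?thesis unfolding Dn_def
   by (intro Q) (insert g t, simp_all add: bskn cost2_def)
 qed
 have "wp (Loop (Lt (Rg hK) (Dg (Rg vU))) (hook2_body em)) Q (rg(hK := 0)) ar (Suc t) out"
 proof (rule wp_loop[where I = M and B = "t + 1 + 45 * deg v + 5 * zeros (ar aCT) + vsum UNIV"])
  show "M (rg(hK := 0)) ar (Suc t) out" by (rule M0)
 next
  fix rg' ar' t' out' assume m: "M rg' ar' t' out'"
  then obtain i where "i <= deg v" "t' + 5 * zeros (ar' aCT) + vsum (VISs (set (bks es))) <= t + 1 + 45 * i + 5 * zeros (ar aCT) + vsum (VISs (set (bsk i)))"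
   unfolding M_def by blast
  then show "t' <= t + 1 + 45 * deg v + 5 * zeros (ar aCT) + vsum UNIV" using vsum_mono[of "VISs (set (bsk i))" UNIV] by simp
  show "bok rg' ar' (Lt (Rg hK) (Dg (Rg vU)))" using m v unfolding M_def by auto
  show "wp (hook2_body em) M rg' ar' (Suc t') out'" if "bv rg' ar' (Lt (Rg hK) (Dg (Rg vU)))"
   using body[OF m] that bvd[OF m] by blast
  show "Q rg' ar' (Suc t') out'" if "\<not> bv rg' ar' (Lt (Rg hK) (Dg (Rg vU)))"
   using fin[OF m] that bvd[OF m] by blast
 qed
 then show ?thesis unfolding hook2_def using w_pos by simp
qed

lemma P_root: "z < n ==> P r <= P z"
 using T_to_root[of z] T_pos[of z r] by (auto simp: rtrancl_eq_or_trancl intro: less_imp_le)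

lemma bks_all: "set (bks (snd (snd F))) = back_edges G T"
proof -
 have "disc (snd (snd F)) = {..<n}" by (rule final_disc[OF F])
 then have "set (bks (snd (snd F))) = (\<Union>v<n. set (bf v))" by (simp add: bks_def disc_def)
 also have "\<dots> = back_edges G T" using bf_back by (auto simp: back_iff)
 finally show ?thesis .
qed

lemma second_ok:
 assumes c: "cst2 rg" and l: "lrel ar" and D: "\<forall>v<n. ar aD v = 0" and U: "\<forall>p < 2 * n + 1. ar aU p = 0"
  and b: "isbit (ar aPI)" "isbit (ar aCT)" and p: "parent_ok T ar" and k: "counters_ok (snd (snd F)) ar"
  and z: "sets3 {} {} {} ar"
  and Q: "\<And>rg' ar' t' cs. cst2 rg' ==> lrel ar' ==> isbit (ar' aPI) ==>
   parent_ok T ar' ==> sets3 (VISs (back_edges G T)) (COVs (back_edges G T)) (NCs (back_edges G T)) ar' ==>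
   ar' aREP = ar aREP ==> chain_decomposition G r cs ==>
   t' <= t + (2 * n + (\<Sum>x<n. cost2 x) + vsum UNIV + 5 * NT) + DFSB ==>
   Q rg' ar' t' (out @ (if em then concat (map (\<lambda>c. c @ [n]) cs) else []))"
 shows "wp (second_prog em) Q rg ar t out"
proof -
 interpret H: dfs_hooks w adj r na len wd xl S B L "hook2 em" Nop "HI2 em rg ar out"
  "2 * n + (\<Sum>x<n. cost2 x) + vsum UNIV + 5 * NT"
 proof
  fix es \<tau> rg' ar' out' assume h: "HI2 em rg ar out es \<tau> rg' ar' out'"
  then obtain s where s: "reach s" "snd (snd s) = es" by (auto simp: HI2_def)
  have "disc es \<subseteq> {..<n}" using reach_dinv[OF s(1)] s(2) by (cases s) simp
  then have "(\<Sum>x\<in>disc es. cost2 x) <= (\<Sum>x<n. cost2 x)" by (intro sum_mono2) auto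
  moreover have "length es <= 2 * n" using reach_events[OF s(1)] s(2) by simp
  moreover have "vsum (VISs (set (bks es))) <= vsum UNIV" by (rule vsum_mono) simp
  moreover have "\<tau> <= length es + (\<Sum>x\<in>disc es. cost2 x) + vsum (VISs (set (bks es))) + 5 * NT" using h by (simp add: HI2_def)
  ultimately show "\<tau> <= 2 * n + (\<Sum>x<n. cost2 x) + vsum UNIV + 5 * NT" by linarith
 next
  fix es \<tau> rg1 ar1 out1 rg2 ar2
  assume "HI2 em rg ar out es \<tau> rg1 ar1 out1" "\<forall>x\<ge>20. rg2 x = rg1 x" "\<forall>k\<ge>10. ar2 k = ar1 k"
  then show "HI2 em rg ar out es \<tau> rg2 ar2 out1" by (simp add: HI2_def crel_def lrel_def parent_ok_def ctr_def sets3_def)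
 next
  fix u i stk k es \<tau> rg' ar' t' out'
  assume s: "reach ((u, i) # stk, k, es)" "\<not> i < deg u" and h: "HI2 em rg ar out es \<tau> rg' ar' out'"
  have "HI2 em rg ar out (es @ [Finish u]) (\<tau> + 1) rg' ar' out'"
   using reach_finish[OF s] h by (simp add: HI2_def bks_def)
  then show "wp Nop (hook_post (HI2 em rg ar out) (es @ [Finish u]) \<tau> rg' ar' t') rg' ar' t' out'"
   by (auto intro!: exI[of _ "\<tau> + 1"])
 next
  fix u stk k es \<tau> rg' ar' t' out'
  assume s: "reach ((u, 0) # stk, k, es @ [Discover u])" "u \<notin> disc es" and h: "HI2 em rg ar out es \<tau> rg' ar' out'"
   and vU: "rg' vU = u" and D: "\<forall>v<n. ar' aD v = (if v \<in> disc (es @ [Discover u]) then 1 else 0)"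
  have cr: "crel em rg ar out (bks es) (disc es) (\<lambda>_. disc es) rg' ar' out'" using h by (simp add: HI2_def)
  show "wp (hook2 em) (hook_post (HI2 em rg ar out) (es @ [Discover u]) \<tau> rg' ar' t') rg' ar' t' out'"
  proof (rule hook2_ok[OF c s cr vU D])
   fix rg2 ar2 t2 out2
   assume c2: "crel em rg ar out (bks (es @ [Discover u])) (disc (es @ [Discover u])) (\<lambda>_. disc (es @ [Discover u])) rg2 ar2 out2"
    and g: "\<forall>x<20. rg2 x = rg' x" "\<forall>k<10. ar2 k = ar' k"
    and t2: "t2 + 5 * zeros (ar2 aCT) + vsum (VISs (set (bks es))) <= t' + cost2 u + 5 * zeros (ar' aCT) + vsum (VISs (set (bks (es @ [Discover u]))))"
   \<comment> \<open>The largest credit that the invariant admits; the subtraction is safe as there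
     are at most \<open>NT\<close> zeros.\<close>
   define \<tau>2 where "\<tau>2 = length es + 1 + ((\<Sum>x\<in>disc es. cost2 x) + cost2 u) + vsum (VISs (set (bks (es @ [Discover u])))) + 5 * NT - 5 * zeros (ar2 aCT)"
   have zl: "5 * zeros (ar2 aCT) <= 5 * NT" using zeros_le by simp
   have e2: "\<tau>2 + 5 * zeros (ar2 aCT) = length es + 1 + ((\<Sum>x\<in>disc es. cost2 x) + cost2 u) + vsum (VISs (set (bks (es @ [Discover u])))) + 5 * NT"
    unfolding \<tau>2_def using zl by linarith
   have sm: "(\<Sum>x\<in>disc (es @ [Discover u]). cost2 x) = (\<Sum>x\<in>disc es. cost2 x) + cost2 u"
    using s(2) by (simp add: disc_def)
   have "HI2 em rg ar out (es @ [Discover u]) \<tau>2 rg2 ar2 out2"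
    unfolding HI2_def sm using s(1) c2 e2 by (auto intro!: exI[of _ "((u, 0) # stk, k, es @ [Discover u])"])
   moreover have "\<tau> + 5 * zeros (ar' aCT) <= length es + (\<Sum>x\<in>disc es. cost2 x) + vsum (VISs (set (bks es))) + 5 * NT"
    using h by (simp add: HI2_def)
   then have "t2 + \<tau> <= t' + \<tau>2" using t2 e2 by linarith
   moreover have "\<forall>x\<ge>70. rg2 x = rg' x" using c2 cr by (simp add: crel_def)
   ultimately show "(\<forall>x. x < 20 | 70 <= x --> rg2 x = rg' x) & (\<forall>k<10. ar2 k = ar' k) &
    (\<exists>\<tau>'. HI2 em rg ar out (es @ [Discover u]) \<tau>' rg2 ar2 out2 & t2 + \<tau> <= t' + \<tau>')" using g by blast
  qed
 qed
 have lowP: "lower (snd (snd F)) x = {z \<in> set (adj ! x). P z < P x}" for x by (simp add: lower_def P_eq)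
 have ct: "ctr {} (\<lambda>_. {}) ar"
  unfolding ctr_def
 proof (intro allI impI)
  fix x assume x: "x < n" and a: "card (set (adj ! x) \<inter> {}) < card {z \<in> set (adj ! x). P z < P x}"
  \<comment> \<open>The first run records no counter for the root, but the root has no neighbour of
    smaller position, so nothing is claimed about it.\<close>
  have "x ~= r"
  proof
   assume xr: "x = r"
   have "{z \<in> set (adj ! x). P z < P x} ~= {}" using a by (metis card.empty less_nat_zero_code)
   then obtain z where z: "z \<in> set (adj ! x)" "P z < P x" by blast
   then show False using P_root[of z] nb_less[OF x, of z] xr by simp
  qed
  then obtain y where "(x, y) \<in> T" using T_parent[OF x] by blast
  then show "nval (ar aCT) x + card (set (adj ! x) \<inter> {}) + 1 = card {z \<in> set (adj ! x). P z < P x}"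
   using k lowP[of x] unfolding counters_ok_def T_eq[symmetric] by fastforce
 qed
 have "crel em rg ar out [] {} (\<lambda>_. {}) rg ar out"
  unfolding crel_def using l b p ct z
  by (auto simp: VISs_def COVs_def NCs_def intro!: exI[of _ "[]"] chains.intros)
 then have h0: "HI2 em rg ar out [] 0 rg ar out" unfolding HI2_def
  using zeros_le[of "ar aCT"] by (auto simp: bks_def intro!: exI[of _ "([], 0, [])"] reach_init)
 have "cst rg" using c by (simp add: cst2_def)
 then show ?thesis unfolding second_prog_def
 proof (rule H.dfs_prog_ok[OF _ D U h0])
  fix rg' ar' t' out' f \<tau>
  assume f: "reach f" "final f" "HI2 em rg ar out (snd (snd f)) \<tau> rg' ar' out'" and g: "\<forall>x\<ge>70. rg' x = rg x"
   and t: "t' <= t + \<tau> + DFSB"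
  \<comment> \<open>Both runs end in the same state; hence \<open>P\<close> and \<open>T\<close>,
    taken from the first, are right for the second.\<close>
  have fF: "f = F" by (rule final_unique[OF f(1,2) F])
  have cr: "crel em rg ar out (bks (snd (snd F))) (disc (snd (snd F))) (\<lambda>_. disc (snd (snd F))) rg' ar' out'"
   using f(3) by (simp add: HI2_def fF)
  then obtain cs where cs: "chains T r {} (bks (snd (snd F))) cs" "out' = out @ (if em then concat (map (\<lambda>c. c @ [n]) cs) else [])"
   unfolding crel_def by blast
  have cd: "chain_decomposition G r cs"
   unfolding chain_decomposition_def
   by (rule exI[of _ "snd (snd F)"], rule exI[of _ T], rule exI[of _ bf])
    (intro conjI ballI traversal[OF F] T_eq cs(1)[unfolded bks_def], simp_all add: bf_back bf_distinct)
  show "Q rg' ar' t' out'" unfolding cs(2)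
  proof (rule Q[OF _ _ _ _ _ _ cd])
   show "cst2 rg'" by (rule cst2_cong[OF c g])
   show "t' <= t + (2 * n + (\<Sum>x<n. cost2 x) + vsum UNIV + 5 * NT) + DFSB" using t H.HI_bound[OF f(3)] by linarith
  qed (insert cr, simp_all add: crel_def bks_all)
 qed
qed

end

subsection \<open>Bridges, cut vertices and 2-connectivity\<close>

definition
 "bridge_body = Cond (Eqv (Rg hX) ST) Nop (Cond (Eqv (Arr aCOV (Rg hX)) (Lit 0))
  (get ;; Emit (Rg hX) ;; Emit (Nb (Rg hX) (Rg hI))) Nop) ;; hX ::= Rg hX +. Lit 1"

definition
 "bridge_tail = hX ::= Lit 0 ;; Loop (Lt (Rg hX) (Rg gN)) bridge_body"

definition
 "edge_body = Cond (Eqv (Rg hX) ST) Nop (Cond (Eqv (Arr aCOV (Rg hX)) (Lit 0)) (hO ::= Lit 0) Nop) ;;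
  hX ::= Rg hX +. Lit 1"

definition
 "edge_tail = hX ::= Lit 0 ;; hO ::= Lit 1 ;; Loop (Lt (Rg hX) (Rg gN)) edge_body ;;
  Cond (Lt (Lit 1) (Rg gN)) (Emit (Rg hO)) (Emit (Lit 0))"

text \<open>A report prints each cut vertex; a decision only has to remember in \<open>hA\<close>
  that there was one.\<close>

definition mark :: "bool => aexp => prg" where
 "mark rep e = (if rep then Emit e else hA ::= Lit 1)"

text \<open>The number of children of the root saturates at 2, and the root is reported at the
  moment it gets there, hence once.\<close>

definition
 "cut_root rep = Cond (Lt (Rg hO) (Lit 2)) (hO ::= Rg hO +. Lit 1 ;; Cond (Eqv (Rg hO) (Lit 2)) (mark rep ST) Nop) Nop"

text \<open>Several children may prove the same vertex to be a cut vertex; \<open>aREP\<close>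
  prevents repeated reports.\<close>

definition
 "cut_other rep = Cond (Eqv (Arr aNC (Rg hX)) (Lit 0))
  (Cond (Eqv (Arr aREP (Rg hY)) (Lit 0)) (Put aREP (Rg hY) (Lit 1) ;; mark rep (Rg hY)) Nop) Nop"

definition
 "cut_body rep = Cond (Eqv (Rg hX) ST) Nop
  (get ;; hY ::= Nb (Rg hX) (Rg hI) ;; Cond (Eqv (Rg hY) ST) (cut_root rep) (cut_other rep)) ;; hX ::= Rg hX +. Lit 1"

definition
 "cut_tail rep = hX ::= Lit 0 ;; hO ::= Lit 0 ;; hA ::= Lit 0 ;; Loop (Lt (Rg hX) (Rg gN)) (cut_body rep)"

definition
 "vertex_tail = cut_tail False ;; Cond (Lt (Lit 2) (Rg gN)) (Cond (Eqv (Rg hA) (Lit 0)) (Emit (Lit 1)) (Emit (Lit 0))) (Emit (Lit 0))"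

context dfs_second
begin

definition post :: "(nat => nat) => arrays => bool" where
 "post rg ar \<longleftrightarrow> cst2 rg & lrel ar & isbit (ar aPI) & parent_ok T ar &
  (\<forall>z<n. ar aCOV z = of_bool (cov z) & (z ~= r --> ar aNC z = of_bool (ncov z)))"

lemma post_sets:
 "cst2 rg ==> lrel ar ==> isbit (ar aPI) ==> parent_ok T ar ==>
 sets3 (VISs (back_edges G T)) (COVs (back_edges G T)) (NCs (back_edges G T)) ar ==> post rg ar"
 using NCs_back par_T by (auto simp: post_def sets3_def COVs_back)

lemma post_cong: "post rg ar ==> (\<forall>x\<ge>70. rg' x = rg x) ==> (\<forall>k. k ~= aREP --> ar' k = ar k) ==> post rg' ar'"
 using cst2_cong[of rg rg'] by (simp add: post_def lrel_def parent_ok_def)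

lemma parent_nval: "post rg ar ==> x < n ==> x ~= r ==> nval (ar aPI) x < deg x & adj ! x ! nval (ar aPI) x = par x"
 using par_T[of x] by (auto simp: post_def parent_ok_def)

lemma T_iff: "(x, y) \<in> T \<longleftrightarrow> x < n & x ~= r & par x = y"
 using T_edge[of x y] T_root[of y] par_eq[of x y] par_T[of x] by auto

lemma cv_sum: "(\<Sum>i = 0..<n. 20 + cv i + 1) = 21 * n + vsum UNIV"
 by (simp add: sum.distrib vsum_def atLeast0LessThan[symmetric])

text \<open>Two lower ends naming the same edge would be parents of each other, a cycle in the
  tree.\<close>

lemma bridges_distinct:
 assumes "distinct xs" "set xs \<subseteq> {x. x < n & x ~= r}"
 shows "distinct (map (\<lambda>(u, v). {u, v}) (map (\<lambda>x. (x, par x)) xs))"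
proof -
 have "x = y" if "x \<in> set xs" "y \<in> set xs" "{x, par x} = {y, par y}" for x y
 proof (rule ccontr)
  assume "x ~= y"
  then have e: "x = par y" "y = par x" using that(3) by (auto simp: doubleton_eq_iff)
  have "(x, y) \<in> T" "(y, x) \<in> T" using e that assms(2) by (auto simp: T_iff)
  then show False using T_irrefl by (meson trancl.simps)
 qed
 then show ?thesis using assms(1) by (simp add: distinct_map inj_on_def comp_def)
qed

lemma bridge_ok:
 assumes p: "post rg ar"
  and Q: "\<And>rg' t' bs. bridges_spec adj r bs ==> t' <= t + 10 + 21 * n + vsum UNIV ==> Q rg' ar t' (out @ bs)"
 shows "wp bridge_tail Q rg ar t out"
proof -
 define os where "os = (\<lambda>i. concat (map (\<lambda>(u, v). [u, v]) (map (\<lambda>x. (x, par x)) (filter (\<lambda>x. x ~= r & \<not> cov x) [0..<i]))))"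
 define M where "M = (\<lambda>i rg' ar' out'. rg' hX = i & post rg' ar & ar' = ar & out' = out @ os i)"
 have rw: "r < 2 ^ w" using r_less by (intro small) simp
 have "wp (Loop (Lt (Rg hX) (Rg gN)) bridge_body) Q (rg(hX := 0)) ar (Suc t) out"
 proof (rule wp_for[where a = 0 and N = n and M = M and c = "\<lambda>i. 20 + cv i"], goal_cases)
  show "M 0 (rg(hX := 0)) ar out" using post_cong[OF p] by (simp add: M_def os_def)
 next
  fix i rg' ar' out' assume m: "M i rg' ar' out'"
  then have "rg' hX = i" "rg' gN = n" by (simp_all add: M_def post_def cst2_def cst_def)
  then show "bok rg' ar' (Lt (Rg hX) (Rg gN)) & (bv rg' ar' (Lt (Rg hX) (Rg gN)) \<longleftrightarrow> i < n)" by simp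
 next
  case (4 i rg' ar' t' out' Q') note m = 4(1) and i = 4(3) and Q' = 4(4)
  have ps: "post rg' ar" and al: "ar' = ar" and X: "rg' hX = i" and o: "out' = out @ os i" using m by (simp_all add: M_def)
  have s: "Suc i < 2 ^ w" "Suc 0 < 2 ^ w" using i by (intro small; linarith)+
  have cz: "ar aCOV i = of_bool (cov i)" using ps i by (simp add: post_def)
  show "wp bridge_body Q' rg' ar' t' out'"
  proof (cases "i = r | cov i")
   case True
   have "M (Suc i) (rg'(hX := Suc i)) ar out'"
    using m True post_cong[OF ps] by (auto simp: M_def os_def)
   then have "Q' (rg'(hX := Suc i)) ar t'' out'" if "t'' <= t' + 20" for t'' using Q' that by simp
   then show ?thesis unfolding bridge_body_def using True s i w_pos rw
    by (auto simp: X al cz lens2)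
  next
   case False
   have pn: "nval (ar aPI) i < deg i" "adj ! i ! nval (ar aPI) i = par i" using parent_nval[OF ps i] False by simp_all
   have "wp get (wp (Emit (Rg hX) ;; Emit (Nb (Rg hX) (Rg hI))) (wp (hX ::= Rg hX +. Lit 1) Q')) rg' ar (Suc (Suc t')) out'"
   proof (rule get_ok[where x = i])
    show "lrel ar" "cst2 rg'" "isbit (ar aPI)" "i < n" "rg' hX = i" using ps i X by (simp_all add: post_def)
    fix rg2 t2
    assume r2: "rg2 hI = nval (ar aPI) i" "eq_off {hP, hD, hI, hW, hC} rg2 rg'" and t2: "t2 <= Suc (Suc t') + 5 + 8 * bl (deg i)"
    have M2: "M (Suc i) (rg2(hX := Suc i)) ar (out' @ [i, par i])"
     using False o r2 post_cong[OF ps] by (simp add: M_def os_def)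
    show "wp (Emit (Rg hX) ;; Emit (Nb (Rg hX) (Rg hI))) (wp (hX ::= Rg hX +. Lit 1) Q') rg2 ar t2 out'"
     using r2 X i pn s Q'[OF M2] t2 by (simp add: cv_def)
   qed
   then show ?thesis unfolding bridge_body_def using False s i w_pos rw by (simp add: X al cz lens2)
  qed
 next
  case (5 rg' ar' t' out') note m = 5(1) and t = 5(2)
  have o: "out' = out @ os n" "ar' = ar" using m by (simp_all add: M_def)
  define xs where "xs = filter (\<lambda>x. x ~= r & \<not> cov x) [0..<n]"
  have xs: "distinct xs" "set xs = {x. x < n & x ~= r & \<not> cov x}" by (auto simp: xs_def)
  have "set (map (\<lambda>(u, v). {u, v}) (map (\<lambda>x. (x, par x)) xs)) = {{u, v} | u v. bridge G u v}"
   unfolding bridge_iff T_iff using xs(2) by (auto simp: doubleton_eq_iff)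
  then have "bridges_spec adj r (os n)" unfolding bridges_spec_def os_def xs_def[symmetric]
   using bridges_distinct[OF xs(1)] xs(2) by blast
  then show "Q rg' ar' t' out'" unfolding o by (rule Q) (insert t, simp add: cv_sum[simplified])
 qed simp
 then show ?thesis unfolding bridge_tail_def using w_pos by simp
qed

lemma edge_ok:
 assumes p: "post rg ar"
  and Q: "\<And>rg' t'. t' <= t + 10 + 21 * n + vsum UNIV ==>
   Q rg' ar t' (out @ [if 2 <= n & (\<forall>x<n. x ~= r --> cov x) then 1 else 0])"
 shows "wp edge_tail Q rg ar t out"
proof -
 define M where "M = (\<lambda>i rg' ar' out'. rg' hX = i & post rg' ar & ar' = ar & out' = out &
  rg' hO = (if \<forall>x<i. x ~= r --> cov x then 1 else 0))"
 have l1: "Suc 0 < 2 ^ w" "r < 2 ^ w" using r_less by (intro small; simp)+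
 have "wp (Loop (Lt (Rg hX) (Rg gN)) edge_body) (wp (Cond (Lt (Lit 1) (Rg gN)) (Emit (Rg hO)) (Emit (Lit 0))) Q)
   (rg(hX := 0, hO := 1)) ar (Suc (Suc t)) out"
 proof (rule wp_for[where a = 0 and N = n and M = M and c = "\<lambda>i. 5"], goal_cases)
  show "M 0 (rg(hX := 0, hO := 1)) ar out" using post_cong[OF p] by (simp add: M_def)
 next
  fix i rg' ar' out' assume m: "M i rg' ar' out'"
  then have "rg' hX = i" "rg' gN = n" by (simp_all add: M_def post_def cst2_def cst_def)
  then show "bok rg' ar' (Lt (Rg hX) (Rg gN)) & (bv rg' ar' (Lt (Rg hX) (Rg gN)) \<longleftrightarrow> i < n)" by simp
 next
  case (4 i rg' ar' t' out' Q') note m = 4(1) and i = 4(3) and Q' = 4(4)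
  have ps: "post rg' ar" and al: "ar' = ar" and X: "rg' hX = i" using m by (simp_all add: M_def)
  have s: "Suc i < 2 ^ w" using i by (intro small; linarith)
  have cz: "ar aCOV i = of_bool (cov i)" using ps i by (simp add: post_def)
  show "wp edge_body Q' rg' ar' t' out'"
  proof (cases "i = r | cov i")
   case True
   have "M (Suc i) (rg'(hX := Suc i)) ar out'"
    using m True post_cong[OF ps, of "rg'(hX := Suc i)" ar] by (auto simp: M_def less_Suc_eq)
   then have "Q' (rg'(hX := Suc i)) ar t'' out'" if "t'' <= t' + 5" for t'' using Q' that by simp
   then show ?thesis unfolding edge_body_def using True s i w_pos l1
    by (auto simp: X al cz lens2)
  next
   case False
   have "M (Suc i) (rg'(hO := 0, hX := Suc i)) ar out'"
    using m False post_cong[OF ps, of "rg'(hO := 0, hX := Suc i)" ar] by (auto simp: M_def less_Suc_eq)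
   then have "Q' (rg'(hO := 0, hX := Suc i)) ar t'' out'" if "t'' <= t' + 5" for t'' using Q' that by simp
   then show ?thesis unfolding edge_body_def using False s i w_pos l1
    by (auto simp: X al cz lens2)
  qed
 next
  case (5 rg' ar' t' out') note m = 5(1) and t = 5(2)
  have o: "out' = out" "ar' = ar" using m by (simp_all add: M_def)
  have g: "rg' gN = n" using m by (simp_all add: M_def post_def cst2_def cst_def)
  have "Suc (Suc t') <= t + 10 + 21 * n + vsum UNIV" using t by simp
  note q = Q[OF this, of rg']
  define ac where "ac \<longleftrightarrow> (\<forall>x<n. x ~= r --> cov x)"
  have O: "rg' hO = (if ac then 1 else 0)" using m by (simp add: M_def ac_def)
  show "wp (Cond (Lt (Lit 1) (Rg gN)) (Emit (Rg hO)) (Emit (Lit 0))) Q rg' ar' t' out'"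
   using q g l1 w_pos O unfolding o ac_def[symmetric] by (cases ac; cases "2 <= n") simp_all
 qed simp
 then show ?thesis unfolding edge_tail_def using w_pos l1 by simp
qed

text \<open>The cut vertices that the first \<open>i\<close> vertices witness in their role as
  children, as needed for the loop invariant.\<close>

definition cutset :: "nat => nat set" where
 "cutset i = {y. y ~= r & (\<exists>x<i. x ~= r & par x = y & \<not> ncov x)} \<union>
  (if 2 <= card {x. x < i & x ~= r & par x = r} then {r} else {})"

lemma cutset_n: "cutset n = {v. cut_vertex G v}"
proof -
 have "cut_vertex G v \<longleftrightarrow> v \<in> cutset n" for v
 proof (cases "v = r")
  case True
  define A where "A = {x. x < n & x ~= r & par x = r}"
  have "finite A" by (simp add: A_def)
  then have "2 <= card A \<longleftrightarrow> (\<exists>c c'. c ~= c' & c \<in> A & c' \<in> A)"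
   using card_le_Suc0_iff_eq[of A] by (auto simp: not_le[symmetric] numeral_2_eq_2 not_less_eq_eq[symmetric])
  moreover have "r \<in> cutset n \<longleftrightarrow> 2 <= card A" by (simp add: cutset_def A_def)
  ultimately show ?thesis unfolding True cut_vertex_root T_iff by (simp add: A_def)
 next
  case False
  show ?thesis
  proof (cases "v < n")
   case True
   show ?thesis unfolding cut_vertex_nonroot[OF True False] T_iff cutset_def using False by auto
  next
   case ge: False
   then have "\<not> (\<exists>x<n. x ~= r & par x = v & \<not> ncov x)" using T_edge[OF par_T] by blast
   then have "v \<notin> cutset n" using False by (simp add: cutset_def)
   then show ?thesis using ge by (simp add: cut_vertex_def)
  qed
 qed
 then show ?thesis by auto
qed

lemma cut_ok:
 assumes p: "post rg ar" and z: "\<forall>x<n. ar aREP x = 0"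
  and Q: "\<And>rg' ar' t' cs. distinct cs ==> set cs = {v. cut_vertex G v} ==> rg' gN = n ==>
   (\<not> rep --> rg' hA = (if cs = [] then 0 else 1)) ==> t' <= t + 10 + 21 * n + vsum UNIV ==>
   Q rg' ar' t' (out @ (if rep then cs else []))"
 shows "wp (cut_tail rep) Q rg ar t out"
proof -
 define rc where "rc = (\<lambda>i. card {x. x < i & x ~= r & par x = r})"
 define M where "M = (\<lambda>i rg' ar' out'. rg' hX = i & post rg' ar' & rg' hO = min 2 (rc i) &
  (\<exists>cs. distinct cs & set cs = cutset i & (\<forall>y<n. y ~= r --> ar' aREP y = of_bool (y \<in> set cs)) &
   (\<not> rep --> rg' hA = (if cs = [] then 0 else 1)) & out' = out @ (if rep then cs else [])))"
 have l1: "Suc 0 < 2 ^ w" "1 < (2::nat) ^ w" "2 < (2::nat) ^ w" "r < 2 ^ w" using r_less by (intro small; simp)+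
 define rg1 where "rg1 = rg(hX := 0, hO := 0, hA := 0)"
 have "wp (Loop (Lt (Rg hX) (Rg gN)) (cut_body rep)) Q rg1 ar (t + 3) out"
 proof (rule wp_for[where a = 0 and N = n and M = M and c = "\<lambda>i. 20 + cv i"], goal_cases)
  show "M 0 rg1 ar out" unfolding M_def
   using post_cong[OF p, of rg1 ar] z by (auto simp: rg1_def rc_def cutset_def intro!: exI[of _ "[]"])
 next
  fix i rg' ar' out' assume m: "M i rg' ar' out'"
  then have "rg' hX = i" "rg' gN = n" by (simp_all add: M_def post_def cst2_def cst_def)
  then show "bok rg' ar' (Lt (Rg hX) (Rg gN)) & (bv rg' ar' (Lt (Rg hX) (Rg gN)) \<longleftrightarrow> i < n)" by simp
 next
  case (4 i rg' ar' t' out' Q') note m = 4(1) and i = 4(3) and Q' = 4(4)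
  have ps: "post rg' ar'" and X: "rg' hX = i" and O: "rg' hO = min 2 (rc i)" using m by (simp_all add: M_def)
  obtain cs where cs: "distinct cs" "set cs = cutset i" "\<forall>y<n. y ~= r --> ar' aREP y = of_bool (y \<in> set cs)"
   "\<not> rep --> rg' hA = (if cs = [] then 0 else 1)" "out' = out @ (if rep then cs else [])" using m unfolding M_def by blast
  have s: "Suc i < 2 ^ w" using i by (intro small; linarith)
  show "wp (cut_body rep) Q' rg' ar' t' out'"
  proof (cases "i = r")
   case True
   have "rc (Suc i) = rc i" unfolding rc_def by (rule arg_cong[where f = card]) (insert True, auto simp: less_Suc_eq)
   moreover from this have "cutset (Suc i) = cutset i" unfolding cutset_def rc_def
    using True by (auto simp: less_Suc_eq)
   ultimately have "M (Suc i) (rg'(hX := Suc i)) ar' out'"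
    unfolding M_def using cs O post_cong[OF ps, of "rg'(hX := Suc i)" ar'] by auto
   then have "Q' (rg'(hX := Suc i)) ar' t'' out'" if "t'' <= t' + 20" for t'' using Q' that by simp
   then show ?thesis unfolding cut_body_def using True s l1 by (simp add: X)
  next
   case False
   define y where "y = par i"
   have pn: "nval (ar' aPI) i < deg i" "adj ! i ! nval (ar' aPI) i = y" using parent_nval[OF ps i] False by (simp_all add: y_def)
   have yn: "y < n" using T_edge[OF par_T[OF i False]] by (simp add: y_def)
   have cz: "ar' aNC i = of_bool (ncov i)" using ps i False by (simp add: post_def)
   have fin: "finite {x. x < i & x ~= r & par x = r}" by simp
   have rS: "rc (Suc i) = (if y = r then Suc (rc i) else rc i)"
   proof -
    have "{x. x < Suc i & x ~= r & par x = r} = (if y = r then {i} else {}) \<union> {x. x < i & x ~= r & par x = r}"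
     using False by (auto simp: less_Suc_eq y_def)
    then show ?thesis using fin by (simp add: rc_def)
   qed
   have cS: "cutset (Suc i) = (if y ~= r & \<not> ncov i | y = r & 2 <= rc (Suc i) then insert y (cutset i) else cutset i)"
   proof -
    have a: "{z. z ~= r & (\<exists>x<Suc i. x ~= r & par x = z & \<not> ncov x)} =
     (if y ~= r & \<not> ncov i then {y} else {}) \<union> {z. z ~= r & (\<exists>x<i. x ~= r & par x = z & \<not> ncov x)}"
     using False by (auto simp: less_Suc_eq y_def)
    have rc': "card {x. x < k & x ~= r & par x = r} = rc k" for k by (simp add: rc_def)
    show ?thesis unfolding cutset_def a rc' rS by auto
   qed
   have yr: "y \<in> cutset i \<longleftrightarrow> 2 <= rc i" if "y = r" using that by (auto simp: cutset_def rc_def)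
   have new: "M (Suc i) rg3 ar3 out3" if g: "rg3 hX = Suc i" "\<forall>x\<ge>70. rg3 x = rg' x" "rg3 hO = min 2 (rc (Suc i))"
    "\<not> rep --> rg3 hA = rg' hA" "cutset (Suc i) = cutset i" "ar3 = ar'" "out3 = out'" for rg3 ar3 out3
    unfolding M_def using g cs post_cong[OF ps, of rg3 ar'] by (auto intro!: exI[of _ cs])
   have rpt: "M (Suc i) rg3 ar3 out3" if g: "rg3 hX = Suc i" "\<forall>x\<ge>70. rg3 x = rg' x" "rg3 hO = min 2 (rc (Suc i))"
    "\<not> rep --> rg3 hA = 1" "cutset (Suc i) = insert y (cutset i)" "y \<notin> cutset i"
    "\<forall>k. k ~= aREP --> ar3 k = ar' k" "\<forall>x<n. x ~= r --> ar3 aREP x = (if x = y then 1 else ar' aREP x)"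
    "out3 = out' @ (if rep then [y] else [])" for rg3 ar3 out3
    unfolding M_def using g cs post_cong[OF ps, of rg3 ar3] by (auto intro!: exI[of _ "cs @ [y]"])
   have "wp get (wp (hY ::= Nb (Rg hX) (Rg hI) ;; Cond (Eqv (Rg hY) ST) (cut_root rep) (cut_other rep))
    (wp (hX ::= Rg hX +. Lit 1) Q')) rg' ar' (Suc t') out'"
   proof (rule get_ok[where x = i])
    show "lrel ar'" "cst2 rg'" "isbit (ar' aPI)" "i < n" "rg' hX = i" using ps i X by (simp_all add: post_def)
    fix rg2 t2
    assume r2: "rg2 hI = nval (ar' aPI) i" "eq_off {hP, hD, hI, hW, hC} rg2 rg'" and t2: "t2 <= Suc t' + 5 + 8 * bl (deg i)"
    have tl: "t3 <= t' + (20 + cv i)" if "t3 <= t2 + 10" for t3 using that t2 by (simp add: cv_def)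
    have r2': "rg2 hX = i" "rg2 hI = nval (ar' aPI) i" "rg2 hO = min 2 (rc i)" "rg2 hA = rg' hA" "\<forall>x\<ge>70. rg2 x = rg' x" using r2 X O by simp_all
    show "wp (hY ::= Nb (Rg hX) (Rg hI) ;; Cond (Eqv (Rg hY) ST) (cut_root rep) (cut_other rep))
    (wp (hX ::= Rg hX +. Lit 1) Q') rg2 ar' t2 out'"
    proof (cases "y = r")
     case yR: True
     show ?thesis
     proof (cases "rc i = 1")
      case True
      have "Q' rg3 ar' t3 (out' @ (if rep then [r] else []))"
       if "t3 <= t2 + 10" "rg3 = (if rep then rg2(hY := r, hO := 2, hX := Suc i) else rg2(hY := r, hO := 2, hA := 1, hX := Suc i))" for t3 rg3
       by (rule Q'[OF rpt tl]) (use that r2' True rS cS yr yR in auto)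
      then show ?thesis unfolding cut_root_def mark_def
       using r2' i pn yR True l1 s by (cases rep) (simp_all add: numeral_2_eq_2[symmetric])
     next
      case False
      have "Q' rg3 ar' t3 out'"
       if "t3 <= t2 + 10" "rg3 = (if rc i = 0 then rg2(hY := r, hO := 1, hX := Suc i) else rg2(hY := r, hX := Suc i))" for t3 rg3
       by (rule Q'[OF new tl]) (insert that r2' False rS cS yr yR, auto simp: min_def insert_absorb)
      then show ?thesis unfolding cut_root_def mark_def
       using r2' i pn yR False l1 s by (cases "rc i = 0") (simp_all add: min_def split: if_splits)
     qed
    next
     case yR: False
     have rep0: "ar' aREP y = of_bool (y \<in> cutset i)" using cs(2,3) yn yR by simp
     show ?thesis
     proof (cases "\<not> ncov i & y \<notin> cutset i")
      case True
      have "Q' rg3 (ar'(aREP := (ar' aREP)(y := 1))) t3 (out' @ (if rep then [y] else []))"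
       if "t3 <= t2 + 10" "rg3 = (if rep then rg2(hY := y, hX := Suc i) else rg2(hY := y, hA := 1, hX := Suc i))" for t3 rg3
       by (rule Q'[OF rpt tl]) (use that r2' True rS cS yR in auto)
      then show ?thesis unfolding cut_other_def mark_def
       using r2' i pn yR True l1 s yn rep0 cz w_pos by (cases rep) (simp_all add: lens2 wds2)
     next
      case False
      have "Q' (rg2(hY := y, hX := Suc i)) ar' t3 out'" if "t3 <= t2 + 10" for t3
       by (rule Q'[OF new tl]) (insert that r2' False rS cS yR, auto simp: insert_absorb)
      then show ?thesis unfolding cut_other_def mark_def
       using r2' i pn yR False l1 s yn rep0 cz w_pos by (auto simp: lens2 wds2)
     qed
    qed
   qed
   then show ?thesis unfolding cut_body_def using False l1 by (simp add: X)
  qed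
 next
  case (5 rg' ar' t' out') note m = 5(1) and t = 5(2)
  obtain cs where cs: "distinct cs" "set cs = cutset n" "\<not> rep --> rg' hA = (if cs = [] then 0 else 1)"
   "out' = out @ (if rep then cs else [])" using m unfolding M_def by blast
  have "rg' gN = n" using m by (simp add: M_def post_def cst2_def cst_def)
  then show "Q rg' ar' t' out'" unfolding cs(4)
   by (intro Q[OF cs(1)]) (use cs(2,3) cutset_n t cv_sum in simp_all)
 qed simp
 then show ?thesis unfolding cut_tail_def using w_pos by (simp add: rg1_def eval_nat_numeral)
qed

lemma two_edge_iff: "two_edge_connected G \<longleftrightarrow> 2 <= n & (\<forall>x<n. x ~= r --> cov x)"
 using gi unfolding two_edge_connected_def bridge_iff T_iff graph_instance_def by auto

lemma two_vertex_iff: "two_vertex_connected G \<longleftrightarrow> 3 <= n & {v. cut_vertex G v} = {}"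
 using gi unfolding two_vertex_connected_def graph_instance_def by auto

lemma vertex_ok:
 assumes p: "post rg ar" and z: "\<forall>x<n. ar aREP x = 0"
  and Q: "\<And>rg' ar' t'. t' <= t + 13 + 21 * n + vsum UNIV ==>
   Q rg' ar' t' (out @ [if two_vertex_connected G then 1 else 0])"
 shows "wp vertex_tail Q rg ar t out"
proof -
 have l1: "Suc 0 < 2 ^ w" "2 < (2::nat) ^ w" by (intro small; simp)+
 show ?thesis unfolding vertex_tail_def wp_simps(5)
 proof (rule cut_ok[OF p z])
  fix rg' ar' t' and cs :: "nat list"
  assume h: "set cs = {v. cut_vertex G v}" "rg' gN = n" "\<not> False --> rg' hA = (if cs = [] then 0 else 1)"
   and t: "t' <= t + 10 + 21 * n + vsum UNIV"
  have e: "two_vertex_connected G \<longleftrightarrow> 3 <= n & cs = []" unfolding two_vertex_iff h(1)[symmetric] by simp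
  have q: "Q rg' ar' t'' (out @ [if 3 <= n & cs = [] then 1 else 0])" if "t'' <= t' + 3" for t''
   using Q[of t'' rg' ar'] that t unfolding e by simp
  show "wp (Cond (Lt (Lit 2) (Rg gN)) (Cond (Eqv (Rg hA) (Lit 0)) (Emit (Lit 1)) (Emit (Lit 0))) (Emit (Lit 0))) Q rg' ar' t' (out @ (if False then cs else []))"
   using h l1 w_pos q[of "Suc (Suc (Suc t'))"] q[of "Suc (Suc t')"]
   by (cases "3 <= n"; cases "cs = []") simp_all
 qed
qed

end

section \<open>The complete programs\<close>

definition
 "prep em = build ;; first_prog ;; reset_prog ;; second_prog em"

context dfs_und
begin

definition msum :: nat where "msum = (\<Sum>v<n. deg v)"

lemma NT_msum: "NT <= n + msum"
proof -
 have "NT <= (\<Sum>v<n. 1 + deg v)" unfolding NT_sum by (intro sum_mono) (simp add: bl_le)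
 then show ?thesis by (simp only: sum.distrib msum_def) simp
qed

lemma S_bound: "S <= 8 * n"
 using S_le n_pos by linarith

lemma DFSB_le: "DFSB <= 60 * msum + 1000 * n"
 using S_bound n_pos unfolding DFSB_def msum_def by linarith

lemma vsum_le: "dfs_second w adj r na len wd xl S B L h P T F ==> dfs_second.vsum adj UNIV <= 20 * n + 8 * msum"
proof -
 assume "dfs_second w adj r na len wd xl S B L h P T F"
 then interpret X: dfs_second w adj r na len wd xl S B L h P T F .
 have "X.vsum UNIV <= (\<Sum>x<n. 20 + 8 * deg x)" unfolding X.vsum_def by (intro sum_mono) (simp add: X.cv_def bl_le)
 then show ?thesis by (simp add: sum.distrib msum_def sum_distrib_left)
qed

text \<open>\<open>P\<close>, \<open>T\<close> and \<open>F\<close> stem from the final state of the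
  first run and are passed on as ghost data to whatever evaluates the marks.\<close>

lemma prep_ok:
 assumes c: "cst2 rg" and z: "\<forall>k<20. \<forall>i < len k. ar k i = 0"
  and Q: "\<And>rg' ar' t' cs P T F. dfs_second w adj r na len wd xl S B L h P T F ==>
   dfs_second.post adj r S B h T rg' ar' ==>
   (\<forall>x<n. ar' aREP x = 0) ==> chain_decomposition (graph_of adj) r cs ==> t' <= t + (4000 * n + 4000 * msum) ==>
   Q rg' ar' t' (out @ (if em then concat (map (\<lambda>c. c @ [n]) cs) else []))"
 shows "wp (prep em) Q rg ar t out"
 unfolding prep_def wp_simps(5)
proof (rule build_ok[OF c])
 show "\<forall>i < bl n + 3. ar aCur i = 0" "\<forall>k < NT div h + 1. ar aV k = 0" "ar aT 0 = 0"
  using z[rule_format, of aCur] z[rule_format, of aV] z[rule_format, of aT 0] by (simp_all add: lens2)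
 fix rg1 ar1 t1
 assume 1: "lrel ar1" "eq_off {aV, aA, aT, aCur} ar1 ar" "cst2 rg1"
  and t1: "t1 <= t + 100 + 50 * NT + 50 * n"
 show "wp first_prog (wp reset_prog (wp (second_prog em) Q)) rg1 ar1 t1 out"
 proof (rule first_ok[OF 1(3) 1(1)])
  show "\<forall>v<n. ar1 aD v = 0" "\<forall>p < 2 * n + 1. ar1 aU p = 0" "isbit (ar1 aPI)" "isbit (ar1 aCT)"
   using 1(2) z[rule_format, of aD] z[rule_format, of aU] z[rule_format, of aPI] z[rule_format, of aCT]
   by (simp_all add: lens lens2 isbit_def)
  fix rg2 ar2 t2 F
  assume F: "reach F" "final F" and 2: "cst2 rg2" "lrel ar2" "isbit (ar2 aPI)" "isbit (ar2 aCT)"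
   "parent_ok (tree_edges [] (snd (snd F))) ar2" "counters_ok (snd (snd F)) ar2" "\<forall>k. 15 <= k --> ar2 k = ar1 k"
   "\<forall>p < 2 * n + 1. ar2 aU p = 0" and t2: "t2 <= t1 + 2 * n + (\<Sum>x<n. cost1 x) + DFSB"
  define P where "P = pos (snd (snd F))"
  define T where "T = tree_edges [] (snd (snd F))"
  have tree: "dfs_tree adj r P T" using dfs_tree_final[OF gi F] by (simp add: P_def T_def)
  have sec: "dfs_second w adj r na len wd xl S B L h P T F"
   by (intro dfs_second.intro dfs_second_axioms.intro dfs_und_axioms tree F P_def T_def)
  interpret X: dfs_second w adj r na len wd xl S B L h P T F by (rule sec)
  show "wp reset_prog (wp (second_prog em) Q) rg2 ar2 t2 out"
  proof (rule reset_ok[OF 2(1)])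
   fix rg3 ar3 t3
   assume 3: "\<forall>v<n. ar3 aD v = 0" "\<forall>k. k ~= aD --> ar3 k = ar2 k" "\<forall>x. x ~= hX --> rg3 x = rg2 x" and t3: "t3 <= t2 + 2 + 3 * n"
   have c3: "cst2 rg3" by (rule cst2_cong[OF 2(1)]) (use 3 in simp)
   show "wp (second_prog em) Q rg3 ar3 t3 out"
   proof (rule X.second_ok[OF c3])
    show "lrel ar3" "\<forall>v<n. ar3 aD v = 0" "\<forall>p < 2 * n + 1. ar3 aU p = 0" "isbit (ar3 aPI)" "isbit (ar3 aCT)"
     "parent_ok T ar3" "counters_ok (snd (snd F)) ar3"
     using 2 3 by (simp_all add: lrel_def parent_ok_def counters_ok_def T_def)
    show "X.sets3 {} {} {} ar3" using 1(2) 2(7) 3(2) z[rule_format, of aVIS] z[rule_format, of aCOV] z[rule_format, of aNC]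
     by (simp add: X.sets3_def lens2)
    fix rg4 ar4 t4 cs
    assume 4: "cst2 rg4" "lrel ar4" "isbit (ar4 aPI)" "parent_ok T ar4"
     "X.sets3 (X.VISs (back_edges (graph_of adj) T)) (X.COVs (back_edges (graph_of adj) T)) (X.NCs (back_edges (graph_of adj) T)) ar4"
     "ar4 aREP = ar3 aREP" "chain_decomposition (graph_of adj) r cs"
     and t4: "t4 <= t3 + (2 * n + (\<Sum>x<n. X.cost2 x) + X.vsum UNIV + 5 * NT) + DFSB"
    have REP: "\<forall>x<n. ar4 aREP x = 0" using 1(2) 2(7) 3(2) 4(6) z[rule_format, of aREP] by (simp add: lens2)
    have s1: "(\<Sum>x<n. cost1 x) = 30 * n + 20 * msum" by (simp add: cost1_def sum.distrib msum_def sum_distrib_left)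
    have s2: "(\<Sum>x<n. X.cost2 x) = 5 * n + 45 * msum" by (simp add: X.cost2_def sum.distrib msum_def sum_distrib_left)
    note s3 = vsum_le[OF sec]
    have "t4 <= t + (4000 * n + 4000 * msum)"
     using t1 t2 t3 t4 s1 s2 s3 DFSB_le NT_msum n_pos by linarith
    then show "Q rg4 ar4 t4 (out @ (if em then concat (map (\<lambda>c. c @ [n]) cs) else []))"
     by (intro Q[OF sec X.post_sets[OF 4(1-5)] REP 4(7)])
   qed
  qed
 qed
qed

lemma programs_ok:
 assumes c: "cst2 rg" and z: "\<forall>k<20. \<forall>i < len k. ar k i = 0"
 shows "wp (prep True) (\<lambda>rg' ar' t' out. chain_spec adj r out & t' <= t + (5000 * n + 5000 * msum)) rg ar t []"
  and "wp (prep False ;; bridge_tail) (\<lambda>rg' ar' t' out. bridges_spec adj r out & t' <= t + (5000 * n + 5000 * msum)) rg ar t []"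
  and "wp (prep False ;; cut_tail True) (\<lambda>rg' ar' t' out. cut_vertices_spec adj r out & t' <= t + (5000 * n + 5000 * msum)) rg ar t []"
  and "wp (prep False ;; vertex_tail) (\<lambda>rg' ar' t' out. two_vertex_connected_spec adj r out & t' <= t + (5000 * n + 5000 * msum)) rg ar t []"
  and "wp (prep False ;; edge_tail) (\<lambda>rg' ar' t' out. two_edge_connected_spec adj r out & t' <= t + (5000 * n + 5000 * msum)) rg ar t []"
proof -
 show "wp (prep True) (\<lambda>rg' ar' t' out. chain_spec adj r out & t' <= t + (5000 * n + 5000 * msum)) rg ar t []"
  by (rule prep_ok[OF c z]) (auto simp: chain_spec_def)
 show "wp (prep False ;; bridge_tail) (\<lambda>rg' ar' t' out. bridges_spec adj r out & t' <= t + (5000 * n + 5000 * msum)) rg ar t []"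
  unfolding wp_simps(5)
 proof (rule prep_ok[OF c z])
  fix rg' ar' t' cs P T F
  assume X: "dfs_second w adj r na len wd xl S B L h P T F" and p: "dfs_second.post adj r S B h T rg' ar'"
   and t: "t' <= t + (4000 * n + 4000 * msum)"
  show "wp bridge_tail (\<lambda>rg' ar' t' out. bridges_spec adj r out & t' <= t + (5000 * n + 5000 * msum)) rg' ar' t' ([] @ (if False then concat (map (\<lambda>c. c @ [n]) cs) else []))"
   by (rule dfs_second.bridge_ok[OF X p]) (use t vsum_le[OF X] n_pos in \<open>intro conjI; (linarith | simp)\<close>)
 qed
 show "wp (prep False ;; cut_tail True) (\<lambda>rg' ar' t' out. cut_vertices_spec adj r out & t' <= t + (5000 * n + 5000 * msum)) rg ar t []"
  unfolding wp_simps(5)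
 proof (rule prep_ok[OF c z])
  fix rg' ar' t' cs P T F
  assume X: "dfs_second w adj r na len wd xl S B L h P T F" and p: "dfs_second.post adj r S B h T rg' ar'"
   and z: "\<forall>x<n. ar' aREP x = 0" and t: "t' <= t + (4000 * n + 4000 * msum)"
  show "wp (cut_tail True) (\<lambda>rg' ar' t' out. cut_vertices_spec adj r out & t' <= t + (5000 * n + 5000 * msum)) rg' ar' t' ([] @ (if False then concat (map (\<lambda>c. c @ [n]) cs) else []))"
   by (rule dfs_second.cut_ok[OF X p z]) (use t vsum_le[OF X] n_pos in \<open>intro conjI; (linarith | simp add: cut_vertices_spec_def)\<close>)
 qed
 show "wp (prep False ;; vertex_tail) (\<lambda>rg' ar' t' out. two_vertex_connected_spec adj r out & t' <= t + (5000 * n + 5000 * msum)) rg ar t []"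
  unfolding wp_simps(5)
 proof (rule prep_ok[OF c z])
  fix rg' ar' t' cs P T F
  assume X: "dfs_second w adj r na len wd xl S B L h P T F" and p: "dfs_second.post adj r S B h T rg' ar'"
   and z: "\<forall>x<n. ar' aREP x = 0" and t: "t' <= t + (4000 * n + 4000 * msum)"
  show "wp vertex_tail (\<lambda>rg' ar' t' out. two_vertex_connected_spec adj r out & t' <= t + (5000 * n + 5000 * msum)) rg' ar' t' ([] @ (if False then concat (map (\<lambda>c. c @ [n]) cs) else []))"
   by (rule dfs_second.vertex_ok[OF X p z]) (use t vsum_le[OF X] n_pos in \<open>intro conjI; (linarith | simp add: two_vertex_connected_spec_def)\<close>)
 qed
 show "wp (prep False ;; edge_tail) (\<lambda>rg' ar' t' out. two_edge_connected_spec adj r out & t' <= t + (5000 * n + 5000 * msum)) rg ar t []"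
  unfolding wp_simps(5)
 proof (rule prep_ok[OF c z])
  fix rg' ar' t' cs P T F
  assume X: "dfs_second w adj r na len wd xl S B L h P T F" and p: "dfs_second.post adj r S B h T rg' ar'"
   and t: "t' <= t + (4000 * n + 4000 * msum)"
  show "wp edge_tail (\<lambda>rg' ar' t' out. two_edge_connected_spec adj r out & t' <= t + (5000 * n + 5000 * msum)) rg' ar' t' ([] @ (if False then concat (map (\<lambda>c. c @ [n]) cs) else []))"
   by (rule dfs_second.edge_ok[OF X p])
    (use t vsum_le[OF X] n_pos in \<open>intro conjI; (linarith | simp add: two_edge_connected_spec_def dfs_second.two_edge_iff[OF X])\<close>)
 qed
qed

end

section \<open>Computing the parameters and the memory layout\<close>

abbreviation (input) "pL \<equiv> 77 :: nat"
abbreviation (input) "pB \<equiv> 78 :: nat"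
abbreviation (input) "pE \<equiv> 79 :: nat"
abbreviation (input) "pA \<equiv> 80 :: nat"
abbreviation (input) "pM \<equiv> 81 :: nat"
abbreviation (input) "pX \<equiv> 82 :: nat"
abbreviation (input) "pY \<equiv> 83 :: nat"

definition
 "bits_loop c = Loop (Lt (Lit 0) (Rg pY)) (c ::= Rg c +. Lit 1 ;; pY ::= Rg pY /. Lit 2)"

definition
 "degrees_body = pM ::= Rg pM +. Dg (Rg pX) ;; gNT ::= Rg gNT +. Lit 1 ;; pY ::= Dg (Rg pX) ;;
  bits_loop gNT ;; pX ::= Rg pX +. Lit 1"

definition
 "degrees = gN ::= NV ;; pX ::= Lit 0 ;; pM ::= Lit 0 ;; gNT ::= Lit 0 ;; Loop (Lt (Rg pX) (Rg gN)) degrees_body"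

definition
 "log_size = pE ::= Lit 0 ;; pY ::= Rg gN ;; bits_loop pE"

definition
 "log_density_body = pB ::= Rg pB +. Lit 1 ;; gB ::= Rg gB *. Lit 2"

text \<open>Finds the least \<open>b >= 1\<close> such that the degree sum is at most
  \<open>2 ^ b * n\<close>. Comparing products avoids a division, and starting at 1 reflects that
  the logarithmic factor of the bound is at least 1.\<close>

definition
 "log_density = pB ::= Lit 1 ;; gB ::= Lit 2 ;; Loop (Lt (Rg gB *. Rg gN) (Rg pM)) log_density_body"

text \<open>Cells of \<open>2 * bl n + 2\<close> bits hold all numbers below
  \<open>4 * ((n + 1) * (n + 1))\<close>. The same number serves as \<open>S\<close>, so that the
  buffers take O(lg^2 n) and the landmarks O(n) bits. Blocks of about (lg n) / 2 bits keep the table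
  at O(sqrt n) entries.\<close>

definition
 "params = pL ::= Lit 2 *. Rg pE +. Lit 2 ;; gS ::= Rg pL ;; gH ::= Rg pE /. Lit 2 +. Lit 1 ;;
  gHH ::= Bin Shl (Lit 1) (Rg gH) ;; gJ ::= Rg pE +. Lit 2 ;; pA ::= Lit 0"

definition alloc :: "nat => aexp => aexp => prg" where
 "alloc k l f = lb k ::= Rg pA ;; lf k ::= f ;; lq k ::= WL /. Rg (lf k) ;;
  lm k ::= Bin Shl (Lit 1) (Rg (lf k)) -. Lit 1 ;; pA ::= Rg pA +. (l /. Rg (lq k) +. Lit 1)"

fun allocs :: "nat => (aexp \<times> aexp) list => prg" where
 "allocs k [] = Nop"
| "allocs k ((l, f) # xs) = alloc k l f ;; allocs (Suc k) xs"

definition arrays_exp :: "(aexp \<times> aexp) list" where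
 "arrays_exp = (let c1 = Lit 1; v = Rg gN; L = Rg pL; mk = (Lit 4 *. (Rg gN /. Rg gS) +. Lit 8, Rg pL); nt = Rg gNT;
   rk = Rg gNT /. Rg gH +. Lit 1 in
  [(v, c1), (c1, c1), (v, Rg pB), (L, L), (L, L), mk, mk, mk, mk, (Lit 2 *. v +. Lit 1, c1),
   (rk, Rg gH), (rk, L), (Rg gHH, L), (nt, c1), (nt, c1), (v, c1), (v, c1), (v, c1), (Rg pE +. Lit 3, L), (v, c1)])"

definition
 "prelude = degrees ;; log_size ;; log_density ;; params ;; allocs 0 arrays_exp"

text \<open>A block of \<open>l\<close> cells of \<open>f\<close> bits, \<open>w div f\<close> of them in a word.\<close>

definition block :: "nat => nat \<times> nat => nat" where
 "block w x = fst x div (w div snd x) + 1"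

definition block_base :: "nat => (nat \<times> nat) list => nat => nat" where
 "block_base w vs k = sum_list (map (block w) (take k vs))"

lemma block_base_Suc: "k < length vs ==> block_base w vs (Suc k) = block_base w vs k + block w (vs ! k)"
 by (simp add: block_base_def take_Suc_conv_app_nth)

lemma block_base_mono: "j <= k ==> block_base w vs j <= block_base w vs k"
proof (rule lift_Suc_mono_le[of "block_base w vs"])
 fix k show "block_base w vs k <= block_base w vs (Suc k)"
  by (cases "k < length vs") (simp add: block_base_Suc, simp add: block_base_def)
qed

text \<open>As \<open>f <= w\<close>, the fields in a word fill more than half of it, so packing at
  most doubles the space, up to one extra word.\<close>

lemma block_bits:
 assumes "0 < f" "f <= w" shows "w * block w (l, f) <= 2 * f * l + w"
proof -
 define q where "q = w div f"
 have q: "0 < q" using assms by (simp add: q_def div_greater_zero_iff)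
 have "w < (q + 1) * f" using assms unfolding q_def by (metis Suc_eq_plus1 dividend_less_div_times mult_Suc)
 also have "\<dots> <= 2 * q * f" using q by simp
 finally have "w * (l div q) <= 2 * q * f * (l div q)" by (intro mult_le_mono1) simp
 also have "\<dots> = 2 * f * (l div q * q)" by (simp add: ac_simps)
 also have "\<dots> <= 2 * f * l" by (intro mult_le_mono2) simp
 finally show ?thesis by (simp add: block_def q_def algebra_simps)
qed

locale instance_size = dfs_input adj r for adj r +
 fixes w :: nat
 assumes deg_le: "\<And>v. v < n ==> deg v <= n"
  and w_big: "1000 * ((n + 1) * (n + 1)) <= 2 ^ w"
begin

definition msum :: nat where "msum = (\<Sum>v<n. deg v)"
definition nt :: nat where "nt = (\<Sum>v<n. 1 + bl (deg v))"

lemma n_pos: "0 < n" using r_less by linarith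

lemma small2: "x <= 100 * ((n + 1) * (n + 1)) ==> x < 2 ^ w"
proof -
 assume "x <= 100 * ((n + 1) * (n + 1))"
 also have "\<dots> < 1000 * ((n + 1) * (n + 1))" by simp
 also note w_big
 finally show ?thesis .
qed

lemma small: "x <= 100 * n + 100 ==> x < 2 ^ w"
 by (rule small2) simp

lemma msum_part: "i <= n ==> (\<Sum>v<i. deg v) <= n * n"
proof -
 assume "i <= n"
 then have "(\<Sum>v<i. deg v) <= (\<Sum>v<i. n)" by (intro sum_mono deg_le) simp
 also have "\<dots> <= n * n" using \<open>i <= n\<close> by simp
 finally show ?thesis .
qed

lemma nt_part: "i <= n ==> (\<Sum>v<i. 1 + bl (deg v)) <= n + n * n"
proof -
 assume i: "i <= n"
 have "(\<Sum>v<i. 1 + bl (deg v)) <= (\<Sum>v<i. 1 + deg v)" by (intro sum_mono) (simp add: bl_le)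
 also have "\<dots> = i + (\<Sum>v<i. deg v)" by (simp only: sum.distrib) simp
 finally show ?thesis using msum_part[OF i] i by linarith
qed

lemma w_pos: "0 < w"
proof (rule ccontr)
 assume "\<not> 0 < w"
 then show False using w_big by simp
qed

end

text \<open>No arrays, and all registers below 300 assignable: the prelude works before the memory
  is laid out and writes the descriptors itself.\<close>

locale prelude_run = instance_size adj r w + ram w adj r 0 len wd 300 for adj r w len wd
begin

lemma bits_ok:
 assumes "c < 300" "c ~= pY" "rg pY = y" "rg c + bl y < 2 ^ w"
  and Q: "\<And>t'. t' <= t + 1 + 3 * bl y ==> Q (rg(c := rg c + bl y, pY := 0)) ar t' out"
 shows "wp (bits_loop c) Q rg ar t out"
 unfolding bits_loop_def
proof (rule wp_for[where a = 0 and N = "bl y" and c = "\<lambda>_. 2" and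
  M = "\<lambda>i rg' ar' out'. rg' = rg(c := rg c + i, pY := y div 2 ^ i) & ar' = ar & out' = out"])
 have l2: "2 < (2::nat) ^ w" by (intro small) simp
 fix i rg' ar' t' and out' :: "nat list" and Q'
 assume m: "rg' = rg(c := rg c + i, pY := y div 2 ^ i) & ar' = ar & out' = out" and i: "i < bl y"
  and Q': "\<And>rg'' ar'' (t'' :: nat) out''. rg'' = rg(c := rg c + Suc i, pY := y div 2 ^ Suc i) & ar'' = ar & out'' = out ==>
   t'' <= t' + 2 ==> Q' rg'' ar'' t'' out''"
 have s: "Suc (rg c + i) < 2 ^ w" using assms(4) i by simp
 have "Q' (rg(c := rg c + Suc i, pY := y div 2 ^ Suc i)) ar (Suc (Suc t')) out" by (rule Q') simp_all
 moreover have "rg(c := rg c + Suc i, pY := y div 2 ^ Suc i) = (rg(c := rg c + i, pY := y div 2 ^ i))(c := Suc (rg c + i), pY := y div 2 ^ i div 2)"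
  using assms(2) by (auto simp: fun_eq_iff div_mult2_eq power_Suc2 simp del: power_Suc)
 ultimately show "wp (c ::= Rg c +. Lit 1 ;; pY ::= Rg pY /. Lit 2) Q' rg' ar' t' out'"
  using m s l2 assms by simp
next
 fix rg' ar' t' out'
 assume m: "rg' = rg(c := rg c + bl y, pY := y div 2 ^ bl y) & ar' = ar & out' = out" and t: "t' <= t + 1 + (\<Sum>i = 0..<bl y. 2 + 1)"
 have "y div 2 ^ bl y = 0" using bl_less[of y] by simp
 then show "Q rg' ar' t' out'" using m t Q[of t'] by simp
qed (insert assms bl_iff, auto simp: fun_eq_iff)

lemma degrees_ok:
 assumes Q: "\<And>rg' t'. rg' gN = n ==> rg' pM = msum ==> rg' gNT = nt ==> t' <= t + 10 + 7 * n + 3 * msum ==> Q rg' ar t' out"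
 shows "wp degrees Q rg ar t out"
proof -
 define rg1 where "rg1 = rg(gN := n, pX := 0, pM := 0, gNT := 0)"
 have l1: "Suc 0 < 2 ^ w" by (intro small) simp
 have "wp (Loop (Lt (Rg pX) (Rg gN)) degrees_body) Q rg1 ar (Suc (Suc (Suc (Suc t)))) out"
 proof (rule wp_for[where a = 0 and N = n and c = "\<lambda>i. 6 + 3 * bl (deg i)" and
  M = "\<lambda>i rg' ar' out'. rg' gN = n & rg' pX = i & rg' pM = (\<Sum>v<i. deg v) & rg' gNT = (\<Sum>v<i. 1 + bl (deg v)) & ar' = ar & out' = out"])
  fix i rg' ar' t' and out' :: "nat list" and Q'
  assume m: "rg' gN = n & rg' pX = i & rg' pM = (\<Sum>v<i. deg v) & rg' gNT = (\<Sum>v<i. 1 + bl (deg v)) & ar' = ar & out' = out" and i: "i < n"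
   and Q': "\<And>rg'' ar'' (t'' :: nat) out''. rg'' gN = n & rg'' pX = Suc i & rg'' pM = (\<Sum>v<Suc i. deg v) & rg'' gNT = (\<Sum>v<Suc i. 1 + bl (deg v)) & ar'' = ar & out'' = out ==>
    t'' <= t' + (6 + 3 * bl (deg i)) ==> Q' rg'' ar'' t'' out''"
  define a where "a = (\<Sum>v<i. deg v)"
  define d where "d = (\<Sum>v<i. 1 + bl (deg v))"
  have a: "a + deg i = (\<Sum>v<Suc i. deg v)" and d: "Suc d + bl (deg i) = (\<Sum>v<Suc i. 1 + bl (deg v))" by (simp_all add: a_def d_def)
  have sa: "a + deg i < 2 ^ w" unfolding a using msum_part[of "Suc i"] i by (intro small2) (simp, linarith?)
  have sd: "Suc d + bl (deg i) < 2 ^ w" unfolding d using nt_part[of "Suc i"] i by (intro small2) (simp, linarith?)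
  then have sd': "Suc d < 2 ^ w" by simp
  have s: "Suc i < 2 ^ w" using i by (intro small) simp
  define rg2 where "rg2 = rg'(pM := a + deg i, gNT := Suc d, pY := deg i)"
  have "wp (bits_loop gNT) (wp (pX ::= Rg pX +. Lit 1) Q') rg2 ar (Suc (Suc (Suc t'))) out"
  proof (rule bits_ok[where y = "deg i"])
   fix t2 assume t2: "t2 <= Suc (Suc (Suc t')) + 1 + 3 * bl (deg i)"
   have "Q' (rg2(gNT := rg2 gNT + bl (deg i), pY := 0, pX := Suc i)) ar (Suc t2) out"
    by (rule Q') (insert m a d t2, simp_all add: rg2_def)
   then show "wp (pX ::= Rg pX +. Lit 1) Q' (rg2(gNT := rg2 gNT + bl (deg i), pY := 0)) ar t2 out"
    using m s l1 by (simp add: rg2_def)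
  qed (insert sd, simp_all add: rg2_def)
  then show "wp degrees_body Q' rg' ar' t' out'" unfolding degrees_body_def
   using m i sa sd' l1 by (simp add: rg2_def a_def[symmetric] d_def[symmetric] del: One_nat_def plus_nat.simps)
    (simp add: rg2_def a_def d_def)?
 next
  fix rg' ar' t' out'
  assume m: "rg' gN = n & rg' pX = n & rg' pM = (\<Sum>v<n. deg v) & rg' gNT = (\<Sum>v<n. 1 + bl (deg v)) & ar' = ar & out' = out"
   and t: "t' <= Suc (Suc (Suc (Suc t))) + 1 + (\<Sum>i = 0..<n. 6 + 3 * bl (deg i) + 1)"
  have "(\<Sum>i = 0..<n. 6 + 3 * bl (deg i) + 1) <= (\<Sum>i = 0..<n. 7 + 3 * deg i)" by (intro sum_mono) (simp add: bl_le)
  also have "\<dots> = 7 * n + 3 * msum" by (simp add: sum.distrib msum_def sum_distrib_left atLeast0LessThan)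
  finally show "Q rg' ar' t' out'" using m t Q[of rg' t'] by (simp add: msum_def nt_def)
 qed (simp_all add: rg1_def)
 then show ?thesis unfolding degrees_def using w_pos by (simp add: rg1_def)
qed

lemma log_size_ok:
 assumes "rg gN = n"
  and Q: "\<And>rg' t'. rg' pE = bl n ==> eq_off {pE, pY} rg' rg ==> t' <= t + 3 + 3 * n ==> Q rg' ar t' out"
 shows "wp log_size Q rg ar t out"
proof -
 have s: "bl n < 2 ^ w" using bl_le[of n] by (intro small) linarith
 have "wp (bits_loop pE) Q (rg(pE := 0, pY := n)) ar (Suc (Suc t)) out"
  by (rule bits_ok[where y = n]) (insert s bl_le[of n], auto intro!: Q split: if_splits)
 then show ?thesis unfolding log_size_def using assms(1) w_pos by simp
qed

lemma log_density_ok: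
 assumes r: "rg gN = n" "rg pM = msum"
  and Q: "\<And>rg' t' b. 1 <= b ==> msum <= 2 ^ b * n ==> b = 1 | 2 ^ (b - 1) * n < msum ==> rg' pB = b ==> rg' gB = 2 ^ b ==>
   eq_off {pB, gB} rg' rg ==> t' <= t + 10 + 3 * n ==> Q rg' ar t' out"
 shows "wp log_density Q rg ar t out"
proof -
 have l: "Suc 0 < 2 ^ w" "2 < (2::nat) ^ w" by (intro small; simp)+
 have mle: "msum <= n * n" unfolding msum_def by (rule msum_part) simp
 \<comment> \<open>Since the degree sum is at most \<open>n * n\<close>, a round that fails to stop
   shows \<open>2 ^ (b - 1) < n\<close>; this bounds the number of rounds as well as the size of the
   products.\<close>
 have bn: "2 ^ b <= 2 * n | b = 1" "b <= n + 1" if h: "b = 1 | 2 ^ (b - 1) * n < msum" for b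
 proof -
  consider "b = 1" | "2 ^ (b - 1) * n < n * n" "b ~= 1" using h order.strict_trans2[OF _ mle, of "2 ^ (b - 1) * n"] by blast
  then have "(2 ^ b <= 2 * n | b = 1) & b <= n + 1"
  proof cases
   case 2
   then have lt: "2 ^ (b - 1) < n" by simp
   have "(2::nat) ^ b <= 2 * 2 ^ (b - 1)" by (cases b) simp_all
   moreover have "b - 1 < 2 ^ (b - 1)" by simp
   ultimately show ?thesis using lt by linarith
  qed simp
  then show "2 ^ b <= 2 * n | b = 1" "b <= n + 1" by blast+
 qed
 define I where "I = (\<lambda>rg' ar' t' out'. \<exists>b\<ge>1. (b = 1 | 2 ^ (b - 1) * n < msum) & rg' pB = b & rg' gB = 2 ^ b &
   eq_off {pB, gB} rg' rg & ar' = ar & out' = out & t' <= t + 2 + 3 * b)"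
 have sB: "2 ^ b < (2::nat) ^ w" "2 ^ b * n < (2::nat) ^ w" "2 ^ b * 2 < (2 :: nat) ^ w" if "b = 1 | 2 ^ (b - 1) * n < msum" for b
 proof -
  have le: "2 ^ b <= 2 * n + 2" using bn(1)[OF that] by auto
  then show "2 ^ b < (2::nat) ^ w" "2 ^ b * 2 < (2 :: nat) ^ w" by (intro small; linarith)+
  have "2 ^ b * n <= (2 * n + 2) * n" using le by (rule mult_le_mono1)
  then show "2 ^ b * n < (2::nat) ^ w" by (intro small2) (simp add: algebra_simps)
 qed
 have "wp (Loop (Lt (Rg gB *. Rg gN) (Rg pM)) log_density_body) Q (rg(pB := 1, gB := 2)) ar (Suc (Suc t)) out"
 proof (rule wp_loop[where I = I and B = "t + 2 + 3 * (n + 1)"])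
  show "I (rg(pB := 1, gB := 2)) ar (Suc (Suc t)) out" unfolding I_def by (rule exI[of _ 1]) simp
 next
  fix rg' ar' t' out' assume i: "I rg' ar' t' out'"
  then obtain b where b: "1 <= b" "b = 1 | 2 ^ (b - 1) * n < msum" "rg' pB = b" "rg' gB = 2 ^ b"
   "eq_off {pB, gB} rg' rg" "ar' = ar" "out' = out" "t' <= t + 2 + 3 * b" unfolding I_def by blast
  have tb: "t' <= t + 2 + 3 * (n + 1)" using b(8) bn(2)[OF b(2)] by simp
  then show "t' <= t + 2 + 3 * (n + 1)" .
  have g: "rg' gN = n" "rg' pM = msum" using b(5) r by simp_all
  show "bok rg' ar' (Lt (Rg gB *. Rg gN) (Rg pM))" using b(4) g sB(2)[OF b(2)] by simp
  show "wp log_density_body I rg' ar' (Suc t') out'" if "bv rg' ar' (Lt (Rg gB *. Rg gN) (Rg pM))"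
  proof -
   have lt: "2 ^ (Suc b - 1) * n < msum" using that b(4) g by simp
   have "Suc b < 2 ^ w" using bn(2)[OF b(2)] by (intro small) simp
   moreover have "I (rg'(pB := Suc b, gB := 2 ^ b * 2)) ar' (Suc (Suc (Suc t'))) out'" unfolding I_def
    by (rule exI[of _ "Suc b"]) (use b lt in simp)
   ultimately show ?thesis unfolding log_density_body_def using b(3,4) sB[OF b(2)] l by simp
  qed
  show "Q rg' ar' (Suc t') out'" if "\<not> bv rg' ar' (Lt (Rg gB *. Rg gN) (Rg pM))"
   unfolding b(6,7) by (rule Q[OF b(1) _ b(2-5)]) (use that b(4) g tb in simp_all)
 qed
 then show ?thesis unfolding log_density_def using l by simp
qed

text \<open>Lengths and widths are read from registers below 80 only, which allocation leaves alone,
  so they may be evaluated at any time during it. The strict \<open>fv < w\<close> lets the mask be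
  computed as a shifted 1 minus 1.\<close>

lemma alloc_ok:
 assumes "k < 50" "rg pA = a" "0 < fv" "fv < w"
  and e: "\<And>rg'. (\<forall>y<80. rg' y = rg y) ==> ok rg' ar l & ev rg' ar l = lv & ok rg' ar f & ev rg' ar f = fv"
  and s: "a + block w (lv, fv) < 2 ^ w"
  and Q: "\<And>rg'. rg' (lb k) = a ==> rg' (lf k) = fv ==> rg' (lq k) = w div fv ==> rg' (lm k) = 2 ^ fv - 1 ==>
   rg' pA = a + block w (lv, fv) ==> eq_off {lb k, lf k, lq k, lm k, pA} rg' rg ==> Q rg' ar (t + 5) out"
 shows "wp (alloc k l f) Q rg ar t out"
proof -
 define rg1 where "rg1 = rg(lb k := a)"
 define rg2 where "rg2 = rg1(lf k := fv)"
 define rg3 where "rg3 = rg2(lq k := w div fv)"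
 define rg4 where "rg4 = rg3(lm k := 2 ^ fv - 1)"
 define rg5 where "rg5 = rg4(pA := a + block w (lv, fv))"
 have e1: "ok rg1 ar f" "ev rg1 ar f = fv" using e[of rg1] by (simp_all add: rg1_def)
 have e4: "ok rg4 ar l" "ev rg4 ar l = lv" using e[of rg4] by (simp_all add: rg1_def rg2_def rg3_def rg4_def)
 have q: "0 < w div fv" using assms by (simp add: div_greater_zero_iff)
 have f2: "(2::nat) ^ fv < 2 ^ w" using assms by simp
 have l1: "Suc 0 < 2 ^ w" by (intro small) simp
 have r2: "rg2 (lf k) = fv" by (simp add: rg2_def)
 have r3: "rg3 (lf k) = fv" by (simp add: rg3_def rg2_def)
 have r4: "rg4 (lq k) = w div fv" "rg4 pA = a" using assms(2) by (simp_all add: rg1_def rg2_def rg3_def rg4_def)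
 have sb: "Suc (lv div (w div fv)) < 2 ^ w" "Suc (a + lv div (w div fv)) < 2 ^ w" using s by (simp_all add: block_def)
 have g: "rg5 (lb k) = a" "rg5 (lf k) = fv" "rg5 (lq k) = w div fv" "rg5 (lm k) = 2 ^ fv - 1" "rg5 pA = a + block w (lv, fv)"
  "eq_off {lb k, lf k, lq k, lm k, pA} rg5 rg"
  by (simp_all add: rg1_def rg2_def rg3_def rg4_def rg5_def)
 have A: "wp (pA ::= Rg pA +. (l /. Rg (lq k) +. Lit 1)) Q rg4 ar (Suc (Suc (Suc (Suc t)))) out"
 proof -
  have r5: "rg4(pA := Suc (a + lv div (w div fv))) = rg5" by (simp add: rg5_def block_def)
  have "Q rg5 ar (Suc (Suc (Suc (Suc (Suc t))))) out" using Q[OF g] by (simp only: add_Suc_right numeral_nat add_0_right)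
  then show ?thesis using sb q l1 assms(1) by (simp add: e4 r4 r5)
 qed
 have B: "wp (lm k ::= Bin Shl (Lit 1) (Rg (lf k)) -. Lit 1) (wp (pA ::= Rg pA +. (l /. Rg (lq k) +. Lit 1)) Q) rg3 ar (Suc (Suc (Suc t))) out"
  using A f2 l1 assms(1) unfolding wp_simps(2)[of "lm k"] by (simp add: r3 rg4_def del: wp_simps)
 have C: "wp (lq k ::= WL /. Rg (lf k)) (wp (lm k ::= Bin Shl (Lit 1) (Rg (lf k)) -. Lit 1) (wp (pA ::= Rg pA +. (l /. Rg (lq k) +. Lit 1)) Q)) rg2 ar (Suc (Suc t)) out"
  using B assms unfolding wp_simps(2)[of "lq k"] by (simp add: r2 rg3_def del: wp_simps)
 show ?thesis unfolding alloc_def wp_simps(5)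
  using C e1 assms(1,2) unfolding wp_simps(2)[of "lb k"] wp_simps(2)[of "lf k"]
  by (simp add: rg1_def[symmetric] rg2_def[symmetric] del: wp_simps)
qed

lemma allocs_ok:
 assumes "list_all2 (\<lambda>(l, f) (lv, fv). 0 < fv & fv < w & (\<forall>rg'. (\<forall>y<80. rg' y = rg0 y) -->
   ok rg' ar l & ev rg' ar l = lv & ok rg' ar f & ev rg' ar f = fv)) xs vs"
  and "k + length xs <= 50" "\<forall>y<80. rg y = rg0 y" "rg pA = a" "a + block_base w vs (length vs) < 2 ^ w"
  and "\<And>rg'. (\<And>j. j < length vs ==> rg' (lb (k + j)) = a + block_base w vs j & rg' (lf (k + j)) = snd (vs ! j) &
    rg' (lq (k + j)) = w div snd (vs ! j) & rg' (lm (k + j)) = 2 ^ snd (vs ! j) - 1) ==>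
   (\<forall>y<80. rg' y = rg0 y) ==> (\<forall>y. 100 <= y & y < 100 + 4 * k --> rg' y = rg y) ==> Q rg' ar (t + 5 * length xs + 1) out"
 shows "wp (allocs k xs) Q rg ar t out"
 using assms
proof (induction xs vs arbitrary: k rg a t Q rule: list_all2_induct)
 case Nil
 then show ?case by simp
next
 case (Cons x xs v vs)
 obtain l f lv fv where xv: "x = (l, f)" "v = (lv, fv)" by (cases x, cases v)
 have bb: "block_base w (v # vs) (Suc j) = block w v + block_base w vs j" for j by (simp add: block_base_def)
 have c: "0 < fv" "fv < w" and e: "\<And>rg'. (\<forall>y<80. rg' y = rg0 y) ==>
   ok rg' ar l & ev rg' ar l = lv & ok rg' ar f & ev rg' ar f = fv" using Cons.hyps(1) xv by auto
 have "wp (alloc k l f) (wp (allocs (Suc k) xs) Q) rg ar t out"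
 proof (rule alloc_ok[where a = a and fv = fv and lv = lv])
  show "rg pA = a" "0 < fv" "fv < w" using Cons.prems(3) c by simp_all
  show "k < 50" using Cons.prems(1) by simp
  show "ok rg' ar l & ev rg' ar l = lv & ok rg' ar f & ev rg' ar f = fv" if "\<forall>y<80. rg' y = rg y" for rg'
   using e[of rg'] that Cons.prems(2) by simp
  show "a + block w (lv, fv) < 2 ^ w" using Cons.prems(4) bb[of "length vs"] xv by simp
  fix rg1
  assume r: "rg1 (lb k) = a" "rg1 (lf k) = fv" "rg1 (lq k) = w div fv" "rg1 (lm k) = 2 ^ fv - 1"
   "rg1 pA = a + block w (lv, fv)" "eq_off {lb k, lf k, lq k, lm k, pA} rg1 rg"
  show "wp (allocs (Suc k) xs) Q rg1 ar (t + 5) out"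
  proof (rule Cons.IH[where a = "a + block w (lv, fv)"])
   show "rg1 pA = a + block w (lv, fv)" by (rule r(5))
   show "Suc k + length xs <= 50" using Cons.prems(1) by simp
   show "\<forall>y<80. rg1 y = rg0 y" using r(6) Cons.prems(2) by simp
   show "a + block w (lv, fv) + block_base w vs (length vs) < 2 ^ w" using Cons.prems(4) bb[of "length vs"] xv by simp
   fix rg2
   assume l2: "\<And>j. j < length vs ==> rg2 (lb (Suc k + j)) = a + block w (lv, fv) + block_base w vs j & rg2 (lf (Suc k + j)) = snd (vs ! j) &
     rg2 (lq (Suc k + j)) = w div snd (vs ! j) & rg2 (lm (Suc k + j)) = 2 ^ snd (vs ! j) - 1"
    and g: "\<forall>y<80. rg2 y = rg0 y" "\<forall>y. 100 <= y & y < 100 + 4 * Suc k --> rg2 y = rg1 y"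
   have "Q rg2 ar (t + 5 * length (x # xs) + 1) out"
   proof (rule Cons.prems(5)[OF _ g(1)])
    fix j assume j: "j < length (v # vs)"
    show "rg2 (lb (k + j)) = a + block_base w (v # vs) j & rg2 (lf (k + j)) = snd ((v # vs) ! j) &
     rg2 (lq (k + j)) = w div snd ((v # vs) ! j) & rg2 (lm (k + j)) = 2 ^ snd ((v # vs) ! j) - 1"
    proof (cases j)
     case 0
     then show ?thesis using r g(2) xv by (simp add: block_base_def)
    next
     case (Suc i)
     then show ?thesis using l2[of i] j xv bb[of i] by simp
    qed
   qed (use g r in auto)
   then show "Q rg2 ar (t + 5 + 5 * length xs + 1) out" by (simp add: add.assoc add.commute add.left_commute)
  qed
 qed
 then show ?case by (simp add: xv)
qed

end

section \<open>Actual sizes of the arrays and the total space\<close>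

context instance_size
begin

definition lw :: nat where "lw = 2 * bl n + 2"
definition hw :: nat where "hw = bl n div 2 + 1"

definition dens :: "nat => bool" where
 "dens b \<longleftrightarrow> 1 <= b & msum <= 2 ^ b * n & (b = 1 | 2 ^ (b - 1) * n < msum)"

text \<open>The values that \<open>arrays_exp\<close> takes after the prelude, entry by
  entry.\<close>

definition vals :: "nat => (nat \<times> nat) list" where
 "vals b = (let mk = (4 * (n div lw) + 8, lw); rk = nt div hw + 1 in
  [(n, 1), (1, 1), (n, b), (lw, lw), (lw, lw), mk, mk, mk, mk, (2 * n + 1, 1),
   (rk, hw), (rk, lw), (2 ^ hw, lw), (nt, 1), (nt, 1), (n, 1), (n, 1), (n, 1), (bl n + 3, lw), (n, 1)])"

lemma length_vals: "length (vals b) = 20" by (simp add: vals_def Let_def)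

lemma bl_n: "0 < bl n" "bl n <= n" "n < 2 ^ bl n" "2 ^ bl n <= 2 * n"
proof -
 show p: "0 < bl n" using n_pos bl_pos[of n] by simp
 show "bl n <= n" by (rule bl_le)
 show "n < 2 ^ bl n" by (rule bl_less)
 have "bl n - 1 < bl n" using p by simp
 then have "0 < n div 2 ^ (bl n - 1)" by (simp only: bl_iff)
 then have "2 ^ (bl n - 1) <= n" by (metis div_less leI less_irrefl)
 moreover have "(2::nat) ^ bl n = 2 * 2 ^ (bl n - 1)" using p by (cases "bl n") simp_all
 ultimately show "2 ^ bl n <= 2 * n" by simp
qed

text \<open>With \<open>E = 2 ^ (bl n div 2)\<close>, of the order of the square root of
  \<open>n\<close>, both \<open>lw <= 4 * E\<close> and \<open>2 ^ hw = 2 * E\<close> hold, so the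
  product of any two such quantities is O(n).\<close>

lemma widths: "lw * lw <= 32 * n" "lw * 2 ^ hw <= 16 * n" "lw <= 4 * hw" "hw <= lw" "2 ^ hw <= 4 * n" "lw <= 32 * n"
 "bl n + 3 <= lw" "0 < hw" "lw <= 2 * n + 2"
proof -
 define e where "e = bl n div 2"
 define E where "E = (2::nat) ^ e"
 have EE: "E * E <= 2 * n"
 proof -
  have "E * E = 2 ^ (e + e)" by (simp add: E_def power_add)
  also have "\<dots> <= 2 ^ bl n" by (rule power_increasing) (simp_all add: e_def)
  finally show ?thesis using bl_n(4) by linarith
 qed
 have "e < E" by (simp add: E_def)
 then have lE: "lw <= 4 * E" unfolding lw_def e_def by linarith
 have "lw * lw <= (4 * E) * (4 * E)" using lE by (intro mult_le_mono)
 then show l2: "lw * lw <= 32 * n" using EE by simp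
 have h2: "2 ^ hw = 2 * E" by (simp add: hw_def E_def e_def)
 have "lw * 2 ^ hw <= (4 * E) * (2 * E)" unfolding h2 using lE by (intro mult_le_mono) simp_all
 then show "lw * 2 ^ hw <= 16 * n" using EE by simp
 have "E <= E * E" by (simp add: E_def)
 then show "2 ^ hw <= 4 * n" unfolding h2 using EE by linarith
 have "lw <= lw * lw" by (simp add: lw_def)
 then show "lw <= 32 * n" using l2 by linarith
 have "2 * m + 2 <= 4 * (m div 2 + 1)" "m div 2 + 1 <= 2 * m + 2" for m :: nat by presburger+
 then show "lw <= 4 * hw" "hw <= lw" "0 < hw" unfolding lw_def hw_def by simp_all
 show "bl n + 3 <= lw" "lw <= 2 * n + 2" using bl_n(1,2) by (simp_all add: lw_def)
qed

lemma pow_lw: "(2::nat) ^ lw = 4 * (2 ^ bl n * 2 ^ bl n)"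
proof -
 have "lw = 2 + (bl n + bl n)" by (simp add: lw_def)
 then show ?thesis by (simp only: power_add) simp
qed

lemma lw_big: "4 * ((n + 1) * (n + 1)) <= 2 ^ lw"
proof -
 have "n + 1 <= 2 ^ bl n" using bl_n(3) by simp
 then have "(n + 1) * (n + 1) <= 2 ^ bl n * 2 ^ bl n" by (intro mult_le_mono)
 then show ?thesis unfolding pow_lw by simp
qed

lemma lw_less: "lw < w"
proof -
 note pow_lw
 also have "4 * (2 ^ bl n * 2 ^ bl n) <= 4 * ((2 * n) * (2 * n))" using bl_n(4) by (intro mult_le_mono) simp_all
 also have "\<dots> < 2 ^ w" by (rule small2) simp
 finally show ?thesis by simp
qed

lemma dens_B: assumes "dens b" shows "2 ^ b <= 2 * n + 2" "b < w" "msum div 2 ^ b <= n"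
proof -
 have mle: "msum <= n * n" unfolding msum_def by (rule msum_part) simp
 show le: "2 ^ b <= 2 * n + 2"
 proof (cases "b = 1")
  case False
  then have "2 ^ (b - 1) * n < n * n" using assms mle order.strict_trans2 unfolding dens_def by blast
  then have "2 ^ (b - 1) < n" by simp
  moreover have "(2::nat) ^ b = 2 * 2 ^ (b - 1)" using assms by (cases b) (simp_all add: dens_def)
  ultimately show ?thesis by simp
 qed simp
 have "(2::nat) ^ b < 2 ^ w" by (rule small2) (use le in simp)
 then show "b < w" by simp
 have "msum div 2 ^ b <= 2 ^ b * n div 2 ^ b" using assms unfolding dens_def by (intro div_le_mono) simp
 then show "msum div 2 ^ b <= n" by simp
qed

text \<open>A substitute for the concavity of the logarithm: the bits beyond the first
  \<open>b\<close> number at most \<open>d div 2 ^ b\<close>. Summed over all degrees, with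
  \<open>2 ^ b\<close> about m/n, the two parts give O(b n) and O(n).\<close>

lemma bl_split: "bl d <= b + d div 2 ^ b"
proof (cases "b < bl d")
 case True
 have "bl d = b + bl (d div 2 ^ b)" if "b <= bl d" for b
  using that
 proof (induction b)
  case (Suc b)
  then have "0 < d div 2 ^ b" using bl_iff[of b d] by simp
  then show ?case using Suc bl_pos[of "d div 2 ^ b"] by (simp add: div_mult2_eq power_Suc2 del: power_Suc)
 qed simp
 from this[of b] True show ?thesis using bl_le[of "d div 2 ^ b"] by simp
qed simp

lemma sum_div_le: "(\<Sum>v\<in>A. f v div c) <= (\<Sum>v\<in>A. f v) div (c :: nat)"
proof (cases "finite A")
 case True
 then show ?thesis
 proof (induction A)
  case (insert x A)
  have "f x div c + sum f A div c <= (f x + sum f A) div c" by (metis div_add1_eq le_add1)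
  then show ?case using insert by simp
 qed simp
qed simp

lemma nt_le: assumes "dens b" shows "nt <= 2 * n + b * n"
proof -
 have "nt <= (\<Sum>v<n. 1 + b + deg v div 2 ^ b)" unfolding nt_def using bl_split by (intro sum_mono) (simp add: add.assoc)
 also have "\<dots> = n + b * n + (\<Sum>v<n. deg v div 2 ^ b)" by (simp only: sum.distrib) simp
 also have "(\<Sum>v<n. deg v div 2 ^ b) <= n"
  using sum_div_le[of deg "2 ^ b" "{..<n}"] dens_B(3)[OF assms] by (simp add: msum_def)
 finally show ?thesis by simp
qed

lemma widths_ok:
 assumes "dens b" "k < 20" shows "0 < snd (vals b ! k)" "snd (vals b ! k) < w"
proof -
 have "\<forall>x \<in> set (vals b). 0 < snd x & snd x < w"
  using dens_B(2)[OF assms(1)] assms(1) lw_less widths(4,8) unfolding dens_def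
  by (simp add: vals_def Let_def)
 then show "0 < snd (vals b ! k)" "snd (vals b ! k) < w" using assms(2) length_vals nth_mem by fastforce+
qed

lemma total_def: "block_base w (vals b) 20 = sum_list (map (block w) (vals b))"
 using length_vals[of b] by (simp add: block_base_def)

lemma total_less: assumes "dens b" shows "block_base w (vals b) 20 < 2 ^ w"
proof -
 have bl: "block w x <= fst x + 1" for x by (simp add: block_def)
 have "sum_list (map (block w) (vals b)) <= sum_list (map (\<lambda>x. fst x + 1) (vals b))"
  by (intro sum_list_mono bl)
 also have "\<dots> = 8 * n + 2 * lw + 4 * (4 * (n div lw)) + 2 * (nt div hw) + 2 ^ hw + 2 * nt + bl n + 59"
  by (simp add: vals_def Let_def)
 also have "\<dots> <= 100 * ((n + 1) * (n + 1))"
 proof -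
  have a: "nt div hw <= nt" "n div lw <= n" by simp_all
  have nt: "nt <= n + n * n" unfolding nt_def by (rule nt_part) simp
  have "8 * n + 2 * lw + 4 * (4 * y) + 2 * z + 2 ^ hw + 2 * nt + bl n + 59 <= 4 * (n * n) + 44 * n + 70"
   if "z <= nt" "y <= n" for z y
   using that nt widths(5,9) bl_n(2) by linarith
  from this[OF a] show ?thesis by simp
 qed
 finally have "sum_list (map (block w) (vals b)) <= 100 * ((n + 1) * (n + 1))" .
 then show ?thesis unfolding total_def by (rule small2)
qed

text \<open>Cells of \<open>lw\<close> bits occur only in numbers O(n / lw), O(nt / hw),
  \<open>2 ^ hw\<close> and O(lw). As \<open>lw <= 4 * hw\<close>, each kind takes O(n) or O(nt)
  bits, and \<open>nt\<close> is O(b n). The 20 extra words are the rounding of the blocks.\<close>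

lemma total_bits: assumes d: "dens b" shows "w * block_base w (vals b) 20 <= 2500 * (b * n) + 20 * w"
proof -
 have "w * sum_list (map (block w) xs) <= sum_list (map (\<lambda>x. 2 * snd x * fst x + w) xs)"
  if "\<forall>x \<in> set xs. 0 < snd x & snd x < w" for xs :: "(nat \<times> nat) list"
  using that
 proof (induction xs)
  case (Cons x xs)
  have "w * block w x <= 2 * snd x * fst x + w" using block_bits[of "snd x" w "fst x"] Cons.prems by simp
  then show ?case using Cons by (simp add: distrib_left)
 qed simp
 moreover have "\<forall>x \<in> set (vals b). 0 < snd x & snd x < w"
  using widths_ok[OF d] length_vals by (metis in_set_conv_nth)
 ultimately have "w * block_base w (vals b) 20 <= sum_list (map (\<lambda>x. 2 * snd x * fst x + w) (vals b))"
  unfolding total_def by blast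
 also have "\<dots> = 14 * n + 4 + 2 * (b * n) + 4 * (lw * lw) + 32 * (lw * (n div lw)) + 64 * lw + 2 * (hw * (nt div hw)) + 2 * hw
  + 2 * (lw * (nt div hw)) + 2 * lw + 2 * (lw * 2 ^ hw) + 4 * nt + 2 * (lw * (bl n + 3)) + 20 * w"
  by (simp add: vals_def Let_def algebra_simps)
 also have "\<dots> <= 2500 * (b * n) + 20 * w"
 proof -
  have a: "lw * (n div lw) <= n" "hw * (nt div hw) <= nt" by simp_all
  have "lw * (nt div hw) <= 4 * hw * (nt div hw)" using widths(3) by (rule mult_le_mono1)
  also have "\<dots> = 4 * (hw * (nt div hw))" by (simp only: mult.assoc)
  also have "\<dots> <= 4 * nt" using a(2) by (rule mult_le_mono2)
  finally have c: "lw * (nt div hw) <= 4 * nt" .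
  have "lw * (bl n + 3) <= lw * lw" using widths(7) by (rule mult_le_mono2)
  also note widths(1)
  finally have e: "lw * (bl n + 3) <= 32 * n" .
  have bn: "n <= b * n" using d by (simp add: dens_def)
  have "14 * n + 4 + 2 * (b * n) + 4 * (lw * lw) + 32 * x1 + 64 * lw + 2 * x2 + 2 * hw
  + 2 * x3 + 2 * lw + 2 * x4 + 4 * nt + 2 * x5 + 20 * w <= 2500 * (b * n) + 20 * w"
   if "x1 <= n" "x2 <= nt" "x3 <= 4 * nt" "x4 <= 16 * n" "x5 <= 32 * n" for x1 x2 x3 x4 x5
   using that widths(1,4,6) nt_le[OF d] bn n_pos by linarith
  from this[OF a c widths(2) e] show ?thesis .
 qed
 finally show ?thesis .
qed

lemma block_less: "i < fst (vals b ! k) ==> k < 20 ==>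
  block_base w (vals b) k + i div (w div snd (vals b ! k)) < block_base w (vals b) (Suc k)"
 using block_base_Suc[of k "vals b" w] length_vals[of b]
 by (simp add: block_def less_Suc_eq_le) (meson div_le_mono less_imp_le)

text \<open>Without arrays the space bound is 0: the prelude runs in registers alone.\<close>

lemma machine_prelude: "machine w adj r 0 (\<lambda>_. 0) (\<lambda>_. 0) 300 (\<lambda>_. 0) 0"
proof
 show "length adj < 2 ^ w" "r < 2 ^ w" using r_less by (intro small; simp)+
 show "length (adj ! v) < 2 ^ w" if "v < length adj" for v using deg_le[OF that] by (intro small) simp
 show "adj ! v ! i < 2 ^ w" if "v < length adj" "i < length (adj ! v)" for v i
  using nb_less[OF that(1), of "adj ! v ! i"] that(2) by (intro small) simp
qed simp_all

lemma machine_main: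
 assumes d: "dens b"
 shows "machine w adj r 20 (\<lambda>k. fst (vals b ! k)) (\<lambda>k. snd (vals b ! k)) 100 (block_base w (vals b)) (block_base w (vals b) 20)"
proof -
 interpret P: machine w adj r 0 "\<lambda>_. 0" "\<lambda>_. 0" 300 "\<lambda>_. 0" 0 by (rule machine_prelude)
 have le: "block_base w (vals b) k + i div (w div snd (vals b ! k)) < block_base w (vals b) k'"
  if "k < k'" "k' <= 20" "i < fst (vals b ! k)" for k k' i
  using block_less[of i b k] block_base_mono[of "Suc k" k' w "vals b"] that by simp
 show ?thesis
 proof
  show "length adj < 2 ^ w" "r < 2 ^ w" by (rule P.n_lt, rule P.r_lt)
  show "length (adj ! v) < 2 ^ w" if "v < length adj" for v using P.deg_lt[OF that] .
  show "adj ! v ! i < 2 ^ w" if "v < length adj" "i < length (adj ! v)" for v i using P.nb_lt[OF that] .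
  show "0 < snd (vals b ! k)" if "k < 20" for k using widths_ok[OF d that] by simp
  show "snd (vals b ! k) <= w" if "k < 20" for k using widths_ok[OF d that] by simp
  show "block_base w (vals b) k + i div (w div snd (vals b ! k)) < block_base w (vals b) 20"
   if "k < 20" "i < fst (vals b ! k)" for k i by (rule le) (use that in simp_all)
  show "block_base w (vals b) 20 <= 2 ^ w" using total_less[OF d] by simp
  show "block_base w (vals b) k + i div (w div snd (vals b ! k)) ~= block_base w (vals b) k' + i' div (w div snd (vals b ! k'))"
   if "k < 20" "k' < 20" "k ~= k'" "i < fst (vals b ! k)" "i' < fst (vals b ! k')" for k k' i i'
   using le[of k k' i] le[of k' k i'] that by (cases "k < k'") auto
 qed simp_all
qed

lemma main_mem:
 assumes d: "dens b"
 shows "dfs_lev w adj r 20 (\<lambda>k. fst (vals b ! k)) (\<lambda>k. snd (vals b ! k)) 100 lw (2 ^ b) lw hw"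
proof -
 have mem: "dfs_mem w adj r 20 (\<lambda>k. fst (vals b ! k)) (\<lambda>k. snd (vals b ! k)) 100 lw (2 ^ b) lw"
 proof
  show "lw <= 4 * n + 4" using widths(9) by simp
  show "2 ^ b <= 2 * n + 2" by (rule dens_B(1)[OF d])
  have "(\<Sum>v<n. 1 + deg v div 2 ^ b) = n + (\<Sum>v<n. deg v div 2 ^ b)" by (simp only: sum.distrib) simp
  also have "(\<Sum>v<n. deg v div 2 ^ b) <= n"
   using sum_div_le[of deg "2 ^ b" "{..<n}"] dens_B(3)[OF d] by (simp add: msum_def)
  finally show "(\<Sum>v<n. 1 + deg v div 2 ^ b) <= 2 * n" by simp
  show "1000 * ((n + 1) * (n + 1)) <= 2 ^ w" by (rule w_big)
  show "4 * ((n + 1) * (n + 1)) <= 2 ^ lw" by (rule lw_big)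
  show "deg v <= n" if "v < n" for v by (rule deg_le[OF that])
 qed (simp_all add: vals_def Let_def lw_def)
 interpret M: dfs_mem w adj r 20 "\<lambda>k. fst (vals b ! k)" "\<lambda>k. snd (vals b ! k)" 100 lw "2 ^ b" lw by (rule mem)
 have NT: "M.NT = nt" by (simp only: M.NT_sum nt_def)
 show ?thesis
 proof
  show "2 ^ hw <= 4 * n + 4" using widths(5) by simp
  have "bl n div 2 + 1 <= n + 2" using bl_n(2) by linarith
  then show "hw <= n + 2" by (simp add: hw_def)
 qed (simp_all add: vals_def Let_def NT hw_def)
qed

end

context prelude_run
begin

lemma prelude_ok:
 assumes Q: "\<And>rg' t' b. dens b ==> (\<And>k. k < 20 ==> rg' (lb k) = block_base w (vals b) k & rg' (lf k) = snd (vals b ! k) &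
   rg' (lq k) = w div snd (vals b ! k) & rg' (lm k) = 2 ^ snd (vals b ! k) - 1) ==>
   rg' gN = n ==> rg' gS = lw ==> rg' gB = 2 ^ b ==> rg' gH = hw ==> rg' gNT = nt ==> rg' gHH = 2 ^ hw ==> rg' gJ = bl n + 2 ==>
   t' <= t + 200 * n + 3 * msum ==> Q rg' ar t' out"
 shows "wp prelude Q rg ar t out"
 unfolding prelude_def wp_simps(5)
proof (rule degrees_ok)
 fix rg1 t1
 assume 1: "rg1 gN = n" "rg1 pM = msum" "rg1 gNT = nt" and t1: "t1 <= t + 10 + 7 * n + 3 * msum"
 show "wp log_size (wp log_density (wp params (wp (allocs 0 arrays_exp) Q))) rg1 ar t1 out"
 proof (rule log_size_ok[where rg = rg1, OF 1(1)])
  fix rg2 t2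
  assume 2: "rg2 pE = bl n" "eq_off {pE, pY} rg2 rg1" and t2: "t2 <= t1 + 3 + 3 * n"
  have g2: "rg2 gN = n" "rg2 pM = msum" using 1 2 by simp_all
  show "wp log_density (wp params (wp (allocs 0 arrays_exp) Q)) rg2 ar t2 out"
  proof (rule log_density_ok[where rg = rg2, OF g2])
   fix rg3 t3 b
   assume b: "1 <= b" "msum <= 2 ^ b * n" "b = 1 | 2 ^ (b - 1) * n < msum" and 3: "rg3 pB = b" "rg3 gB = 2 ^ b"
    "eq_off {pB, gB} rg3 rg2" and t3: "t3 <= t2 + 10 + 3 * n"
   have d: "dens b" using b by (simp add: dens_def)
   define rg4 where "rg4 = rg3(pL := lw, gS := lw, gH := hw, gHH := 2 ^ hw, gJ := bl n + 2, pA := 0)"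
   have e3: "rg3 pE = bl n" using 2 3 by simp
   have s: "2 * bl n + 2 < 2 ^ w" "2 * bl n < 2 ^ w" "bl n div 2 + 1 < 2 ^ w" "2 ^ hw < (2::nat) ^ w" "bl n + 2 < 2 ^ w" "2 < (2::nat) ^ w" "Suc 0 < 2 ^ w"
    using bl_n(2) widths(5) n_pos by (intro small; linarith)+
   have g4: "rg4 gN = n" "rg4 gS = lw" "rg4 gB = 2 ^ b" "rg4 gH = hw" "rg4 gNT = nt" "rg4 gHH = 2 ^ hw" "rg4 gJ = bl n + 2"
    "rg4 pB = b" "rg4 pL = lw" "rg4 pE = bl n" using 1 2 3 by (simp_all add: rg4_def)
   have a4: "list_all2 (\<lambda>(l, f) (lv, fv). 0 < fv & fv < w & (\<forall>rg'. (\<forall>y<80. rg' y = rg4 y) -->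
    ok rg' ar l & ev rg' ar l = lv & ok rg' ar f & ev rg' ar f = fv)) arrays_exp (vals b)"
   proof -
    have nts: "nt div hw <= nt" "n div lw <= n" by simp_all
    have ntb: "nt <= n + n * n" unfolding nt_def by (rule nt_part) simp
    have "nt div hw + 1 <= 100 * ((n + 1) * (n + 1))" using order_trans[OF nts(1) ntb] by simp
    then have s2: "Suc (nt div hw) < 2 ^ w" using small2 by simp
    have m8: "4 * (n div lw) + 8 <= 100 * n + 100" using nts(2) by linarith
    have s3: "4 * (n div lw) + 8 < 2 ^ w" "2 * n + 1 < 2 ^ w" "bl n + 3 < 2 ^ w" "4 < (2::nat) ^ w" "8 < (2::nat) ^ w" "3 < (2::nat) ^ w" "2 * n < 2 ^ w"
     using m8 bl_n(2) by (intro small; linarith)+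
    have s4: "4 * (n div lw) < 2 ^ w" using s3(1) by simp
    have lp: "0 < lw" by (simp add: lw_def)
    have all: "list_all2 (\<lambda>(l, f) (lv, fv). ok rg' ar l & ev rg' ar l = lv & ok rg' ar f & ev rg' ar f = fv) arrays_exp (vals b)"
     if "\<forall>y<80. rg' y = rg4 y" for rg'
    proof -
     have g: "rg' gN = n" "rg' gS = lw" "rg' gH = hw" "rg' gNT = nt" "rg' gHH = 2 ^ hw" "rg' pB = b" "rg' pL = lw" "rg' pE = bl n"
      using that g4 by simp_all
     show ?thesis using s2 s3 s4 s lp widths(8) by (simp add: arrays_exp_def vals_def Let_def g)
    qed
    show ?thesis unfolding list_all2_conv_all_nth
    proof (intro conjI allI impI)
     show "length arrays_exp = length (vals b)" by (simp add: arrays_exp_def vals_def Let_def)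
    next
     fix i assume i: "i < length arrays_exp"
     obtain l f lv fv where x: "arrays_exp ! i = (l, f)" "vals b ! i = (lv, fv)" by (metis surj_pair)
     have "i < 20" using i by (simp add: arrays_exp_def Let_def)
     then have wd: "0 < fv" "fv < w" using widths_ok[OF d, of i] x by simp_all
     have "ok rg' ar l & ev rg' ar l = lv & ok rg' ar f & ev rg' ar f = fv" if "\<forall>y<80. rg' y = rg4 y" for rg'
      using list_all2_nthD[OF all[OF that] i] x by simp
     then show "(\<lambda>(l, f) (lv, fv). 0 < fv & fv < w & (\<forall>rg'. (\<forall>y<80. rg' y = rg4 y) -->
      ok rg' ar l & ev rg' ar l = lv & ok rg' ar f & ev rg' ar f = fv)) (arrays_exp ! i) (vals b ! i)"
      using wd x by simp
    qed
   qed
   have len: "length arrays_exp = 20" by (simp add: arrays_exp_def Let_def)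
   have "wp (allocs 0 arrays_exp) Q rg4 ar (Suc (Suc (Suc (Suc (Suc (Suc t3)))))) out"
   proof (rule allocs_ok[OF a4])
    show "0 + length arrays_exp <= 50" "\<forall>y<80. rg4 y = rg4 y" "rg4 pA = 0" by (simp_all add: len rg4_def)
    show "0 + block_base w (vals b) (length (vals b)) < 2 ^ w" using total_less[OF d] length_vals by simp
    fix rg'
    assume l: "\<And>j. j < length (vals b) ==> rg' (lb (0 + j)) = 0 + block_base w (vals b) j & rg' (lf (0 + j)) = snd (vals b ! j) &
     rg' (lq (0 + j)) = w div snd (vals b ! j) & rg' (lm (0 + j)) = 2 ^ snd (vals b ! j) - 1"
     and g: "\<forall>y<80. rg' y = rg4 y"
    show "Q rg' ar (Suc (Suc (Suc (Suc (Suc (Suc t3))))) + 5 * length arrays_exp + 1) out"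
    proof (rule Q[OF d])
     show "rg' (lb k) = block_base w (vals b) k & rg' (lf k) = snd (vals b ! k) &
      rg' (lq k) = w div snd (vals b ! k) & rg' (lm k) = 2 ^ snd (vals b ! k) - 1" if "k < 20" for k
      using l[of k] that length_vals by simp
     show "Suc (Suc (Suc (Suc (Suc (Suc t3))))) + 5 * length arrays_exp + 1 <= t + 200 * n + 3 * msum"
      unfolding len using t1 t2 t3 n_pos by linarith
    qed (use g g4 in simp_all)
   qed
   then show "wp params (wp (allocs 0 arrays_exp) Q) rg3 ar t3 out" unfolding params_def
    using s w_pos by (simp add: e3 rg4_def lw_def hw_def)
  qed
 qed
qed

end

section \<open>Solvability\<close>

text \<open>Space 0 means that no memory was accessed. So the prelude hands over a memory that is
  still zero, which the main program then reads as zero arrays.\<close>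

lemma exec_no_memory: "exec w adj r c \<sigma> t s out \<sigma>' ==> s = 0 ==> snd \<sigma>' = snd \<sigma>"
 by (induction rule: exec.induct) auto

lemma arcs_card:
 assumes "\<And>v. v < length adj ==> distinct (adj ! v)"
 shows "card (arcs (graph_of adj)) = (\<Sum>v<length adj. length (adj ! v))"
proof -
 have "arcs (graph_of adj) = (SIGMA u:{..<length adj}. set (adj ! u))"
  by (auto simp: graph_of_def with_proj_def)
 then have "card (arcs (graph_of adj)) = (\<Sum>v<length adj. card (set (adj ! v)))" by simp
 also have "\<dots> = (\<Sum>v<length adj. length (adj ! v))"
  by (rule sum.cong) (simp_all add: assms distinct_card)
 finally show ?thesis .
qed

text \<open>For \<open>b > 1\<close> the minimality of \<open>b\<close> gives
  \<open>2 ^ (b - 1) < 4 * m / n\<close>, so \<open>b\<close> is below 3 + lg (m/n). The bound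
  \<open>3 * m + 1\<close> on the degree sum serves digraphs, where the sum is \<open>m\<close>, as
  well as undirected graphs, where each edge counts twice.\<close>

lemma (in instance_size) dens_lg:
 assumes d: "dens b" and m: "msum <= 3 * m + 1"
 shows "real b <= 4 * lg_density m n"
proof (cases "b = 1")
 case True
 then show ?thesis by (simp add: lg_density_def)
next
 case False
 then have b: "2 <= b" "2 ^ (b - 1) * n < msum" using d by (auto simp: dens_def)
 have "2 ^ 1 <= (2::nat) ^ (b - 1)" using b(1) by (intro power_increasing) simp_all
 then have "2 * 1 <= 2 ^ (b - 1) * n" using n_pos by (intro mult_le_mono) (simp_all add: Suc_le_eq)
 then have "1 < msum" using b(2) by linarith
 then have m1: "1 <= m" using m by linarith
 then have "2 ^ (b - 1) * n < 4 * m" using b(2) m by linarith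
 then have "real (2 ^ (b - 1) * n) < real (4 * m)" by (simp only: of_nat_less_iff)
 then have "2 ^ (b - 1) < 4 * (real m / real n)" using n_pos by (simp add: field_simps)
 then have "log 2 (2 ^ (b - 1)) < log 2 (4 * (real m / real n))" using m1 n_pos by (subst log_less_cancel_iff) simp_all
 moreover have "log 2 (2 ^ (b - 1)) = real (b - 1)" by (simp add: log_nat_power)
 moreover have "log 2 (4 * (real m / real n)) = 2 + log 2 (real m / real n)"
 proof -
  have "log 2 (4 * (real m / real n)) = log 2 4 + log 2 (real m / real n)" using m1 n_pos by (subst log_mult) simp_all
  moreover have "log 2 4 = log 2 (2 ^ 2)" by simp
  ultimately show ?thesis by (simp only: log_nat_power) simp
 qed
 ultimately show ?thesis using b(1) by (simp add: lg_density_def of_nat_diff)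
qed

text \<open>Origin of the 16 used for \<beta>: of the factors of \<open>(n + 1) ^ 16\<close> two
  give the square, and the other fourteen give at least \<open>2 ^ 14\<close>, which exceeds
  1000.\<close>

lemma word_size:
 assumes "16 * log 2 (real (n + 1)) <= real w" "0 < n"
 shows "1000 * ((n + 1) * (n + 1)) <= 2 ^ w"
proof -
 have "1000 * ((n + 1) * (n + 1)) <= 2 ^ 14 * (n + 1) ^ 2" by (simp add: power2_eq_square)
 also have "\<dots> <= (n + 1) ^ 14 * (n + 1) ^ 2" using assms(2) by (intro mult_le_mono1 power_mono) simp_all
 also have "\<dots> = (n + 1) ^ 16" by (simp only: power_add[symmetric]) simp
 also have "\<dots> <= 2 ^ w"
 proof -
  have "log 2 (real (n + 1) ^ 16) <= real w" using assms by (simp add: log_nat_power)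
  then have "real (n + 1) ^ 16 <= 2 powr real w" by (subst (asm) log_le_iff) simp_all
  then have "real ((n + 1) ^ 16) <= real (2 ^ w)" by (simp add: powr_realpow)
  then show ?thesis by (simp only: of_nat_le_iff)
 qed
 finally show ?thesis .
qed

text \<open>
 The registers and the last partially used words of the arrays cost \<open>O(w)\<close> bits, which the
 proviso of \<^const>\<open>solvable\<close> allows for.
\<close>

lemma solvableI:
 fixes main :: prg and K :: nat
 assumes I: "\<And>adj. I adj ==> graph_instance adj | digraph_instance adj"
  and size: "\<And>adj. I adj ==> card (arcs (graph_of adj)) <= 3 * ne adj + 1"
  and main: "\<And>w adj r na len wd xl S B L h rg ar. I adj ==> dfs_lev w adj r na len wd xl S B L h ==>
   dfs_lev.cst2 adj S B h rg ==> \<forall>k<20. \<forall>i<len k. ar k i = 0 ==>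
   ram.wp w adj r na len wd xl main (\<lambda>rg' ar' t' out. spec adj r out &
    t' <= K * length adj + K * (\<Sum>v<length adj. length (adj ! v))) rg ar 0 []"
 shows "solvable I ne spec"
proof -
 define P where "P = SEQ (cp prelude) (cp main)"
 define R where "R = card (regs P)"
 define K1 where "K1 = 200 * pcost prelude + pcost main * K"
 have main_run: "\<exists>t s out \<sigma>'. exec w adj r P (\<lambda>_. 0, \<lambda>_. 0) t s out \<sigma>' & real t <= C * real (m + n) &
   real (w * (R + s)) <= C * (real n * lg_density m n) & spec adj r out"
  if h: "I adj" "n = length adj" "m = ne adj" "r < n" "16 * log 2 (real (n + 1)) <= real w"
   "real w <= \<kappa> * (real n * lg_density m n)" and C: "C = 4 * real K1 + real (R + 20) * \<bar>\<kappa>\<bar> + 10000"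
  for adj r w n m \<kappa> C
 proof -
  have rl: "r < length adj" using h by simp
  have dst: "distinct (adj ! v)" if "v < length adj" for v using distinct_adj[OF I[OF h(1)] that] .
  interpret A: dfs_input adj r by (rule instance_input[OF I[OF h(1)] rl])
  have deg: "length (adj ! v) <= length adj" if "v < length adj" for v
  proof -
   have "card (set (adj ! v)) <= card {..<length adj}" by (rule card_mono) (use A.nb_less[OF that] in auto)
   then show ?thesis using dst[OF that] by (simp add: distinct_card)
  qed
  have wb: "1000 * ((length adj + 1) * (length adj + 1)) <= 2 ^ w" by (rule word_size) (insert h(2,5) rl, simp, linarith)
  interpret PR: prelude_run adj r w "\<lambda>_. 0" "\<lambda>_. 0" by unfold_locales (use deg wb in simp_all)
  \<comment> \<open>Two machines are used in turn: this one, without arrays, for the prelude, and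
    then \<open>M2\<close> with the 20 arrays whose descriptors the prelude has computed.\<close>
  interpret M1: machine w adj r 0 "\<lambda>_. 0" "\<lambda>_. 0" 300 "\<lambda>_. 0" 0 by (rule PR.machine_prelude)
  have ms: "PR.msum <= 3 * m + 1" using size[OF h(1)] arcs_card[OF dst] h(3) by (simp add: PR.msum_def)
  define Z :: arrays where "Z = (\<lambda>_ _. 0)"
  define Q1 where "Q1 = (\<lambda>rg1 ar1 t1 out1. ar1 = Z & out1 = ([] :: nat list) & t1 <= 200 * n + 3 * PR.msum & (\<exists>b. PR.dens b &
   (\<forall>k<20. rg1 (lb k) = block_base w (PR.vals b) k & rg1 (lf k) = snd (PR.vals b ! k) &
   rg1 (lq k) = w div snd (PR.vals b ! k) & rg1 (lm k) = 2 ^ snd (PR.vals b ! k) - 1) &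
   rg1 gN = n & rg1 gS = PR.lw & rg1 gB = 2 ^ b & rg1 gH = PR.hw & rg1 gNT = PR.nt & rg1 gHH = 2 ^ PR.hw &
   rg1 gJ = bl n + 2))"
  have "PR.wp prelude Q1 (\<lambda>_. 0) Z 0 []"
   by (rule PR.prelude_ok) (auto simp: Q1_def h(2))
  then obtain rg1 ar1 t1 out1 where hx1: "PR.hx prelude (\<lambda>_. 0, Z, 0, []) (rg1, ar1, t1, out1)" and Q1: "Q1 rg1 ar1 t1 out1"
   unfolding PR.wp_def by blast
  have "M1.sim (\<lambda>_. 0) Z (\<lambda>_. 0) (\<lambda>_. 0)" by (simp add: M1.sim_def M1.layout_def)
  from M1.cp_ok[OF PR.w_pos hx1, of "\<lambda>_. 0" "\<lambda>_. 0"] this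
  obtain t a out rg1' mu1 where e1: "exec w adj r (cp prelude) (\<lambda>_. 0, \<lambda>_. 0) t a out (rg1', mu1)"
   and a: "a <= 0" and t: "t <= pcost prelude * t1" and o: "out1 = out" and s1: "M1.sim rg1 ar1 rg1' mu1"
   by auto
  have mu: "mu1 = (\<lambda>_. 0)" using exec_no_memory[OF e1] a by simp
  obtain b where d: "PR.dens b" and lay: "\<forall>k<20. rg1 (lb k) = block_base w (PR.vals b) k & rg1 (lf k) = snd (PR.vals b ! k) &
   rg1 (lq k) = w div snd (PR.vals b ! k) & rg1 (lm k) = 2 ^ snd (PR.vals b ! k) - 1"
   and g: "rg1 gN = n" "rg1 gS = PR.lw" "rg1 gB = 2 ^ b" "rg1 gH = PR.hw" "rg1 gNT = PR.nt" "rg1 gHH = 2 ^ PR.hw" "rg1 gJ = bl n + 2"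
   using Q1 unfolding Q1_def by blast
  have o1: "out = []" "t1 <= 200 * n + 3 * PR.msum" using Q1 o by (simp_all add: Q1_def)
  define len where "len = (\<lambda>k. fst (PR.vals b ! k))"
  define wd where "wd = (\<lambda>k. snd (PR.vals b ! k))"
  interpret M2: machine w adj r 20 len wd 100 "block_base w (PR.vals b)" "block_base w (PR.vals b) 20"
   unfolding len_def wd_def by (rule PR.machine_main[OF d])
  have lev: "dfs_lev w adj r 20 len wd 100 PR.lw (2 ^ b) PR.lw PR.hw"
   unfolding len_def wd_def by (rule PR.main_mem[OF d])
  then have mem: "dfs_mem w adj r 20 len wd 100 PR.lw (2 ^ b) PR.lw" by (simp add: dfs_lev_def)
  have "dfs_mem.NT adj = PR.nt" using dfs_mem.NT_sum[OF mem] by (simp add: PR.nt_def)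
  then have c2: "dfs_lev.cst2 adj PR.lw (2 ^ b) PR.hw rg1"
   unfolding dfs_lev.cst2_def[OF lev] dfs_mem.cst_def[OF mem] using g h(2) by simp
  have "M2.wp main (\<lambda>rg' ar' t' out. spec adj r out & t' <= K * length adj + K * (\<Sum>v<length adj. length (adj ! v))) rg1 Z 0 []"
   by (rule main[OF h(1) lev c2]) (simp add: Z_def)
  then obtain rg2 ar2 t2 out2 where hx2: "M2.hx main (rg1, Z, 0, []) (rg2, ar2, t2, out2)"
   and sp: "spec adj r out2" and t2: "t2 <= K * n + K * PR.msum"
   unfolding M2.wp_def PR.msum_def h(2) by blast
  \<comment> \<open>A zero memory represents all-zero arrays under any layout, so the state left by
    the prelude can be reread in terms of the second machine.\<close>
  have "M2.sim rg1 Z rg1' (\<lambda>_. 0)"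
   unfolding M2.sim_def M2.layout_def using s1 lay by (simp add: M1.sim_def wd_def cell_def Z_def)
  with M2.cp_ok[OF PR.w_pos hx2, of rg1' "\<lambda>_. 0"]
  obtain t' a' out' rg2' mu2 where e2: "exec w adj r (cp main) (rg1', \<lambda>_. 0) t' a' out' (rg2', mu2)"
   and a': "a' <= block_base w (PR.vals b) 20" and t': "t' <= pcost main * t2" and o2: "out2 = out'"
   by auto
  have ex: "exec w adj r P (\<lambda>_. 0, \<lambda>_. 0) (t + t') a' out' (rg2', mu2)"
   using exec.Seq[OF e1[unfolded mu] e2] a by (simp add: P_def o1)
  have lg: "1 <= lg_density m n" by (simp add: lg_density_def)
  have nlg: "0 <= real n * lg_density m n" using lg by simp
  have tn: "t + t' <= K1 * (n + PR.msum)"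
  proof -
   have "t <= pcost prelude * (200 * (n + PR.msum))"
    using t by (rule order_trans) (intro mult_le_mono2, use o1 in simp)
   moreover have "t' <= pcost main * (K * (n + PR.msum))"
    using t' by (rule order_trans) (intro mult_le_mono2, use t2 in \<open>simp add: distrib_left\<close>)
   ultimately show ?thesis by (simp add: K1_def algebra_simps)
  qed
  also have "\<dots> <= K1 * (4 * (m + n))" using ms h(4) by (intro mult_le_mono2) simp
  finally have "t + t' <= 4 * K1 * (m + n)" by (simp add: ac_simps)
  then have "real (t + t') <= real (4 * K1 * (m + n))" by (simp only: of_nat_le_iff)
  also have "\<dots> = 4 * real K1 * real (m + n)" by simp
  also have "\<dots> <= C * real (m + n)" unfolding C by (intro mult_right_mono) simp_all
  finally have time: "real (t + t') <= C * real (m + n)" .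
  have "w * (R + a') <= w * (R + block_base w (PR.vals b) 20)" using a' by (intro mult_le_mono2) simp
  also have "\<dots> <= (R + 20) * w + 2500 * (b * n)"
   using PR.total_bits[OF d] h(2) by (simp add: algebra_simps)
  finally have "real (w * (R + a')) <= real ((R + 20) * w + 2500 * (b * n))" by (simp only: of_nat_le_iff)
  also have "\<dots> = real (R + 20) * real w + 2500 * (real b * real n)" by simp
  also have "real (R + 20) * real w <= real (R + 20) * (\<bar>\<kappa>\<bar> * (real n * lg_density m n))"
  proof (intro mult_left_mono)
   have "\<kappa> * (real n * lg_density m n) <= \<bar>\<kappa>\<bar> * (real n * lg_density m n)" using nlg by (intro mult_right_mono) simp_all
   then show "real w <= \<bar>\<kappa>\<bar> * (real n * lg_density m n)" using h(6) by linarith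
  qed simp
  also have "2500 * (real b * real n) <= 2500 * (4 * lg_density m n * real n)"
   using PR.dens_lg[OF d ms] h(2) by (intro mult_left_mono mult_right_mono) simp_all
  finally have "real (w * (R + a')) <= (real (R + 20) * \<bar>\<kappa>\<bar> + 10000) * (real n * lg_density m n)"
   by (simp add: algebra_simps)
  also have "\<dots> <= C * (real n * lg_density m n)" unfolding C using nlg by (intro mult_right_mono) simp_all
  finally show ?thesis using ex time sp o2 by blast
 qed
 show ?thesis unfolding solvable_def R_def[symmetric]
  \<comment> \<open>The program and the factor 16 are chosen before \<kappa>; only the constant of
    the bounds depends on it.\<close>
  apply (rule exI[of _ P], rule exI[of _ 16], intro allI)
  subgoal for \<kappa>
   apply (rule exI[of _ "4 * real K1 + real (R + 20) * \<bar>\<kappa>\<bar> + 10000"], intro allI impI, elim conjE)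
   unfolding R_def[symmetric]
   apply (rule main_run[OF _ _ _ _ _ _ refl])
     apply assumption+
   done
  done
qed

lemma (in dfs_lev) report_main:
 assumes c: "cst2 rg" and z: "\<forall>k<20. \<forall>i<len k. ar k i = 0"
 shows "wp report_prog (\<lambda>rg' ar' t' out. dfs_spec adj r out & t' <= 5000 * n + 5000 * (\<Sum>v<n. deg v)) rg ar 0 []"
proof (rule report_ok)
 show "cst rg" using c by (simp add: cst2_def)
 show "\<forall>v<n. ar aD v = 0" "\<forall>p < 2 * n + 1. ar aU p = 0"
  using z[rule_format, of aD] z[rule_format, of aU] by (simp_all add: lens)
 fix t' es
 assume es: "dfs_traversal (graph_of adj) r es" and t: "t' <= 0 + 4 * n + DFSB"
 have "t' <= 5000 * n + 5000 * (\<Sum>v<n. deg v)" using t S_le n_pos unfolding DFSB_def by linarith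
 then show "dfs_spec adj r ([] @ concat (map (case_event (\<lambda>v. [0, v]) (\<lambda>v. [1, v])) es)) & t' <= 5000 * n + 5000 * (\<Sum>v<n. deg v)"
  using es by (auto simp: dfs_spec_def)
qed

lemmas (in dfs_und) programs_sum = programs_ok[where t = 0, unfolded msum_def add_0]

theorem theorem21:
 shows "solvable graph_instance undirected_size dfs_spec
   & solvable digraph_instance directed_size dfs_spec
   & solvable graph_instance undirected_size chain_spec
   & solvable graph_instance undirected_size two_vertex_connected_spec
   & solvable graph_instance undirected_size two_edge_connected_spec
   & solvable graph_instance undirected_size bridges_spec
   & solvable graph_instance undirected_size cut_vertices_spec"
proof (intro conjI)
 have us: "card (arcs (graph_of adj)) <= 3 * undirected_size adj + 1" for adj
  unfolding undirected_size_def by linarith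
 have und: "dfs_und w adj r na len wd xl S B L h" if "graph_instance adj" "dfs_lev w adj r na len wd xl S B L h"
  for w adj r na len wd xl S B L h using that by (simp add: dfs_und_def dfs_und_axioms_def)
 note progs = dfs_und.programs_sum[OF und]
 show "solvable graph_instance undirected_size dfs_spec"
  by (rule solvableI[where main = report_prog and K = 5000, OF _ us]) (simp, rule dfs_lev.report_main)
 show "solvable digraph_instance directed_size dfs_spec"
  by (rule solvableI[where main = report_prog and K = 5000]) (simp_all add: directed_size_def dfs_lev.report_main)
 show "solvable graph_instance undirected_size chain_spec"
  by (rule solvableI[where main = "prep True" and K = 5000, OF _ us]) (simp, rule progs(1))
 show "solvable graph_instance undirected_size two_vertex_connected_spec"
  by (rule solvableI[where main = "prep False ;; vertex_tail" and K = 5000, OF _ us]) (simp, rule progs(4))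
 show "solvable graph_instance undirected_size two_edge_connected_spec"
  by (rule solvableI[where main = "prep False ;; edge_tail" and K = 5000, OF _ us]) (simp, rule progs(5))
 show "solvable graph_instance undirected_size bridges_spec"
  by (rule solvableI[where main = "prep False ;; bridge_tail" and K = 5000, OF _ us]) (simp, rule progs(2))
 show "solvable graph_instance undirected_size cut_vertices_spec"
  by (rule solvableI[where main = "prep False ;; cut_tail True" and K = 5000, OF _ us]) (simp, rule progs(3))
qed

end
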